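(* The PAL-equation (perfect absorbing layer equation) associated with the star-shaped domain truncation of the exterior Helmholtz problem described in the context, obtained by applying the complex compression coordinate transformation $\tilde r=S(r,\theta)$, $\tilde\theta=\theta$ to that problem, takes the form $$\begin{cases}\nabla\cdot(\boldsymbol{C}\,\nabla U_{\rm PAL})+k^2\,n\,U_{\rm PAL}=f & \text{in }\Omega\cup\Omega_\varrho^{\rm PAL},\\ U_{\rm PAL}=g & \text{on }\Gamma_D,\\ |U_{\rm PAL}|\ \text{is uniformly bounded as } r\to R_2,\end{cases}$$ where $\boldsymbol{C}=\boldsymbol{I}$, $n=1$ in $\Omega$, and in $\Omega_\varrho^{\rm PAL}$ $$\boldsymbol{C}=\boldsymbol{T}\boldsymbol{B}\boldsymbol{T}^t,\quad n=\frac{SS_r}{r},\quad \boldsymbol{B}=\begin{pmatrix}\frac{S}{rS_r}\Big(1+\frac{S_\theta^2}{S^2}\Big) & -\frac{S_\theta}{S}\\ -\frac{S_\theta}{S} & \frac{rS_r}{S}\end{pmatrix},\quad \boldsymbol{T}=\begin{pmatrix}\cos\theta & -\sin\theta\\ \sin\theta & \cos\theta\end{pmatrix}.$$ Here the usual transmission conditions are imposed across the interface $r=R_1(\theta)$ (continuity of $U_{\rm PAL}$ and of the conormal flux $\boldsymbol\nu\cdot\boldsymbol{C}\nabla U_{\rm PAL}$, with $\boldsymbol\nu$ the unit normal to the interface).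
   Context: Exterior Helmholtz problem: $k>0$ is the wave number; $D\subset\mathbb{R}^2$ is a bounded scatterer with Lipschitz boundary $\Gamma_D=\partial D$; $g\in H^{1/2}(\Gamma_D)$; the source $f$ is compactly supported in a disk $B\supset D$. The field $U$ solves $\Delta U+k^2U=f$ in $\mathbb{R}^2\setminus\bar D$, $U=g$ on $\Gamma_D$, with the Sommerfeld radiation condition in the form $\big|\frac{\partial U}{\partial r}-\mathrm{i}kU\big|\le\frac cr$ for $r=|\boldsymbol x|\gg1$. Truncation: $\Omega_{\rm s}$ is a domain that encloses $\bar D$, is star-shaped with respect to the origin, and has piecewise smooth boundary $\{(r,\theta): r=R_1(\theta),\ \theta\in[0,2\pi)\}$ in polar coordinates. For a constant $\varrho>1$, put $R_2(\theta)=\varrho R_1(\theta)$, $\Omega=\Omega_{\rm s}\setminus\bar D$, and $\Omega_\varrho^{\rm PAL}=\{(r,\theta): R_1(\theta)<r<R_2(\theta),\ \theta\in[0,2\pi)\}$ (the artificial layer). Transformation: with tuning parameters $\sigma_0,\sigma_1>0$, set $\tilde\theta=\theta$ and $\tilde r=S(r,\theta)$, where $S=r$ in $\Omega$ and $S=R_1(\theta)+\sigma_1T(r,\theta)+\mathrm{i}\,\sigma_0T(r,\theta)$ in $\Omega_\varrho^{\rm PAL}$, with $$T(r,\theta)=\frac{(R_2-R_1)(r-R_1)}{R_2-r}=(R_2-R_1)^2\int_{R_1}^r\frac{\mathrm{d}t}{(R_2-t)^2},\quad r\in(R_1,R_2).$$ Here $(\tilde r,\tilde\theta)$ and $(r,\theta)$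 are the polar coordinates associated with the Cartesian coordinates $(\tilde x,\tilde y)$ and $(x,y)$ respectively; the Helmholtz problem is posed in $(\tilde x,\tilde y)$ and the PAL-equation in $(x,y)$. The operators $\nabla$ and $\nabla\cdot$ are in $(x,y)$-coordinates, while $\boldsymbol C$ and $n$ are expressed in $(r,\theta)$-coordinates; $S_r=\partial_rS$, $S_\theta=\partial_\theta S$, and $\boldsymbol I$ is the $2\times2$ identity matrix.
   Formalization: Assumes U has, for each θ, an analytic continuation in r (C² in θ) to a neighbourhood of the closed sector between the real ray r≥R₁(θ) and the ray of values of S; without it U at r̃=S may be undefined or unbounded, e.g. for elongated Ω_s. f is assumed integrable. *)

theory Defs
  imports "HOL-Analysis.Analysis"
begin

section \<open>Smooth functions, weak derivatives, divergence-form equations\<close>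

primrec cont_diff ::
    "nat \<Rightarrow> ('a::real_normed_vector \<Rightarrow> 'b::real_normed_vector) \<Rightarrow> bool" where
  "cont_diff 0 f \<longleftrightarrow> continuous_on UNIV f"
| "cont_diff (Suc m) f \<longleftrightarrow>
     (\<forall>x. f differentiable (at x)) \<and> (\<forall>v. cont_diff m (\<lambda>x. frechet_derivative f (at x) v))"

definition smooth :: "('a::real_normed_vector \<Rightarrow> 'b::real_normed_vector) \<Rightarrow> bool" where
  "smooth f \<longleftrightarrow> (\<forall>m. cont_diff m f)"

definition partial :: "2 \<Rightarrow> (real^2 \<Rightarrow> 'b::real_normed_vector) \<Rightarrow> real^2 \<Rightarrow> 'b" where
  "partial i u x = frechet_derivative u (at x) (axis i 1)"

definition grad :: "(real^2 \<Rightarrow> complex) \<Rightarrow> real^2 \<Rightarrow> complex^2" where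
  "grad u x = (\<chi> i. partial i u x)"

text \<open>Real-valued test functions; by linearity they give the same weak notions as complex ones.\<close>

definition test_functions :: "(real^2) set \<Rightarrow> (real^2 \<Rightarrow> real) set" where
  "test_functions G =
     {\<phi>. smooth \<phi> \<and> compact (closure {x. \<phi> x \<noteq> 0}) \<and> closure {x. \<phi> x \<noteq> 0} \<subseteq> G}"

definition locally_integrable ::
    "(real^2) set \<Rightarrow> (real^2 \<Rightarrow> 'b::{banach, second_countable_topology}) \<Rightarrow> bool" where
  "locally_integrable G u \<longleftrightarrow> (\<forall>K. compact K \<and> K \<subseteq> G \<longrightarrow> set_integrable lebesgue K u)"

definition has_weak_gradient ::
    "(real^2) set \<Rightarrow> (real^2 \<Rightarrow> complex) \<Rightarrow> (real^2 \<Rightarrow> complex^2) \<Rightarrow> bool" where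
  "has_weak_gradient G u p \<longleftrightarrow>
     locally_integrable G u \<and> locally_integrable G p \<and>
     (\<forall>\<phi>\<in>test_functions G. \<forall>i.
        (LINT x:G|lebesgue. partial i \<phi> x *\<^sub>R u x) = - (LINT x:G|lebesgue. \<phi> x *\<^sub>R p x $ i))"

text \<open>\<^term>\<open>u\<close> is in \<open>H\<^sup>1\<^sub>l\<^sub>o\<^sub>c(G)\<close> and satisfies \<open>\<nabla>\<cdot>(C \<nabla>u) + k\<^sup>2 n u = f\<close> in the sense of
  distributions on the open set \<^term>\<open>G\<close>.\<close>

definition solves_div_form ::
    "(real^2) set \<Rightarrow> (real^2 \<Rightarrow> complex^2^2) \<Rightarrow> (real^2 \<Rightarrow> complex) \<Rightarrow> real
     \<Rightarrow> (real^2 \<Rightarrow> complex) \<Rightarrow> (real^2 \<Rightarrow> complex) \<Rightarrow> bool" where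
  "solves_div_form G C n k f u \<longleftrightarrow>
     (\<exists>p. has_weak_gradient G u p \<and>
        locally_integrable G (\<lambda>x. (norm (u x))\<^sup>2) \<and>
        locally_integrable G (\<lambda>x. (norm (p x))\<^sup>2) \<and>
        locally_integrable G (\<lambda>x. C x *v p x) \<and>
        locally_integrable G (\<lambda>x. n x * u x) \<and>
        (\<forall>\<phi>\<in>test_functions G.
           - (LINT x:G|lebesgue. (\<Sum>i\<in>UNIV. partial i \<phi> x *\<^sub>R (C x *v p x) $ i))
           + of_real (k\<^sup>2) * (LINT x:G|lebesgue. \<phi> x *\<^sub>R (n x * u x))
           = (LINT x:G|lebesgue. \<phi> x *\<^sub>R f x)))"


section \<open>Lipschitz boundaries, the trace and \<open>H\<^sup>1\<^sup>/\<^sup>2\<close>\<close>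

definition lipschitz_boundary :: "(real^2) set \<Rightarrow> bool" where
  "lipschitz_boundary D \<longleftrightarrow>
     (\<forall>x\<in>frontier D. \<exists>e d h L \<epsilon>.
        norm e = 1 \<and> norm d = 1 \<and> e \<bullet> d = 0 \<and> L-lipschitz_on UNIV (h :: real \<Rightarrow> real) \<and> 0 < \<epsilon> \<and>
        D \<inter> ball x \<epsilon> = {y \<in> ball x \<epsilon>. (y - x) \<bullet> d < h ((y - x) \<bullet> e)})"

text \<open>Arc length is the one-dimensional Hausdorff measure. The guard \<^const>\<open>bounded\<close> is needed
  because \<^const>\<open>diameter\<close> is unspecified on unbounded sets. The Hausdorff outer measure is
  countably additive on the Borel sets, so \<^const>\<open>measure_of\<close> does not degenerate here.\<close>

definition hausdorff1 :: "(real^2) set \<Rightarrow> ennreal" where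
  "hausdorff1 A = (SUP \<delta>\<in>{0<..}.
     INF E\<in>{E :: nat \<Rightarrow> (real^2) set. A \<subseteq> (\<Union>i. E i) \<and> (\<forall>i. bounded (E i) \<and> diameter (E i) \<le> \<delta>)}.
       (\<Sum>i. ennreal (diameter (E i))))"

definition arc_length :: "(real^2) measure" where
  "arc_length = measure_of UNIV (sets borel) hausdorff1"

text \<open>The Sobolev--Slobodeckij definition; the exponent of \<^term>\<open>norm (x - y)\<close> is
  \<open>(2 - 1) + 2 \<cdot> 1/2 = 2\<close>.\<close>

definition H_half :: "(real^2) set \<Rightarrow> (real^2 \<Rightarrow> complex) \<Rightarrow> bool" where
  "H_half \<Gamma> g \<longleftrightarrow>
     set_borel_measurable arc_length \<Gamma> g \<and>
     (\<integral>\<^sup>+x\<in>\<Gamma>. ennreal ((norm (g x))\<^sup>2) \<partial>arc_length) < \<infinity> \<and>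
     (\<integral>\<^sup>+x\<in>\<Gamma>. (\<integral>\<^sup>+y\<in>\<Gamma>. ennreal ((norm (g x - g y) / norm (x - y))\<^sup>2) \<partial>arc_length) \<partial>arc_length)
       < \<infinity>"

text \<open>The trace on \<^term>\<open>frontier D\<close> from outside: restrictions of smooth functions that converge
  to \<^term>\<open>u\<close> in \<open>H\<^sup>1\<close> of an outer neighbourhood converge to \<^term>\<open>g\<close> in \<open>L\<^sup>2\<close> of the boundary.\<close>

definition has_outer_trace ::
    "(real^2) set \<Rightarrow> (real^2 \<Rightarrow> complex) \<Rightarrow> (real^2 \<Rightarrow> complex) \<Rightarrow> bool" where
  "has_outer_trace D u g \<longleftrightarrow>
     (\<exists>N p (\<phi> :: nat \<Rightarrow> real^2 \<Rightarrow> complex).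
        open N \<and> bounded N \<and> closure D \<subseteq> N \<and>
        has_weak_gradient (N - closure D) u p \<and> (\<forall>j. smooth (\<phi> j)) \<and>
        (\<lambda>j. \<integral>\<^sup>+x\<in>N - closure D. ennreal ((norm (u x - \<phi> j x))\<^sup>2 + (norm (p x - grad (\<phi> j) x))\<^sup>2)
           \<partial>lebesgue) \<longlonglongrightarrow> 0 \<and>
        (\<lambda>j. \<integral>\<^sup>+x\<in>frontier D. ennreal ((norm (\<phi> j x - g x))\<^sup>2) \<partial>arc_length) \<longlonglongrightarrow> 0)"


section \<open>The exterior Helmholtz problem\<close>

definition sommerfeld :: "real \<Rightarrow> (real^2 \<Rightarrow> complex) \<Rightarrow> bool" where
  "sommerfeld k U \<longleftrightarrow>
     (\<exists>c R. 0 < R \<and>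
       (\<forall>x. R \<le> norm x \<longrightarrow>
          (\<exists>d. ((\<lambda>t. U (t *\<^sub>R sgn x)) has_vector_derivative d) (at (norm x)) \<and>
               norm (d - \<i> * of_real k * U x) \<le> c / norm x)))"

definition solves_exterior_helmholtz ::
    "real \<Rightarrow> (real^2) set \<Rightarrow> (real^2 \<Rightarrow> complex) \<Rightarrow> (real^2 \<Rightarrow> complex) \<Rightarrow> (real^2 \<Rightarrow> complex) \<Rightarrow> bool"
  where
  "solves_exterior_helmholtz k D f g U \<longleftrightarrow>
     solves_div_form (- closure D) (\<lambda>x. mat 1) (\<lambda>x. 1) k f U \<and>
     has_outer_trace D U g \<and>
     sommerfeld k U"


section \<open>Star-shaped truncation and the complex compression transformation\<close>

definition polar :: "real \<Rightarrow> real \<Rightarrow> real^2" where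
  "polar r \<theta> = vector [r * cos \<theta>, r * sin \<theta>]"

definition ang :: "real^2 \<Rightarrow> real" where
  "ang x = Arg (Complex (x $ 1) (x $ 2))"

definition smooth_on_interval :: "(real \<Rightarrow> real) \<Rightarrow> real set \<Rightarrow> bool" where
  "smooth_on_interval R I \<longleftrightarrow> (\<exists>h. smooth h \<and> (\<forall>\<theta>\<in>I. R \<theta> = h \<theta>))"

definition star_radius :: "(real \<Rightarrow> real) \<Rightarrow> bool" where
  "star_radius R1 \<longleftrightarrow>
     continuous_on UNIV R1 \<and> (\<forall>\<theta>. 0 < R1 \<theta>) \<and> (\<forall>\<theta>. R1 (\<theta> + 2 * pi) = R1 \<theta>) \<and>
     (\<exists>(m::nat) t. t 0 = 0 \<and> t m = 2 * pi \<and> strict_mono_on {..m} t \<and>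
        (\<forall>i<m. smooth_on_interval R1 {t i..t (Suc i)}))"

definition star_domain :: "(real \<Rightarrow> real) \<Rightarrow> (real^2) set" where
  "star_domain R1 = {polar r \<theta> | r \<theta>. 0 \<le> r \<and> r < R1 \<theta>}"

definition layer :: "(real \<Rightarrow> real) \<Rightarrow> real \<Rightarrow> (real^2) set" where
  "layer R1 \<rho> = {polar r \<theta> | r \<theta>. R1 \<theta> < r \<and> r < \<rho> * R1 \<theta>}"

definition pal_T :: "(real \<Rightarrow> real) \<Rightarrow> real \<Rightarrow> real \<Rightarrow> real \<Rightarrow> real" where
  "pal_T R1 \<rho> r \<theta> = (\<rho> * R1 \<theta> - R1 \<theta>) * (r - R1 \<theta>) / (\<rho> * R1 \<theta> - r)"

definition pal_S :: "(real \<Rightarrow> real) \<Rightarrow> real \<Rightarrow> real \<Rightarrow> real \<Rightarrow> real \<Rightarrow> real \<Rightarrow> complex" where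
  "pal_S R1 \<rho> \<sigma>0 \<sigma>1 r \<theta> =
     (if R1 \<theta> < r \<and> r < \<rho> * R1 \<theta>
      then of_real (R1 \<theta>) + of_real (\<sigma>1 * pal_T R1 \<rho> r \<theta>) + \<i> * of_real (\<sigma>0 * pal_T R1 \<rho> r \<theta>)
      else of_real r)"

definition pal_S_r :: "(real \<Rightarrow> real) \<Rightarrow> real \<Rightarrow> real \<Rightarrow> real \<Rightarrow> real \<Rightarrow> real \<Rightarrow> complex" where
  "pal_S_r R1 \<rho> \<sigma>0 \<sigma>1 r \<theta> = vector_derivative (\<lambda>s. pal_S R1 \<rho> \<sigma>0 \<sigma>1 s \<theta>) (at r)"

text \<open>On the finitely many rays through corners of the interface the angular derivative need not
  exist; these rays form a null set.\<close>

definition pal_S_theta :: "(real \<Rightarrow> real) \<Rightarrow> real \<Rightarrow> real \<Rightarrow> real \<Rightarrow> real \<Rightarrow> real \<Rightarrow> complex" where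
  "pal_S_theta R1 \<rho> \<sigma>0 \<sigma>1 r \<theta> = vector_derivative (\<lambda>t. pal_S R1 \<rho> \<sigma>0 \<sigma>1 r t) (at \<theta>)"

text \<open>The values \<open>S(r,\<theta>)\<close> on the layer lie on the ray from \<^term>\<open>R1 \<theta>\<close> in the direction
  \<open>\<sigma>\<^sub>1 + \<i> \<sigma>\<^sub>0\<close>. The field at a complex radius is the analytic continuation of \<open>r \<mapsto> U(r,\<theta>)\<close> to the
  closed sector between this ray and the real axis; continuing along the ray alone could select a
  branch other than the one subject to the radiation condition on the real axis.\<close>

definition sector :: "(real \<Rightarrow> real) \<Rightarrow> real \<Rightarrow> real \<Rightarrow> real \<Rightarrow> complex set" where
  "sector R1 \<sigma>0 \<sigma>1 \<theta> = {of_real (R1 \<theta>) + Complex a b | a b. 0 \<le> b \<and> \<sigma>1 * b \<le> \<sigma>0 * a}"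

definition radial_continuation ::
    "(real \<Rightarrow> real) \<Rightarrow> real \<Rightarrow> real \<Rightarrow> (real^2 \<Rightarrow> complex) \<Rightarrow> (complex \<Rightarrow> real \<Rightarrow> complex) \<Rightarrow> bool" where
  "radial_continuation R1 \<sigma>0 \<sigma>1 U W \<longleftrightarrow>
     (\<exists>Z W1 W2.
        open Z \<and> (\<forall>\<theta>. \<forall>z\<in>sector R1 \<sigma>0 \<sigma>1 \<theta>. (z, \<theta>) \<in> Z) \<and>
        (\<forall>\<theta>. (\<lambda>z. W z \<theta>) holomorphic_on {z. (z, \<theta>) \<in> Z}) \<and>
        (\<forall>z \<theta>. (z, \<theta>) \<in> Z \<longrightarrow>
           ((\<lambda>t. W z t) has_vector_derivative W1 z \<theta>) (at \<theta>) \<and>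
           ((\<lambda>t. W1 z t) has_vector_derivative W2 z \<theta>) (at \<theta>)) \<and>
        continuous_on Z (\<lambda>(z, \<theta>). W z \<theta>) \<and>
        continuous_on Z (\<lambda>(z, \<theta>). W1 z \<theta>) \<and>
        continuous_on Z (\<lambda>(z, \<theta>). W2 z \<theta>) \<and>
        (\<forall>r \<theta>. (of_real r, \<theta>) \<in> Z \<longrightarrow> W (of_real r) \<theta> = U (polar r \<theta>)))"

text \<open>The transformed field \<open>W(S(r,\<theta>),\<theta>)\<close>; inside the interface \<open>S = r\<close> and it is \<^term>\<open>U\<close>.\<close>

definition pal_field ::
    "(real \<Rightarrow> real) \<Rightarrow> real \<Rightarrow> real \<Rightarrow> real \<Rightarrow> (real^2 \<Rightarrow> complex) \<Rightarrow> (complex \<Rightarrow> real \<Rightarrow> complex)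
     \<Rightarrow> real^2 \<Rightarrow> complex" where
  "pal_field R1 \<rho> \<sigma>0 \<sigma>1 U W x =
     (if x \<in> layer R1 \<rho> then W (pal_S R1 \<rho> \<sigma>0 \<sigma>1 (norm x) (ang x)) (ang x) else U x)"


section \<open>The PAL problem\<close>

definition rot :: "real \<Rightarrow> complex^2^2" where
  "rot \<theta> = vector [vector [of_real (cos \<theta>), - of_real (sin \<theta>)],
                   vector [of_real (sin \<theta>), of_real (cos \<theta>)]]"

definition pal_B :: "(real \<Rightarrow> real) \<Rightarrow> real \<Rightarrow> real \<Rightarrow> real \<Rightarrow> real \<Rightarrow> real \<Rightarrow> complex^2^2" where
  "pal_B R1 \<rho> \<sigma>0 \<sigma>1 r \<theta> =
     (let S = pal_S R1 \<rho> \<sigma>0 \<sigma>1 r \<theta>;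
          Sr = pal_S_r R1 \<rho> \<sigma>0 \<sigma>1 r \<theta>;
          St = pal_S_theta R1 \<rho> \<sigma>0 \<sigma>1 r \<theta>
      in vector [vector [S / (of_real r * Sr) * (1 + St\<^sup>2 / S\<^sup>2), - St / S],
                 vector [- St / S, of_real r * Sr / S]])"

definition pal_C :: "(real \<Rightarrow> real) \<Rightarrow> real \<Rightarrow> real \<Rightarrow> real \<Rightarrow> real^2 \<Rightarrow> complex^2^2" where
  "pal_C R1 \<rho> \<sigma>0 \<sigma>1 x =
     (if x \<in> layer R1 \<rho>
      then rot (ang x) ** pal_B R1 \<rho> \<sigma>0 \<sigma>1 (norm x) (ang x) ** transpose (rot (ang x))
      else mat 1)"

definition pal_n :: "(real \<Rightarrow> real) \<Rightarrow> real \<Rightarrow> real \<Rightarrow> real \<Rightarrow> real^2 \<Rightarrow> complex" where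
  "pal_n R1 \<rho> \<sigma>0 \<sigma>1 x =
     (if x \<in> layer R1 \<rho>
      then pal_S R1 \<rho> \<sigma>0 \<sigma>1 (norm x) (ang x) * pal_S_r R1 \<rho> \<sigma>0 \<sigma>1 (norm x) (ang x)
             / of_real (norm x)
      else 1)"

definition conormal_flux ::
    "real^2 \<Rightarrow> (real^2 \<Rightarrow> complex^2^2) \<Rightarrow> (real^2 \<Rightarrow> complex) \<Rightarrow> real^2 \<Rightarrow> complex" where
  "conormal_flux \<nu> C u x = (\<Sum>i\<in>UNIV. of_real (\<nu> $ i) * (C x *v grad u x) $ i)"

text \<open>Both one-sided limits at every interface point agree; the flux condition is imposed wherever
  the interface is smooth, i.e. has a unit normal (unique up to sign).\<close>

definition transmission ::
    "(real \<Rightarrow> real) \<Rightarrow> (real^2) set \<Rightarrow> (real^2) set \<Rightarrow> (real^2 \<Rightarrow> complex^2^2) \<Rightarrow> (real^2 \<Rightarrow> complex)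
     \<Rightarrow> bool" where
  "transmission R1 A B C u \<longleftrightarrow>
     (\<forall>\<theta>. \<exists>l. (u \<longlongrightarrow> l) (at (polar (R1 \<theta>) \<theta>) within A) \<and>
               (u \<longlongrightarrow> l) (at (polar (R1 \<theta>) \<theta>) within B)) \<and>
     (\<forall>\<theta> \<epsilon> \<nu>. 0 < \<epsilon> \<and> smooth_on_interval R1 {\<theta> - \<epsilon><..<\<theta> + \<epsilon>} \<and>
        norm \<nu> = 1 \<and> \<nu> \<bullet> vector_derivative (\<lambda>t. polar (R1 t) t) (at \<theta>) = 0 \<longrightarrow>
        (\<forall>\<^sub>F x in at (polar (R1 \<theta>) \<theta>) within (A \<union> B). u differentiable (at x)) \<and>
        (\<exists>q. (conormal_flux \<nu> C u \<longlongrightarrow> q) (at (polar (R1 \<theta>) \<theta>) within A) \<and>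
             (conormal_flux \<nu> C u \<longlongrightarrow> q) (at (polar (R1 \<theta>) \<theta>) within B)))"

definition bounded_at_outer_boundary ::
    "(real \<Rightarrow> real) \<Rightarrow> real \<Rightarrow> (real^2 \<Rightarrow> complex) \<Rightarrow> bool" where
  "bounded_at_outer_boundary R1 \<rho> u \<longleftrightarrow>
     (\<exists>M \<delta>. 0 < \<delta> \<and>
       (\<forall>r \<theta>. R1 \<theta> < r \<and> r < \<rho> * R1 \<theta> \<and> \<rho> * R1 \<theta> - r < \<delta> \<longrightarrow> norm (u (polar r \<theta>)) \<le> M))"

definition solves_pal_problem ::
    "real \<Rightarrow> (real^2) set \<Rightarrow> (real \<Rightarrow> real) \<Rightarrow> real \<Rightarrow> real \<Rightarrow> real
     \<Rightarrow> (real^2 \<Rightarrow> complex) \<Rightarrow> (real^2 \<Rightarrow> complex) \<Rightarrow> (real^2 \<Rightarrow> complex) \<Rightarrow> bool" where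
  "solves_pal_problem k D R1 \<rho> \<sigma>0 \<sigma>1 f g u \<longleftrightarrow>
     solves_div_form ((star_domain R1 - closure D) \<union> layer R1 \<rho>)
       (pal_C R1 \<rho> \<sigma>0 \<sigma>1) (pal_n R1 \<rho> \<sigma>0 \<sigma>1) k f u \<and>
     has_outer_trace D u g \<and>
     bounded_at_outer_boundary R1 \<rho> u \<and>
     transmission R1 (star_domain R1 - closure D) (layer R1 \<rho>) (pal_C R1 \<rho> \<sigma>0 \<sigma>1) u"

end

theory Submission
  imports Defs "HOL-Complex_Analysis.Complex_Analysis" "HOL-Real_Asymp.Real_Asymp"
begin

text \<open>Outside the interface \<open>U(r,\<theta>) = W(r,\<theta>)\<close> with \<open>W\<close> holomorphic in the radius, and
  \<open>\<Lambda> = W\<^sub>z\<^sub>z + W\<^sub>z/z + W\<^sub>\<theta>\<^sub>\<theta>/z\<^sup>2 + k\<^sup>2W\<close> is holomorphic too. Testing the weak equation with bump functions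
  gives \<open>\<Lambda> = 0\<close> for large real radii, hence on the whole sector by the identity theorem. With
  \<open>P = S W\<^sub>z - S\<^sub>\<theta> W\<^sub>\<theta>/S\<close> and \<open>Q = S\<^sub>r W\<^sub>\<theta>/S\<close>, all evaluated at \<open>(S(r,\<theta>),\<theta>)\<close>, the vector field
  \<open>C \<nabla>U\<^sub>P\<^sub>A\<^sub>L\<close> has the polar components \<open>P/r\<close> and \<open>Q\<close>, and \<open>P\<^sub>r + Q\<^sub>\<theta> = S S\<^sub>r (\<Lambda> - k\<^sup>2W)\<close>; the
  divergence theorem in polar coordinates turns this into the weak PAL equation.

  Boundedness near the outer boundary means boundedness of \<open>W\<close> on the sector at large real part.
  The angular Fourier modes, multiplied by \<open>\<surd>z\<close>, satisfy \<open>y'' = ((n\<^sup>2 - 1/4)/z\<^sup>2 - k\<^sup>2) y\<close>. On every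
  horizontal line in the upper half plane the radiation condition persists, and since
  \<open>Re (i y' conj y)\<close> is increasing there with nonpositive limit, each mode with \<open>n \<noteq> 0\<close> decreases
  in modulus along vertical lines; the mode \<open>n = 0\<close> is integrated directly. The sum of the moduli on
  the real axis is bounded: by Parseval and the radiation condition for \<open>|n| \<le> 2kr\<close>, by convexity of
  \<open>|y|\<^sup>2/r\<close> in \<open>ln r\<close> for larger \<open>|n|\<close>.
  The resulting bounded function agrees with \<open>W\<close> on the real axis, hence on the sector by Schwarz
  reflection.\<close>


section \<open>Smooth functions and test functions\<close>

text \<open>The continuation W comes without any growth bound on the sector, and the radiation
  condition speaks about real radii only. So a bounded continuation is built separately from the
  angular modes and identified with W afterwards. The potential of mode n is (n^2 - 1/4)/z^2; its
  sign drives the monotonicity along vertical lines for n \<noteq> 0 and is wrong for n = 0.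

  The corners of the interface shape the divergence part. S_\<theta> contains the derivative of R1,
  which jumps across finitely many rays, and the radial flux P jumps with it. But P is
  differentiated in r only, while Q, which is differentiated in \<theta>, contains S_r instead of
  S_\<theta> and stays continuous. Hence Green's formula has no contribution from the rays and the
  second derivative of R1 never occurs.

  The disk that carries f may reach into the layer. As the continuation starts at the interface,
  \<Lambda> = 0 also holds at all real radii beyond it, which forces f to vanish there in the sense
  of distributions; otherwise the layer equation could not have f on its right-hand side.\<close>

lemma smooth_family:
  assumes diff: "\<And>f x. f \<in> F \<Longrightarrow> f differentiable (at x)"
    and closed: "\<And>f v. f \<in> F \<Longrightarrow> (\<lambda>x. frechet_derivative f (at x) v) \<in> F"
    and "f \<in> F"
  shows "smooth f"
proof -
  \<comment> \<open>The order of smoothness is treated for all members of F at once, because the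
    directional derivative in the induction step is another member of F.\<close>
  have "cont_diff m f" for m
    using \<open>f \<in> F\<close>
  proof (induction m arbitrary: f)
    case 0
    then show ?case
      using diff differentiable_imp_continuous_on[of f UNIV]
      by (auto simp: differentiable_on_def)
  next
    case (Suc m)
    then show ?case using diff closed by auto
  qed
  then show ?thesis by (simp add: smooth_def)
qed

lemma smooth_differentiable: "smooth f \<Longrightarrow> f differentiable (at x)"
  using cont_diff.simps(2)[of 0 f] unfolding smooth_def by blast

lemma smooth_frechet: "smooth f \<Longrightarrow> smooth (\<lambda>x. frechet_derivative f (at x) v)"
  using cont_diff.simps(2)[of _ f] unfolding smooth_def by blast

lemma smooth_continuous: "smooth f \<Longrightarrow> continuous_on S f"
  using cont_diff.simps(1)[of f] continuous_on_subset[of UNIV f S] unfolding smooth_def by blast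

section \<open>Smooth bump functions\<close>

text \<open>The classical function exp(-1/t), extended by 0 and divided by a power of t. With the
  power as a parameter, the derivative of a member is a linear combination of two members, also at t
  = 0.\<close>

definition flat :: "nat \<Rightarrow> real \<Rightarrow> real" where
  "flat j t = (if 0 < t then exp (- (1 / t)) / t ^ j else 0)"

lemma flat_small: "(flat j \<longlongrightarrow> 0) (at_right 0)"
proof -
  have "((\<lambda>t. exp (- (1 / t)) / t ^ j) \<longlongrightarrow> 0) (at_right (0::real))"
  proof -
    have "((\<lambda>s. s ^ j / exp s) \<longlongrightarrow> 0) (at_top :: real filter)"
      by (rule tendsto_power_div_exp_0)
    then have "((\<lambda>t. inverse t ^ j / exp (inverse t)) \<longlongrightarrow> 0) (at_right (0::real))"
      by (rule filterlim_compose[OF _ filterlim_inverse_at_top_right])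
    then show ?thesis
      by (rule Lim_transform_eventually)
        (auto simp: exp_minus field_simps power_inverse[symmetric] eventually_at_filter)
  qed
  then show ?thesis
    by (rule Lim_transform_eventually) (auto simp: flat_def eventually_at_filter)
qed

lemma flat_deriv: "(flat j has_real_derivative (flat (j + 2) t - j * flat (j + 1) t)) (at t)"
proof -
  consider "0 < t" | "t < 0" | "t = 0" by linarith
  then show ?thesis
  proof cases
    case 1
    have "((\<lambda>t. exp (- (1 / t)) / t ^ j) has_real_derivative (flat (j + 2) t - j * flat (j + 1) t)) (at t)"
    proof -
      have p: "((\<lambda>t. inverse t ^ j) has_real_derivative (- (real j * inverse t ^ (j + 1)))) (at t)"
      proof (cases j)
        case (Suc i)
        show ?thesis
          by (rule DERIV_cong[OF DERIV_power[OF DERIV_inverse]]) (use 1 Suc in \<open>auto simp: algebra_simps\<close>)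
      qed simp
      have e: "((\<lambda>t. exp (- (1 / t))) has_real_derivative exp (- (1 / t)) * inverse t ^ 2) (at t)"
        using 1 by (auto intro!: derivative_eq_intros simp: power2_eq_square field_simps)
      show ?thesis
        using DERIV_mult[OF e p] 1
        by (simp add: flat_def power_inverse divide_inverse algebra_simps power_add power2_eq_square)
    qed
    moreover have "\<forall>\<^sub>F s in nhds t. exp (- (1 / s)) / s ^ j = flat j s"
      using eventually_nhds_in_open[of "{0<..}" t] 1
      by (auto simp: flat_def elim!: eventually_mono)
    ultimately show ?thesis
      by (subst DERIV_cong_ev[OF refl _ refl, where g = "\<lambda>t. exp (- (1 / t)) / t ^ j"])
        (auto elim: eventually_mono)
  next
    case 2
    have "\<forall>\<^sub>F s in nhds t. flat j s = 0"
      using eventually_nhds_in_open[of "{..<0}" t] 2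
      by (auto simp: flat_def elim!: eventually_mono)
    then show ?thesis using 2
      by (subst DERIV_cong_ev[OF refl _ refl, where g = "\<lambda>t. 0"]) (auto simp: flat_def)
  next
    case 3
    \<comment> \<open>To the right of 0 the difference quotient is itself a member,
      \<open>flat (Suc j)\<close>, and these are small near 0.\<close>
    have r: "((\<lambda>h. flat j h / h) \<longlongrightarrow> 0) (at_right 0)"
      using flat_small[of "Suc j"]
      by (rule Lim_transform_eventually) (auto simp: flat_def eventually_at_filter)
    have l: "((\<lambda>h. flat j h / h) \<longlongrightarrow> 0) (at_left 0)"
      by (rule tendsto_eventually) (auto simp: flat_def eventually_at_filter)
    have "((\<lambda>h. flat j h / h) \<longlongrightarrow> 0) (at 0)"
      using r l by (simp add: filterlim_at_split)
    then show ?thesis using 3 by (simp add: DERIV_def flat_def)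
  qed
qed

text \<open>An algebra that is closed under directional derivatives when q is a quadratic polynomial
  in x - x0: the chain rule for \<open>flat j (q x)\<close> yields members of \<open>flat\<close>
  times an inner product with x - x0. This closure is what \<open>smooth_family\<close> asks
  for.\<close>

inductive_set bump_family :: "(real^2 \<Rightarrow> real) \<Rightarrow> real^2 \<Rightarrow> (real^2 \<Rightarrow> real) set"
  for q :: "real^2 \<Rightarrow> real" and x0 :: "real^2" where
  const: "(\<lambda>x. c) \<in> bump_family q x0"
| inner: "(\<lambda>x. (x - x0) \<bullet> w) \<in> bump_family q x0"
| flat: "(\<lambda>x. flat j (q x)) \<in> bump_family q x0"
| add: "f \<in> bump_family q x0 \<Longrightarrow> g \<in> bump_family q x0 \<Longrightarrow> (\<lambda>x. f x + g x) \<in> bump_family q x0"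
| mult: "f \<in> bump_family q x0 \<Longrightarrow> g \<in> bump_family q x0 \<Longrightarrow> (\<lambda>x. f x * g x) \<in> bump_family q x0"

lemma bump_family_deriv:
  assumes q: "q = (\<lambda>x. 1 - (x - x0) \<bullet> (x - x0) * c)"
    and "f \<in> bump_family q x0"
  shows "\<exists>f'. (\<forall>x. (f has_derivative f' x) (at x)) \<and> (\<forall>v. (\<lambda>x. f' x v) \<in> bump_family q x0)"
  using assms(2)
proof induction
  case (const c)
  then show ?case
    by (intro exI[of _ "\<lambda>x v. 0"]) (auto intro: bump_family.const)
next
  case (inner w)
  then show ?case
    by (intro exI[of _ "\<lambda>x v. v \<bullet> w"]) (auto intro!: bump_family.const derivative_eq_intros)
next
  case (flat j)
  have qd: "(q has_derivative (\<lambda>v. - 2 * c * ((x - x0) \<bullet> v))) (at x)" for x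
    unfolding q by (auto intro!: derivative_eq_intros simp: inner_commute algebra_simps)
  have "((\<lambda>x. flat j (q x)) has_derivative
      (\<lambda>v. (flat (j + 2) (q x) + (- real j) * flat (j + 1) (q x)) * (- 2 * c * ((x - x0) \<bullet> v)))) (at x)" for x
    using has_derivative_compose[OF qd flat_deriv[of j "q x", unfolded has_field_derivative_def]]
    by simp
  moreover have "(\<lambda>x. (flat (j + 2) (q x) + (- real j) * flat (j + 1) (q x)) * (- 2 * c * ((x - x0) \<bullet> v)))
      \<in> bump_family q x0" for v
    by (intro bump_family.mult bump_family.add bump_family.flat bump_family.const bump_family.inner)
  ultimately show ?case
    by (intro exI[of _ "\<lambda>x v. (flat (j + 2) (q x) + - real j * flat (j + 1) (q x)) * (- 2 * c * ((x - x0) \<bullet> v))"]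
        conjI allI)
next
  case (add f g)
  then obtain f' g' where
    "\<And>x. (f has_derivative f' x) (at x)" "\<And>v. (\<lambda>x. f' x v) \<in> bump_family q x0"
    "\<And>x. (g has_derivative g' x) (at x)" "\<And>v. (\<lambda>x. g' x v) \<in> bump_family q x0"
    by blast
  then show ?case
    by (intro exI[of _ "\<lambda>x v. f' x v + g' x v"]) (auto intro!: bump_family.add has_derivative_add)
next
  case (mult f g)
  then obtain f' g' where
    "\<And>x. (f has_derivative f' x) (at x)" "\<And>v. (\<lambda>x. f' x v) \<in> bump_family q x0"
    "\<And>x. (g has_derivative g' x) (at x)" "\<And>v. (\<lambda>x. g' x v) \<in> bump_family q x0"
    by blast
  with mult show ?case
    by (intro exI[of _ "\<lambda>x v. f x * g' x v + f' x v * g x"])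
      (auto intro!: bump_family.add bump_family.mult has_derivative_mult)
qed

lemma smooth_bump:
  assumes "0 < \<epsilon>"
  obtains \<phi> :: "real^2 \<Rightarrow> real"
  where "smooth \<phi>" "\<And>x. 0 \<le> \<phi> x" "{x. \<phi> x \<noteq> 0} = ball x0 \<epsilon>"
proof -
  define c where "c = 1 / \<epsilon>\<^sup>2"
  \<comment> \<open>Positive exactly on the open ball, so composing with \<open>flat 0\<close> gives
    a function that is nonzero precisely there.\<close>
  define q where "q = (\<lambda>x::real^2. 1 - (x - x0) \<bullet> (x - x0) * c)"
  define \<phi> where "\<phi> = (\<lambda>x. flat 0 (q x))"
  have "smooth \<phi>"
  proof (rule smooth_family[of "bump_family q x0"])
    fix f x v assume f: "f \<in> bump_family q x0"
    obtain f' where f': "\<And>x. (f has_derivative f' x) (at x)" "\<And>v. (\<lambda>x. f' x v) \<in> bump_family q x0"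
      using bump_family_deriv[OF q_def f] by blast
    then show "f differentiable at x" by (auto simp: differentiable_def)
    have "f' x = frechet_derivative f (at x)" for x
      using f'(1) by (rule frechet_derivative_at)
    then show "(\<lambda>x. frechet_derivative f (at x) v) \<in> bump_family q x0"
      using f'(2)[of v] by simp
  qed (auto simp: \<phi>_def intro: bump_family.flat)
  moreover have "\<phi> x \<noteq> 0 \<longleftrightarrow> x \<in> ball x0 \<epsilon>" for x
  proof -
    have "\<phi> x \<noteq> 0 \<longleftrightarrow> (norm (x - x0))\<^sup>2 < \<epsilon>\<^sup>2"
      using assms by (auto simp: \<phi>_def flat_def q_def c_def dot_square_norm field_simps)
    also have "\<dots> \<longleftrightarrow> x \<in> ball x0 \<epsilon>"
      using assms by (auto simp: dist_norm norm_minus_commute intro: power_strict_mono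
          dest: power_less_imp_less_base)
    finally show ?thesis .
  qed
  moreover have "0 \<le> \<phi> x" for x by (auto simp: \<phi>_def flat_def)
  ultimately show thesis by (intro that[of \<phi>]) blast+
qed

section \<open>Test functions and their derivatives\<close>

lemma test_functionsD:
  assumes "\<phi> \<in> test_functions G"
  shows "smooth \<phi>" "compact (closure {x. \<phi> x \<noteq> 0})" "closure {x. \<phi> x \<noteq> 0} \<subseteq> G"
  using assms by (auto simp: test_functions_def)

lemma test_functions_mono: "G \<subseteq> H \<Longrightarrow> test_functions G \<subseteq> test_functions H"
  by (auto simp: test_functions_def)

lemma test_function_zero_near:
  assumes "x \<notin> closure {x. \<phi> x \<noteq> 0}"
  shows "\<forall>\<^sub>F y in nhds x. \<phi> y = 0"
  using eventually_nhds_in_open[of "- closure {x. \<phi> x \<noteq> 0}" x] assms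
  using closure_subset[of "{x. \<phi> x \<noteq> 0}"] by (force elim!: eventually_mono)

lemma test_function_deriv_zero:
  fixes \<phi> :: "'a::real_normed_vector \<Rightarrow> 'b::real_normed_vector"
  assumes "x \<notin> closure {x. \<phi> x \<noteq> 0}"
  shows "frechet_derivative \<phi> (at x) = (\<lambda>v. 0)"
proof -
  have ev: "\<forall>\<^sub>F y in nhds x. \<phi> y = 0" by (rule test_function_zero_near[OF assms])
  have "((\<lambda>x. 0 :: 'b) has_derivative (\<lambda>v. 0)) (at x)" by simp
  then have "(\<phi> has_derivative (\<lambda>v. 0)) (at x)"
    using ev eventually_nhds_x_imp_x[OF ev]
    by (elim has_derivative_transform_eventually) (auto simp: eventually_at_filter elim: eventually_mono)
  then show ?thesis using frechet_derivative_at by metis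
qed

lemma test_functions_frechet:
  assumes "\<phi> \<in> test_functions G"
  shows "(\<lambda>x. frechet_derivative \<phi> (at x) v) \<in> test_functions G"
proof -
  have sub: "closure {x. frechet_derivative \<phi> (at x) v \<noteq> 0} \<subseteq> closure {x. \<phi> x \<noteq> 0}" (is "closure ?A \<subseteq> _")
  proof (rule closure_minimal)
    show "?A \<subseteq> closure {x. \<phi> x \<noteq> 0}"
      using test_function_deriv_zero[of _ \<phi>] by force
  qed simp
  have "compact (closure {x. \<phi> x \<noteq> 0} \<inter> closure ?A)"
    using test_functionsD(2)[OF assms] closed_closure by (rule compact_Int_closed)
  then have "compact (closure ?A)" using sub by (simp add: inf.absorb2)
  then show ?thesis
    using sub test_functionsD[OF assms] smooth_frechet[of \<phi> v]
    unfolding test_functions_def by blast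
qed

lemma test_functions_partial: "\<phi> \<in> test_functions G \<Longrightarrow> partial i \<phi> \<in> test_functions G"
  using test_functions_frechet[of \<phi> G "axis i 1"] by (simp add: partial_def[abs_def])

lemma smooth_has_derivative:
  "smooth \<phi> \<Longrightarrow> (\<phi> has_derivative frechet_derivative \<phi> (at x)) (at x)"
  using smooth_differentiable frechet_derivative_works by blast

lemma frechet_partial:
  fixes \<phi> :: "real^2 \<Rightarrow> 'b::real_normed_vector"
  assumes "\<phi> differentiable (at x)"
  shows "frechet_derivative \<phi> (at x) v = (\<Sum>i\<in>UNIV. v $ i *\<^sub>R partial i \<phi> x)"
proof -
  have l: "linear (frechet_derivative \<phi> (at x))"
    using assms by (rule linear_frechet_derivative)
  have "v = (\<Sum>i\<in>UNIV. v $ i *\<^sub>R axis i 1)"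
    using basis_expansion[of v] by (simp add: scalar_mult_eq_scaleR)
  then have "frechet_derivative \<phi> (at x) v = frechet_derivative \<phi> (at x) (\<Sum>i\<in>UNIV. v $ i *\<^sub>R axis i 1)"
    by simp
  also have "\<dots> = (\<Sum>i\<in>UNIV. v $ i *\<^sub>R frechet_derivative \<phi> (at x) (axis i 1))"
    by (simp add: linear_sum[OF l] linear_scale[OF l])
  finally show ?thesis by (simp add: partial_def)
qed

section \<open>Linear second-order equations in the complex domain\<close>

text \<open>One step of Picard's iteration: integrating the bound along the segment from z0, which
  convexity keeps inside K, raises the power by one and supplies the next factor of the
  factorial.\<close>

lemma deriv_power_bound_integrate:
  fixes F f :: "complex \<Rightarrow> complex"
  assumes "convex K" "z0 \<in> K" "z \<in> K" "0 \<le> C"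
    and der: "\<And>\<zeta>. \<zeta> \<in> K \<Longrightarrow> (F has_field_derivative f \<zeta>) (at \<zeta>)"
    and bnd: "\<And>\<zeta>. \<zeta> \<in> K \<Longrightarrow> norm (f \<zeta>) \<le> C * norm (\<zeta> - z0) ^ j / fact j"
    and "F z0 = 0"
  shows "norm (F z) \<le> C * norm (z - z0) ^ Suc j / fact (Suc j)"
proof -
  define p where "p = (\<lambda>t::real. z0 + of_real t * (z - z0))"
  define \<phi> where "\<phi> = (\<lambda>t::real. C * norm (z - z0) ^ Suc j / fact (Suc j) * t ^ Suc j)"
  have pK: "p t \<in> K" if "0 \<le> t" "t \<le> 1" for t
    using convexD[OF assms(1,2,3), of "1 - t" t] that
    by (simp add: p_def scaleR_conv_of_real algebra_simps)
  have pder: "(p has_vector_derivative (z - z0)) (at t)" for t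
    unfolding p_def has_vector_derivative_def
    by (auto intro!: derivative_eq_intros simp: scaleR_conv_of_real)
  have Fp: "((F \<circ> p) has_vector_derivative ((z - z0) * f (p t))) (at t)" if "0 \<le> t" "t \<le> 1" for t
    using field_vector_diff_chain_at[OF pder der[OF pK[OF that]]] .
  have "norm ((F \<circ> p) 1 - (F \<circ> p) 0) \<le> \<phi> 1 - \<phi> 0"
  proof (rule differentiable_bound_general[where f' = "\<lambda>t. (z - z0) * f (p t)"
      and \<phi>' = "\<lambda>t. C * norm (z - z0) ^ Suc j / fact j * t ^ j"])
    show "continuous_on {0..1} (F \<circ> p)"
      using has_vector_derivative_continuous[OF Fp] by (intro continuous_at_imp_continuous_on) auto
    show "(\<phi> has_vector_derivative C * norm (z - z0) ^ Suc j / fact j * t ^ j) (at t)" for t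
      unfolding \<phi>_def has_real_derivative_iff_has_vector_derivative[symmetric]
      by (rule DERIV_cong[OF DERIV_cmult[OF DERIV_pow]]) (simp add: field_simps del: of_nat_Suc)
    show "norm ((z - z0) * f (p t)) \<le> C * norm (z - z0) ^ Suc j / fact j * t ^ j"
      if "0 < t" "t < 1" for t
    proof -
      have "norm (f (p t)) \<le> C * (t * norm (z - z0)) ^ j / fact j"
        using bnd[of "p t"] pK[of t] that by (simp add: p_def norm_mult)
      then have "norm (z - z0) * norm (f (p t)) \<le> norm (z - z0) * (C * (t * norm (z - z0)) ^ j / fact j)"
        by (rule mult_left_mono) simp
      then show ?thesis unfolding norm_mult by (simp add: power_mult_distrib mult_ac)
    qed
  qed (use Fp in \<open>auto simp: \<phi>_def o_def intro!: continuous_intros\<close>)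
  then show ?thesis using assms(7) by (simp add: p_def \<phi>_def)
qed

text \<open>Picard iteration for the system u' = v, v' = q u, written as a series whose terms are
  successive primitives. The terms decay like M^n D^n / n! near every point of S, so the series and
  its termwise derivative converge locally uniformly. Convexity of S provides the
  primitives.\<close>

lemma complex_second_order_ivp:
  fixes q :: "complex \<Rightarrow> complex"
  assumes "open S" "convex S" "z0 \<in> S" and q: "q holomorphic_on S"
  obtains u v where "\<And>z. z \<in> S \<Longrightarrow> (u has_field_derivative v z) (at z)"
    "\<And>z. z \<in> S \<Longrightarrow> (v has_field_derivative q z * u z) (at z)" "u z0 = a" "v z0 = b"
proof -
  define J where "J f = (SOME g. g z0 = 0 \<and> (\<forall>z\<in>S. (g has_field_derivative f z) (at z)))"
    for f :: "complex \<Rightarrow> complex"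
  have J: "J f z0 = 0 \<and> (\<forall>z\<in>S. (J f has_field_derivative f z) (at z))"
    if "f holomorphic_on S" for f
  proof -
    obtain g where g: "\<And>x. x \<in> S \<Longrightarrow> (g has_field_derivative f x) (at x within S)"
      using holomorphic_convex_primitive'[OF \<open>convex S\<close> \<open>open S\<close> \<open>f holomorphic_on S\<close>] by metis
    have "((\<lambda>z. g z - g z0) has_field_derivative f z) (at z)" if "z \<in> S" for z
      using DERIV_diff[OF g[OF that] DERIV_const[of "g z0"]] at_within_open[OF that \<open>open S\<close>] by simp
    then have "(\<lambda>z. g z - g z0) z0 = 0 \<and>
        (\<forall>z\<in>S. ((\<lambda>z. g z - g z0) has_field_derivative f z) (at z))"
      by simp
    then show ?thesis unfolding J_def
      by (rule someI[of "\<lambda>g. g z0 = 0 \<and> (\<forall>z\<in>S. (g has_field_derivative f z) (at z))"])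
  qed
  \<comment> \<open>The pairs of Picard terms: the next u is the primitive of v, the next v the
    primitive of q u, both vanishing at z0. The initial values therefore sit in the constant terms
    alone.\<close>
  define uv where "uv = rec_nat (\<lambda>z::complex. a, \<lambda>z::complex. b) (\<lambda>_ (u, v). (J v, J (\<lambda>z. q z * u z)))"
  define us where "us j = fst (uv j)" for j
  define vs where "vs j = snd (uv j)" for j
  have us0: "us 0 = (\<lambda>z. a)" and vs0: "vs 0 = (\<lambda>z. b)" by (auto simp: us_def vs_def uv_def)
  have usS: "us (Suc j) = J (vs j)" and vsS: "vs (Suc j) = J (\<lambda>z. q z * us j z)" for j
    by (simp_all add: us_def vs_def uv_def case_prod_beta)
  have hol: "us j holomorphic_on S \<and> vs j holomorphic_on S" for j
  proof (induction j)
    case 0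
    then show ?case by (simp add: us0 vs0)
  next
    case (Suc j)
    then have "(\<lambda>z. q z * us j z) holomorphic_on S" using q by (intro holomorphic_intros) auto
    from J[OF this] J[of "vs j"] Suc have
      "\<forall>z\<in>S. (us (Suc j) has_field_derivative vs j z) (at z)"
      "\<forall>z\<in>S. (vs (Suc j) has_field_derivative q z * us j z) (at z)"
      by (auto simp: usS vsS)
    then show ?case
      using holomorphic_on_open[OF \<open>open S\<close>] by blast
  qed
  have qus: "(\<lambda>z. q z * us j z) holomorphic_on S" for j
    using q hol by (intro holomorphic_intros) auto
  have dus: "(us (Suc j) has_field_derivative vs j z) (at z)"
    and dvs: "(vs (Suc j) has_field_derivative q z * us j z) (at z)" if "z \<in> S" for j z
    using J[OF qus[of j]] J[of "vs j"] hol that by (auto simp: usS vsS)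
  have us_z0: "us (Suc j) z0 = 0" and vs_z0: "vs (Suc j) z0 = 0" for j
    using J[OF qus[of j]] J[of "vs j"] hol by (auto simp: usS vsS)
  have bound: "\<exists>d h. 0 < d \<and> summable h \<and> (\<forall>n. \<forall>y\<in>ball x d \<inter> S. norm (us n y) \<le> h n \<and> norm (vs n y) \<le> h n)"
    if xS: "x \<in> S" for x
  proof -
    obtain d where d: "0 < d" "cball x d \<subseteq> S" using \<open>open S\<close> xS unfolding open_contains_cball by meson
    \<comment> \<open>A compact convex set that contains a whole neighbourhood of x and the segments
      from z0 to it. The estimates are proved by integration along these segments.\<close>
    define K where "K = convex hull (insert z0 (cball x d))"
    have K: "compact K" "convex K" "K \<subseteq> S" "z0 \<in> K" "cball x d \<subseteq> K"
    proof -
      show "compact K" unfolding K_def by (intro compact_convex_hull compact_insert compact_cball)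
      show "convex K" unfolding K_def by (rule convex_convex_hull)
      show "K \<subseteq> S" unfolding K_def using d assms(2,3) by (intro hull_minimal) auto
      show "z0 \<in> K" "cball x d \<subseteq> K" unfolding K_def using hull_subset[of "insert z0 (cball x d)" convex] by auto
    qed
    have "bounded (q ` K)"
      by (intro compact_imp_bounded compact_continuous_image K(1)
          holomorphic_on_imp_continuous_on holomorphic_on_subset[OF q K(3)])
    then obtain M0 where M0: "\<And>z. z \<in> K \<Longrightarrow> norm (q z) \<le> M0" by (auto simp: bounded_iff)
    \<comment> \<open>The lower bound 1 makes C M^n nondecreasing in n. The step from v to u, which
      carries no factor q, is then covered by the same bound as the step from u to v.\<close>
    define M where "M = max 1 M0"
    obtain D where D: "\<And>z. z \<in> K \<Longrightarrow> norm (z - z0) \<le> D"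
      using compact_imp_bounded[OF K(1)] unfolding bounded_any_center[of K z0]
      by (metis dist_norm norm_minus_commute)
    define C where "C = max (norm a) (norm b)"
    have "0 \<le> D" using D[OF K(4)] by simp
    have B: "\<forall>z\<in>K. norm (us n z) \<le> (C * M ^ n) * norm (z - z0) ^ n / fact n \<and>
               norm (vs n z) \<le> (C * M ^ n) * norm (z - z0) ^ n / fact n" for n
    proof (induction n)
      case 0
      then show ?case by (auto simp: us0 vs0 C_def)
    next
      case (Suc n)
      have nn: "0 \<le> C * M ^ n" "0 \<le> C * M ^ Suc n" by (auto simp: C_def M_def le_max_iff_disj)
      have le: "C * M ^ n \<le> C * M ^ Suc n"
        by (intro mult_left_mono power_increasing) (auto simp: C_def M_def le_max_iff_disj)
      have up: "C * M ^ n * norm (z - z0) ^ n / fact n \<le> C * M ^ Suc n * norm (z - z0) ^ n / fact n" for z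
        using le by (intro divide_right_mono mult_right_mono) auto
      show ?case
      proof (intro ballI conjI)
        fix z assume z: "z \<in> K"
        show "norm (us (Suc n) z) \<le> (C * M ^ Suc n) * norm (z - z0) ^ Suc n / fact (Suc n)"
          using Suc K up nn
          by (intro deriv_power_bound_integrate[OF K(2,4) z nn(2) dus _ us_z0]) (auto intro: order_trans)
        show "norm (vs (Suc n) z) \<le> (C * M ^ Suc n) * norm (z - z0) ^ Suc n / fact (Suc n)"
        proof (intro deriv_power_bound_integrate[OF K(2,4) z nn(2) dvs _ vs_z0])
          fix \<zeta> assume \<zeta>: "\<zeta> \<in> K"
          have "norm (q \<zeta>) * norm (us n \<zeta>) \<le> M * ((C * M ^ n) * norm (\<zeta> - z0) ^ n / fact n)"
            using Suc \<zeta> M0[OF \<zeta>] by (intro mult_mono) (auto simp: M_def)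
          then show "norm (q \<zeta> * us n \<zeta>) \<le> (C * M ^ Suc n) * norm (\<zeta> - z0) ^ n / fact n"
            by (simp add: norm_mult algebra_simps)
        qed (use K in auto)
      qed
    qed
    define h where "h n = C * ((M * D) ^ n / fact n)" for n
    have "summable h"
      unfolding h_def using summable_exp_generic[of "M * D"]
      by (intro summable_mult) (simp add: divide_inverse mult.commute)
    moreover have "norm (us n y) \<le> h n \<and> norm (vs n y) \<le> h n" if "y \<in> ball x d \<inter> S" for n y
    proof -
      have y: "y \<in> K" using that K by auto
      have "(C * M ^ n) * norm (y - z0) ^ n / fact n \<le> (C * M ^ n) * D ^ n / fact n"
        using D[OF y] by (intro divide_right_mono mult_left_mono power_mono) (auto simp: C_def M_def le_max_iff_disj)
      also have "\<dots> = h n" by (simp add: h_def power_mult_distrib)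
      finally show ?thesis using B[of n] y by (auto intro: order_trans)
    qed
    ultimately show ?thesis using d(1) by blast
  qed
  \<comment> \<open>The termwise derivatives are the other series shifted by one index, with a
    leading zero for the constant term. Summing them identifies u' with v and v' with q u.\<close>
  define us' where "us' n z = (case n of 0 \<Rightarrow> 0 | Suc j \<Rightarrow> vs j z)" for n z
  define vs' where "vs' n z = (case n of 0 \<Rightarrow> 0 | Suc j \<Rightarrow> q z * us j z)" for n z
  have d1: "(us n has_field_derivative us' n z) (at z)" "(vs n has_field_derivative vs' n z) (at z)"
    if "z \<in> S" for n z
    using dus dvs that by (cases n; auto simp: us'_def vs'_def us0 vs0)+
  have "\<exists>g g'. \<forall>x\<in>S. ((\<lambda>n. us n x) sums g x) \<and> ((\<lambda>n. us' n x) sums g' x) \<and> (g has_field_derivative g' x) (at x)"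
  proof (rule series_and_derivative_comparison_local[OF \<open>open S\<close> d1(1)])
    fix x assume "x \<in> S"
    from bound[OF this] show "\<exists>d h. 0 < d \<and> summable h \<and> (\<forall>\<^sub>F n in sequentially. \<forall>y\<in>ball x d \<inter> S. norm (us n y) \<le> h n)"
      by (elim exE conjE) (intro exI conjI always_eventually allI ballI, auto)
  qed
  then obtain u u' where u: "\<And>x. x \<in> S \<Longrightarrow> (\<lambda>n. us n x) sums u x"
    "\<And>x. x \<in> S \<Longrightarrow> (\<lambda>n. us' n x) sums u' x" "\<And>x. x \<in> S \<Longrightarrow> (u has_field_derivative u' x) (at x)"
    by blast
  have "\<exists>g g'. \<forall>x\<in>S. ((\<lambda>n. vs n x) sums g x) \<and> ((\<lambda>n. vs' n x) sums g' x) \<and> (g has_field_derivative g' x) (at x)"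
  proof (rule series_and_derivative_comparison_local[OF \<open>open S\<close> d1(2)])
    fix x assume "x \<in> S"
    from bound[OF this] show "\<exists>d h. 0 < d \<and> summable h \<and> (\<forall>\<^sub>F n in sequentially. \<forall>y\<in>ball x d \<inter> S. norm (vs n y) \<le> h n)"
      by (elim exE conjE) (intro exI conjI always_eventually allI ballI, auto)
  qed
  then obtain v v' where v: "\<And>x. x \<in> S \<Longrightarrow> (\<lambda>n. vs n x) sums v x"
    "\<And>x. x \<in> S \<Longrightarrow> (\<lambda>n. vs' n x) sums v' x" "\<And>x. x \<in> S \<Longrightarrow> (v has_field_derivative v' x) (at x)"
    by blast
  have "u' x = v x" if "x \<in> S" for x
  proof -
    have "(\<lambda>n. us' (Suc n) x) sums v x" using v(1)[OF that] by (simp add: us'_def)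
    then have "(\<lambda>n. us' n x) sums v x" using sums_Suc_iff[of "\<lambda>n. us' n x" "v x"] by (simp add: us'_def)
    then show ?thesis using u(2)[OF that] sums_unique2 by blast
  qed
  moreover have "v' x = q x * u x" if "x \<in> S" for x
  proof -
    have "(\<lambda>n. vs' (Suc n) x) sums (q x * u x)" using sums_mult[OF u(1)[OF that]] by (simp add: vs'_def)
    then have "(\<lambda>n. vs' n x) sums (q x * u x)"
      using sums_Suc_iff[of "\<lambda>n. vs' n x" "q x * u x"] by (simp add: vs'_def)
    then show ?thesis using v(2)[OF that] sums_unique2 by blast
  qed
  moreover have "u z0 = a"
  proof -
    have "(\<lambda>n. us (Suc n) z0) sums 0" by (simp add: us_z0)
    then have "(\<lambda>n. us n z0) sums a" using sums_Suc_iff[of "\<lambda>n. us n z0" 0] by (simp add: us0)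
    then show ?thesis using u(1)[OF \<open>z0 \<in> S\<close>] sums_unique2 by blast
  qed
  moreover have "v z0 = b"
  proof -
    have "(\<lambda>n. vs (Suc n) z0) sums 0" by (simp add: vs_z0)
    then have "(\<lambda>n. vs n z0) sums b" using sums_Suc_iff[of "\<lambda>n. vs n z0" 0] by (simp add: vs0)
    then show ?thesis using v(1)[OF \<open>z0 \<in> S\<close>] sums_unique2 by blast
  qed
  ultimately show thesis using that[of u v] u(3) v(3) by auto
qed

section \<open>Outgoing solutions of the reduced Bessel equation\<close>

lemma has_vector_derivative_Complex_Re:
  assumes "(y has_field_derivative y') (at (Complex x h))"
  shows "((\<lambda>x. y (Complex x h)) has_vector_derivative y') (at x)"
proof -
  have "((\<lambda>x. of_real x + \<i> * of_real h) has_vector_derivative 1) (at x)"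
    unfolding has_vector_derivative_def
    by (auto intro!: derivative_eq_intros simp: scaleR_conv_of_real)
  moreover have "(\<lambda>x. of_real x + \<i> * of_real h) = (\<lambda>x. Complex x h)" by (simp add: complex_eq_iff fun_eq_iff)
  ultimately show ?thesis
    using field_vector_diff_chain_at[of "\<lambda>x. Complex x h" 1 x y y'] assms by (simp add: o_def)
qed

lemma has_vector_derivative_Complex_Im:
  assumes "(y has_field_derivative y') (at (Complex x h))"
  shows "((\<lambda>h. y (Complex x h)) has_vector_derivative (\<i> * y')) (at h)"
proof -
  have "((\<lambda>h. of_real x + \<i> * of_real h) has_vector_derivative \<i>) (at h)"
    unfolding has_vector_derivative_def
    by (auto intro!: derivative_eq_intros simp: scaleR_conv_of_real)
  moreover have "(\<lambda>h. of_real x + \<i> * of_real h) = (\<lambda>h. Complex x h)" by (simp add: complex_eq_iff fun_eq_iff)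
  ultimately show ?thesis
    using field_vector_diff_chain_at[of "\<lambda>h. Complex x h" \<i> h y y'] assms by (simp add: o_def)
qed

lemma norm_sq_has_real_derivative:
  fixes f :: "real \<Rightarrow> complex"
  assumes "(f has_vector_derivative f') (at t)"
  shows "((\<lambda>t. (norm (f t))\<^sup>2) has_real_derivative 2 * Re (f' * cnj (f t))) (at t)"
proof -
  have d: "((\<lambda>t. f t \<bullet> f t) has_derivative (\<lambda>h. f t \<bullet> (h *\<^sub>R f') + (h *\<^sub>R f') \<bullet> f t)) (at t)"
    using assms unfolding has_vector_derivative_def by (intro has_derivative_inner)
  have "(\<lambda>h. f t \<bullet> (h *\<^sub>R f') + (h *\<^sub>R f') \<bullet> f t) = (*) (2 * Re (f' * cnj (f t)))"
    by (auto simp: fun_eq_iff inner_complex_def algebra_simps)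
  with d show ?thesis
    unfolding has_field_derivative_def by (simp add: dot_square_norm)
qed

lemma Re_mult_cnj_le: "\<bar>Re (a * cnj b)\<bar> \<le> norm a * norm b"
  by (metis abs_Re_le_cmod complex_mod_cnj norm_mult)

lemma two_mult_le_squares: "2 * (a * b) \<le> a\<^sup>2 + (b::real)\<^sup>2"
  using sum_squares_bound[of a b] by simp

lemma tail_derivative_bound:
  fixes F :: "real \<Rightarrow> complex"
  assumes "0 < X" "X \<le> x" "x \<le> x'"
    and der: "\<And>t. X \<le> t \<Longrightarrow> (F has_vector_derivative F' t) (at t)"
    and bnd: "\<And>t. X \<le> t \<Longrightarrow> norm (F' t) \<le> c / t\<^sup>2" and "0 \<le> c"
  shows "norm (F x' - F x) \<le> c / x"
proof (cases "x = x'")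
  case False
  have "norm (F x' - F x) \<le> - c / x' - (- c / x)"
  proof (rule differentiable_bound_general[where f' = F' and \<phi>' = "\<lambda>t. c / t\<^sup>2" and \<phi> = "\<lambda>t. - c / t"])
    show "continuous_on {x..x'} F"
      using has_vector_derivative_continuous[OF der] assms by (intro continuous_at_imp_continuous_on) auto
    show "((\<lambda>t. - c / t) has_vector_derivative c / t\<^sup>2) (at t)" if "x < t" "t < x'" for t
      using that assms unfolding has_real_derivative_iff_has_vector_derivative[symmetric]
      by (auto intro!: derivative_eq_intros simp: power2_eq_square)
  qed (use False assms in \<open>auto intro!: continuous_intros\<close>)
  also have "\<dots> \<le> c / x" using assms by simp
  finally show ?thesis .
qed (use assms in auto)

text \<open>Throughout, \<open>y'' = (\<mu>/z\<^sup>2 - k\<^sup>2) y\<close> is the equation for \<open>\<surd>z\<close> times a Bessel function,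
  and \<open>y' - \<i>ky \<rightarrow> 0\<close> on the real axis is the radiation condition.\<close>

locale outgoing =
  fixes y y1 :: "complex \<Rightarrow> complex" and \<mu> k X0 Y :: real
  assumes k: "0 < k" and X0: "1 \<le> X0" and Y: "0 \<le> Y"
    and y: "\<And>z. X0 \<le> Re z \<Longrightarrow> (y has_field_derivative y1 z) (at z)"
    and y1: "\<And>z. X0 \<le> Re z \<Longrightarrow> (y1 has_field_derivative (of_real \<mu> / z\<^sup>2 - of_real (k\<^sup>2)) * y z) (at z)"
    and real_bound: "\<And>x. X0 \<le> x \<Longrightarrow> norm (y (of_real x)) \<le> Y"
    and real_rad: "((\<lambda>x. y1 (of_real x) - \<i> * of_real k * y (of_real x)) \<longlongrightarrow> 0) at_top"
begin

definition "s z = y1 z - \<i> * of_real k * y z"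

lemma s_deriv:
  assumes "X0 \<le> Re z"
  shows "(s has_field_derivative (of_real \<mu> / z\<^sup>2 * y z - \<i> * of_real k * s z)) (at z)"
proof -
  have *: "(of_real \<mu> / z\<^sup>2 - of_real (k\<^sup>2)) * y z - \<i> * of_real k * y1 z
      = of_real \<mu> / z\<^sup>2 * y z - \<i> * of_real k * s z"
  proof -
    have "\<i> * (\<i> * x) = - x" for x :: complex by (simp flip: mult.assoc)
    then show ?thesis by (simp add: s_def algebra_simps power2_eq_square)
  qed
  have "((\<lambda>z. y1 z - \<i> * of_real k * y z) has_field_derivative
      ((of_real \<mu> / z\<^sup>2 - of_real (k\<^sup>2)) * y z - \<i> * of_real k * y1 z)) (at z)"
    by (intro DERIV_diff y1 y assms DERIV_cmult)
  then show ?thesis unfolding * by (simp add: s_def[abs_def])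
qed

lemma Complex_norm_sq_ge: "0 \<le> x \<Longrightarrow> x\<^sup>2 \<le> (norm (Complex x h))\<^sup>2"
  by (simp add: cmod_power2)

lemma quotient_bound:
  assumes "1 \<le> x"
  shows "norm (of_real \<mu> / (Complex x h)\<^sup>2 * w) \<le> \<bar>\<mu>\<bar> * norm w / x\<^sup>2"
proof -
  have "norm (of_real \<mu> / (Complex x h)\<^sup>2 * w) = \<bar>\<mu>\<bar> * norm w / (norm (Complex x h))\<^sup>2"
    by (simp add: norm_mult norm_divide norm_power)
  also have "\<dots> \<le> \<bar>\<mu>\<bar> * norm w / x\<^sup>2"
    using assms Complex_norm_sq_ge[of x h]
    by (intro divide_left_mono) (auto intro!: mult_pos_pos simp: complex_eq_iff)
  finally show ?thesis .
qed

text \<open>A crude Gronwall estimate in the height, where 1 \<le> x replaces \<mu>/z^2 by a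
  constant. Its exponential growth is harmless: it only shows that y is bounded on strips of fixed
  height, so that limits along horizontal lines can be taken.\<close>

lemma vertical_growth:
  assumes x: "X0 \<le> x" and "0 \<le> h"
  shows "(norm (y (Complex x h)))\<^sup>2 + (norm (s (Complex x h)))\<^sup>2
    \<le> exp ((2 * k + 1 + \<bar>\<mu>\<bar>) * h) * ((norm (y (of_real x)))\<^sup>2 + (norm (s (of_real x)))\<^sup>2)"
proof -
  define c where "c = 2 * k + 1 + \<bar>\<mu>\<bar>"
  define p where "p t = (norm (y (Complex x t)))\<^sup>2 + (norm (s (Complex x t)))\<^sup>2" for t
  define p' where "p' t = 2 * Re (\<i> * y1 (Complex x t) * cnj (y (Complex x t)))
      + 2 * Re (\<i> * (of_real \<mu> / (Complex x t)\<^sup>2 * y (Complex x t) - \<i> * of_real k * s (Complex x t))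
          * cnj (s (Complex x t)))" for t
  have dp: "(p has_real_derivative p' t) (at t)" for t
    unfolding p_def p'_def
    using x by (intro DERIV_add norm_sq_has_real_derivative has_vector_derivative_Complex_Im y s_deriv) auto
  have le: "p' t \<le> c * p t" for t
  proof -
    let ?z = "Complex x t"
    have x1: "1 \<le> x" using x X0 by simp
    have 1: "\<i> * y1 ?z = \<i> * s ?z - of_real k * y ?z"
      by (simp add: s_def algebra_simps flip: mult.assoc)
    have "Re (\<i> * y1 ?z * cnj (y ?z)) = Re ((\<i> * s ?z) * cnj (y ?z)) - k * (norm (y ?z))\<^sup>2"
      unfolding 1 cmod_power2 by (simp add: algebra_simps power2_eq_square)
    also have "\<dots> \<le> norm (s ?z) * norm (y ?z)"
    proof -
      have "Re ((\<i> * s ?z) * cnj (y ?z)) \<le> norm (s ?z) * norm (y ?z)"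
        using abs_le_D1[OF Re_mult_cnj_le[of "\<i> * s ?z" "y ?z"]] by (simp only: norm_mult norm_ii mult_1)
      moreover have "0 \<le> k * (norm (y ?z))\<^sup>2" using k by simp
      ultimately show ?thesis by linarith
    qed
    finally have A: "Re (\<i> * y1 ?z * cnj (y ?z)) \<le> norm (s ?z) * norm (y ?z)" .
    have "norm (of_real \<mu> / ?z\<^sup>2 * y ?z) \<le> \<bar>\<mu>\<bar> * norm (y ?z) / x\<^sup>2"
      by (rule quotient_bound[OF x1])
    also have "\<dots> \<le> \<bar>\<mu>\<bar> * norm (y ?z)"
      using divide_left_mono[of 1 "x\<^sup>2" "\<bar>\<mu>\<bar> * norm (y ?z)"] x1 one_le_power[OF x1, of 2] by simp
    finally have "norm (of_real \<mu> / ?z\<^sup>2 * y ?z) \<le> \<bar>\<mu>\<bar> * norm (y ?z)" .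
    then have "norm (\<i> * (of_real \<mu> / ?z\<^sup>2 * y ?z - \<i> * of_real k * s ?z)) \<le> \<bar>\<mu>\<bar> * norm (y ?z) + k * norm (s ?z)"
      using norm_triangle_ineq4[of "of_real \<mu> / ?z\<^sup>2 * y ?z" "\<i> * of_real k * s ?z"] k
      by (simp add: norm_mult)
    then have "Re (\<i> * (of_real \<mu> / ?z\<^sup>2 * y ?z - \<i> * of_real k * s ?z) * cnj (s ?z))
        \<le> (\<bar>\<mu>\<bar> * norm (y ?z) + k * norm (s ?z)) * norm (s ?z)"
      using Re_mult_cnj_le[of "\<i> * (of_real \<mu> / ?z\<^sup>2 * y ?z - \<i> * of_real k * s ?z)" "s ?z"]
      by (meson abs_le_D1 mult_right_mono norm_ge_zero order_trans)
    then have "p' t \<le> 2 * (norm (s ?z) * norm (y ?z)) + 2 * ((\<bar>\<mu>\<bar> * norm (y ?z) + k * norm (s ?z)) * norm (s ?z))"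
      using A unfolding p'_def by simp
    also have "\<dots> = (1 + \<bar>\<mu>\<bar>) * (2 * (norm (y ?z) * norm (s ?z))) + 2 * k * (norm (s ?z))\<^sup>2"
      by (simp add: algebra_simps power2_eq_square)
    also have "\<dots> \<le> (1 + \<bar>\<mu>\<bar>) * p t + 2 * k * p t"
      using two_mult_le_squares[of "norm (y ?z)" "norm (s ?z)"] k
      by (intro add_mono mult_left_mono) (auto simp: p_def)
    finally show ?thesis by (simp add: c_def algebra_simps)
  qed
  have "exp (- c * h) * p h \<le> exp (- c * 0) * p 0"
  proof (rule DERIV_nonpos_imp_nonincreasing[OF \<open>0 \<le> h\<close>])
    fix t
    have "((\<lambda>t. exp (- c * t) * p t) has_real_derivative (exp (- c * t) * (p' t - c * p t))) (at t)"
      using dp[of t] by (auto intro!: derivative_eq_intros simp: algebra_simps)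
    moreover have "exp (- c * t) * (p' t - c * p t) \<le> 0"
      using le[of t] by (simp add: mult_nonneg_nonpos)
    ultimately show "\<exists>D. ((\<lambda>t. exp (- c * t) * p t) has_real_derivative D) (at t) \<and> D \<le> 0" by blast
  qed
  then have "p h \<le> exp (c * h) * p 0" by (simp add: exp_minus field_simps)
  moreover have "Complex x 0 = of_real x" by (simp add: complex_eq_iff)
  ultimately show ?thesis by (simp add: p_def c_def)
qed

lemma strip_bound:
  assumes "0 \<le> h"
  obtains B X where "X0 \<le> X" "0 \<le> B"
    "\<And>x t. X \<le> x \<Longrightarrow> 0 \<le> t \<Longrightarrow> t \<le> h \<Longrightarrow> norm (y (Complex x t)) \<le> B"
proof -
  have "\<forall>\<^sub>F x in at_top. norm (s (of_real x)) < 1"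
    using tendstoD[OF real_rad, of 1] by (simp add: s_def)
  then obtain X1 where X1: "\<And>x. X1 \<le> x \<Longrightarrow> norm (s (of_real x)) < 1"
    by (auto simp: eventually_at_top_linorder)
  define c where "c = 2 * k + 1 + \<bar>\<mu>\<bar>"
  have c: "0 \<le> c" using k by (simp add: c_def)
  have "norm (y (Complex x t)) \<le> sqrt (exp (c * h) * (Y\<^sup>2 + 1))"
    if "max X0 X1 \<le> x" "0 \<le> t" "t \<le> h" for x t
  proof -
    have "(norm (y (Complex x t)))\<^sup>2 \<le> exp (c * t) * ((norm (y (of_real x)))\<^sup>2 + (norm (s (of_real x)))\<^sup>2)"
      using vertical_growth[of x t] that by (smt (verit) c_def zero_le_power2)
    also have "\<dots> \<le> exp (c * h) * (Y\<^sup>2 + 1\<^sup>2)"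
      using that X1[of x] real_bound[of x] c
      by (intro mult_mono add_mono power_mono) (auto simp: mult_left_mono)
    finally show ?thesis by (intro real_le_rsqrt) simp
  qed
  then show thesis by (intro that[of "max X0 X1" "sqrt (exp (c * h) * (Y\<^sup>2 + 1))"]) auto
qed

text \<open>A vertical shift by a fixed amount changes \<open>e\<^sup>-\<^sup>i\<^sup>k\<^sup>z(y' \<plusminus> \<i>ky)\<close> by \<open>O(1/x\<^sup>2)\<close> only.\<close>

lemma vertical_shift:
  assumes "0 \<le> h" "X0 \<le> x" and B: "\<And>t. 0 \<le> t \<Longrightarrow> t \<le> h \<Longrightarrow> norm (y (Complex x t)) \<le> B"
    and \<epsilon>: "\<epsilon> = 1 \<or> \<epsilon> = - 1"
  shows "norm (exp (of_real (\<epsilon> * k * h)) * (y1 (Complex x h) + \<i> * of_real (\<epsilon> * k) * y (Complex x h))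
     - (y1 (of_real x) + \<i> * of_real (\<epsilon> * k) * y (of_real x))) \<le> h * (exp (k * h) * (\<bar>\<mu>\<bar> * B / x\<^sup>2))"
proof -
  have x1: "1 \<le> x" using assms X0 by simp
  \<comment> \<open>The exponential is the integrating factor for vertical motion: differentiating F
    removes the k^2 part of the equation and leaves the \<mu>/z^2 term alone.\<close>
  define F where "F t = exp (of_real (\<epsilon> * k * t)) * (y1 (Complex x t) + \<i> * of_real (\<epsilon> * k) * y (Complex x t))" for t
  define F' where "F' t = exp (of_real (\<epsilon> * k * t)) * (\<i> * (of_real \<mu> / (Complex x t)\<^sup>2 * y (Complex x t)))" for t
  have dF: "(F has_vector_derivative F' t) (at t)" for t
  proof -
    have e: "((\<lambda>t. exp (complex_of_real (\<epsilon> * k * t))) has_vector_derivative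
        of_real (\<epsilon> * k) * exp (of_real (\<epsilon> * k * t))) (at t)"
    proof -
      have "((\<lambda>t. exp (complex_of_real (\<epsilon> * k) * t)) has_field_derivative
          of_real (\<epsilon> * k) * exp (of_real (\<epsilon> * k) * of_real t)) (at (of_real t))"
        by (auto intro!: derivative_eq_intros)
      then show ?thesis
        using has_vector_derivative_real_field by force
    qed
    have v1: "((\<lambda>t. y (Complex x t)) has_vector_derivative \<i> * y1 (Complex x t)) (at t)"
      using assms by (intro has_vector_derivative_Complex_Im y) auto
    have v2: "((\<lambda>t. y1 (Complex x t)) has_vector_derivative
        \<i> * ((of_real \<mu> / (Complex x t)\<^sup>2 - of_real (k\<^sup>2)) * y (Complex x t))) (at t)"
      using assms by (intro has_vector_derivative_Complex_Im y1) auto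
    have v3: "((\<lambda>t. \<i> * of_real (\<epsilon> * k) * y (Complex x t)) has_vector_derivative
        \<i> * of_real (\<epsilon> * k) * (\<i> * y1 (Complex x t))) (at t)"
      using has_vector_derivative_mult_right[OF v1] .
    note d = has_vector_derivative_mult[OF e has_vector_derivative_add[OF v2 v3]]
    have ii: "\<i> * (\<i> * x) = - x" for x :: complex by (simp flip: mult.assoc)
    have eq: "a = b \<Longrightarrow> (F has_vector_derivative a) G \<Longrightarrow> (F has_vector_derivative b) G" for F :: "real \<Rightarrow> complex" and a b G by simp
    have ee: "complex_of_real \<epsilon> * complex_of_real \<epsilon> = 1" using \<epsilon> by auto
    have ee': "complex_of_real \<epsilon> * (complex_of_real \<epsilon> * x) = x" for x using ee by (simp flip: mult.assoc)
    have "F = (\<lambda>t. exp (complex_of_real (\<epsilon> * k * t)) * (y1 (Complex x t) + \<i> * of_real (\<epsilon> * k) * y (Complex x t)))"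
      by (simp add: F_def fun_eq_iff)
    then show ?thesis
      by (simp only:) (rule eq[OF _ d],
        simp add: F'_def algebra_simps power2_eq_square ii ee ee')
  qed
  have bF: "norm (F' t) \<le> exp (k * h) * (\<bar>\<mu>\<bar> * B / x\<^sup>2)" if "0 \<le> t" "t \<le> h" for t
  proof -
    have "norm (F' t) = exp (\<epsilon> * k * t) * norm (of_real \<mu> / (Complex x t)\<^sup>2 * y (Complex x t))"
      unfolding F'_def norm_mult norm_ii norm_exp_eq_Re by simp
    also have "\<dots> \<le> exp (k * h) * (\<bar>\<mu>\<bar> * B / x\<^sup>2)"
    proof (rule mult_mono)
      have "0 \<le> k * t" "k * t \<le> k * h" using k that assms by (auto intro: mult_left_mono)
      then have "\<epsilon> * k * t \<le> k * h" using \<epsilon> by (elim disjE) (auto intro: order_trans[of _ 0])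
      then show "exp (\<epsilon> * k * t) \<le> exp (k * h)" by simp
      show "norm (of_real \<mu> / (Complex x t)\<^sup>2 * y (Complex x t)) \<le> \<bar>\<mu>\<bar> * B / x\<^sup>2"
        using quotient_bound[OF x1, of t "y (Complex x t)"] B[OF that]
        by (elim order_trans) (auto intro!: divide_right_mono mult_left_mono)
    qed auto
    finally show ?thesis .
  qed
  have "norm (F h - F 0) \<le> (exp (k * h) * (\<bar>\<mu>\<bar> * B / x\<^sup>2)) * norm (h - 0)"
  proof (rule differentiable_bound[of "{0..h}" F "\<lambda>t u. u *\<^sub>R F' t"])
    fix t assume t: "t \<in> {0..h}"
    show "(F has_derivative (\<lambda>u. u *\<^sub>R F' t)) (at t within {0..h})"
      using dF by (auto simp: has_vector_derivative_def intro: has_derivative_at_withinI)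
    show "onorm (\<lambda>u. u *\<^sub>R F' t) \<le> exp (k * h) * (\<bar>\<mu>\<bar> * B / x\<^sup>2)"
    proof (rule onorm_le)
      fix u :: real
      show "norm (u *\<^sub>R F' t) \<le> exp (k * h) * (\<bar>\<mu>\<bar> * B / x\<^sup>2) * norm u"
        using mult_right_mono[OF bF[of t] norm_ge_zero[of u]] t by (simp add: mult.commute)
    qed
  qed (use assms in auto)
  moreover have "Complex x 0 = of_real x" by (simp add: complex_eq_iff)
  ultimately show ?thesis using \<open>0 \<le> h\<close> by (simp add: F_def mult.commute)
qed

text \<open>The case \<epsilon> = -1 of \<open>vertical_shift\<close>: on a strip of fixed height y
  is bounded, so the weighted s at height h differs from s on the real axis by O(1/x^2).\<close>

lemma s_vanishes:
  assumes "0 \<le> h"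
  shows "((\<lambda>x. s (Complex x h)) \<longlongrightarrow> 0) at_top"
proof -
  obtain B X where BX: "X0 \<le> X" "0 \<le> B"
    "\<And>x t. X \<le> x \<Longrightarrow> 0 \<le> t \<Longrightarrow> t \<le> h \<Longrightarrow> norm (y (Complex x t)) \<le> B"
    using strip_bound[OF assms] by metis
  define K where "K = h * (exp (k * h) * (\<bar>\<mu>\<bar> * B))"
  have sh: "norm (exp (of_real (- k * h)) * s (Complex x h) - s (of_real x)) \<le> K / x\<^sup>2" if "X \<le> x" for x
    using vertical_shift[of h x B "- 1"] assms BX that by (simp add: s_def K_def mult.assoc)
  have "((\<lambda>x. K / x\<^sup>2) \<longlongrightarrow> 0) at_top" by real_asymp
  then have "((\<lambda>x. exp (of_real (- k * h)) * s (Complex x h) - s (of_real x)) \<longlongrightarrow> 0) at_top"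
    by (rule Lim_null_comparison[rotated]) (rule eventually_mono[OF eventually_ge_at_top[of X] sh])
  from tendsto_add[OF this real_rad[folded s_def]]
  have "((\<lambda>x. exp (of_real (- k * h)) * s (Complex x h)) \<longlongrightarrow> 0) at_top" by simp
  from tendsto_mult_left[OF this, of "exp (of_real (k * h))"]
  show ?thesis by (simp add: exp_minus mult.assoc[symmetric] del: of_real_mult)
qed

section \<open>Modes with nonnegative \<mu>: decay along vertical lines\<close>

lemma flux_nonpos:
  assumes "0 \<le> \<mu>" "0 \<le> h" "X0 \<le> x"
  shows "Re (\<i> * y1 (Complex x h) * cnj (y (Complex x h))) \<le> 0"
proof -
  define g where "g x = Re (\<i> * y1 (Complex x h) * cnj (y (Complex x h)))" for x
  obtain B X where BX: "X0 \<le> X" "0 \<le> B"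
    "\<And>x t. X \<le> x \<Longrightarrow> 0 \<le> t \<Longrightarrow> t \<le> h \<Longrightarrow> norm (y (Complex x t)) \<le> B"
    using strip_bound[OF \<open>0 \<le> h\<close>] by metis
  \<comment> \<open>Inserting y' = s + i k y splits off -k |y|^2 from the flux and leaves a product
    with s, which vanishes at infinity. This gives the nonpositive limit.\<close>
  have le: "g x \<le> B * norm (s (Complex x h))" if "X \<le> x" for x
  proof -
    let ?z = "Complex x h"
    have 1: "\<i> * y1 ?z = \<i> * s ?z - of_real k * y ?z"
      by (simp add: s_def algebra_simps flip: mult.assoc)
    have "g x = Re ((\<i> * s ?z) * cnj (y ?z)) - k * (norm (y ?z))\<^sup>2"
      unfolding g_def 1 cmod_power2 by (simp add: algebra_simps power2_eq_square)
    moreover have "Re ((\<i> * s ?z) * cnj (y ?z)) \<le> norm (s ?z) * norm (y ?z)"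
      using abs_le_D1[OF Re_mult_cnj_le[of "\<i> * s ?z" "y ?z"]] by (simp only: norm_mult norm_ii mult_1)
    moreover have "norm (s ?z) * norm (y ?z) \<le> norm (s ?z) * B"
      using BX that assms by (intro mult_left_mono) auto
    moreover have "0 \<le> k * (norm (y ?z))\<^sup>2" using k by simp
    ultimately show ?thesis by (simp add: mult.commute)
  qed
  have mono: "g x \<le> g x'" if "x \<le> x'" "X0 \<le> x" for x x'
  proof (rule DERIV_nonneg_imp_nondecreasing[OF that(1)])
    fix t assume t: "x \<le> t" "t \<le> x'"
    let ?z = "Complex t h"
    have z: "X0 \<le> Re ?z" using t that by simp
    have t1: "1 \<le> t" using t that X0 by simp
    have d1: "((\<lambda>x. y1 (Complex x h)) has_vector_derivative (of_real \<mu> / ?z\<^sup>2 - of_real (k\<^sup>2)) * y ?z) (at t)"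
      by (rule has_vector_derivative_Complex_Re[OF y1[OF z]])
    have d2: "((\<lambda>x. cnj (y (Complex x h))) has_vector_derivative cnj (y1 ?z)) (at t)"
      using bounded_linear.has_vector_derivative[OF bounded_linear_cnj has_vector_derivative_Complex_Re[OF y[OF z]]] .
    have d3: "((\<lambda>x. \<i> * y1 (Complex x h) * cnj (y (Complex x h))) has_vector_derivative
        (\<i> * y1 ?z * cnj (y1 ?z) + \<i> * ((of_real \<mu> / ?z\<^sup>2 - of_real (k\<^sup>2)) * y ?z) * cnj (y ?z))) (at t)"
      by (rule has_vector_derivative_mult[OF has_vector_derivative_mult_right[OF d1] d2])
    have "(g has_vector_derivative
        Re (\<i> * y1 ?z * cnj (y1 ?z) + \<i> * ((of_real \<mu> / ?z\<^sup>2 - of_real (k\<^sup>2)) * y ?z) * cnj (y ?z))) (at t)"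
      unfolding g_def[abs_def] using bounded_linear.has_vector_derivative[OF bounded_linear_Re d3] .
    moreover have "0 \<le> Re (\<i> * y1 ?z * cnj (y1 ?z) + \<i> * ((of_real \<mu> / ?z\<^sup>2 - of_real (k\<^sup>2)) * y ?z) * cnj (y ?z))"
    proof -
      \<comment> \<open>The sign of this quantity is where 0 \<le> \<mu> and 0 \<le> h enter: 1/z^2
        has nonpositive imaginary part in the right upper quadrant.\<close>
      have "Re (\<i> * (of_real \<mu> / ?z\<^sup>2 - of_real (k\<^sup>2))) = 2 * \<mu> * (t * h) / (norm (?z\<^sup>2))\<^sup>2"
        unfolding cmod_power2 by (simp add: Re_divide Im_divide power2_eq_square algebra_simps)
      also have "\<dots> \<ge> 0" using assms t1 by simp
      finally have "0 \<le> Re (\<i> * (of_real \<mu> / ?z\<^sup>2 - of_real (k\<^sup>2)))" .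
      then have "0 \<le> Re (\<i> * (of_real \<mu> / ?z\<^sup>2 - of_real (k\<^sup>2))) * (norm (y ?z))\<^sup>2"
        by (rule mult_nonneg_nonneg) simp
      also have "\<dots> = Re (\<i> * (of_real \<mu> / ?z\<^sup>2 - of_real (k\<^sup>2)) * (y ?z * cnj (y ?z)))"
        by (simp add: complex_mult_cnj cmod_power2)
      also have "\<dots> = Re (\<i> * y1 ?z * cnj (y1 ?z) + \<i> * ((of_real \<mu> / ?z\<^sup>2 - of_real (k\<^sup>2)) * y ?z) * cnj (y ?z))"
        by (simp add: mult.assoc complex_mult_cnj)
      finally show ?thesis .
    qed
    ultimately show "\<exists>D. (g has_real_derivative D) (at t) \<and> 0 \<le> D"
      unfolding has_real_derivative_iff_has_vector_derivative by blast
  qed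
  have lim: "((\<lambda>x. B * norm (s (Complex x h))) \<longlongrightarrow> 0) at_top"
    using tendsto_mult_left[OF tendsto_norm[OF s_vanishes[OF \<open>0 \<le> h\<close>]], of B] by simp
  have "g x \<le> 0"
  proof (rule tendsto_lowerbound[OF lim])
    show "\<forall>\<^sub>F x' in at_top. g x \<le> B * norm (s (Complex x' h))"
      using eventually_ge_at_top[of "max X x"]
    proof (rule eventually_mono)
      fix x' assume "max X x \<le> x'"
      then show "g x \<le> B * norm (s (Complex x' h))"
        using mono[of x x'] le[of x'] assms by simp
    qed
  qed simp
  then show ?thesis by (simp add: g_def)
qed

text \<open>Moving upwards multiplies the derivative of y by i, so twice the flux of
  \<open>flux_nonpos\<close> is the derivative of |y|^2 with respect to the height.\<close>

lemma norm_le_real_axis: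
  assumes "0 \<le> \<mu>" "0 \<le> h" "X0 \<le> x"
  shows "norm (y (Complex x h)) \<le> norm (y (of_real x))"
proof -
  have "(norm (y (Complex x h)))\<^sup>2 \<le> (norm (y (Complex x 0)))\<^sup>2"
  proof (rule DERIV_nonpos_imp_nonincreasing[OF \<open>0 \<le> h\<close>])
    fix t assume "0 \<le> t" "t \<le> h"
    then have "2 * Re (\<i> * y1 (Complex x t) * cnj (y (Complex x t))) \<le> 0"
      using flux_nonpos[of t x] assms by simp
    moreover have "((\<lambda>h. (norm (y (Complex x h)))\<^sup>2) has_real_derivative
        2 * Re (\<i> * y1 (Complex x t) * cnj (y (Complex x t)))) (at t)"
      using assms by (intro norm_sq_has_real_derivative has_vector_derivative_Complex_Im y) auto
    ultimately show "\<exists>D. ((\<lambda>h. (norm (y (Complex x h)))\<^sup>2) has_real_derivative D) (at t) \<and> D \<le> 0" by blast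
  qed
  moreover have "Complex x 0 = of_real x" by (simp add: complex_eq_iff)
  ultimately show ?thesis by (simp add: power_mono_iff)
qed

section \<open>Modes with \<mu> of either sign: a bound by direct integration\<close>

text \<open>The horizontal counterpart of \<open>vertical_shift\<close>. The weight has modulus 1
  and removes the k^2 part; what remains is of order 1/x^2 and hence integrable up to
  infinity.\<close>

lemma weighted_derivative:
  assumes "X0 \<le> x" and \<epsilon>: "\<epsilon> = 1 \<or> \<epsilon> = - 1"
  shows "((\<lambda>x. exp (of_real (- \<epsilon> * k * x) * \<i>) * (y1 (Complex x h) + \<i> * of_real (\<epsilon> * k) * y (Complex x h)))
    has_vector_derivative
      exp (of_real (- \<epsilon> * k * x) * \<i>) * (of_real \<mu> / (Complex x h)\<^sup>2 * y (Complex x h))) (at x)"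
proof -
  let ?z = "Complex x h"
  have e: "((\<lambda>t. exp (complex_of_real (- \<epsilon> * k * t) * \<i>)) has_vector_derivative
      (of_real (- \<epsilon> * k) * \<i>) * exp (of_real (- \<epsilon> * k * x) * \<i>)) (at x)"
  proof -
    have "((\<lambda>t. exp ((complex_of_real (- \<epsilon> * k) * \<i>) * t)) has_field_derivative
        (of_real (- \<epsilon> * k) * \<i>) * exp ((of_real (- \<epsilon> * k) * \<i>) * of_real x)) (at (of_real x))"
      by (auto intro!: derivative_eq_intros)
    from has_vector_derivative_real_field[OF this] show ?thesis by (simp add: algebra_simps)
  qed
  have v1: "((\<lambda>t. y (Complex t h)) has_vector_derivative y1 ?z) (at x)"
    using assms by (intro has_vector_derivative_Complex_Re y) auto
  have v2: "((\<lambda>t. y1 (Complex t h)) has_vector_derivative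
      ((of_real \<mu> / ?z\<^sup>2 - of_real (k\<^sup>2)) * y ?z)) (at x)"
    using assms by (intro has_vector_derivative_Complex_Re y1) auto
  note d = has_vector_derivative_mult[OF e has_vector_derivative_add[OF v2 has_vector_derivative_mult_right[OF v1]]]
  have ii: "\<i> * (\<i> * x) = - x" for x :: complex by (simp flip: mult.assoc)
  have ee: "complex_of_real \<epsilon> * complex_of_real \<epsilon> = 1" using \<epsilon> by auto
  have ee': "complex_of_real \<epsilon> * (complex_of_real \<epsilon> * x) = x" for x using ee by (simp flip: mult.assoc)
  have eq: "a = b \<Longrightarrow> (F has_vector_derivative a) G \<Longrightarrow> (F has_vector_derivative b) G"
    for F :: "real \<Rightarrow> complex" and a b G by simp
  show ?thesis
    by (rule eq[OF _ d]) (simp add: algebra_simps power2_eq_square ii ee ee')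
qed

lemma weighted_difference_bound:
  assumes X: "X0 \<le> X" and m: "\<And>x. X \<le> x \<Longrightarrow> norm (y (Complex x h)) \<le> m"
    and "X \<le> x" "x \<le> x'" and \<epsilon>: "\<epsilon> = 1 \<or> \<epsilon> = - 1"
  shows "norm (y1 (Complex x h) + \<i> * of_real (\<epsilon> * k) * y (Complex x h))
    \<le> norm (y1 (Complex x' h) + \<i> * of_real (\<epsilon> * k) * y (Complex x' h)) + \<bar>\<mu>\<bar> * m / X"
proof -
  define F where "F x = exp (of_real (- \<epsilon> * k * x) * \<i>) * (y1 (Complex x h) + \<i> * of_real (\<epsilon> * k) * y (Complex x h))" for x
  have X1: "1 \<le> X" using X X0 by simp
  have m0: "0 \<le> m" using m[OF order_refl] norm_ge_zero order_trans by blast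
  have "norm (F x' - F x) \<le> \<bar>\<mu>\<bar> * m / x"
  proof (rule tail_derivative_bound[where X = X])
    fix t assume t: "X \<le> t"
    show "(F has_vector_derivative
      exp (of_real (- \<epsilon> * k * t) * \<i>) * (of_real \<mu> / (Complex t h)\<^sup>2 * y (Complex t h))) (at t)"
      unfolding F_def using weighted_derivative[of t \<epsilon> h] t X \<epsilon> by simp
    have "norm (of_real \<mu> / (Complex t h)\<^sup>2 * y (Complex t h)) \<le> \<bar>\<mu>\<bar> * norm (y (Complex t h)) / t\<^sup>2"
      using t X1 by (intro quotient_bound) auto
    also have "\<dots> \<le> \<bar>\<mu>\<bar> * m / t\<^sup>2"
      using m[OF t] by (intro divide_right_mono mult_left_mono) auto
    finally show "norm (exp (of_real (- \<epsilon> * k * t) * \<i>) * (of_real \<mu> / (Complex t h)\<^sup>2 * y (Complex t h)))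
      \<le> \<bar>\<mu>\<bar> * m / t\<^sup>2"
      unfolding norm_mult[of "exp _"] norm_exp_eq_Re by simp
  qed (use assms X1 m0 in auto)
  also have "\<dots> \<le> \<bar>\<mu>\<bar> * m / X" using assms X1 m0 by (intro divide_left_mono) auto
  finally have "norm (F x) \<le> norm (F x') + \<bar>\<mu>\<bar> * m / X"
    using norm_triangle_ineq2[of "F x" "F x'"] by (simp add: norm_minus_commute)
  then show ?thesis by (simp add: F_def norm_mult norm_exp_eq_Re)
qed

text \<open>y is recovered from the difference of y' + i k y and y' - i k y. Both are controlled at
  a far point x' of the line, by the real axis and by the radiation condition, and change on the way
  back to x by at most |\<mu>| m / X, where m is the supremum of |y| on the line. For large X this
  error is absorbed into m. As \<mu> enters through |\<mu>| only, the mode n = 0 with \<mu> = -1/4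
  is covered.\<close>

lemma bounded_right_quadrant: "\<exists>C X. X0 \<le> X \<and> (\<forall>z. X \<le> Re z \<and> 0 \<le> Im z \<longrightarrow> norm (y z) \<le> C)"
proof -
  define E where "E = 2 * k * Y + 2"
  \<comment> \<open>Chosen so that the two errors |\<mu>| m / X add up to at most k m, half of the
    factor 2 k in front of |y|.\<close>
  define X where "X = max X0 (2 * \<bar>\<mu>\<bar> / k + 1)"
  have X: "X0 \<le> X" "1 \<le> X" and X\<mu>: "2 * \<bar>\<mu>\<bar> \<le> k * X"
    using X0 k by (auto simp: X_def max_def field_simps)
  have "norm (y (Complex x h)) \<le> E / k" if "X \<le> x" "0 \<le> h" for x h
  proof -
    obtain B X1 where BX: "X0 \<le> X1" "0 \<le> B"
      "\<And>x t. X1 \<le> x \<Longrightarrow> 0 \<le> t \<Longrightarrow> t \<le> h \<Longrightarrow> norm (y (Complex x t)) \<le> B"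
      using strip_bound[OF \<open>0 \<le> h\<close>] by metis
    have cont: "continuous_on {X..X1} (\<lambda>x. norm (y (Complex x h)))"
    proof (intro continuous_on_norm continuous_at_imp_continuous_on ballI)
      fix x assume "x \<in> {X..X1}"
      then have "X0 \<le> Re (Complex x h)" using X by simp
      from has_vector_derivative_continuous[OF has_vector_derivative_Complex_Re[OF y[OF this]]]
      show "isCont (\<lambda>x. y (Complex x h)) x" .
    qed
    have "bounded ((\<lambda>x. norm (y (Complex x h))) ` {X..X1})"
      by (rule compact_imp_bounded[OF compact_continuous_image[OF cont compact_Icc]])
    then obtain B2 where B2: "\<And>x. x \<in> {X..X1} \<Longrightarrow> norm (y (Complex x h)) \<le> B2"
      unfolding bounded_iff by force
    \<comment> \<open>Its supremum is finite, by \<open>strip_bound\<close> far out and by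
      compactness before that, but a priori depends on h. The absorption replaces it by
      \<open>E / k\<close>, which does not depend on h.\<close>
    define A where "A = (\<lambda>x. norm (y (Complex x h))) ` {X..}"
    define m where "m = Sup A"
    have "bdd_above A"
    proof (rule bdd_aboveI[of _ "max B B2"])
      fix a assume "a \<in> A"
      then obtain x where x: "X \<le> x" "a = norm (y (Complex x h))" by (auto simp: A_def)
      show "a \<le> max B B2"
        using B2[of x] BX(3)[of x h] x \<open>0 \<le> h\<close> by (cases "x \<le> X1") auto
    qed
    then have m: "norm (y (Complex x h)) \<le> m" if "X \<le> x" for x
      unfolding m_def by (rule cSup_upper[rotated]) (use that in \<open>auto simp: A_def\<close>)
    have up: "norm (y (Complex x h)) \<le> E / (2 * k) + m / 2" if "X \<le> x" for x
    proof -
      let ?z = "Complex x h"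
      have "\<forall>\<^sub>F x' in at_top. norm (s (Complex x' h)) < 1"
        using tendstoD[OF s_vanishes[OF \<open>0 \<le> h\<close>], of 1] by simp
      moreover have "\<forall>\<^sub>F x' in at_top. norm (s (of_real x')) < 1 / 2"
        using tendstoD[OF real_rad, of "1 / 2"] by (simp add: s_def)
      moreover have "\<forall>\<^sub>F x' in at_top. h * (exp (k * h) * (\<bar>\<mu>\<bar> * B / x'\<^sup>2)) < 1 / 2"
      proof -
        have "((\<lambda>x'. h * (exp (k * h) * (\<bar>\<mu>\<bar> * B / x'\<^sup>2))) \<longlongrightarrow> 0) at_top" by real_asymp
        then show ?thesis by (rule order_tendstoD) simp
      qed
      ultimately have "\<forall>\<^sub>F x' in at_top. x \<le> x' \<and> X1 \<le> x' \<and> norm (s (Complex x' h)) < 1 \<and>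
          norm (s (of_real x')) < 1 / 2 \<and> h * (exp (k * h) * (\<bar>\<mu>\<bar> * B / x'\<^sup>2)) < 1 / 2"
        using eventually_ge_at_top[of x] eventually_ge_at_top[of X1] by eventually_elim auto
      then obtain x' where x': "x \<le> x'" "X1 \<le> x'" "norm (s (Complex x' h)) < 1"
          "norm (s (of_real x')) < 1 / 2" "h * (exp (k * h) * (\<bar>\<mu>\<bar> * B / x'\<^sup>2)) < 1 / 2"
        by (auto dest: eventually_happens)
      define p where "p z = y1 z + \<i> * of_real k * y z" for z
      have ps: "p z - s z = 2 * (\<i> * of_real k * y z)" for z by (simp add: p_def s_def)
      have "norm (exp (of_real (k * h)) * p (Complex x' h) - p (of_real x')) \<le> 1 / 2"
      proof -
        have "norm (exp (of_real (1 * k * h)) * (y1 (Complex x' h) + \<i> * of_real (1 * k) * y (Complex x' h))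
            - (y1 (of_real x') + \<i> * of_real (1 * k) * y (of_real x'))) \<le> h * (exp (k * h) * (\<bar>\<mu>\<bar> * B / x'\<^sup>2))"
          by (rule vertical_shift) (use x' BX \<open>0 \<le> h\<close> in auto)
        then show ?thesis using x'(5) unfolding p_def mult_1 by linarith
      qed
      moreover have "norm (p (of_real x')) \<le> 2 * k * Y + 1 / 2"
      proof -
        have "norm (p (of_real x')) \<le> norm (s (of_real x')) + norm (2 * (\<i> * of_real k * y (of_real x')))"
          using norm_triangle_ineq[of "s (of_real x')" "p (of_real x') - s (of_real x')"]
          unfolding ps[of "of_real x'", symmetric] by simp
        moreover have "norm (2 * (\<i> * of_real k * y (of_real x'))) \<le> 2 * k * Y"
          using real_bound[of x'] x' that X k by (simp add: norm_mult)
        ultimately show ?thesis using x' by linarith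
      qed
      ultimately have "norm (exp (of_real (k * h)) * p (Complex x' h)) \<le> 2 * k * Y + 1"
        using norm_triangle_ineq2[of "exp (of_real (k * h)) * p (Complex x' h)" "p (of_real x')"] by linarith
      then have "exp (k * h) * norm (p (Complex x' h)) \<le> 2 * k * Y + 1"
        by (simp add: norm_mult norm_exp_eq_Re)
      \<comment> \<open>In the upper half plane the weight exp(k h) is at least 1, so dropping it
        keeps the bound for y' + i k y independent of the height.\<close>
      moreover have "1 * norm (p (Complex x' h)) \<le> exp (k * h) * norm (p (Complex x' h))"
        using k \<open>0 \<le> h\<close> by (intro mult_right_mono) auto
      ultimately have px': "norm (p (Complex x' h)) \<le> 2 * k * Y + 1" by linarith
      have A: "norm (p ?z) \<le> norm (p (Complex x' h)) + \<bar>\<mu>\<bar> * m / X"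
        using weighted_difference_bound[of X h m x x' 1] X m that x' by (simp add: p_def)
      have B: "norm (s ?z) \<le> norm (s (Complex x' h)) + \<bar>\<mu>\<bar> * m / X"
        using weighted_difference_bound[of X h m x x' "- 1"] X m that x' by (simp add: s_def)
      have "2 * k * norm (y ?z) = norm (p ?z - s ?z)"
        unfolding ps using k by (simp add: norm_mult)
      also have "\<dots> \<le> norm (p ?z) + norm (s ?z)" by (rule norm_triangle_ineq4)
      also have "\<dots> \<le> E + 2 * (\<bar>\<mu>\<bar> * m / X)" using A B px' x' by (simp add: E_def)
      also have "\<dots> \<le> E + k * m"
      proof -
        have "0 \<le> m" using m[OF that] norm_ge_zero order_trans by blast
        then have "2 * \<bar>\<mu>\<bar> * m \<le> k * X * m" using X\<mu> by (rule mult_right_mono[rotated])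
        then show ?thesis using X by (simp add: field_simps)
      qed
      finally show ?thesis using k by (simp add: field_simps)
    qed
    have "m \<le> E / (2 * k) + m / 2"
      unfolding m_def by (rule cSup_least) (use up in \<open>auto simp: A_def m_def\<close>)
    then have "m \<le> E / k" by (simp add: field_simps)
    then show ?thesis using m[OF that(1)] by simp
  qed
  then show ?thesis
    using X by (intro exI[of _ "E / k"] exI[of _ X]) (metis complex_surj)
qed

end

section \<open>Fourier series\<close>

definition fc :: "(real \<Rightarrow> complex) \<Rightarrow> int \<Rightarrow> complex" where
  "fc f n = integral {0..2*pi} (\<lambda>t. f t * cis (- (of_int n * t))) / of_real (2 * pi)"

lemma cis_2pi_int [simp]: "cis (of_int n * (2 * pi)) = 1" "cis (2 * pi * of_int n) = 1"
proof -
  show "cis (2 * pi * of_int n) = 1" by (rule cis_multiple_2pi) simp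
  then show "cis (of_int n * (2 * pi)) = 1" by (simp add: mult.commute)
qed

lemma has_vector_derivative_cis [derivative_intros]:
  "((\<lambda>t. cis (a * t)) has_vector_derivative (\<i> * of_real a * cis (a * t))) (at t within S)"
proof -
  have "((\<lambda>t. exp (\<i> * of_real a * t)) has_field_derivative
      \<i> * of_real a * exp (\<i> * of_real a * of_real t)) (at (of_real t))"
    by (auto intro!: derivative_eq_intros)
  from has_vector_derivative_real_field[OF this] show ?thesis
    by (simp add: cis_conv_exp mult_ac has_vector_derivative_at_within)
qed

lemma continuous_on_cis_mult [continuous_intros]: "continuous_on A (\<lambda>t. cis (- (a * t)))"
  by (intro continuous_intros)

lemma fc_integrable:
  assumes "continuous_on {0..2*pi} f"
  shows "(\<lambda>t. f t * cis (- (of_int n * t))) integrable_on {0..2*pi}"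
  by (intro integrable_continuous_interval continuous_intros assms)

lemma fc_norm_le:
  assumes "continuous_on {0..2*pi} f" "\<And>t. t \<in> {0..2*pi} \<Longrightarrow> norm (f t) \<le> B"
  shows "norm (fc f n) \<le> B"
proof -
  have "norm (integral {0..2*pi} (\<lambda>t. f t * cis (- (of_int n * t)))) \<le> B * (2 * pi - 0)"
    by (rule integral_bound) (use assms in \<open>auto simp: norm_mult intro!: continuous_intros\<close>)
  then show ?thesis by (simp add: fc_def norm_divide field_simps)
qed

lemma integral_cis:
  "integral {0..2*pi} (\<lambda>t. cis (- (of_int n * t))) = (if n = 0 then of_real (2 * pi) else 0)"
proof (cases "n = 0")
  case False
  define F where "F t = \<i> / of_int n * cis (- of_int n * t)" for t :: real
  have "((\<lambda>t. cis (- of_int n * t)) has_integral (F (2*pi) - F 0)) {0..2*pi}"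
  proof (rule fundamental_theorem_of_calculus)
    fix t
    have "(F has_vector_derivative \<i> / of_int n * (\<i> * of_real (- of_int n) * cis (- of_int n * t))) (at t within {0..2*pi})"
      unfolding F_def by (intro has_vector_derivative_mult_right has_vector_derivative_cis)
    moreover have "\<i> / of_int n * (\<i> * of_real (- of_int n) * cis (- of_int n * t)) = cis (- of_int n * t)"
      using False by (simp add: field_simps)
    ultimately show "(F has_vector_derivative cis (- of_int n * t)) (at t within {0..2*pi})" by simp
  qed simp
  moreover have "F (2*pi) = F 0"
    using cis_2pi_int(1)[of "- n"] by (simp add: F_def)
  ultimately show ?thesis using False by (simp add: integral_unique)
qed (simp add: scaleR_conv_of_real)

lemma fc_diff:
  assumes "continuous_on {0..2*pi} f" "continuous_on {0..2*pi} g"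
  shows "fc (\<lambda>t. f t - g t) n = fc f n - fc g n"
  using integral_diff[OF fc_integrable[OF assms(1), of n] fc_integrable[OF assms(2), of n]]
  by (simp add: fc_def left_diff_distrib diff_divide_distrib)

lemma fc_cmult: "fc (\<lambda>t. c * f t) n = c * fc f n"
  by (simp add: fc_def mult.assoc)

lemma fc_cis: "fc (\<lambda>t. cis (of_int m * t)) n = (if m = n then 1 else 0)"
proof -
  have "cis (of_int m * t) * cis (- (of_int n * t)) = cis (- (of_int (n - m) * t))" for t
    by (simp add: cis_mult algebra_simps)
  then show ?thesis unfolding fc_def by (simp only: integral_cis) simp
qed

lemma fc_shift:
  assumes "continuous_on {0..2*pi} f"
  shows "fc (\<lambda>t. f t * cis t) n = fc f (n - 1)"
proof -
  have "f t * cis t * cis (- (of_int n * t)) = f t * cis (- (of_int (n - 1) * t))" for t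
    by (simp add: cis_mult algebra_simps)
  then show ?thesis unfolding fc_def by (simp only:)
qed

text \<open>Subtracting one mode from f lowers the integral of |f|^2 by exactly 2 pi |c|^2 and
  leaves the coefficients with index in A unchanged. Hence an induction over the index set that
  varies f.\<close>

lemma bessel_inequality:
  assumes "finite A" "continuous_on {0..2*pi} f"
  shows "2 * pi * (\<Sum>n\<in>A. (norm (fc f n))\<^sup>2) \<le> integral {0..2*pi} (\<lambda>t. (norm (f t))\<^sup>2)"
  using assms
proof (induction A arbitrary: f rule: finite_induct)
  case empty
  then show ?case
    by (auto intro!: integral_nonneg integrable_continuous_interval continuous_intros)
next
  case (insert n A)
  note f = insert.prems
  define c where "c = fc f n"
  define g where "g t = f t - c * cis (of_int n * t)" for t
  have e: "continuous_on {0..2*pi} (\<lambda>t. c * cis (of_int n * t))"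
    by (intro continuous_intros)
  have g: "continuous_on {0..2*pi} g"
    unfolding g_def by (intro continuous_intros f)
  have gm: "fc g m = fc f m" if "m \<in> A" for m
    unfolding g_def fc_diff[OF f e] fc_cmult fc_cis using that insert.hyps by auto
  have sq: "(norm (g t))\<^sup>2 = (norm (f t))\<^sup>2 - 2 * Re (cnj c * (f t * cis (- (of_int n * t)))) + (norm c)\<^sup>2" for t
  proof -
    have "complex_of_real ((norm (g t))\<^sup>2) = g t * cnj (g t)" by (rule complex_norm_square)
    also have "\<dots> = f t * cnj (f t) - (cnj c * (f t * cis (- (of_int n * t))) + cnj (cnj c * (f t * cis (- (of_int n * t)))))
        + c * cnj c * (cis (of_int n * t) * cis (- (of_int n * t)))"
      by (simp add: g_def algebra_simps cis_cnj)
    also have "cis (of_int n * t) * cis (- (of_int n * t)) = 1" by (simp add: cis_mult)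
    also have "cnj c * (f t * cis (- (of_int n * t))) + cnj (cnj c * (f t * cis (- (of_int n * t))))
        = of_real (2 * Re (cnj c * (f t * cis (- (of_int n * t)))))"
      by (rule complex_add_cnj)
    finally have "complex_of_real ((norm (g t))\<^sup>2) = of_real ((norm (f t))\<^sup>2
        - 2 * Re (cnj c * (f t * cis (- (of_int n * t)))) + (norm c)\<^sup>2)"
      by (simp only: of_real_add of_real_diff complex_norm_square mult_1_right)
    then show ?thesis by (simp only: of_real_eq_iff)
  qed
  have i1: "(\<lambda>t. (norm (f t))\<^sup>2) integrable_on {0..2*pi}"
    by (intro integrable_continuous_interval continuous_intros f)
  have i2: "((\<lambda>t. f t * cis (- (of_int n * t))) has_integral (c * of_real (2 * pi))) {0..2*pi}"
    using integrable_integral[OF fc_integrable[OF f, of n]] by (simp add: c_def fc_def)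
  have i3: "((\<lambda>t. 2 * Re (cnj c * (f t * cis (- (of_int n * t))))) has_integral
      2 * Re (cnj c * (c * of_real (2 * pi)))) {0..2*pi}"
    by (intro has_integral_mult_right has_integral_Re i2)
  have i4: "((\<lambda>t. (norm c)\<^sup>2) has_integral (2 * pi * (norm c)\<^sup>2)) {0..2*pi}"
    using has_integral_const_real[of "(norm c)\<^sup>2" 0 "2*pi"] by simp
  have "((\<lambda>t. (norm (g t))\<^sup>2) has_integral (integral {0..2*pi} (\<lambda>t. (norm (f t))\<^sup>2)
      - 2 * Re (cnj c * (c * of_real (2 * pi))) + 2 * pi * (norm c)\<^sup>2)) {0..2*pi}"
    unfolding sq by (intro has_integral_add has_integral_diff i3 i4 integrable_integral i1)
  moreover have "Re (cnj c * (c * of_real (2 * pi))) = 2 * pi * (norm c)\<^sup>2"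
    unfolding cmod_power2 by (simp add: power2_eq_square algebra_simps)
  ultimately have "integral {0..2*pi} (\<lambda>t. (norm (g t))\<^sup>2)
      = integral {0..2*pi} (\<lambda>t. (norm (f t))\<^sup>2) - 2 * pi * (norm c)\<^sup>2"
    by (simp add: integral_unique)
  moreover have "2 * pi * (\<Sum>m\<in>A. (norm (fc f m))\<^sup>2) \<le> integral {0..2*pi} (\<lambda>t. (norm (g t))\<^sup>2)"
    using insert.IH[OF g] gm by simp
  ultimately show ?case
    using insert.hyps by (simp add: c_def algebra_simps)
qed

text \<open>The Riemann-Lebesgue lemma along distinct frequencies: by Bessel's inequality the
  squares of the coefficients are summable. Injectivity of m keeps frequencies from being counted
  twice.\<close>

lemma fc_null_sequence:
  assumes "continuous_on {0..2*pi} f" and inj: "inj m"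
  shows "(\<lambda>j::nat. fc f (m j)) \<longlonglongrightarrow> 0"
proof -
  have "summable (\<lambda>j. (norm (fc f (m j)))\<^sup>2)"
  proof (rule summableI_nonneg_bounded)
    fix N
    have "2 * pi * (\<Sum>n\<in>m ` {..<N}. (norm (fc f n))\<^sup>2) \<le> integral {0..2*pi} (\<lambda>t. (norm (f t))\<^sup>2)"
      by (rule bessel_inequality) (use assms in auto)
    moreover have "(\<Sum>n\<in>m ` {..<N}. (norm (fc f n))\<^sup>2) = (\<Sum>j<N. (norm (fc f (m j)))\<^sup>2)"
      using inj by (subst sum.reindex) (auto intro: inj_on_subset)
    ultimately show "(\<Sum>j<N. (norm (fc f (m j)))\<^sup>2) \<le> integral {0..2*pi} (\<lambda>t. (norm (f t))\<^sup>2) / (2 * pi)"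
      by (simp add: field_simps)
  qed simp
  from summable_LIMSEQ_zero[OF this] have "(\<lambda>j. sqrt ((norm (fc f (m j)))\<^sup>2)) \<longlonglongrightarrow> sqrt 0"
    by (rule tendsto_real_sqrt)
  then show ?thesis by (simp add: tendsto_norm_zero_iff)
qed

lemma periodic_int:
  assumes "\<And>t::real. f (t + 2 * pi) = f t"
  shows "f (t + 2 * pi * of_int j) = f t"
proof -
  have nat: "f (t + 2 * pi * real n) = f t" for n t
  proof (induction n)
    case (Suc n)
    have "f (t + 2 * pi * real (Suc n)) = f ((t + 2 * pi * real n) + 2 * pi)"
      by (simp add: algebra_simps)
    then show ?case using assms Suc by simp
  qed simp
  show ?thesis
  proof (cases "0 \<le> j")
    case True
    then show ?thesis using nat[of t "nat j"] by simp
  next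
    case False
    then show ?thesis using nat[of "t + 2 * pi * of_int j" "nat (- j)"] by simp
  qed
qed

lemma difference_quotient_tendsto:
  fixes f :: "real \<Rightarrow> complex"
  assumes "(f has_vector_derivative f') (at t0)"
  shows "((\<lambda>x. (f x - f t0) / of_real (x - t0)) \<longlongrightarrow> f') (at t0)"
proof -
  have "((\<lambda>x. norm ((1 / norm (x - t0)) *\<^sub>R (f x - (f t0 + (x - t0) *\<^sub>R f')))) \<longlongrightarrow> 0) (at t0)"
    using assms[unfolded has_vector_derivative_def has_derivative_at2, THEN conjunct2, THEN tendsto_norm_zero] .
  moreover have "\<forall>\<^sub>F x in at t0. norm ((f x - f t0) / of_real (x - t0) - f')
      \<le> norm ((1 / norm (x - t0)) *\<^sub>R (f x - (f t0 + (x - t0) *\<^sub>R f')))"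
  proof (rule eventually_at_filter[THEN iffD2, OF always_eventually], safe)
    fix x assume "x \<noteq> t0"
    then have "(f x - f t0) / of_real (x - t0) - f' = (f x - (f t0 + (x - t0) *\<^sub>R f')) / of_real (x - t0)"
      by (simp add: field_simps scaleR_conv_of_real)
    then show "norm ((f x - f t0) / of_real (x - t0) - f')
      \<le> norm ((1 / norm (x - t0)) *\<^sub>R (f x - (f t0 + (x - t0) *\<^sub>R f')))"
      by (simp add: norm_divide del: of_real_diff)
  qed
  ultimately have "((\<lambda>x. (f x - f t0) / of_real (x - t0) - f') \<longlongrightarrow> 0) (at t0)"
    by (rule Lim_null_comparison[rotated])
  then show ?thesis by (simp add: LIM_zero_iff)
qed

text \<open>Dividing \<open>f - f(t\<^sub>0)\<close> by \<open>e\<^sup>i\<^sup>(\<^sup>t\<^sup>-\<^sup>t\<^sup>0\<^sup>) - 1\<close> turns the partial sums into telescoping ones.\<close>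

lemma fourier_series_pointwise:
  assumes cont: "continuous_on UNIV f" and per: "\<And>t. f (t + 2 * pi) = f t"
    and der: "(f has_vector_derivative f') (at t0)"
  shows "(\<lambda>N::nat. \<Sum>n=-int N..int N. fc f n * cis (of_int n * t0)) \<longlonglongrightarrow> f t0"
proof -
  define h where "h t = f t - f t0" for t
  \<comment> \<open>Where the denominator vanishes, g takes the quotient of the derivatives of
    numerator and denominator at t0. Periodicity carries this value over to all translates of t0, so
    g is continuous everywhere.\<close>
  define g where "g t = (if cis (t - t0) = 1 then f' / \<i> else h t / (cis (t - t0) - 1))" for t
  have cis1: "cis (t - t0) = 1 \<longleftrightarrow> (\<exists>j::int. t = t0 + 2 * pi * of_int j)" for t
  proof -
    have "cis (t - t0) = 1 \<longleftrightarrow> (\<exists>j::int. t - t0 = of_int j * (2 * pi))"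
      using cos_one_2pi_int[of "t - t0"] cis_2pi_int(1) by (metis cis.sel(1) one_complex.sel(1) mult.assoc mult.commute)
    then show ?thesis by (auto simp: algebra_simps)
  qed
  have hg: "h t = g t * (cis (t - t0) - 1)" for t
    using periodic_int[of f t0] per by (auto simp: g_def h_def cis1)
  have gper: "g (t + 2 * pi * of_int j) = g t" for t j
  proof -
    have "cis (t + 2 * pi * of_int j - t0) = cis (t - t0) * cis (2 * pi * of_int j)"
      by (simp add: cis_mult algebra_simps)
    then have "cis (t + 2 * pi * of_int j - t0) = cis (t - t0)" by simp
    then show ?thesis using periodic_int[of f t] per by (simp add: g_def h_def)
  qed
  have g0: "isCont g t0"
  proof -
    have 1: "((\<lambda>x. h x / of_real (x - t0)) \<longlongrightarrow> f') (at t0)"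
      using difference_quotient_tendsto[OF der] by (simp add: h_def)
    have "((\<lambda>t. t - t0) has_vector_derivative 1) (at t0)"
      by (auto intro!: derivative_eq_intros simp: has_vector_derivative_def)
    from vector_diff_chain_at[OF this, of "\<lambda>t. cis (1 * t)" \<i>] has_vector_derivative_cis[of 1 0 UNIV]
    have "((\<lambda>t. cis (t - t0)) has_vector_derivative \<i>) (at t0)" by (simp add: o_def)
    from difference_quotient_tendsto[OF this]
    have 2: "((\<lambda>x. (cis (x - t0) - 1) / of_real (x - t0)) \<longlongrightarrow> \<i>) (at t0)" by simp
    have "((\<lambda>x. (h x / of_real (x - t0)) / ((cis (x - t0) - 1) / of_real (x - t0))) \<longlongrightarrow> f' / \<i>) (at t0)"
      by (rule tendsto_divide[OF 1 2]) simp
    moreover have "\<forall>\<^sub>F x in at t0. (h x / of_real (x - t0)) / ((cis (x - t0) - 1) / of_real (x - t0)) = g x"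
    proof -
      have "\<forall>\<^sub>F x in at t0. (cis (x - t0) - 1) / of_real (x - t0) \<noteq> 0"
        by (rule tendsto_imp_eventually_ne[OF 2]) simp
      then show ?thesis
        by eventually_elim (auto simp: g_def)
    qed
    ultimately have "(g \<longlongrightarrow> f' / \<i>) (at t0)" by (rule Lim_transform_eventually)
    then show ?thesis by (simp add: isCont_def g_def)
  qed
  have gc: "isCont g t" for t
  proof (cases "cis (t - t0) = 1")
    case True
    then obtain j :: int where j: "t = t0 + 2 * pi * of_int j" using cis1 by auto
    have "isCont (\<lambda>x. g (x - 2 * pi * of_int j)) t"
      by (rule isCont_o2[where g = g]) (use g0 j in \<open>auto intro!: continuous_intros\<close>)
    moreover have "(\<lambda>x. g (x - 2 * pi * of_int j)) = g"
      using gper[of _ "- j"] by (simp add: fun_eq_iff)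
    ultimately show ?thesis by simp
  next
    case False
    have c: "isCont (\<lambda>x. cis (x - t0)) t" unfolding cis_conv_exp by (intro continuous_intros)
    have "\<forall>\<^sub>F x in nhds t. cis (x - t0) \<noteq> 1"
    proof -
      note c
      then have "((\<lambda>x. cis (x - t0)) \<longlongrightarrow> cis (t - t0)) (nhds t)"
        using tendsto_at_iff_tendsto_nhds[of "\<lambda>x. cis (x - t0)" t] unfolding isCont_def by blast
      then show ?thesis using False by (rule tendsto_imp_eventually_ne)
    qed
    then have ev: "\<forall>\<^sub>F x in nhds t. g x = h x / (cis (x - t0) - 1)"
      by eventually_elim (simp add: g_def)
    have "isCont (\<lambda>x. h x / (cis (x - t0) - 1)) t"
    proof (intro isCont_divide isCont_diff c continuous_const)
      show "isCont h t" using cont by (auto intro!: continuous_intros simp: h_def[abs_def] continuous_on_eq_continuous_at)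
    qed (use False in simp)
    then show ?thesis using isCont_cong[OF ev] by simp
  qed
  have gco: "continuous_on A g" for A using gc by (simp add: continuous_at_imp_continuous_on)
  have fco: "continuous_on A f" for A using cont continuous_on_subset by blast
  define a where "a n = fc g n * cis (of_int n * t0)" for n
  \<comment> \<open>Multiplication by e^{it} shifts the index of a coefficient by one, which
    produces the telescoping difference; the constant f t0 contributes to the mode 0 only.\<close>
  have coeff: "fc f n * cis (of_int n * t0) = (a (n - 1) - a n) + (if n = 0 then f t0 else 0)" for n
  proof -
    have "fc h n = fc (\<lambda>t. cis (- t0) * (g t * cis t) - g t) n"
      unfolding hg by (rule arg_cong[of _ _ "\<lambda>f. fc f n"]) (simp add: fun_eq_iff algebra_simps cis_mult)
    also have "\<dots> = cis (- t0) * fc g (n - 1) - fc g n"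
      by (subst fc_diff) (auto intro!: continuous_intros gco simp: fc_cmult fc_shift[OF gco])
    finally have 1: "fc h n = cis (- t0) * fc g (n - 1) - fc g n" .
    have "fc h n = fc f n - fc (\<lambda>t. f t0 * cis (of_int 0 * t)) n"
      unfolding h_def by (subst fc_diff[symmetric]) (auto intro!: continuous_intros fco)
    also have "\<dots> = fc f n - f t0 * (if n = 0 then 1 else 0)"
      unfolding fc_cmult fc_cis by simp
    finally have "fc f n = cis (- t0) * fc g (n - 1) - fc g n + (if n = 0 then f t0 else 0)"
      using 1 by (auto split: if_splits)
    moreover have "cis (- t0) * fc g (n - 1) * cis (of_int n * t0) = a (n - 1)"
      by (simp add: a_def mult.commute mult.left_commute cis_mult algebra_simps)
    ultimately show ?thesis by (simp add: a_def ring_distribs)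
  qed
  have sum: "(\<Sum>n=-int N..int N. fc f n * cis (of_int n * t0)) = a (- int N - 1) - a (int N) + f t0" for N
  proof -
    have "(\<Sum>n=-int N..int N. a (n - 1) - a n) = a (- int N - 1) - a (int N)"
    proof (induction N)
      case (Suc N)
      have "{-int (Suc N)..int (Suc N)} = insert (- int (Suc N)) (insert (int (Suc N)) {-int N..int N})" by auto
      moreover have "a (- 1 - int N) = a (- int N - 1)" by (rule arg_cong[of _ _ a]) simp
      ultimately show ?case using Suc by (simp add: algebra_simps)
    qed simp
    then show ?thesis by (simp add: coeff sum.distrib)
  qed
  have "(\<lambda>N. a (m N)) \<longlonglongrightarrow> 0" if "inj m" for m :: "nat \<Rightarrow> int"
    using tendsto_norm_zero[OF fc_null_sequence[OF gco that]]
    by (intro tendsto_norm_zero_cancel[of "\<lambda>N. a (m N)"]) (simp add: a_def norm_mult)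
  from tendsto_diff[OF this[of "\<lambda>N. - int N - 1"] this[of int]]
  have "(\<lambda>N. a (- int N - 1) - a (int N)) \<longlonglongrightarrow> 0" by (simp add: inj_def)
  from tendsto_add[OF this tendsto_const[of "f t0"]] show ?thesis by (simp add: sum)
qed

lemma fc_derivative:
  assumes der: "\<And>t. (f has_vector_derivative f' t) (at t)" and f': "continuous_on UNIV f'"
    and per: "f (2 * pi) = f 0"
  shows "fc f' n = \<i> * of_int n * fc f n"
proof -
  define e where "e t = cis (- (of_int n * t))" for t :: real
  have e: "(e has_vector_derivative (- \<i> * of_int n * e t)) (at t)" for t
    using has_vector_derivative_cis[of "- of_int n" t UNIV] by (simp add: e_def[abs_def])
  have "((\<lambda>t. f t * (- \<i> * of_int n * e t) + f' t * e t) has_integral (f (2*pi) * e (2*pi) - f 0 * e 0)) {0..2*pi}"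
    by (rule fundamental_theorem_of_calculus)
      (simp, intro has_vector_derivative_at_within[OF has_vector_derivative_mult[OF der e]])
  moreover have "f (2*pi) * e (2*pi) - f 0 * e 0 = 0"
    using cis_2pi_int(1)[of "- n"] per by (simp add: e_def)
  ultimately have 1: "((\<lambda>t. f t * (- \<i> * of_int n * e t) + f' t * e t) has_integral 0) {0..2*pi}" by simp
  have fc: "continuous_on {0..2*pi} f"
    using has_vector_derivative_continuous[OF der] by (intro continuous_at_imp_continuous_on) auto
  have f'c: "continuous_on {0..2*pi} f'" using f' continuous_on_subset by blast
  have 2: "((\<lambda>t. f t * e t) has_integral (fc f n * of_real (2 * pi))) {0..2*pi}"
    using integrable_integral[OF fc_integrable[OF fc, of n]] by (simp add: e_def fc_def)
  have 3: "((\<lambda>t. f' t * e t) has_integral (fc f' n * of_real (2 * pi))) {0..2*pi}"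
    using integrable_integral[OF fc_integrable[OF f'c, of n]] by (simp add: e_def fc_def)
  have "((\<lambda>t. - \<i> * of_int n * (f t * e t) + f' t * e t) has_integral
      (- \<i> * of_int n * (fc f n * of_real (2 * pi)) + fc f' n * of_real (2 * pi))) {0..2*pi}"
    by (intro has_integral_add has_integral_mult_right 2 3)
  with 1 have "- \<i> * of_int n * (fc f n * of_real (2 * pi)) + fc f' n * of_real (2 * pi) = 0"
    by (intro has_integral_unique) (auto simp: mult_ac)
  then have "of_real (2 * pi) * (fc f' n - \<i> * of_int n * fc f n) = 0" by (simp add: algebra_simps)
  then show ?thesis by simp
qed

section \<open>Angular modes of a radiating field\<close>

text \<open>Gronwall for |d|^2 + |d1|^2, run forwards or backwards from x0 with q bounded on the
  compact interval between x0 and x.\<close>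

lemma second_order_ode_unique:
  fixes d d1 :: "real \<Rightarrow> complex"
  assumes der: "\<And>x. a < x \<Longrightarrow> (d has_vector_derivative d1 x) (at x)"
      "\<And>x. a < x \<Longrightarrow> (d1 has_vector_derivative q x * d x) (at x)"
    and q: "continuous_on {a<..} q" and x0: "a < x0" "d x0 = 0" "d1 x0 = 0" and "a < x"
  shows "d x = 0 \<and> d1 x = 0"
proof -
  define l where "l = min x x0"
  define u where "u = max x x0"
  have "continuous_on {l..u} q" using q by (rule continuous_on_subset) (use assms in \<open>auto simp: l_def u_def\<close>)
  then have "bounded (q ` {l..u})" by (intro compact_imp_bounded compact_continuous_image compact_Icc)
  then obtain M where M: "\<And>t. t \<in> {l..u} \<Longrightarrow> norm (q t) \<le> M" unfolding bounded_iff by force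
  define p where "p t = (norm (d t))\<^sup>2 + (norm (d1 t))\<^sup>2" for t
  define p' where "p' t = 2 * Re (d1 t * cnj (d t)) + 2 * Re (q t * d t * cnj (d1 t))" for t
  have dp: "(p has_real_derivative p' t) (at t)" if "t \<in> {l..u}" for t
    unfolding p_def p'_def using that assms
    by (intro DERIV_add norm_sq_has_real_derivative der) (auto simp: l_def)
  have p0: "p x0 = 0" using x0 by (simp add: p_def)
  have bnd: "\<bar>p' t\<bar> \<le> (1 + M) * p t" if "t \<in> {l..u}" for t
  proof -
    have "0 \<le> M" using M[OF that] norm_ge_zero order_trans by blast
    have "\<bar>Re (d1 t * cnj (d t))\<bar> \<le> norm (d1 t) * norm (d t)" by (rule Re_mult_cnj_le)
    moreover have "\<bar>Re (q t * d t * cnj (d1 t))\<bar> \<le> M * (norm (d1 t) * norm (d t))"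
    proof -
      have "\<bar>Re (q t * d t * cnj (d1 t))\<bar> \<le> norm (q t) * (norm (d1 t) * norm (d t))"
        using Re_mult_cnj_le[of "q t * d t" "d1 t"] by (simp add: norm_mult mult_ac)
      also have "\<dots> \<le> M * (norm (d1 t) * norm (d t))" using M[OF that] by (intro mult_right_mono) auto
      finally show ?thesis .
    qed
    ultimately have "\<bar>p' t\<bar> \<le> (1 + M) * (2 * (norm (d1 t) * norm (d t)))"
      unfolding p'_def by (simp add: algebra_simps)
    also have "\<dots> \<le> (1 + M) * p t"
      using two_mult_le_squares[of "norm (d1 t)" "norm (d t)"] \<open>0 \<le> M\<close>
      by (intro mult_left_mono) (auto simp: p_def)
    finally show ?thesis .
  qed
  have "p x \<le> 0"
  proof (cases "x0 \<le> x")
    case True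
    have "exp (- (1 + M) * x) * p x \<le> exp (- (1 + M) * x0) * p x0"
    proof (rule DERIV_nonpos_imp_nonincreasing[OF True])
      fix t assume t: "x0 \<le> t" "t \<le> x"
      then have t: "t \<in> {l..u}" by (auto simp: l_def u_def)
      have "((\<lambda>t. exp (- (1 + M) * t) * p t) has_real_derivative (exp (- (1 + M) * t) * (p' t - (1 + M) * p t))) (at t)"
        using dp[OF t] by (auto intro!: derivative_eq_intros simp: algebra_simps)
      moreover have "exp (- (1 + M) * t) * (p' t - (1 + M) * p t) \<le> 0"
        using bnd[OF t] by (intro mult_nonneg_nonpos) auto
      ultimately show "\<exists>D. ((\<lambda>t. exp (- (1 + M) * t) * p t) has_real_derivative D) (at t) \<and> D \<le> 0" by blast
    qed
    then show ?thesis using p0 by (simp add: mult_le_0_iff)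
  next
    case False
    have "exp ((1 + M) * x) * p x \<le> exp ((1 + M) * x0) * p x0"
    proof (rule DERIV_nonneg_imp_nondecreasing[of x x0])
      fix t assume t: "x \<le> t" "t \<le> x0"
      then have t: "t \<in> {l..u}" by (auto simp: l_def u_def)
      have "((\<lambda>t. exp ((1 + M) * t) * p t) has_real_derivative (exp ((1 + M) * t) * (p' t + (1 + M) * p t))) (at t)"
        using dp[OF t] by (auto intro!: derivative_eq_intros simp: algebra_simps)
      moreover have "exp ((1 + M) * t) * (p' t + (1 + M) * p t) \<ge> 0"
        using bnd[OF t] by (intro mult_nonneg_nonneg) auto
      ultimately show "\<exists>D. ((\<lambda>t. exp ((1 + M) * t) * p t) has_real_derivative D) (at t) \<and> 0 \<le> D" by blast
    qed (use False in auto)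
    then show ?thesis using p0 by (simp add: mult_le_0_iff)
  qed
  moreover have "0 \<le> (norm (d x))\<^sup>2" "0 \<le> (norm (d1 x))\<^sup>2" by auto
  ultimately have "(norm (d x))\<^sup>2 = 0 \<and> (norm (d1 x))\<^sup>2 = 0" unfolding p_def by linarith
  then show ?thesis by simp
qed

lemma has_vector_derivative_shift:
  assumes "(f has_vector_derivative f') (at (\<theta> + a))"
  shows "((\<lambda>t. f (t + a)) has_vector_derivative f') (at (\<theta>::real))"
proof -
  have "((\<lambda>t. t + a) has_vector_derivative 1) (at \<theta>)"
    unfolding has_vector_derivative_def by (auto intro!: derivative_eq_intros)
  from vector_diff_chain_at[OF this assms] show ?thesis by (simp add: o_def)
qed

text \<open>Cauchy-Schwarz in the form that turns square sums of modes into sums of their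
  moduli.\<close>

lemma sum_abs_le_sqrt:
  fixes a :: "'a \<Rightarrow> real"
  assumes "finite A" "\<And>i. i \<in> A \<Longrightarrow> a i \<le> b i * g i" "(\<Sum>i\<in>A. (b i)\<^sup>2) \<le> B" "(\<Sum>i\<in>A. (g i)\<^sup>2) \<le> G"
  shows "(\<Sum>i\<in>A. a i) \<le> sqrt (B * G)"
proof -
  have "(\<Sum>i\<in>A. b i * g i)\<^sup>2 \<le> (\<Sum>i\<in>A. (b i)\<^sup>2) * (\<Sum>i\<in>A. (g i)\<^sup>2)" by (rule Cauchy_Schwarz_ineq_sum)
  also have "\<dots> \<le> B * G" using assms order_trans[OF sum_nonneg assms(3)]
    by (intro mult_mono) (auto intro: sum_nonneg)
  finally have "(\<Sum>i\<in>A. b i * g i) \<le> sqrt (B * G)" by (rule real_le_rsqrt)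
  moreover have "(\<Sum>i\<in>A. a i) \<le> (\<Sum>i\<in>A. b i * g i)" using assms(2) by (rule sum_mono)
  ultimately show ?thesis by linarith
qed

text \<open>p is convex, so by the sign of its slope at x it is nondecreasing in at least one
  direction. In that direction the second derivative stays above m p(x), and two integrations give
  the factor. Having both neighbours on the right-hand side makes the choice of direction
  invisible.\<close>

lemma convexity_gain:
  fixes p :: "real \<Rightarrow> real"
  assumes "0 < \<delta>" "0 \<le> m"
    and p1: "\<And>t. \<bar>t - x\<bar> \<le> \<delta> \<Longrightarrow> (p has_real_derivative p1 t) (at t)"
    and p2: "\<And>t. \<bar>t - x\<bar> \<le> \<delta> \<Longrightarrow> (p1 has_real_derivative p2 t) (at t)"
    and ge: "\<And>t. \<bar>t - x\<bar> \<le> \<delta> \<Longrightarrow> m * p t \<le> p2 t" and pos: "\<And>t. \<bar>t - x\<bar> \<le> \<delta> \<Longrightarrow> 0 \<le> p t"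
  shows "p x * (1 + m * \<delta>\<^sup>2 / 2) \<le> p (x + \<delta>) + p (x - \<delta>)"
proof -
  have right: "f 0 * (1 + m * \<delta>\<^sup>2 / 2) \<le> f \<delta>"
    if f1: "\<And>t. 0 \<le> t \<Longrightarrow> t \<le> \<delta> \<Longrightarrow> (f has_real_derivative f1 t) (at t)"
      and f2: "\<And>t. 0 \<le> t \<Longrightarrow> t \<le> \<delta> \<Longrightarrow> (f1 has_real_derivative f2 t) (at t)"
      and ge: "\<And>t. 0 \<le> t \<Longrightarrow> t \<le> \<delta> \<Longrightarrow> m * f t \<le> f2 t" and pos: "\<And>t. 0 \<le> t \<Longrightarrow> t \<le> \<delta> \<Longrightarrow> 0 \<le> f t"
      and "0 \<le> f1 0" for f f1 f2
  proof -
    have f1nn: "0 \<le> f1 t" if "0 \<le> t" "t \<le> \<delta>" for t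
    proof -
      have "f1 0 \<le> f1 t"
      proof (rule DERIV_nonneg_imp_nondecreasing[OF that(1)])
        fix s assume "0 \<le> s" "s \<le> t"
        then show "\<exists>D. (f1 has_real_derivative D) (at s) \<and> 0 \<le> D"
          using f2[of s] order_trans[OF mult_nonneg_nonneg[OF \<open>0 \<le> m\<close> pos[of s]] ge[of s]] that
          by (intro exI[of _ "f2 s"]) auto
      qed
      then show ?thesis using \<open>0 \<le> f1 0\<close> by simp
    qed
    have f0: "f 0 \<le> f t" if "0 \<le> t" "t \<le> \<delta>" for t
    proof (rule DERIV_nonneg_imp_nondecreasing[OF that(1)])
      fix s assume "0 \<le> s" "s \<le> t"
      then show "\<exists>D. (f has_real_derivative D) (at s) \<and> 0 \<le> D"
        using f1[of s] f1nn[of s] that by (intro exI[of _ "f1 s"]) auto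
    qed
    have f1ge: "m * f 0 * t \<le> f1 t" if "0 \<le> t" "t \<le> \<delta>" for t
    proof -
      have "f1 0 - m * f 0 * 0 \<le> f1 t - m * f 0 * t"
      proof (rule DERIV_nonneg_imp_nondecreasing[OF that(1)])
        fix s assume s: "0 \<le> s" "s \<le> t"
        have "((\<lambda>t. f1 t - m * f 0 * t) has_real_derivative (f2 s - m * f 0 * 1)) (at s)"
          using f2[of s] s that by (intro DERIV_diff DERIV_cmult DERIV_ident) auto
        moreover have "m * f 0 \<le> f2 s"
          using mult_left_mono[OF f0[of s] \<open>0 \<le> m\<close>] ge[of s] s that by simp
        ultimately show "\<exists>D. ((\<lambda>t. f1 t - m * f 0 * t) has_real_derivative D) (at s) \<and> 0 \<le> D" by force
      qed
      then show ?thesis using \<open>0 \<le> f1 0\<close> by simp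
    qed
    have "f 0 - m * f 0 * 0\<^sup>2 / 2 \<le> f \<delta> - m * f 0 * \<delta>\<^sup>2 / 2"
    proof (rule DERIV_nonneg_imp_nondecreasing[of 0 \<delta>])
      fix s assume s: "0 \<le> s" "s \<le> \<delta>"
      have "((\<lambda>t. m * f 0 * t\<^sup>2 / 2) has_real_derivative (m * f 0 * s)) (at s)"
        by (auto intro!: derivative_eq_intros)
      from DERIV_diff[OF f1[OF s] this] f1ge[OF s]
      show "\<exists>D. ((\<lambda>t. f t - m * f 0 * t\<^sup>2 / 2) has_real_derivative D) (at s) \<and> 0 \<le> D"
        by (intro exI conjI) auto
    qed (use assms in auto)
    then show ?thesis by (simp add: algebra_simps)
  qed
  have nn: "0 \<le> p (x + \<delta>)" "0 \<le> p (x - \<delta>)" using pos assms(1) by auto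
  show ?thesis
  proof (cases "0 \<le> p1 x")
    case True
    have "p (x + 0) * (1 + m * \<delta>\<^sup>2 / 2) \<le> p (x + \<delta>)"
    proof (rule right[of "\<lambda>t. p (x + t)" "\<lambda>t. p1 (x + t)" "\<lambda>t. p2 (x + t)"])
      fix t assume t: "0 \<le> t" "t \<le> \<delta>"
      show "((\<lambda>t. p (x + t)) has_real_derivative p1 (x + t)) (at t)"
        using DERIV_shift[of p "p1 (x + t)" t x] p1[of "x + t"] t by (simp add: add.commute)
      show "((\<lambda>t. p1 (x + t)) has_real_derivative p2 (x + t)) (at t)"
        using DERIV_shift[of p1 "p2 (x + t)" t x] p2[of "x + t"] t by (simp add: add.commute)
    qed (use ge pos True in auto)
    then show ?thesis using nn by simp
  next
    case False
    have "p (x - 0) * (1 + m * \<delta>\<^sup>2 / 2) \<le> p (x - \<delta>)"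
    proof (rule right[of "\<lambda>t. p (x - t)" "\<lambda>t. - p1 (x - t)" "\<lambda>t. p2 (x - t)"])
      fix t assume t: "0 \<le> t" "t \<le> \<delta>"
      have d: "((\<lambda>t. x - t) has_real_derivative - 1) (at t)" by (auto intro!: derivative_eq_intros)
      show "((\<lambda>t. p (x - t)) has_real_derivative - p1 (x - t)) (at t)"
        using DERIV_chain2[of p "p1 (x - t)" "\<lambda>t. x - t" t, OF _ d] p1[of "x - t"] t by simp
      show "((\<lambda>t. - p1 (x - t)) has_real_derivative p2 (x - t)) (at t)"
        using DERIV_minus[OF DERIV_chain2[of p1 "p2 (x - t)" "\<lambda>t. x - t" t, OF _ d]] p2[of "x - t"] t by simp
    qed (use ge pos False in auto)
    then show ?thesis using nn by simp
  qed
qed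

text \<open>The summands are the reciprocals of the gain factors in
  \<open>mode_gain\<close>.\<close>

lemma sum_inverse_squares_int: "\<exists>Z\<ge>0. \<forall>A. finite (A :: int set) \<longrightarrow> (\<Sum>n\<in>A. 1 / (1 + (of_int n)\<^sup>2 / 32)) \<le> (Z::real)"
proof -
  define g where "g n = 1 / (1 + (real n)\<^sup>2 / 32)" for n
  have "summable g"
  proof (rule summable_comparison_test')
    show "summable (\<lambda>n. 32 * inverse ((real n)\<^sup>2))"
      using inverse_power_summable[of 2] by (intro summable_mult) auto
    show "norm (g n) \<le> 32 * inverse ((real n)\<^sup>2)" if "1 \<le> n" for n
    proof -
      have "g n \<le> 1 / ((real n)\<^sup>2 / 32)"
        using that unfolding g_def by (intro divide_left_mono) (auto intro!: mult_pos_pos add_pos_nonneg)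
      moreover have "1 / ((real n)\<^sup>2 / 32) = 32 * inverse ((real n)\<^sup>2)" by (simp add: inverse_eq_divide)
      moreover have "0 \<le> g n" by (simp add: g_def)
      ultimately show ?thesis by (simp only: real_norm_def abs_of_nonneg)
    qed
  qed
  moreover have nn: "0 \<le> g n" for n by (simp add: g_def)
  ultimately have fin: "(\<Sum>n\<in>B. g n) \<le> suminf g" if "finite B" for B
    using that by (intro sum_le_suminf) (auto simp: nn)
  have "(\<Sum>n\<in>A. 1 / (1 + (of_int n)\<^sup>2 / 32)) \<le> 2 * suminf g" if A: "finite A" for A :: "int set"
  proof -
    have eq: "1 / (1 + (of_int n)\<^sup>2 / 32) = g (nat \<bar>n\<bar>)" for n :: int by (simp add: g_def)
    have "(\<Sum>n\<in>A. g (nat \<bar>n\<bar>)) = (\<Sum>n\<in>A \<inter> {0..}. g (nat \<bar>n\<bar>)) + (\<Sum>n\<in>A - {0..}. g (nat \<bar>n\<bar>))"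
      using A by (rule sum.Int_Diff)
    also have "(\<Sum>n\<in>A \<inter> {0..}. g (nat \<bar>n\<bar>)) = sum g ((\<lambda>n. nat \<bar>n\<bar>) ` (A \<inter> {0..}))"
      by (subst sum.reindex) (auto simp: inj_on_def)
    also have "(\<Sum>n\<in>A - {0..}. g (nat \<bar>n\<bar>)) = sum g ((\<lambda>n. nat \<bar>n\<bar>) ` (A - {0..}))"
      by (subst sum.reindex) (auto simp: inj_on_def)
    finally show ?thesis using fin[of "(\<lambda>n. nat \<bar>n\<bar>) ` (A \<inter> {0..})"] fin[of "(\<lambda>n. nat \<bar>n\<bar>) ` (A - {0..})"] A
      by (simp add: eq)
  qed
  moreover have "0 \<le> suminf g" using fin[of "{}"] by simp
  ultimately show ?thesis by (intro exI[of _ "2 * suminf g"]) auto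
qed

text \<open>The field beyond a disk as a function of real polar coordinates. Its continuation is
  constructed from these data alone and is compared with W only afterwards.\<close>

locale radiating =
  fixes k R0 R c :: real and V Vr Vrr Vt Vtt :: "real \<Rightarrow> real \<Rightarrow> complex"
  assumes k: "0 < k" and R0: "0 < R0" "R0 < R" "1 \<le> R"
    and Vr: "\<And>r \<theta>. R0 < r \<Longrightarrow> ((\<lambda>r. V r \<theta>) has_vector_derivative Vr r \<theta>) (at r)"
    and Vrr: "\<And>r \<theta>. R0 < r \<Longrightarrow> ((\<lambda>r. Vr r \<theta>) has_vector_derivative Vrr r \<theta>) (at r)"
    and Vt: "\<And>r \<theta>. R0 < r \<Longrightarrow> ((\<lambda>\<theta>. V r \<theta>) has_vector_derivative Vt r \<theta>) (at \<theta>)"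
    and Vtt: "\<And>r \<theta>. R0 < r \<Longrightarrow> ((\<lambda>\<theta>. Vt r \<theta>) has_vector_derivative Vtt r \<theta>) (at \<theta>)"
    and cont: "continuous_on ({R0<..} \<times> UNIV) (\<lambda>(r, \<theta>). V r \<theta>)"
      "continuous_on ({R0<..} \<times> UNIV) (\<lambda>(r, \<theta>). Vr r \<theta>)"
      "continuous_on ({R0<..} \<times> UNIV) (\<lambda>(r, \<theta>). Vrr r \<theta>)"
      "continuous_on ({R0<..} \<times> UNIV) (\<lambda>(r, \<theta>). Vtt r \<theta>)"
    and per: "\<And>r \<theta>. R0 < r \<Longrightarrow> V r (\<theta> + 2 * pi) = V r \<theta>"
    and pde: "\<And>r \<theta>. R0 < r \<Longrightarrow> Vrr r \<theta> + Vr r \<theta> / of_real r + Vtt r \<theta> / of_real (r\<^sup>2) + of_real (k\<^sup>2) * V r \<theta> = 0"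
    and rad: "\<And>r \<theta>. R \<le> r \<Longrightarrow> norm (Vr r \<theta> - \<i> * of_real k * V r \<theta>) \<le> c / r"
begin

lemma angular_cont:
  assumes "continuous_on ({R0<..} \<times> UNIV) (\<lambda>(r, \<theta>). (F r \<theta> :: complex))" "R0 < r"
  shows "continuous_on A (F r)"
proof -
  have "continuous_on A (\<lambda>\<theta>. (\<lambda>(r, \<theta>). F r \<theta>) (r, \<theta>))"
    by (rule continuous_on_compose2[OF assms(1)]) (use assms(2) in \<open>auto intro!: continuous_intros\<close>)
  then show ?thesis by simp
qed

lemmas V_cont = angular_cont[OF cont(1)] and Vr_cont = angular_cont[OF cont(2)]
  and Vrr_cont = angular_cont[OF cont(3)] and Vtt_cont = angular_cont[OF cont(4)]

lemma fc_has_derivative: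
  assumes der: "\<And>r \<theta>. R0 < r \<Longrightarrow> ((\<lambda>r. F r \<theta>) has_vector_derivative F' r \<theta>) (at r)"
    and F: "continuous_on ({R0<..} \<times> UNIV) (\<lambda>(r, \<theta>). (F r \<theta> :: complex))"
    and F': "continuous_on ({R0<..} \<times> UNIV) (\<lambda>(r, \<theta>). F' r \<theta>)" and r: "R0 < r"
  shows "((\<lambda>r. fc (F r) n) has_vector_derivative fc (F' r) n) (at r)"
proof -
  have "((\<lambda>r. integral (cbox 0 (2*pi)) (\<lambda>t. F r t * cis (- (of_int n * t)))) has_vector_derivative
      integral (cbox 0 (2*pi)) (\<lambda>t. F' r t * cis (- (of_int n * t)))) (at r within {R0<..})"
  proof (rule leibniz_rule_vector_derivative)
    show "((\<lambda>r. F r t * cis (- (of_int n * t))) has_vector_derivative F' r t * cis (- (of_int n * t))) (at r within {R0<..})"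
      if "r \<in> {R0<..}" for r t
      by (rule has_vector_derivative_mult_left[OF has_vector_derivative_at_within[OF der]]) (use that in simp)
    show "(\<lambda>t. F r t * cis (- (of_int n * t))) integrable_on cbox 0 (2 * pi)" if "r \<in> {R0<..}" for r
      using fc_integrable[OF angular_cont[OF F]] that by auto
    show "continuous_on ({R0<..} \<times> cbox 0 (2 * pi)) (\<lambda>(r, t). F' r t * cis (- (of_int n * t)))"
      unfolding case_prod_beta
      by (intro continuous_intros continuous_on_subset[OF F'[unfolded case_prod_beta]]) auto
  qed (use r in auto)
  from has_vector_derivative_divide[OF this, of "of_real (2 * pi)"]
  show ?thesis unfolding fc_def using r at_within_open[of r "{R0<..}"] by simp
qed

definition w where "w n r = fc (V r) n"
definition w1 where "w1 n r = fc (Vr r) n"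
definition w2 where "w2 n r = (of_real ((of_int n / r)\<^sup>2 - k\<^sup>2) * w n r - w1 n r / of_real r)"

lemma w_deriv: "R0 < r \<Longrightarrow> (w n has_vector_derivative w1 n r) (at r)"
  unfolding w_def[abs_def] w1_def by (rule fc_has_derivative[OF Vr cont(1,2)])

lemma Vt_per: "R0 < r \<Longrightarrow> Vt r (\<theta> + 2 * pi) = Vt r \<theta>"
proof -
  assume r: "R0 < r"
  have "((\<lambda>t. V r (t + 2 * pi)) has_vector_derivative Vt r (\<theta> + 2 * pi)) (at \<theta>)"
    by (rule has_vector_derivative_shift[OF Vt[OF r]])
  then have "(V r has_vector_derivative Vt r (\<theta> + 2 * pi)) (at \<theta>)" using per[OF r] by simp
  then show ?thesis using Vt[OF r] vector_derivative_unique_at by blast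
qed

lemma fc_Vtt: "R0 < r \<Longrightarrow> fc (Vtt r) n = - (of_int n)\<^sup>2 * w n r"
proof -
  assume r: "R0 < r"
  have "continuous_on UNIV (Vt r)"
    using has_vector_derivative_continuous[OF Vtt[OF r]] by (intro continuous_at_imp_continuous_on) auto
  then have "fc (Vt r) n = \<i> * of_int n * w n r"
    using fc_derivative[OF Vt[OF r]] per[OF r, of 0] by (simp add: w_def)
  moreover have "fc (Vtt r) n = \<i> * of_int n * fc (Vt r) n"
    using fc_derivative[OF Vtt[OF r] Vtt_cont[OF r]] Vt_per[OF r, of 0] by simp
  ultimately have "fc (Vtt r) n = (\<i> * \<i>) * (of_int n * of_int n * w n r)" by (simp only: mult_ac)
  then show ?thesis by (simp add: power2_eq_square)
qed

lemma w1_deriv: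
  assumes r: "R0 < r"
  shows "(w1 n has_vector_derivative w2 n r) (at r)"
proof -
  have r0: "r \<noteq> 0" using r R0 by simp
  \<comment> \<open>The equation solved for the second radial derivative and written with
    differences and constant multiples only, the shape in which \<open>fc_diff\<close> and
    \<open>fc_cmult\<close> apply.\<close>
  have "Vrr r = (\<lambda>t. (- of_real (k\<^sup>2)) * V r t - ((1 / of_real r) * Vr r t - (- (1 / of_real (r\<^sup>2))) * Vtt r t))"
  proof
    fix t show "Vrr r t = (- of_real (k\<^sup>2)) * V r t - ((1 / of_real r) * Vr r t - (- (1 / of_real (r\<^sup>2))) * Vtt r t)"
      using pde[OF r, of t] by (simp add: algebra_simps eq_neg_iff_add_eq_0)
  qed
  then have "fc (Vrr r) n = (- of_real (k\<^sup>2)) * w n r - ((1 / of_real r) * w1 n r - (- (1 / of_real (r\<^sup>2))) * fc (Vtt r) n)"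
    by (simp only:) (subst fc_diff | intro continuous_intros V_cont Vr_cont Vtt_cont r | simp only: fc_cmult w_def w1_def)+
  also have "\<dots> = w2 n r"
    using r0 by (simp add: fc_Vtt[OF r] w2_def field_simps power2_eq_square)
  finally show ?thesis
    using fc_has_derivative[OF Vrr cont(2,3) r, of n] by (simp add: w1_def[abs_def])
qed

section \<open>Sums over all modes at a fixed radius\<close>

text \<open>Up to a constant factor this is r times the Wronskian of w and its conjugate. Both solve
  the same Bessel equation with real coefficients, and the factor r compensates its first-order
  term.\<close>

lemma flux_const:
  assumes "R \<le> r"
  shows "r * Im (w1 n r * cnj (w n r)) = R * Im (w1 n R * cnj (w n R))"
proof (cases "r = R")
  case False
  define \<phi> where "\<phi> r = r * Im (w1 n r * cnj (w n r))" for r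
  have d: "(\<phi> has_real_derivative 0) (at t)" if "R \<le> t" for t
  proof -
    have t: "R0 < t" "t \<noteq> 0" using that R0 by auto
    have "((\<lambda>r. cnj (w n r)) has_vector_derivative cnj (w1 n t)) (at t)"
      using bounded_linear.has_vector_derivative[OF bounded_linear_cnj w_deriv[OF t(1)]] .
    from bounded_linear.has_vector_derivative[OF bounded_linear_Im has_vector_derivative_mult[OF w1_deriv[OF t(1)] this]]
    have i: "((\<lambda>r. Im (w1 n r * cnj (w n r))) has_real_derivative
        Im (w1 n t * cnj (w1 n t) + w2 n t * cnj (w n t))) (at t)"
      by (simp only: has_real_derivative_iff_has_vector_derivative)
    have "(\<phi> has_real_derivative
        (1 * Im (w1 n t * cnj (w n t)) + Im (w1 n t * cnj (w1 n t) + w2 n t * cnj (w n t)) * t)) (at t)"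
      unfolding \<phi>_def[abs_def] by (rule DERIV_mult[OF DERIV_ident i])
    moreover have "1 * Im (w1 n t * cnj (w n t)) + Im (w1 n t * cnj (w1 n t) + w2 n t * cnj (w n t)) * t = 0"
    proof -
      define a where "a = (of_int n / t)\<^sup>2 - k\<^sup>2"
      have "w2 n t * cnj (w n t) = of_real a * (w n t * cnj (w n t)) - (w1 n t * cnj (w n t)) / of_real t"
        by (simp add: w2_def a_def algebra_simps)
      then have "Im (w2 n t * cnj (w n t)) = - (Im (w1 n t * cnj (w n t)) / t)"
        by (simp add: complex_mult_cnj)
      moreover have "Im (w1 n t * cnj (w1 n t)) = 0" by (simp add: complex_mult_cnj)
      ultimately show ?thesis using t by (simp only: plus_complex.sel) simp
    qed
    ultimately show ?thesis by simp
  qed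
  have c: "continuous_on {R..r} \<phi>"
    using DERIV_isCont[OF d] by (intro continuous_at_imp_continuous_on) auto
  have "\<phi> r = \<phi> R"
    by (rule DERIV_isconst_end[OF _ c]) (use assms False d in auto)
  then show ?thesis by (simp add: \<phi>_def)
qed simp

text \<open>In |w' - i k w|^2 = |w'|^2 + k^2 |w|^2 - 2 k Im(w' conj w) the sum of the left-hand side
  is at most (c/r)^2, by Bessel's inequality and the radiation condition. The cross term is a
  conserved flux divided by r, and the fluxes are summed at the fixed radius R. What remains bounds
  k^2 times the sum of |w|^2 by a multiple of 1/r.\<close>

lemma w_sq_sum_bound: "\<exists>C\<ge>0. \<forall>r\<ge>R. \<forall>A. finite A \<longrightarrow> (\<Sum>n\<in>A. (norm (w n r))\<^sup>2) \<le> C / r"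
proof -
  \<comment> \<open>Bounds any finite sum of fluxes through the circle of radius R, by 2 a b \<le>
    a^2 + b^2 and Bessel's inequality for the field and its radial derivative.\<close>
  define K where "K = R / 2 * (integral {0..2*pi} (\<lambda>t. (norm (Vr R t))\<^sup>2) / (2 * pi) + integral {0..2*pi} (\<lambda>t. (norm (V R t))\<^sup>2) / (2 * pi))"
  define C where "C = (c\<^sup>2 + 2 * k * K) / k\<^sup>2"
  have flux: "(\<Sum>n\<in>A. R * Im (w1 n R * cnj (w n R))) \<le> K" if "finite A" for A
  proof -
    have "R * Im (w1 n R * cnj (w n R)) \<le> R / 2 * ((norm (w1 n R))\<^sup>2 + (norm (w n R))\<^sup>2)" for n
    proof -
      have "Im (w1 n R * cnj (w n R)) \<le> norm (w1 n R) * norm (w n R)"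
        by (metis abs_Im_le_cmod abs_le_D1 complex_mod_cnj norm_mult)
      also have "\<dots> \<le> ((norm (w1 n R))\<^sup>2 + (norm (w n R))\<^sup>2) / 2"
        using two_mult_le_squares[of "norm (w1 n R)" "norm (w n R)"] by simp
      finally show ?thesis using R0 mult_left_mono[of _ _ R] by fastforce
    qed
    then have "(\<Sum>n\<in>A. R * Im (w1 n R * cnj (w n R))) \<le> (\<Sum>n\<in>A. R / 2 * ((norm (w1 n R))\<^sup>2 + (norm (w n R))\<^sup>2))"
      by (rule sum_mono)
    also have "\<dots> = R / 2 * ((\<Sum>n\<in>A. (norm (w1 n R))\<^sup>2) + (\<Sum>n\<in>A. (norm (w n R))\<^sup>2))"
      by (simp add: sum_distrib_left sum.distrib algebra_simps)
    also have "\<dots> \<le> K"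
      unfolding K_def w1_def w_def
      using R0 bessel_inequality[OF that Vr_cont[OF R0(2)]] bessel_inequality[OF that V_cont[OF R0(2)]]
      by (intro mult_left_mono add_mono) (auto simp: field_simps)
    finally show ?thesis .
  qed
  have bnd: "(\<Sum>n\<in>A. (norm (w n r))\<^sup>2) \<le> C / r" if r: "R \<le> r" and A: "finite A" for r A
  proof -
    have r': "R0 < r" "1 \<le> r" "0 < r" using r R0 by auto
    define g where "g t = Vr r t - \<i> * of_real k * V r t" for t
    have gc: "continuous_on {0..2*pi} g"
      unfolding g_def by (intro continuous_intros Vr_cont V_cont r')
    have fcg: "fc g n = w1 n r - \<i> * of_real k * w n r" for n
      unfolding g_def w1_def w_def
      by (subst fc_diff) (auto intro!: continuous_intros Vr_cont V_cont r' simp: fc_cmult)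
    have "integral {0..2*pi} (\<lambda>t. (norm (g t))\<^sup>2) \<le> integral {0..2*pi} (\<lambda>t. (c / r)\<^sup>2)"
      using rad[OF r] by (intro integral_le integrable_continuous_interval continuous_intros gc power_mono)
        (auto simp: g_def)
    also have "\<dots> = 2 * pi * (c / r)\<^sup>2" by simp
    finally have "2 * pi * (\<Sum>n\<in>A. (norm (fc g n))\<^sup>2) \<le> 2 * pi * (c / r)\<^sup>2"
      using bessel_inequality[OF A gc] by linarith
    then have 1: "(\<Sum>n\<in>A. (norm (fc g n))\<^sup>2) \<le> (c / r)\<^sup>2" by simp
    have id: "k\<^sup>2 * (norm (w n r))\<^sup>2 \<le> (norm (fc g n))\<^sup>2 + 2 * k / r * (R * Im (w1 n R * cnj (w n R)))" for n
    proof -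
      have "(norm (fc g n))\<^sup>2 = (norm (w1 n r))\<^sup>2 + k\<^sup>2 * (norm (w n r))\<^sup>2 - 2 * k * Im (w1 n r * cnj (w n r))"
        unfolding fcg cmod_power2 by (simp add: power2_eq_square algebra_simps)
      moreover have "2 * k / r * (R * Im (w1 n R * cnj (w n R))) = 2 * k * Im (w1 n r * cnj (w n r))"
        unfolding flux_const[OF r, symmetric] using r' by simp
      ultimately show ?thesis by simp
    qed
    have "k\<^sup>2 * (\<Sum>n\<in>A. (norm (w n r))\<^sup>2) = (\<Sum>n\<in>A. k\<^sup>2 * (norm (w n r))\<^sup>2)" by (rule sum_distrib_left)
    also have "\<dots> \<le> (\<Sum>n\<in>A. (norm (fc g n))\<^sup>2 + 2 * k / r * (R * Im (w1 n R * cnj (w n R))))"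
      using id by (rule sum_mono)
    also have "\<dots> = (\<Sum>n\<in>A. (norm (fc g n))\<^sup>2) + 2 * k / r * (\<Sum>n\<in>A. R * Im (w1 n R * cnj (w n R)))"
      by (simp only: sum.distrib sum_distrib_left)
    also have "\<dots> \<le> (c / r)\<^sup>2 + 2 * k / r * K"
      using 1 flux[OF A] k r' by (intro add_mono mult_left_mono) auto
    also have "\<dots> \<le> c\<^sup>2 / r + 2 * k / r * K"
      using r' divide_left_mono[of r "r\<^sup>2" "c\<^sup>2"] self_le_power[of r 2] by (simp add: power_divide)
    also have "\<dots> = k\<^sup>2 * (C / r)"
    proof -
      have "k\<^sup>2 * C = c\<^sup>2 + 2 * k * K" using k by (simp add: C_def)
      then have "k\<^sup>2 * (C / r) = (c\<^sup>2 + 2 * k * K) / r" by simp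
      then show ?thesis by (simp add: add_divide_distrib)
    qed
    finally show ?thesis by (rule mult_left_le_imp_le) (use k in simp)
  qed
  have "0 \<le> C / R" using bnd[of R "{}"] by simp
  then have "0 \<le> C" using R0 by (simp add: zero_le_divide_iff)
  then show ?thesis using bnd by blast
qed

text \<open>In t = ln r Bessel's equation reads w'' = (n^2 - k^2 e^{2t}) w, without a first-order
  term. For |n| > 2 k r and steps of at most 1/4 one has exp(1/2) \<le> 2, so the coefficient stays
  above n^2/2 and p = |w|^2 satisfies p'' \<ge> n^2 p. With \<delta> = 1/4,
  \<open>convexity_gain\<close> gives the constant 32 = 2 * 4^2.\<close>

lemma mode_gain:
  assumes r: "R0 < r * exp (- (1/4))" and n: "2 * k * r < \<bar>of_int n\<bar>"
  shows "(norm (w n r))\<^sup>2 * (1 + (of_int n)\<^sup>2 / 32)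
    \<le> (norm (w n (r * exp (1/4))))\<^sup>2 + (norm (w n (r * exp (- (1/4)))))\<^sup>2"
proof -
  have r0: "0 < r" using r R0 by (smt (verit) mult_nonpos_nonneg exp_ge_zero)
  define e where "e t = r * exp t" for t
  have e: "(e has_real_derivative e t) (at t)" for t unfolding e_def by (auto intro!: derivative_eq_intros)
  have e0: "R0 < e t" if "\<bar>t - 0\<bar> \<le> 1/4" for t
  proof -
    have "r * exp (- (1/4)) \<le> r * exp t" using that r0 by (intro mult_left_mono) auto
    then show ?thesis using r by (simp add: e_def)
  qed
  define \<omega> where "\<omega> t = w n (e t)" for t
  define \<omega>1 where "\<omega>1 t = of_real (e t) * w1 n (e t)" for t
  define q where "q t = (of_int n)\<^sup>2 - k\<^sup>2 * (e t)\<^sup>2" for t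
  have ev: "(e has_vector_derivative e t) (at t)" for t
    using e by (simp add: has_real_derivative_iff_has_vector_derivative)
  have d1: "(\<omega> has_vector_derivative \<omega>1 t) (at t)" if "\<bar>t - 0\<bar> \<le> 1/4" for t
    using vector_diff_chain_at[OF ev w_deriv[OF e0[OF that]]]
    by (simp add: \<omega>_def[abs_def] \<omega>1_def o_def scaleR_conv_of_real)
  have d2: "(\<omega>1 has_vector_derivative of_real (q t) * \<omega> t) (at t)" if t: "\<bar>t - 0\<bar> \<le> 1/4" for t
  proof -
    have a: "((\<lambda>t. w1 n (e t)) has_vector_derivative of_real (e t) * w2 n (e t)) (at t)"
      using vector_diff_chain_at[OF ev w1_deriv[OF e0[OF t]]] by (simp add: o_def scaleR_conv_of_real)
    have b: "((\<lambda>t. complex_of_real (e t)) has_vector_derivative of_real (e t)) (at t)"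
      using bounded_linear.has_vector_derivative[OF bounded_linear_of_real ev] .
    have nz: "e t \<noteq> 0" using e0[OF t] R0 by simp
    have "of_real (e t) * (of_real (e t) * w2 n (e t)) + of_real (e t) * w1 n (e t) = of_real (q t) * \<omega> t"
      using nz by (simp add: w2_def q_def \<omega>_def field_simps power2_eq_square)
    with has_vector_derivative_mult[OF b a] show ?thesis by (simp add: \<omega>1_def[abs_def])
  qed
  define p where "p t = (norm (\<omega> t))\<^sup>2" for t
  define p1 where "p1 t = 2 * Re (\<omega>1 t * cnj (\<omega> t))" for t
  define p2 where "p2 t = 2 * Re (\<omega>1 t * cnj (\<omega>1 t) + of_real (q t) * \<omega> t * cnj (\<omega> t))" for t
  have "p 0 * (1 + (of_int n)\<^sup>2 * (1/4)\<^sup>2 / 2) \<le> p (0 + 1/4) + p (0 - 1/4)"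
  proof (rule convexity_gain)
    fix t :: real assume t: "\<bar>t - 0\<bar> \<le> 1/4"
    show "(p has_real_derivative p1 t) (at t)"
      unfolding p_def[abs_def] p1_def by (rule norm_sq_has_real_derivative[OF d1[OF t]])
    have "((\<lambda>r. cnj (\<omega> r)) has_vector_derivative cnj (\<omega>1 t)) (at t)"
      using bounded_linear.has_vector_derivative[OF bounded_linear_cnj d1[OF t]] .
    from bounded_linear.has_vector_derivative[OF bounded_linear_Re has_vector_derivative_mult[OF d2[OF t] this]]
    have "((\<lambda>t. Re (\<omega>1 t * cnj (\<omega> t))) has_real_derivative
        Re (\<omega>1 t * cnj (\<omega>1 t) + of_real (q t) * \<omega> t * cnj (\<omega> t))) (at t)"
      by (simp only: has_real_derivative_iff_has_vector_derivative)
    from DERIV_cmult[OF this, of 2] show "(p1 has_real_derivative p2 t) (at t)"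
      by (simp only: p1_def[abs_def] p2_def)
    show "(of_int n)\<^sup>2 * p t \<le> p2 t"
    proof -
      have "exp (2 * t) \<le> exp (1/2)" using t by simp
      also have "exp (1/2::real) \<le> 2"
        using exp_bound_half[of "1/2::real"] by simp
      finally have "exp (2 * t) \<le> 2" .
      have "k\<^sup>2 * (e t)\<^sup>2 = (k * r)\<^sup>2 * exp (2 * t)"
        by (simp add: e_def power_mult_distrib exp_double)
      also have "\<dots> \<le> (k * r)\<^sup>2 * 2" using \<open>exp (2 * t) \<le> 2\<close> by (intro mult_left_mono) auto
      also have "\<dots> \<le> (of_int n)\<^sup>2 / 2"
      proof -
        have "(2 * k * r)\<^sup>2 \<le> \<bar>of_int n\<bar>\<^sup>2" using n k r0 by (intro power_mono) auto
        then show ?thesis by (simp add: power_mult_distrib)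
      qed
      finally have q: "(of_int n)\<^sup>2 \<le> 2 * q t" by (simp add: q_def)
      have "p2 t = 2 * (norm (\<omega>1 t))\<^sup>2 + 2 * q t * p t"
        unfolding p2_def p_def cmod_power2 by (simp add: power2_eq_square algebra_simps)
      moreover have "(of_int n)\<^sup>2 * p t \<le> 2 * q t * p t"
        using q by (intro mult_right_mono) (auto simp: p_def)
      moreover have "0 \<le> (norm (\<omega>1 t))\<^sup>2" by simp
      ultimately show ?thesis by linarith
    qed
  qed (auto simp: p_def)
  then show ?thesis by (simp add: p_def \<omega>_def e_def power2_eq_square)
qed

text \<open>Cauchy-Schwarz in two regimes. There are at most (4k + 1) r modes with |n| \<le> 2 k r,
  and this count cancels the decay C/r of the square sum. For the others \<open>mode_gain\<close>
  trades the square at r for squares at two nearby radii times a summable weight in n.\<close>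

lemma w_abs_sum_bound: "\<exists>C X. R \<le> X \<and> (\<forall>r\<ge>X. \<forall>A. finite A \<longrightarrow> (\<Sum>n\<in>A. norm (w n r)) \<le> C)"
proof -
  obtain C where C: "0 \<le> C" "\<And>r A. R \<le> r \<Longrightarrow> finite A \<Longrightarrow> (\<Sum>n\<in>A. (norm (w n r))\<^sup>2) \<le> C / r"
    using w_sq_sum_bound by blast
  obtain Z where Z: "0 \<le> Z" "\<And>A. finite (A :: int set) \<Longrightarrow> (\<Sum>n\<in>A. 1 / (1 + (of_int n)\<^sup>2 / 32)) \<le> (Z::real)"
    using sum_inverse_squares_int by blast
  \<comment> \<open>Keeps the smaller of the two comparison radii, r exp(-1/4), at or above R, where
    the square sums are controlled.\<close>
  define X where "X = R * exp (1/4)"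
  have X: "R \<le> X" using R0 by (simp add: X_def)
  have "(\<Sum>n\<in>A. norm (w n r)) \<le> sqrt (C * (4 * k + 1)) + sqrt (2 * C * Z)" if r: "X \<le> r" and A: "finite A" for r A
  proof -
    have rR: "R \<le> r" "1 \<le> r" "R \<le> r * exp (- (1/4))" "R \<le> r * exp (1/4)"
    proof -
      show "R \<le> r" "1 \<le> r" using r X R0 by auto
      show "R \<le> r * exp (- (1/4))" using r by (simp add: X_def exp_minus field_simps)
      have "r * 1 \<le> r * exp (1/4)" using \<open>1 \<le> r\<close> by (intro mult_left_mono) auto
      then show "R \<le> r * exp (1/4)" using \<open>R \<le> r\<close> by simp
    qed
    define L where "L = {n::int. \<bar>of_int n\<bar> \<le> 2 * k * r}"
    have low: "(\<Sum>n\<in>A \<inter> L. norm (w n r)) \<le> sqrt (C / r * ((4 * k + 1) * r))"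
    proof (rule sum_abs_le_sqrt)
      show "(\<Sum>n\<in>A \<inter> L. (norm (w n r))\<^sup>2) \<le> C / r" using C(2)[OF rR(1)] A by simp
      have "card (A \<inter> L) \<le> card {- \<lfloor>2 * k * r\<rfloor>..\<lfloor>2 * k * r\<rfloor>}"
        by (rule card_mono) (auto simp: L_def abs_le_iff le_floor_iff, linarith)
      then have "real (card (A \<inter> L)) \<le> real (nat (2 * \<lfloor>2 * k * r\<rfloor> + 1))" by simp
      also have "\<dots> = 2 * of_int \<lfloor>2 * k * r\<rfloor> + 1" using k rR by simp
      also have "\<dots> \<le> 2 * (2 * k * r) + 1" using of_int_floor_le[of "2 * k * r"] by linarith
      finally have "real (card (A \<inter> L)) \<le> 2 * (2 * k * r) + 1" .
      moreover have "\<dots> \<le> (4 * k + 1) * r" using rR by (simp add: algebra_simps)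
      ultimately show "(\<Sum>n\<in>A \<inter> L. 1\<^sup>2) \<le> (4 * k + 1) * r" by simp
    qed (use A in auto)
    define b where "b n = sqrt ((norm (w n (r * exp (1/4))))\<^sup>2 + (norm (w n (r * exp (- (1/4)))))\<^sup>2)" for n
    define g :: "int \<Rightarrow> real" where "g n = sqrt (1 / (1 + (of_int n)\<^sup>2 / 32))" for n
    have high: "(\<Sum>n\<in>A - L. norm (w n r)) \<le> sqrt (2 * C * Z)"
    proof (rule sum_abs_le_sqrt)
      show "norm (w n r) \<le> b n * g n" if "n \<in> A - L" for n
      proof -
        have pos: "0 < 1 + (real_of_int n)\<^sup>2 / 32" by (simp add: add_pos_nonneg)
        have "(norm (w n r))\<^sup>2 * (1 + (of_int n)\<^sup>2 / 32)
          \<le> (norm (w n (r * exp (1/4))))\<^sup>2 + (norm (w n (r * exp (- (1/4)))))\<^sup>2"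
          by (rule mode_gain) (use that rR R0 in \<open>auto simp: L_def\<close>)
        then have "(norm (w n r))\<^sup>2 \<le> ((norm (w n (r * exp (1/4))))\<^sup>2 + (norm (w n (r * exp (- (1/4)))))\<^sup>2) * (1 / (1 + (of_int n)\<^sup>2 / 32))"
          using pos by (simp add: pos_le_divide_eq)
        then show ?thesis
          unfolding b_def g_def real_sqrt_mult[symmetric] by (rule real_le_rsqrt)
      qed
      have "(\<Sum>n\<in>A - L. (b n)\<^sup>2) = (\<Sum>n\<in>A - L. (norm (w n (r * exp (1/4))))\<^sup>2) + (\<Sum>n\<in>A - L. (norm (w n (r * exp (- (1/4)))))\<^sup>2)"
        by (simp add: b_def sum.distrib)
      also have "\<dots> \<le> C / (r * exp (1/4)) + C / (r * exp (- (1/4)))"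
        using A rR by (intro add_mono C(2)) auto
      also have "\<dots> \<le> C / 1 + C / 1"
        using rR R0 C by (intro add_mono divide_left_mono) auto
      finally show "(\<Sum>n\<in>A - L. (b n)\<^sup>2) \<le> 2 * C" by simp
      show "(\<Sum>n\<in>A - L. (g n)\<^sup>2) \<le> Z"
        using Z(2)[of "A - L"] A by (simp add: g_def add_nonneg_nonneg)
    qed (use A in auto)
    have "(\<Sum>n\<in>A. norm (w n r)) = (\<Sum>n\<in>A \<inter> L. norm (w n r)) + (\<Sum>n\<in>A - L. norm (w n r))"
      using A by (rule sum.Int_Diff)
    also have "C / r * ((4 * k + 1) * r) = C * (4 * k + 1)" using rR by simp
    with low high have "(\<Sum>n\<in>A \<inter> L. norm (w n r)) + (\<Sum>n\<in>A - L. norm (w n r)) \<le> sqrt (C * (4 * k + 1)) + sqrt (2 * C * Z)"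
      by simp
    finally show ?thesis .
  qed
  then show ?thesis using X by blast
qed

section \<open>Continuation of the modes to complex radii\<close>

text \<open>The factor sqrt r brings Bessel's equation into Liouville normal form: the first-order
  term disappears at the price of the shift -1/4.\<close>

lemma sqrt_mode_deriv:
  assumes "R0 < r"
  shows "((\<lambda>r. of_real (sqrt r) * w n r) has_vector_derivative
      of_real (sqrt r) * w1 n r + of_real (1 / (2 * sqrt r)) * w n r) (at r)"
    and "((\<lambda>r. of_real (sqrt r) * w1 n r + of_real (1 / (2 * sqrt r)) * w n r) has_vector_derivative
      (of_real (((of_int n)\<^sup>2 - 1/4) / r\<^sup>2 - k\<^sup>2)) * (of_real (sqrt r) * w n r)) (at r)"
proof -
  have r: "0 < r" using assms R0 by simp
  have of: "((\<lambda>r. complex_of_real (f r)) has_vector_derivative of_real f') (at r)"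
    if "(f has_real_derivative f') (at r)" for f f'
    using bounded_linear.has_vector_derivative[OF bounded_linear_of_real that[unfolded has_real_derivative_iff_has_vector_derivative]] .
  have s1: "((\<lambda>r. complex_of_real (sqrt r)) has_vector_derivative of_real (1 / (2 * sqrt r))) (at r)"
    by (rule of) (use r in \<open>auto intro!: derivative_eq_intros simp: field_simps\<close>)
  have s2: "((\<lambda>r. complex_of_real (1 / (2 * sqrt r))) has_vector_derivative of_real (- (1 / (4 * r * sqrt r)))) (at r)"
    by (rule of) (use r in \<open>auto intro!: derivative_eq_intros simp: field_simps real_sqrt_mult[symmetric] power2_eq_square\<close>)
  show "((\<lambda>r. of_real (sqrt r) * w n r) has_vector_derivative
      of_real (sqrt r) * w1 n r + of_real (1 / (2 * sqrt r)) * w n r) (at r)"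
    by (rule has_vector_derivative_mult[OF s1 w_deriv[OF assms]])
  \<comment> \<open>With r written as a square, the identity to be checked becomes rational in sqrt
    r.\<close>
  have sq: "complex_of_real r = of_real (sqrt r) * of_real (sqrt r)"
    using r by (simp flip: of_real_mult)
  have sn: "complex_of_real (sqrt r) \<noteq> 0" using r by simp
  have "of_real (sqrt r) * w2 n r + of_real (1 / (2 * sqrt r)) * w1 n r
      + (of_real (1 / (2 * sqrt r)) * w1 n r + of_real (- (1 / (4 * r * sqrt r))) * w n r)
    = (of_real (((of_int n)\<^sup>2 - 1/4) / r\<^sup>2 - k\<^sup>2)) * (of_real (sqrt r) * w n r)"
    using sn unfolding w2_def of_real_divide of_real_mult of_real_minus of_real_diff of_real_power of_real_of_int_eq
      of_real_1 of_real_numeral sq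
    by (simp add: field_simps power2_eq_square)
  with has_vector_derivative_add[OF has_vector_derivative_mult[OF s1 w1_deriv[OF assms, of n]]
      has_vector_derivative_mult[OF s2 w_deriv[OF assms, of n]]]
  show "((\<lambda>r. of_real (sqrt r) * w1 n r + of_real (1 / (2 * sqrt r)) * w n r) has_vector_derivative
      (of_real (((of_int n)\<^sup>2 - 1/4) / r\<^sup>2 - k\<^sup>2)) * (of_real (sqrt r) * w n r)) (at r)"
    by (simp only:)
qed

text \<open>The initial value problem at R is solved in the half plane Re z > 0, which is convex and
  avoids the singularity at 0. On the real axis the solution agrees with the mode by
  uniqueness.\<close>

lemma mode_extension:
  obtains y y1 where
    "\<And>z. 0 < Re z \<Longrightarrow> (y has_field_derivative y1 z) (at z)"
    "\<And>z. 0 < Re z \<Longrightarrow> (y1 has_field_derivative (of_real ((of_int n)\<^sup>2 - 1/4) / z\<^sup>2 - of_real (k\<^sup>2)) * y z) (at z)"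
    "\<And>r. R0 < r \<Longrightarrow> y (of_real r) = of_real (sqrt r) * w n r"
    "\<And>r. R0 < r \<Longrightarrow> y1 (of_real r) = of_real (sqrt r) * w1 n r + of_real (1 / (2 * sqrt r)) * w n r"
proof -
  define S where "S = {z. 0 < Re z}"
  define q where "q z = of_real ((of_int n)\<^sup>2 - 1/4) / z\<^sup>2 - complex_of_real (k\<^sup>2)" for z
  have S: "open S" "convex S" unfolding S_def by (simp_all add: open_halfspace_Re_gt convex_halfspace_Re_gt)
  have q: "q holomorphic_on S" unfolding q_def S_def by (intro holomorphic_intros) auto
  have RS: "of_real R \<in> S" using R0 by (simp add: S_def)
  obtain y y1 where y: "\<And>z. z \<in> S \<Longrightarrow> (y has_field_derivative y1 z) (at z)"
    "\<And>z. z \<in> S \<Longrightarrow> (y1 has_field_derivative q z * y z) (at z)"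
    "y (of_real R) = of_real (sqrt R) * w n R"
    "y1 (of_real R) = of_real (sqrt R) * w1 n R + of_real (1 / (2 * sqrt R)) * w n R"
    using complex_second_order_ivp[OF S RS q] by metis
  define d where "d r = y (of_real r) - of_real (sqrt r) * w n r" for r
  define d1 where "d1 r = y1 (of_real r) - (of_real (sqrt r) * w1 n r + of_real (1 / (2 * sqrt r)) * w n r)" for r
  have "d r = 0 \<and> d1 r = 0" if r: "R0 < r" for r
  proof (rule second_order_ode_unique[of R0 d d1 "\<lambda>x. q (of_real x)" R r])
    fix x assume x: "R0 < x"
    then have xS: "of_real x \<in> S" using R0 by (simp add: S_def)
    show "(d has_vector_derivative d1 x) (at x)"
      unfolding d_def[abs_def] d1_def
      by (intro has_vector_derivative_diff sqrt_mode_deriv(1)[OF x] has_vector_derivative_real_field[OF y(1)[OF xS]])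
    have "(d1 has_vector_derivative q (of_real x) * y (of_real x)
        - (of_real (((of_int n)\<^sup>2 - 1/4) / x\<^sup>2 - k\<^sup>2)) * (of_real (sqrt x) * w n x)) (at x)"
      unfolding d1_def[abs_def]
      by (intro has_vector_derivative_diff sqrt_mode_deriv(2)[OF x] has_vector_derivative_real_field[OF y(2)[OF xS]])
    moreover have "q (of_real x) = of_real (((of_int n)\<^sup>2 - 1/4) / x\<^sup>2 - k\<^sup>2)" by (simp add: q_def)
    ultimately show "(d1 has_vector_derivative q (of_real x) * d x) (at x)"
      by (simp only: d_def right_diff_distrib)
  next
    show "continuous_on {R0<..} (\<lambda>x. q (of_real x))"
      unfolding q_def using R0 by (intro continuous_intros) auto
  qed (use r R0 y in \<open>auto simp: d_def d1_def\<close>)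
  then show thesis using y(1,2) by (intro that[of y y1]) (auto simp: d_def d1_def S_def q_def)
qed

text \<open>The factor n^2 comes from two integrations by parts in the angle. While
  \<open>w_abs_sum_bound\<close> works radius by radius, this majorant is uniform on an interval of
  radii, as locally uniform convergence of the series demands.\<close>

lemma w_decay:
  assumes "R0 < a"
  obtains B where "0 \<le> B" "\<And>n r. a \<le> r \<Longrightarrow> r \<le> b \<Longrightarrow> (of_int n)\<^sup>2 * norm (w n r) \<le> B"
proof -
  have "bounded ((\<lambda>(r, \<theta>). Vtt r \<theta>) ` ({a..b} \<times> {0..2*pi}))"
    using assms by (intro compact_imp_bounded compact_continuous_image continuous_on_subset[OF cont(4)] compact_Times) auto
  then obtain B where B: "\<And>r \<theta>. a \<le> r \<Longrightarrow> r \<le> b \<Longrightarrow> \<theta> \<in> {0..2*pi} \<Longrightarrow> norm (Vtt r \<theta>) \<le> B"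
    unfolding bounded_iff by fastforce
  have "(of_int n)\<^sup>2 * norm (w n r) \<le> max B 0" if "a \<le> r" "r \<le> b" for n r
  proof -
    have r: "R0 < r" using that assms by simp
    have "norm (fc (Vtt r) n) \<le> B" by (rule fc_norm_le[OF Vtt_cont[OF r] B[OF that]])
    then show ?thesis unfolding fc_Vtt[OF r] by (simp add: norm_mult norm_power)
  qed
  then show thesis by (intro that[of "max B 0"]) auto
qed

text \<open>For n \<noteq> 0 a continued mode is dominated by its value on the real axis straight
  below. The series thus converges in the closed quadrant wherever the majorants on the real axis
  are summable, and the bound on the sum of the moduli carries over. The mode 0 adds a constant of
  its own.\<close>

lemma continuation_bounded:
  obtains X C Vc where "R0 < X"
    "\<And>\<theta>. (\<lambda>z. Vc z \<theta>) holomorphic_on {z. X < Re z \<and> 0 < Im z}"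
    "\<And>\<theta>. continuous_on {z. X < Re z \<and> 0 \<le> Im z} (\<lambda>z. Vc z \<theta>)"
    "\<And>r \<theta>. X < r \<Longrightarrow> Vc (of_real r) \<theta> = V r \<theta>"
    "\<And>z \<theta>. X < Re z \<Longrightarrow> 0 \<le> Im z \<Longrightarrow> norm (Vc z \<theta>) \<le> C"
proof -
  obtain K where K: "0 \<le> K" "\<And>r A. R \<le> r \<Longrightarrow> finite A \<Longrightarrow> (\<Sum>n\<in>A. (norm (w n r))\<^sup>2) \<le> K / r"
    using w_sq_sum_bound by blast
  obtain C1 X1 where X1: "R \<le> X1" "\<And>r A. X1 \<le> r \<Longrightarrow> finite A \<Longrightarrow> (\<Sum>n\<in>A. norm (w n r)) \<le> C1"
    using w_abs_sum_bound by blast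
  have "\<exists>y y1. (\<forall>z. 0 < Re z \<longrightarrow> (y has_field_derivative y1 z) (at z)) \<and>
      outgoing y y1 ((of_int n)\<^sup>2 - 1/4) k R (sqrt K) \<and> (\<forall>r>R0. y (of_real r) = of_real (sqrt r) * w n r)" for n
  proof -
    obtain y y1 where y: "\<And>z. 0 < Re z \<Longrightarrow> (y has_field_derivative y1 z) (at z)"
      "\<And>z. 0 < Re z \<Longrightarrow> (y1 has_field_derivative (of_real ((of_int n)\<^sup>2 - 1/4) / z\<^sup>2 - of_real (k\<^sup>2)) * y z) (at z)"
      "\<And>r. R0 < r \<Longrightarrow> y (of_real r) = of_real (sqrt r) * w n r"
      "\<And>r. R0 < r \<Longrightarrow> y1 (of_real r) = of_real (sqrt r) * w1 n r + of_real (1 / (2 * sqrt r)) * w n r"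
      using mode_extension[of n] by blast
    have wn: "sqrt r * norm (w n r) \<le> sqrt K" if "R \<le> r" for r
    proof -
      have "(norm (w n r))\<^sup>2 \<le> K / r" using K(2)[OF that, of "{n}"] by simp
      then have "r * (norm (w n r))\<^sup>2 \<le> K" using that R0 by (simp add: field_simps)
      then show ?thesis using real_sqrt_le_mono by (fastforce simp: real_sqrt_mult)
    qed
    have "outgoing y y1 ((of_int n)\<^sup>2 - 1/4) k R (sqrt K)"
    proof
      fix x assume x: "R \<le> x"
      then show "norm (y (of_real x)) \<le> sqrt K" using y(3)[of x] wn[OF x] R0 by (simp add: norm_mult)
    next
      \<comment> \<open>The factor sqrt r costs half a power in the radiation bound c/r, and its
        derivative adds the second term; both still vanish at infinity.\<close>
      have "((\<lambda>r. c / sqrt r + sqrt K / (2 * r)) \<longlongrightarrow> 0) at_top" by real_asymp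
      moreover have "\<forall>\<^sub>F r in at_top. norm (y1 (of_real r) - \<i> * of_real k * y (of_real r)) \<le> c / sqrt r + sqrt K / (2 * r)"
        using eventually_ge_at_top[of R]
      proof (rule eventually_mono)
        fix r assume r: "R \<le> r"
        then have r': "R0 < r" "0 < r" using R0 by auto
        have "y1 (of_real r) - \<i> * of_real k * y (of_real r)
            = of_real (sqrt r) * (w1 n r - \<i> * of_real k * w n r) + of_real (1 / (2 * sqrt r)) * w n r"
          by (simp add: y r' algebra_simps)
        also have "norm \<dots> \<le> sqrt r * norm (w1 n r - \<i> * of_real k * w n r) + 1 / (2 * sqrt r) * norm (w n r)"
          using r' by (intro order_trans[OF norm_triangle_ineq]) (simp add: norm_mult norm_divide)
        also have "\<dots> \<le> sqrt r * (c / r) + 1 / (2 * sqrt r) * (sqrt K / sqrt r)"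
        proof (intro add_mono mult_left_mono)
          have "w1 n r - \<i> * of_real k * w n r = fc (\<lambda>t. Vr r t - \<i> * of_real k * V r t) n"
            unfolding w1_def w_def
            by (subst fc_diff) (auto intro!: continuous_intros Vr_cont V_cont r' simp: fc_cmult)
          also have "norm \<dots> \<le> c / r"
            by (rule fc_norm_le) (auto intro!: continuous_intros Vr_cont V_cont r' rad r)
          finally show "norm (w1 n r - \<i> * of_real k * w n r) \<le> c / r" .
          show "norm (w n r) \<le> sqrt K / sqrt r" using wn[OF r] r' by (simp add: field_simps)
        qed (use r' in auto)
        also have "\<dots> = c / sqrt r + sqrt K / (2 * r)"
        proof -
          define s where "s = sqrt r"
          have s: "r = s * s" "0 < s" using r' by (auto simp: s_def)
          have "s * (c / (s * s)) + 1 / (2 * s) * (sqrt K / s) = c / s + sqrt K / (2 * (s * s))"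
            using s(2) by (simp add: field_simps)
          then show ?thesis unfolding s(1)[symmetric] by (simp only: s_def)
        qed
        finally show "norm (y1 (of_real r) - \<i> * of_real k * y (of_real r)) \<le> c / sqrt r + sqrt K / (2 * r)" .
      qed
      ultimately show "((\<lambda>x. y1 (of_real x) - \<i> * of_real k * y (of_real x)) \<longlongrightarrow> 0) at_top"
        by (rule Lim_null_comparison[rotated])
    qed (use k R0 K y in auto)
    then show ?thesis using y by blast
  qed
  then obtain y y1 where y: "\<And>n z. 0 < Re z \<Longrightarrow> (y n has_field_derivative y1 n z) (at z)"
    "\<And>n. outgoing (y n) (y1 n) ((of_int n)\<^sup>2 - 1/4) k R (sqrt K)"
    "\<And>n r. R0 < r \<Longrightarrow> y n (of_real r) = of_real (sqrt r) * w n r"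
    by metis
  obtain C0 X0 where X0: "R \<le> X0" "\<And>z. X0 \<le> Re z \<Longrightarrow> 0 \<le> Im z \<Longrightarrow> norm (y 0 z) \<le> C0"
    using outgoing.bounded_right_quadrant[OF y(2)[of 0]] by blast
  \<comment> \<open>A nonzero integer has n^2 \<ge> 1, so \<mu> = n^2 - 1/4 is positive and the
    decay along vertical lines applies.\<close>
  have yn: "norm (y n z) \<le> sqrt (Re z) * norm (w n (Re z))" if "n \<noteq> 0" "R \<le> Re z" "0 \<le> Im z" for n z
  proof -
    have "(1::real) \<le> (of_int n)\<^sup>2"
    proof -
      have "1 \<le> n\<^sup>2" using that(1) by (simp add: int_one_le_iff_zero_less)
      then have "real_of_int 1 \<le> real_of_int (n\<^sup>2)" by (simp only: of_int_le_iff)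
      then show ?thesis by simp
    qed
    then have "norm (y n (Complex (Re z) (Im z))) \<le> norm (y n (of_real (Re z)))"
      using outgoing.norm_le_real_axis[OF y(2)[of n], of "Im z" "Re z"] that by simp
    then show ?thesis using y(3)[of "Re z" n] that R0 by (simp add: norm_mult)
  qed
  define X where "X = max X0 X1"
  have X: "R \<le> X" "X0 \<le> X" "X1 \<le> X" "0 < X" "1 \<le> X" using X0 X1 R0 by (auto simp: X_def)
  \<comment> \<open>The modes m and -m are grouped, so that the partial sums of a series over the
    natural numbers are the symmetric Fourier sums.\<close>
  define T where "T m \<theta> z = (if m = 0 then y 0 z else
      y (int m) z * cis (of_int (int m) * \<theta>) + y (- int m) z * cis (of_int (- int m) * \<theta>))" for m :: nat and \<theta> :: real and z :: complex
  define Sm where "Sm \<theta> z = (\<Sum>m. T m \<theta> z)" for \<theta> z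
  define Vc where "Vc z \<theta> = Sm \<theta> z / csqrt z" for z \<theta>
  have T_hol: "T m \<theta> holomorphic_on {z. 0 < Re z}" for m \<theta>
  proof -
    have "y n holomorphic_on {z. 0 < Re z}" for n
      using y(1) by (auto simp: holomorphic_on_open open_halfspace_Re_gt)
    then show ?thesis unfolding T_def by (cases "m = 0") (auto intro!: holomorphic_intros)
  qed
  have unif: "uniform_limit {z. a \<le> Re z \<and> Re z \<le> b \<and> 0 \<le> Im z} (\<lambda>N z. \<Sum>m<N. T m \<theta> z) (Sm \<theta>) sequentially"
    if "X \<le> a" for a b \<theta>
  proof -
    obtain B where B: "0 \<le> B" "\<And>n r. a \<le> r \<Longrightarrow> r \<le> b \<Longrightarrow> (of_int n)\<^sup>2 * norm (w n r) \<le> B"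
      by (rule w_decay[of a b]) (use \<open>X \<le> a\<close> X R0 in auto)
    show ?thesis unfolding Sm_def
    proof (rule Weierstrass_m_test_ev)
      show "summable (\<lambda>m. 2 * (sqrt b * B) * inverse ((real m)\<^sup>2))"
        using inverse_power_summable[of 2] by (intro summable_mult) auto
      show "\<forall>\<^sub>F m in sequentially. \<forall>z\<in>{z. a \<le> Re z \<and> Re z \<le> b \<and> 0 \<le> Im z}. norm (T m \<theta> z) \<le> 2 * (sqrt b * B) * inverse ((real m)\<^sup>2)"
        using eventually_gt_at_top[of 0]
      proof (eventually_elim, safe)
        fix m :: nat and z assume m: "0 < m" and z: "a \<le> Re z" "Re z \<le> b" "0 \<le> Im z"
        have each: "norm (y n z) \<le> sqrt b * B * inverse ((real m)\<^sup>2)" if "n = int m \<or> n = - int m" for n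
        proof -
          have "norm (y n z) \<le> sqrt (Re z) * norm (w n (Re z))"
            using yn[of n z] that m z X \<open>X \<le> a\<close> by auto
          also have "norm (w n (Re z)) \<le> B * inverse ((real m)\<^sup>2)"
          proof -
            have "(of_int n)\<^sup>2 = (real m)\<^sup>2" using that by auto
            then show ?thesis using B(2)[of "Re z" n] z m by (simp add: field_simps)
          qed
          also have "sqrt (Re z) * (B * inverse ((real m)\<^sup>2)) \<le> sqrt b * (B * inverse ((real m)\<^sup>2))"
            using z B by (intro mult_right_mono) auto
          finally show ?thesis using z X \<open>X \<le> a\<close> by (simp add: mult.assoc mult_left_mono)
        qed
        have "norm (T m \<theta> z) \<le> norm (y (int m) z) + norm (y (- int m) z)"
          using m by (auto simp: T_def norm_mult intro!: order_trans[OF norm_triangle_ineq])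
        then show "norm (T m \<theta> z) \<le> 2 * (sqrt b * B) * inverse ((real m)\<^sup>2)"
          using each[of "int m"] each[of "- int m"] by simp
      qed
    qed
  qed
  have psum: "(\<Sum>m<Suc N. T m \<theta> z) = (\<Sum>n=-int N..int N. y n z * cis (of_int n * \<theta>))" for N \<theta> z
  proof (induction N)
    case (Suc N)
    have "{-int (Suc N)..int (Suc N)} = insert (- int (Suc N)) (insert (int (Suc N)) {-int N..int N})" by auto
    then show ?case using Suc by (simp add: T_def algebra_simps)
  qed (simp add: T_def)
  have lim: "(\<lambda>N. \<Sum>n=-int N..int N. y n z * cis (of_int n * \<theta>)) \<longlonglongrightarrow> Sm \<theta> z" if "X \<le> Re z" "0 \<le> Im z" for z \<theta>
  proof -
    define Q where "Q = {x. Re z \<le> Re x \<and> Re x \<le> Re z \<and> 0 \<le> Im x}"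
    have zQ: "z \<in> Q" using that by (simp add: Q_def)
    have u: "uniform_limit Q (\<lambda>N z. \<Sum>m<N. T m \<theta> z) (Sm \<theta>) sequentially"
      unfolding Q_def by (rule unif[OF that(1)])
    have "(\<lambda>N. \<Sum>m<Suc N. T m \<theta> z) \<longlonglongrightarrow> Sm \<theta> z"
      using LIMSEQ_Suc[OF tendsto_uniform_limitI[OF u zQ]] .
    then show ?thesis unfolding psum .
  qed
  show thesis
  proof (rule that[of X Vc "max 0 C0 + C1"])
    show "R0 < X" using X R0 by simp
    fix \<theta>
    define H where "H = {z. X < Re z \<and> 0 < Im z}"
    have oH: "open H" unfolding H_def Collect_conj_eq
      by (intro open_Int open_halfspace_Re_gt open_halfspace_Im_gt)
    have "Sm \<theta> holomorphic_on H"
    proof (rule holomorphic_uniform_sequence[OF oH])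
      show "(\<lambda>z. \<Sum>m<N. T m \<theta> z) holomorphic_on H" for N
        using X by (intro holomorphic_intros holomorphic_on_subset[OF T_hol]) (auto simp: H_def)
      fix z assume "z \<in> H"
      then obtain d where d: "0 < d" "cball z d \<subseteq> H" using oH unfolding open_contains_cball by meson
      have "cball z d \<subseteq> {x. X \<le> Re x \<and> Re x \<le> Re z + d \<and> 0 \<le> Im x}"
      proof
        fix x assume x: "x \<in> cball z d"
        then have "\<bar>Re x - Re z\<bar> \<le> d"
          using abs_Re_le_cmod[of "x - z"] by (simp add: dist_norm norm_minus_commute)
        then show "x \<in> {x. X \<le> Re x \<and> Re x \<le> Re z + d \<and> 0 \<le> Im x}" using x d by (auto simp: H_def)
      qed
      from uniform_limit_on_subset[OF unif[OF order_refl] this]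
      show "\<exists>d>0. cball z d \<subseteq> H \<and> uniform_limit (cball z d) (\<lambda>N z. \<Sum>m<N. T m \<theta> z) (Sm \<theta>) sequentially"
        using d by blast
    qed
    then show "(\<lambda>z. Vc z \<theta>) holomorphic_on {z. X < Re z \<and> 0 < Im z}"
      unfolding Vc_def H_def[symmetric]
      by (intro holomorphic_intros) (auto simp: H_def complex_nonpos_Reals_iff)
    show "continuous_on {z. X < Re z \<and> 0 \<le> Im z} (\<lambda>z. Vc z \<theta>)"
      unfolding Vc_def
    proof (intro continuous_on_divide)
      show "continuous_on {z. X < Re z \<and> 0 \<le> Im z} csqrt"
        using X by (intro holomorphic_on_imp_continuous_on holomorphic_on_subset[OF holomorphic_on_csqrt])
          (auto simp: complex_nonpos_Reals_iff)
      show "continuous_on {z. X < Re z \<and> 0 \<le> Im z} (Sm \<theta>)"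
      proof (subst continuous_on_eq_continuous_within, safe)
        fix z assume z: "X < Re z" "0 \<le> Im z"
        define Q where "Q = {x. X \<le> Re x \<and> Re x \<le> Re z + 1 \<and> 0 \<le> Im x}"
        have u: "uniform_limit Q (\<lambda>N z. \<Sum>m<N. T m \<theta> z) (Sm \<theta>) sequentially"
          unfolding Q_def by (rule unif[OF order_refl])
        have c: "\<forall>\<^sub>F N in sequentially. continuous_on Q (\<lambda>z. \<Sum>m<N. T m \<theta> z)"
          using X by (intro always_eventually allI continuous_on_sum holomorphic_on_imp_continuous_on holomorphic_on_subset[OF T_hol])
            (auto simp: Q_def)
        have "continuous_on Q (Sm \<theta>)"
          using uniform_limit_theorem[OF c u] by simp
        then have "continuous (at z within Q) (Sm \<theta>)"
          using z by (auto simp: continuous_on_eq_continuous_within Q_def)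
        moreover have "at z within {z. X < Re z \<and> 0 \<le> Im z} = at z within Q"
        proof (rule at_within_nhd[where S = "{x. X < Re x} \<inter> {x. Re x < Re z + 1}"])
          show "open ({x. X < Re x} \<inter> {x. Re x < Re z + 1})"
            by (intro open_Int open_halfspace_Re_gt open_halfspace_Re_lt)
        qed (use z in \<open>auto simp: Q_def\<close>)
        ultimately show "continuous (at z within {z. X < Re z \<and> 0 \<le> Im z}) (Sm \<theta>)" by simp
      qed
    qed (use X in auto)
    show "Vc (of_real r) \<theta> = V r \<theta>" if r: "X < r" for r
    proof -
      have r': "R0 < r" "0 \<le> r" "r \<noteq> 0" using r X R0 by auto
      have "(\<lambda>N. of_real (sqrt r) * (\<Sum>n=-int N..int N. w n r * cis (of_int n * \<theta>))) \<longlonglongrightarrow> Sm \<theta> (of_real r)"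
        using lim[of "of_real r" \<theta>] r by (simp add: y(3)[OF r'(1)] sum_distrib_left mult.assoc)
      moreover have "(\<lambda>N. of_real (sqrt r) * (\<Sum>n=-int N..int N. w n r * cis (of_int n * \<theta>))) \<longlonglongrightarrow> of_real (sqrt r) * V r \<theta>"
        unfolding w_def
        by (intro tendsto_mult_left fourier_series_pointwise[OF V_cont[OF r'(1)] per[OF r'(1)] Vt[OF r'(1)]])
      ultimately have "Sm \<theta> (of_real r) = of_real (sqrt r) * V r \<theta>" by (rule LIMSEQ_unique)
      then show ?thesis using r' by (simp add: Vc_def)
    qed
    show "norm (Vc z \<theta>) \<le> max 0 C0 + C1" if z: "X < Re z" "0 \<le> Im z" for z
    proof -
      have x: "X1 \<le> Re z" "R \<le> Re z" "1 \<le> Re z" "0 \<le> Re z" "X0 \<le> Re z" using z X by auto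
      have sx: "1 \<le> sqrt (Re z)" using x by simp
      have C1: "0 \<le> C1" using X1(2)[OF order_refl, of "{}"] by simp
      have part: "norm (\<Sum>n=-int N..int N. y n z * cis (of_int n * \<theta>)) \<le> max 0 C0 + sqrt (Re z) * C1" for N
      proof -
        have "norm (\<Sum>n=-int N..int N. y n z * cis (of_int n * \<theta>)) \<le> (\<Sum>n=-int N..int N. norm (y n z))"
          by (rule order_trans[OF norm_sum]) (simp add: norm_mult)
        also have "\<dots> \<le> (\<Sum>n=-int N..int N. (if n = 0 then max 0 C0 else 0) + sqrt (Re z) * norm (w n (Re z)))"
        proof (rule sum_mono)
          fix n
          show "norm (y n z) \<le> (if n = 0 then max 0 C0 else 0) + sqrt (Re z) * norm (w n (Re z))"
          proof (cases "n = 0")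
            case True
            have "norm (y 0 z) \<le> C0" using X0(2)[of z] z x by simp
            moreover have "0 \<le> sqrt (Re z) * norm (w 0 (Re z))" using x by simp
            ultimately show ?thesis using True by simp
          qed (use yn[of n z] z x in simp)
        qed
        also have "\<dots> = max 0 C0 + sqrt (Re z) * (\<Sum>n=-int N..int N. norm (w n (Re z)))"
          by (simp add: sum.distrib sum_distrib_left)
        also have "\<dots> \<le> max 0 C0 + sqrt (Re z) * C1"
          using X1(2)[OF x(1)] x by (intro add_left_mono mult_left_mono) auto
        finally show ?thesis .
      qed
      have "norm (Sm \<theta> z) \<le> max 0 C0 + sqrt (Re z) * C1"
        by (rule LIMSEQ_le_const2[OF tendsto_norm[OF lim]]) (use z part in auto)
      \<comment> \<open>The mode 0 is bounded without the factor sqrt(Re z); since Re z \<ge> 1 it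
        can be given this factor. Division by \<open>csqrt z\<close> then removes the growth,
        because Re z \<le> |z|.\<close>
      also have "\<dots> \<le> sqrt (Re z) * (max 0 C0 + C1)"
        using mult_right_mono[OF sx, of "max 0 C0"] by (simp add: algebra_simps)
      also have "\<dots> \<le> sqrt (norm z) * (max 0 C0 + C1)"
        using C1 complex_Re_le_cmod[of z] by (intro mult_right_mono) auto
      finally have "norm (Sm \<theta> z) \<le> sqrt (norm z) * (max 0 C0 + C1)" .
      moreover have "0 < sqrt (norm z)" using x complex_Re_le_cmod[of z] by auto
      ultimately show ?thesis
        by (simp add: Vc_def norm_divide norm_csqrt pos_divide_le_eq mult.commute)
    qed
  qed
qed

end

section \<open>Functions holomorphic in one variable and smooth in a real parameter\<close>

definition dz :: "(complex \<Rightarrow> real \<Rightarrow> complex) \<Rightarrow> complex \<Rightarrow> real \<Rightarrow> complex" where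
  "dz F z \<theta> = deriv (\<lambda>z. F z \<theta>) z"

lemma open_slice:
  assumes "open (Z :: (complex \<times> real) set)"
  shows "open {z. (z, \<theta>) \<in> Z}"
proof -
  have "open ((\<lambda>z. (z, \<theta>)) -` Z)"
    using assms by (intro open_vimage continuous_intros)
  then show ?thesis by (simp add: vimage_def)
qed

lemma product_neighbourhood:
  assumes "open (Z :: (complex \<times> real) set)" "(z0, \<theta>0) \<in> Z"
  obtains r where "0 < r" "cball z0 r \<times> cball \<theta>0 r \<subseteq> Z"
proof -
  obtain A B where AB: "open A" "open B" "z0 \<in> A" "\<theta>0 \<in> B" "A \<times> B \<subseteq> Z"
    using open_prod_elim[OF assms] by (metis mem_Sigma_iff)
  obtain a b where ab: "0 < a" "cball z0 a \<subseteq> A" "0 < b" "cball \<theta>0 b \<subseteq> B"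
    using AB open_contains_cball by metis
  have "cball z0 (min a b) \<times> cball \<theta>0 (min a b) \<subseteq> Z"
    using ab AB(5) by fastforce
  then show thesis using ab by (intro that[of "min a b"]) auto
qed

lemma product_uniform_continuity:
  fixes F :: "complex \<Rightarrow> real \<Rightarrow> complex"
  assumes "cball z0 r \<times> cball \<theta>0 r \<subseteq> Z" "continuous_on Z (\<lambda>(z, \<theta>). F z \<theta>)" "0 < e" "0 < r"
  obtains d where "0 < d" "d \<le> r"
    "\<And>z \<theta>. z \<in> cball z0 r \<Longrightarrow> \<bar>\<theta> - \<theta>0\<bar> \<le> d \<Longrightarrow> norm (F z \<theta> - F z \<theta>0) \<le> e"
proof -
  have "uniformly_continuous_on (cball z0 r \<times> cball \<theta>0 r) (\<lambda>(z, \<theta>). F z \<theta>)"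
    by (intro compact_uniformly_continuous continuous_on_subset[OF assms(2,1)] compact_Times compact_cball)
  then obtain d where d: "0 < d" "\<And>x x'. x \<in> cball z0 r \<times> cball \<theta>0 r \<Longrightarrow> x' \<in> cball z0 r \<times> cball \<theta>0 r \<Longrightarrow>
      dist x' x < d \<Longrightarrow> dist ((\<lambda>(z, \<theta>). F z \<theta>) x') ((\<lambda>(z, \<theta>). F z \<theta>) x) < e"
    unfolding uniformly_continuous_on_def using \<open>0 < e\<close> by metis
  have "norm (F z \<theta> - F z \<theta>0) \<le> e" if "z \<in> cball z0 r" "\<bar>\<theta> - \<theta>0\<bar> \<le> min r (d / 2)" for z \<theta>
    using d(2)[of "(z, \<theta>0)" "(z, \<theta>)"] that d(1) \<open>0 < r\<close>
    by (auto simp: dist_norm dist_Pair_Pair norm_minus_commute dist_real_def abs_minus_commute)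
  then show thesis using d(1) \<open>0 < r\<close> by (intro that[of "min r (d / 2)"]) auto
qed

lemma dz_has_field_derivative:
  assumes "open Z" "\<And>\<theta>. (\<lambda>z. F z \<theta>) holomorphic_on {z. (z, \<theta>) \<in> Z}" "(z, \<theta>) \<in> Z"
  shows "((\<lambda>z. F z \<theta>) has_field_derivative dz F z \<theta>) (at z)"
  unfolding dz_def by (rule holomorphic_derivI[OF assms(2) open_slice[OF assms(1)]]) (use assms in simp)

lemma dz_holomorphic:
  assumes "open Z" "\<And>\<theta>. (\<lambda>z. F z \<theta>) holomorphic_on {z. (z, \<theta>) \<in> Z}"
  shows "(\<lambda>z. dz F z \<theta>) holomorphic_on {z. (z, \<theta>) \<in> Z}"
  unfolding dz_def[abs_def] by (rule holomorphic_deriv[OF assms(2) open_slice[OF assms(1)]])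

text \<open>Cauchy's inequality: if F at \<theta> and at \<theta>0 are uniformly close on a disk, so
  are their z-derivatives on a smaller disk. Uniform continuity on a compact product provides the
  closeness.\<close>

lemma dz_continuous:
  assumes Z: "open Z" and hol: "\<And>\<theta>. (\<lambda>z. F z \<theta>) holomorphic_on {z. (z, \<theta>) \<in> Z}"
    and cont: "continuous_on Z (\<lambda>(z, \<theta>). F z \<theta>)"
  shows "continuous_on Z (\<lambda>(z, \<theta>). dz F z \<theta>)"
proof (rule continuous_at_imp_continuous_on, safe)
  fix z0 \<theta>0 assume z0: "(z0, \<theta>0) \<in> Z"
  obtain r where r: "0 < r" "cball z0 r \<times> cball \<theta>0 r \<subseteq> Z" using product_neighbourhood[OF Z z0] .
  show "isCont (\<lambda>(z, \<theta>). dz F z \<theta>) (z0, \<theta>0)"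
    unfolding continuous_at_eps_delta
  proof (intro allI impI)
    fix e :: real assume e: "0 < e"
    have "continuous_on {z. (z, \<theta>0) \<in> Z} (\<lambda>z. dz F z \<theta>0)"
      by (rule holomorphic_on_imp_continuous_on[OF dz_holomorphic[OF Z hol]])
    then have "isCont (\<lambda>z. dz F z \<theta>0) z0"
      using z0 open_slice[OF Z] by (simp add: continuous_on_eq_continuous_at)
    then obtain d1 where d1: "0 < d1" "\<And>z. dist z z0 < d1 \<Longrightarrow> dist (dz F z \<theta>0) (dz F z0 \<theta>0) < e / 2"
      unfolding continuous_at_eps_delta using e by (metis half_gt_zero)
    \<comment> \<open>Cauchy's inequality on disks of radius r/2 turns e r / 8 into e / 4.\<close>
    obtain d2 where d2: "0 < d2" "d2 \<le> r"
      "\<And>z \<theta>. z \<in> cball z0 r \<Longrightarrow> \<bar>\<theta> - \<theta>0\<bar> \<le> d2 \<Longrightarrow> norm (F z \<theta> - F z \<theta>0) \<le> e * r / 8"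
      using product_uniform_continuity[OF r(2) cont, of "e * r / 8"] e r(1) by auto
    have near: "dist (dz F z \<theta>) (dz F z \<theta>0) \<le> e / 4" if "dist z z0 \<le> r / 2" "\<bar>\<theta> - \<theta>0\<bar> \<le> d2" for z \<theta>
    proof -
      have sub: "cball z (r / 2) \<subseteq> cball z0 r"
      proof
        fix x assume "x \<in> cball z (r / 2)"
        then show "x \<in> cball z0 r"
          using that(1) dist_triangle[of z0 x z] by (simp add: dist_commute)
      qed
      have \<theta>: "\<theta> \<in> cball \<theta>0 r" "\<theta>0 \<in> cball \<theta>0 r" using that d2 r by (auto simp: dist_real_def)
      have hb: "(\<lambda>z. F z t) holomorphic_on cball z (r / 2)" if "t \<in> cball \<theta>0 r" for t
        by (rule holomorphic_on_subset[OF hol]) (use sub that r(2) in auto)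
      have "norm ((deriv ^^ 1) (\<lambda>z. F z \<theta> - F z \<theta>0) z) \<le> fact 1 * (e * r / 8) / (r / 2) ^ 1"
      proof (rule Cauchy_inequality)
        show "(\<lambda>z. F z \<theta> - F z \<theta>0) holomorphic_on ball z (r / 2)"
          using hb[OF \<theta>(1)] hb[OF \<theta>(2)] ball_subset_cball
          by (intro holomorphic_intros) (blast intro: holomorphic_on_subset)+
        show "continuous_on (cball z (r / 2)) (\<lambda>z. F z \<theta> - F z \<theta>0)"
          using hb[OF \<theta>(1)] hb[OF \<theta>(2)] by (intro holomorphic_on_imp_continuous_on holomorphic_intros)
        fix x assume "norm (z - x) = r / 2"
        then have "x \<in> cball z0 r" using sub by (auto simp: dist_norm)
        then show "norm (F x \<theta> - F x \<theta>0) \<le> e * r / 8" using d2 that by simp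
      qed (use r in auto)
      moreover have "deriv (\<lambda>z. F z \<theta> - F z \<theta>0) z = dz F z \<theta> - dz F z \<theta>0"
      proof -
        have "z \<in> cball z0 r" using that r by (simp add: dist_commute)
        then have "(z, \<theta>) \<in> Z" "(z, \<theta>0) \<in> Z" using r(2) \<theta> by auto
        then show ?thesis
          by (intro DERIV_imp_deriv DERIV_diff dz_has_field_derivative[OF Z hol])
      qed
      ultimately show ?thesis using r by (simp add: dist_norm field_simps)
    qed
    have "dist (dz F z \<theta>) (dz F z0 \<theta>0) < e" if "dist (z, \<theta>) (z0, \<theta>0) < min d1 (min d2 (r / 2))" for z \<theta>
    proof -
      have "dist z z0 < min d1 (min d2 (r / 2))" "\<bar>\<theta> - \<theta>0\<bar> < min d1 (min d2 (r / 2))"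
        using that dist_fst_le[of "(z, \<theta>)" "(z0, \<theta>0)"] dist_snd_le[of "(z, \<theta>)" "(z0, \<theta>0)"] by (auto simp: dist_real_def)
      then show ?thesis
        using near[of z \<theta>] d1(2)[of z] e dist_triangle[of "dz F z \<theta>" "dz F z0 \<theta>0" "dz F z \<theta>0"] by auto
    qed
    then show "\<exists>d>0. \<forall>x'. dist x' (z0, \<theta>0) < d \<longrightarrow>
        dist (case x' of (z, \<theta>) \<Rightarrow> dz F z \<theta>) (case (z0, \<theta>0) of (z, \<theta>) \<Rightarrow> dz F z \<theta>) < e"
      using d1 d2 r by (intro exI[of _ "min d1 (min d2 (r / 2))"]) auto
  qed
qed

lemma difference_quotient_bound:
  fixes f :: "real \<Rightarrow> complex"
  assumes "0 < h" and der: "\<And>t. a \<le> t \<Longrightarrow> t \<le> a + h \<Longrightarrow> (f has_vector_derivative f' t) (at t)"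
    and bnd: "\<And>t. a \<le> t \<Longrightarrow> t \<le> a + h \<Longrightarrow> norm (f' t - c) \<le> e"
  shows "norm ((f (a + h) - f a) / of_real h - c) \<le> e"
proof -
  define g where "g t = f t - of_real t * c" for t
  have dg: "(g has_vector_derivative f' t - c) (at t)" if "a \<le> t" "t \<le> a + h" for t
  proof -
    have "((\<lambda>t. of_real t * c) has_vector_derivative 1 * c) (at t)"
      by (intro has_vector_derivative_mult_left) (auto simp: has_vector_derivative_def scaleR_conv_of_real intro!: derivative_eq_intros)
    from has_vector_derivative_diff[OF der[OF that] this] show ?thesis by (simp add: g_def[abs_def])
  qed
  have "norm (g (a + h) - g a) \<le> e * (a + h) - e * a"
  proof (rule differentiable_bound_general[where f' = "\<lambda>t. f' t - c" and \<phi>' = "\<lambda>t. e"])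
    show "continuous_on {a..a + h} g"
      using has_vector_derivative_continuous[OF dg] by (intro continuous_at_imp_continuous_on) auto
    show "((*) e has_vector_derivative e) (at t)" for t
      by (auto simp: has_vector_derivative_def intro!: derivative_eq_intros)
  qed (use assms dg in \<open>auto intro!: continuous_intros\<close>)
  then have "norm (g (a + h) - g a) / h \<le> e" using \<open>0 < h\<close> by (simp add: field_simps)
  moreover have "(f (a + h) - f a) / of_real h - c = (g (a + h) - g a) / of_real h"
    using \<open>0 < h\<close> by (simp add: g_def field_simps)
  ultimately show ?thesis using \<open>0 < h\<close> by (simp add: norm_divide)
qed

text \<open>The difference quotients in \<theta> are holomorphic in z and converge locally
  uniformly, because the \<theta>-derivative is jointly continuous. This supplies holomorphy of W1
  and W2, of which \<open>radial_continuation\<close> states continuity.\<close>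

lemma parameter_derivative_holomorphic:
  assumes Z: "open Z" and hol: "\<And>\<theta>. (\<lambda>z. F z \<theta>) holomorphic_on {z. (z, \<theta>) \<in> Z}"
    and der: "\<And>z \<theta>. (z, \<theta>) \<in> Z \<Longrightarrow> ((\<lambda>t. F z t) has_vector_derivative F1 z \<theta>) (at \<theta>)"
    and cont: "continuous_on Z (\<lambda>(z, \<theta>). F1 z \<theta>)"
  shows "(\<lambda>z. F1 z \<theta>0) holomorphic_on {z. (z, \<theta>0) \<in> Z}"
proof -
  have "\<exists>r>0. (\<lambda>z. F1 z \<theta>0) holomorphic_on ball z0 r" if z0: "(z0, \<theta>0) \<in> Z" for z0
  proof -
    obtain r where r: "0 < r" "cball z0 r \<times> cball \<theta>0 r \<subseteq> Z" using product_neighbourhood[OF Z z0] .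
    define h where "h n = r / real (Suc n)" for n
    have h: "0 < h n" "h n \<le> r" for n using r by (auto simp: h_def field_simps)
    define f where "f n z = (F z (\<theta>0 + h n) - F z \<theta>0) / of_real (h n)" for n z
    have unif: "uniform_limit (cball z0 r) f (\<lambda>z. F1 z \<theta>0) sequentially"
      unfolding uniform_limit_iff
    proof (intro allI impI)
      fix e :: real assume e: "0 < e"
      obtain d where d: "0 < d" "d \<le> r"
        "\<And>z \<theta>. z \<in> cball z0 r \<Longrightarrow> \<bar>\<theta> - \<theta>0\<bar> \<le> d \<Longrightarrow> norm (F1 z \<theta> - F1 z \<theta>0) \<le> e / 2"
        using product_uniform_continuity[OF r(2) cont, of "e / 2"] e r(1) by auto
      have "(\<lambda>n. h n) \<longlonglongrightarrow> 0"
        unfolding h_def by (rule LIMSEQ_Suc[OF lim_const_over_n])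
      then have "\<forall>\<^sub>F n in sequentially. h n < d" using d(1) by (rule order_tendstoD)
      then show "\<forall>\<^sub>F n in sequentially. \<forall>z\<in>cball z0 r. dist (f n z) (F1 z \<theta>0) < e"
      proof (eventually_elim, intro ballI)
        fix n z assume hn: "h n < d" and z: "z \<in> cball z0 r"
        have "norm (f n z - F1 z \<theta>0) \<le> e / 2"
          unfolding f_def
        proof (rule difference_quotient_bound[OF h(1)])
          fix t assume t: "\<theta>0 \<le> t" "t \<le> \<theta>0 + h n"
          have "(z, t) \<in> Z" using r(2) z t hn d by (auto simp: dist_real_def)
          then show "(F z has_vector_derivative F1 z t) (at t)" using der by simp
          show "norm (F1 z t - F1 z \<theta>0) \<le> e / 2" using d(3)[OF z, of t] t hn by auto
        qed
        then show "dist (f n z) (F1 z \<theta>0) < e" using e by (simp add: dist_norm)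
      qed
    qed
    have "(\<lambda>z. F1 z \<theta>0) holomorphic_on ball z0 r"
    proof (rule holomorphic_uniform_sequence[of _ f])
      show "f n holomorphic_on ball z0 r" for n
      proof -
        have "(\<lambda>z. F z t) holomorphic_on ball z0 r" if "t \<in> cball \<theta>0 r" for t
          by (rule holomorphic_on_subset[OF hol]) (use that r(2) ball_subset_cball in blast)
        moreover have "\<theta>0 + h n \<in> cball \<theta>0 r" "\<theta>0 \<in> cball \<theta>0 r" using h[of n] r by (auto simp: dist_real_def)
        ultimately show ?thesis unfolding f_def[abs_def] using h[of n]
          by (intro holomorphic_intros) auto
      qed
      fix x assume x: "x \<in> ball z0 r"
      then obtain d where d: "0 < d" "cball x d \<subseteq> ball z0 r" using open_ball[of z0 r] unfolding open_contains_cball by meson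
      then have "cball x d \<subseteq> cball z0 r" using ball_subset_cball by blast
      from uniform_limit_on_subset[OF unif this] d
      show "\<exists>d>0. cball x d \<subseteq> ball z0 r \<and> uniform_limit (cball x d) f (\<lambda>z. F1 z \<theta>0) sequentially" by blast
    qed simp
    then show ?thesis using r by blast
  qed
  then have "(\<lambda>z. F1 z \<theta>0) field_differentiable at z" if "(z, \<theta>0) \<in> Z" for z
    using that holomorphic_on_imp_differentiable_at[OF _ open_ball, of "\<lambda>z. F1 z \<theta>0" z _ z] by force
  then show ?thesis
    by (auto simp: holomorphic_on_def intro: field_differentiable_at_within)
qed

text \<open>Partial differentiability becomes joint differentiability as soon as one of the two
  partial derivatives is continuous; here it is the one in \<theta>.\<close>

lemma parameter_chain_rule:
  fixes F :: "complex \<Rightarrow> real \<Rightarrow> complex"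
  assumes Z: "open Z" and hol: "\<And>\<theta>. (\<lambda>z. F z \<theta>) holomorphic_on {z. (z, \<theta>) \<in> Z}"
    and der: "\<And>z \<theta>. (z, \<theta>) \<in> Z \<Longrightarrow> ((\<lambda>t. F z t) has_vector_derivative F1 z \<theta>) (at \<theta>)"
    and cont: "continuous_on Z (\<lambda>(z, \<theta>). F1 z \<theta>)" and mem: "(z, \<theta>) \<in> Z"
  shows "((\<lambda>(z, \<theta>). F z \<theta>) has_derivative (\<lambda>(u, h). dz F z \<theta> * u + h *\<^sub>R F1 z \<theta>)) (at (z, \<theta>))"
proof -
  obtain r where r: "0 < r" "cball z r \<times> cball \<theta> r \<subseteq> Z" using product_neighbourhood[OF Z mem] .
  have sub: "ball z r \<times> ball \<theta> r \<subseteq> Z" using r(2) ball_subset_cball[of z r] ball_subset_cball[of \<theta> r] by blast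
  have "((\<lambda>(z, \<theta>). F z \<theta>) has_derivative (\<lambda>(u, h). dz F z \<theta> * u + blinfun_scaleR_left (F1 z \<theta>) h))
      (at (z, \<theta>) within ball z r \<times> ball \<theta> r)"
  proof (rule has_derivative_partialsI)
    show "((\<lambda>x. F x \<theta>) has_derivative (\<lambda>u. dz F z \<theta> * u)) (at z within ball z r)"
      using dz_has_field_derivative[OF Z hol mem] by (simp add: has_field_derivative_def has_derivative_at_withinI)
    show "((\<lambda>y. F x y) has_derivative blinfun_apply (blinfun_scaleR_left (F1 x y))) (at y within ball \<theta> r)"
      if "x \<in> ball z r" "y \<in> ball \<theta> r" for x y
    proof -
      have "(x, y) \<in> Z" using sub that by blast
      then have "((\<lambda>y. F x y) has_derivative (\<lambda>h. h *\<^sub>R F1 x y)) (at y within ball \<theta> r)"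
        by (rule has_derivative_at_withinI[OF der[unfolded has_vector_derivative_def]])
      moreover have "blinfun_apply (blinfun_scaleR_left (F1 x y)) = (\<lambda>h. h *\<^sub>R F1 x y)"
        by (simp add: blinfun_scaleR_left.rep_eq fun_eq_iff)
      ultimately show ?thesis by (simp only:)
    qed
    have c: "continuous_on Z (\<lambda>p. blinfun_scaleR_left (case p of (z, \<theta>) \<Rightarrow> F1 z \<theta>))"
      by (rule bounded_linear.continuous_on[OF bounded_linear_blinfun_scaleR_left cont])
    have c2: "continuous (at (z, \<theta>)) (\<lambda>p. blinfun_scaleR_left (case p of (z, \<theta>) \<Rightarrow> F1 z \<theta>))"
      by (rule continuous_on_interior[OF c]) (unfold interior_open[OF Z], rule mem)
    have e: "(\<lambda>p. blinfun_scaleR_left (case p of (z, \<theta>) \<Rightarrow> F1 z \<theta>)) = (\<lambda>(x, y). blinfun_scaleR_left (F1 x y))"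
      unfolding case_prod_unfold by (rule refl)
    show "continuous (at (z, \<theta>) within ball z r \<times> ball \<theta> r) (\<lambda>(x, y). blinfun_scaleR_left (F1 x y))"
      by (rule continuous_at_imp_continuous_at_within) (rule c2[unfolded e])
  qed (use r in auto)
  moreover have "at (z, \<theta>) within ball z r \<times> ball \<theta> r = at (z, \<theta>)"
    using r by (intro at_within_open open_Times) auto
  ultimately show ?thesis by (simp add: blinfun_scaleR_left.rep_eq)
qed

section \<open>Sectors and uniqueness of continuations\<close>

lemma sector_iff:
  "z \<in> sector R1 \<sigma>0 \<sigma>1 \<theta> \<longleftrightarrow> 0 \<le> Im z \<and> \<sigma>1 * Im z \<le> \<sigma>0 * (Re z - R1 \<theta>)"
  unfolding sector_def mem_Collect_eq
proof
  assume "0 \<le> Im z \<and> \<sigma>1 * Im z \<le> \<sigma>0 * (Re z - R1 \<theta>)"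
  moreover have "z = of_real (R1 \<theta>) + Complex (Re z - R1 \<theta>) (Im z)" by (simp add: complex_eq_iff)
  ultimately show "\<exists>a b. z = of_real (R1 \<theta>) + Complex a b \<and> 0 \<le> b \<and> \<sigma>1 * b \<le> \<sigma>0 * a" by blast
qed auto

lemma of_real_in_sector: "0 < \<sigma>0 \<Longrightarrow> R1 \<theta> \<le> r \<Longrightarrow> of_real r \<in> sector R1 \<sigma>0 \<sigma>1 \<theta>"
  by (simp add: sector_iff)

lemma sector_convex: "convex (sector R1 \<sigma>0 \<sigma>1 \<theta>)"
proof -
  have "sector R1 \<sigma>0 \<sigma>1 \<theta> = {z. Im z \<ge> 0} \<inter> {z. (Complex \<sigma>0 (- \<sigma>1)) \<bullet> z \<ge> \<sigma>0 * R1 \<theta>}"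
    by (auto simp: sector_iff inner_complex_def algebra_simps)
  then show ?thesis
    by (simp only:) (intro convex_Int convex_halfspace_Im_ge convex_halfspace_ge)
qed

lemma Re_sector_ge:
  assumes "0 < \<sigma>0" "0 < \<sigma>1" "z \<in> sector R1 \<sigma>0 \<sigma>1 \<theta>"
  shows "R1 \<theta> \<le> Re z"
proof -
  have "0 \<le> \<sigma>1 * Im z" "\<sigma>1 * Im z \<le> \<sigma>0 * (Re z - R1 \<theta>)" using assms by (auto simp: sector_iff)
  then have "0 \<le> \<sigma>0 * (Re z - R1 \<theta>)" by linarith
  then show ?thesis using assms(1) by (simp add: zero_le_mult_iff)
qed

text \<open>The open set A may be disconnected, so the identity theorem is applied on the component
  that contains the sector, which is convex and hence connected.\<close>

lemma sector_identity:
  assumes A: "open A" "sector R1 \<sigma>0 \<sigma>1 \<theta> \<subseteq> A" and g: "g holomorphic_on A" and "0 < \<sigma>0"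
    and zero: "\<And>r. r1 \<le> r \<Longrightarrow> g (of_real r) = 0" and z: "z \<in> sector R1 \<sigma>0 \<sigma>1 \<theta>"
  shows "g z = 0"
proof -
  define a where "a = max r1 (R1 \<theta>)"
  define C where "C = connected_component_set A (of_real a)"
  have aS: "of_real x \<in> sector R1 \<sigma>0 \<sigma>1 \<theta>" if "a \<le> x" for x
    using that assms by (intro of_real_in_sector) (auto simp: a_def)
  have sub: "sector R1 \<sigma>0 \<sigma>1 \<theta> \<subseteq> C"
    unfolding C_def using aS[of a] A(2)
    by (intro connected_component_maximal convex_connected sector_convex) auto
  show ?thesis
  proof (rule analytic_continuation[of g C "of_real ` {a..}" "of_real a"])
    show "g holomorphic_on C" using g unfolding C_def by (rule holomorphic_on_subset) (rule connected_component_subset)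
    show "open C" unfolding C_def using A(1) by (rule open_connected_component)
    show "connected C" unfolding C_def by (rule connected_connected_component)
    show "of_real ` {a..} \<subseteq> C" using aS sub by auto
    show "complex_of_real a \<in> C" using aS[of a] sub by auto
    show "complex_of_real a islimpt of_real ` {a..}"
      unfolding islimpt_approachable
    proof (intro allI impI)
      fix e :: real assume "0 < e"
      then show "\<exists>x'\<in>of_real ` {a..}. x' \<noteq> complex_of_real a \<and> dist x' (complex_of_real a) < e"
        by (intro bexI[of _ "of_real (a + e / 2)"]) (auto simp: dist_norm simp flip: of_real_add of_real_diff)
    qed
  qed (use sub z zero in \<open>auto simp: a_def\<close>)
qed

text \<open>h is holomorphic only above the real axis and merely continuous on it. But h - g
  vanishes on the real ray, so its Schwarz reflection is holomorphic across the ray, and the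
  identity theorem makes it zero on the doubled wedge. The bound for h thereby passes to g.\<close>

lemma sector_bound_by_reflection:
  assumes A: "open A" "sector R1 \<sigma>0 \<sigma>1 \<theta> \<subseteq> A" and g: "g holomorphic_on A"
    and \<sigma>: "0 < \<sigma>0" "0 < \<sigma>1" and X: "R1 \<theta> \<le> X"
    and h: "h holomorphic_on {z. X < Re z \<and> 0 < Im z}" "continuous_on {z. X < Re z \<and> 0 \<le> Im z} h"
    and eq: "\<And>r. X < r \<Longrightarrow> h (of_real r) = g (of_real r)"
    and bnd: "\<And>z. X < Re z \<Longrightarrow> 0 \<le> Im z \<Longrightarrow> norm (h z) \<le> C"
    and z: "z \<in> sector R1 \<sigma>0 \<sigma>1 \<theta>" "X < Re z"
  shows "norm (g z) \<le> C"
proof -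
  \<comment> \<open>The interior of the sector beyond X, doubled across the real axis. The slanted
    edge is left out here and is reached by a limit at the end.\<close>
  define S where "S = {z. X < Re z \<and> \<sigma>1 * Im z < \<sigma>0 * (Re z - R1 \<theta>) \<and> - (\<sigma>1 * Im z) < \<sigma>0 * (Re z - R1 \<theta>)}"
  have Seq: "S = {z. Re z > X} \<inter> ({z. (Complex \<sigma>0 (- \<sigma>1)) \<bullet> z > \<sigma>0 * R1 \<theta>} \<inter> {z. (Complex \<sigma>0 \<sigma>1) \<bullet> z > \<sigma>0 * R1 \<theta>})"
    by (auto simp: S_def inner_complex_def algebra_simps)
  have "open S" unfolding Seq by (intro open_Int open_halfspace_Re_gt open_halfspace_gt)
  have "convex S" unfolding Seq by (intro convex_Int convex_halfspace_Re_gt convex_halfspace_gt)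
  have subA: "S \<inter> {z. 0 \<le> Im z} \<subseteq> A" using A(2) by (auto simp: S_def sector_iff)
  define f where "f z = h z - g z" for z
  define F where "F z = (if 0 \<le> Im z then f z else cnj (f (cnj z)))" for z
  have "F holomorphic_on S"
    unfolding F_def
  proof (rule Schwarz_reflection)
    show "cnj ` S \<subseteq> S" by (auto simp: S_def)
    show "f holomorphic_on (S \<inter> {z. 0 < Im z})"
      unfolding f_def using subA
      by (intro holomorphic_intros holomorphic_on_subset[OF h(1)] holomorphic_on_subset[OF g]) (auto simp: S_def)
    show "continuous_on (S \<inter> {z. 0 \<le> Im z}) f"
      unfolding f_def using subA
      by (intro continuous_intros continuous_on_subset[OF h(2)]
          continuous_on_subset[OF holomorphic_on_imp_continuous_on[OF g]]) (auto simp: S_def)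
    show "f x \<in> \<real>" if "x \<in> S" "x \<in> \<real>" for x
      using that eq by (auto elim!: Reals_cases simp: S_def f_def)
  qed (fact \<open>open S\<close>)
  have real_in: "of_real r \<in> S" if "X < r" for r
    using that X \<sigma> by (auto simp: S_def)
  have zero: "F w = 0" if w: "w \<in> S" for w
  proof (rule analytic_continuation[of F S "of_real ` {X<..}" "of_real (X + 1)" w])
    show "complex_of_real (X + 1) islimpt of_real ` {X<..}"
      unfolding islimpt_approachable
    proof (intro allI impI)
      fix e :: real assume "0 < e"
      then show "\<exists>x'\<in>of_real ` {X<..}. x' \<noteq> complex_of_real (X + 1) \<and> dist x' (complex_of_real (X + 1)) < e"
        by (intro bexI[of _ "of_real (X + 1 + e / 2)"]) (auto simp: dist_norm simp flip: of_real_add of_real_diff)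
    qed
    show "complex_of_real (X + 1) \<in> S" by (rule real_in) simp
  qed (use \<open>F holomorphic_on S\<close> \<open>open S\<close> \<open>convex S\<close> real_in w eq in
      \<open>auto simp: F_def f_def convex_connected\<close>)
  have inside: "norm (g w) \<le> C" if "w \<in> S" "0 \<le> Im w" for w
  proof -
    have "h w = g w" using zero[OF that(1)] that(2) by (simp add: F_def f_def)
    moreover have "X < Re w" using that(1) by (simp add: S_def)
    ultimately show ?thesis using bnd[of w] that(2) by simp
  qed
  \<comment> \<open>A shift to the right by 1/(n+1) moves any point of the sector, including its
    slanted edge, into S while keeping it in the closed upper half plane.\<close>
  have "isCont g z"
    using continuous_on_eq_continuous_at[OF A(1)] holomorphic_on_imp_continuous_on[OF g] A(2) z(1) by blast
  moreover have "(\<lambda>n. z + of_real (inverse (real (Suc n)))) \<longlonglongrightarrow> z + of_real 0"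
    by (intro tendsto_intros LIMSEQ_inverse_real_of_nat)
  ultimately have "(\<lambda>n. g (z + of_real (inverse (real (Suc n))))) \<longlonglongrightarrow> g z"
    by (intro isCont_tendsto_compose[of z g]) auto
  then have "(\<lambda>n. norm (g (z + of_real (inverse (real (Suc n)))))) \<longlonglongrightarrow> norm (g z)"
    by (rule tendsto_norm)
  then show ?thesis
  proof (rule LIMSEQ_le_const2, intro exI allI impI)
    fix n
    define e where "e = inverse (real (Suc n))"
    have e: "0 < e" by (simp add: e_def)
    have "\<sigma>1 * Im z < \<sigma>0 * (Re z + e - R1 \<theta>)"
      using z \<sigma> mult_pos_pos[OF \<sigma>(1) e] by (auto simp: sector_iff algebra_simps)
    moreover have "0 \<le> \<sigma>1 * Im z" using z \<sigma> by (auto simp: sector_iff)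
    ultimately have "z + of_real e \<in> S" using z e by (auto simp: S_def)
    then show "norm (g (z + of_real (inverse (real (Suc n))))) \<le> C"
      unfolding e_def[symmetric] using z by (intro inside) (auto simp: sector_iff)
  qed
qed

section \<open>Polar coordinates\<close>

lemma polar_nth [simp]: "polar r \<theta> $ 1 = r * cos \<theta>" "polar r \<theta> $ 2 = r * sin \<theta>"
  by (simp_all add: polar_def)

lemma cos_plus_quarter [simp]: "cos (\<theta> + pi / 2) = - sin \<theta>" and sin_plus_quarter [simp]: "sin (\<theta> + pi / 2) = cos \<theta>"
  by (simp_all add: cos_add sin_add)

lemma vec2_eq_iff: "(x :: 'a^2) = y \<longleftrightarrow> x $ 1 = y $ 1 \<and> x $ 2 = y $ 2"
  by (simp add: vec_eq_iff forall_2)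

lemma inner_vec2: "(x :: real^2) \<bullet> y = x $ 1 * y $ 1 + x $ 2 * y $ 2"
  by (simp add: inner_vec_def UNIV_2)

lemma norm_polar: "norm (polar r \<theta>) = \<bar>r\<bar>"
proof -
  have "(norm (polar r \<theta>))\<^sup>2 = r\<^sup>2 * ((cos \<theta>)\<^sup>2 + (sin \<theta>)\<^sup>2)"
    by (simp only: dot_square_norm[symmetric] inner_vec2 polar_nth) algebra
  then have "(norm (polar r \<theta>))\<^sup>2 = \<bar>r\<bar>\<^sup>2" by simp
  then show ?thesis by (rule power2_eq_imp_eq) auto
qed

lemma polar_eq_0_iff [simp]: "polar r \<theta> = 0 \<longleftrightarrow> r = 0"
  using norm_polar[of r \<theta>] by (metis abs_eq_0 norm_eq_zero)

lemma polar_scaleR: "polar (s * r) \<theta> = s *\<^sub>R polar r \<theta>"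
  by (simp add: vec2_eq_iff)

lemma polar_periodic_int: "polar r (\<theta> + 2 * pi * of_int j) = polar r \<theta>"
  by (rule periodic_int) (simp add: vec2_eq_iff)

lemma polar_periodic [simp]: "polar r (\<theta> + 2 * pi) = polar r \<theta>"
  by (simp add: vec2_eq_iff)

lemma Complex_polar: "Complex (polar r \<theta> $ 1) (polar r \<theta> $ 2) = of_real r * cis \<theta>"
  by (simp add: complex_eq_iff)

lemma polar_norm_ang: "polar (norm x) (ang x) = x"
proof -
  define c where "c = Complex (x $ 1) (x $ 2)"
  have n: "norm x = cmod c"
    by (simp add: c_def cmod_def norm_eq_sqrt_inner inner_vec2 power2_eq_square)
  have "of_real (cmod c) * cis (Arg c) = c" by (metis rcis_cmod_Arg rcis_def)
  then have "Complex (polar (norm x) (ang x) $ 1) (polar (norm x) (ang x) $ 2) = c"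
    unfolding Complex_polar by (simp add: n ang_def c_def)
  then show ?thesis by (simp add: c_def vec2_eq_iff)
qed

lemma polar_eqD:
  assumes "polar r \<theta> = polar s t" "0 < r" "0 < s"
  obtains j :: int where "r = s" "\<theta> = t + 2 * pi * of_int j"
proof -
  have rs: "r = s" using assms norm_polar[of r \<theta>] norm_polar[of s t] by simp
  then have "cos \<theta> = cos t" "sin \<theta> = sin t"
    using assms by (auto simp: vec2_eq_iff)
  then obtain j :: int where "\<theta> = t + 2 * pi * j"
    using sin_cos_eq_iff[of \<theta> t] by auto
  then show thesis using rs that by blast
qed

lemma ang_polar:
  assumes "0 < r"
  obtains j :: int where "ang (polar r \<theta>) = \<theta> + 2 * pi * of_int j"
proof -
  have "polar r (ang (polar r \<theta>)) = polar r \<theta>" using polar_norm_ang[of "polar r \<theta>"] assms by (simp add: norm_polar)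
  then show thesis using polar_eqD assms that by blast
qed

lemma polar_onto:
  assumes "x \<noteq> 0"
  obtains r \<theta> where "0 < r" "0 \<le> \<theta>" "\<theta> < 2 * pi" "x = polar r \<theta>"
proof -
  define j where "j = \<lfloor>ang x / (2 * pi)\<rfloor>"
  have a: "of_int j \<le> ang x / (2 * pi)" "ang x / (2 * pi) < of_int j + 1"
    unfolding j_def by linarith+
  have "0 \<le> ang x - 2 * pi * of_int j" "ang x - 2 * pi * of_int j < 2 * pi"
    using a by (simp_all add: field_simps)
  moreover have "x = polar (norm x) (ang x - 2 * pi * of_int j)"
    using polar_periodic_int[of "norm x" "ang x" "- j"] polar_norm_ang[of x] by simp
  ultimately show thesis using assms by (intro that[of "norm x" "ang x - 2 * pi * of_int j"]) auto
qed

lemma polar_has_derivative: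
  "((\<lambda>p. polar (fst p) (snd p)) has_derivative
    (\<lambda>d. fst d *\<^sub>R polar 1 \<theta> + snd d *\<^sub>R polar r (\<theta> + pi / 2))) (at (r, \<theta>) within S)"
proof -
  have eq: "(\<lambda>p. polar (fst p) (snd p)) = (\<lambda>p. fst p *\<^sub>R (cos (snd p) *\<^sub>R axis 1 1 + sin (snd p) *\<^sub>R axis 2 1))"
    by (simp add: fun_eq_iff vec2_eq_iff axis_def)
  show ?thesis unfolding eq
    by (auto intro!: derivative_eq_intros simp: fun_eq_iff vec2_eq_iff axis_def algebra_simps)
qed

lemma continuous_on_polar [continuous_intros]:
  fixes f g :: "'a::t2_space \<Rightarrow> real"
  assumes "continuous_on S f" "continuous_on S g"
  shows "continuous_on S (\<lambda>x. polar (f x) (g x))"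
proof -
  have eq: "(\<lambda>x. polar (f x) (g x)) = (\<lambda>x. f x *\<^sub>R (cos (g x) *\<^sub>R axis 1 1 + sin (g x) *\<^sub>R axis 2 1))"
    by (simp add: fun_eq_iff vec2_eq_iff axis_def)
  show ?thesis unfolding eq by (intro continuous_intros assms)
qed

lemma open_polar_preimage:
  assumes "open G"
  shows "open {p :: real \<times> real. 0 < fst p \<and> polar (fst p) (snd p) \<in> G}"
proof -
  have "open ((\<lambda>p. polar (fst p) (snd p)) -` G \<inter> {p :: real \<times> real. 0 < fst p})"
    by (intro open_Int open_vimage assms open_Collect_less continuous_intros)
  then show ?thesis by (simp add: vimage_def Int_def conj_commute)
qed

lemma polar_radial_derivative:
  assumes "\<phi> differentiable (at (polar r \<theta>))"
  shows "((\<lambda>r. \<phi> (polar r \<theta>)) has_vector_derivative frechet_derivative \<phi> (at (polar r \<theta>)) (polar 1 \<theta>)) (at r)"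
proof -
  have "((\<lambda>r. r *\<^sub>R polar 1 \<theta>) has_derivative (\<lambda>h. h *\<^sub>R polar 1 \<theta>)) (at r)"
    by (auto intro!: derivative_eq_intros)
  moreover have "(\<lambda>r. r *\<^sub>R polar 1 \<theta>) = (\<lambda>r. polar r \<theta>)" by (simp add: fun_eq_iff vec2_eq_iff)
  ultimately have 1: "((\<lambda>r. polar r \<theta>) has_derivative (\<lambda>h. h *\<^sub>R polar 1 \<theta>)) (at r)" by simp
  have l: "linear (frechet_derivative \<phi> (at (polar r \<theta>)))" using assms by (rule linear_frechet_derivative)
  have "(\<phi> has_derivative frechet_derivative \<phi> (at (polar r \<theta>))) (at (polar r \<theta>))"
    using assms frechet_derivative_works by blast
  from has_derivative_compose[OF 1 this] show ?thesis
    by (simp add: has_vector_derivative_def linear_scale[OF l])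
qed

lemma polar_angular_derivative:
  assumes "\<phi> differentiable (at (polar r \<theta>))"
  shows "((\<lambda>\<theta>. \<phi> (polar r \<theta>)) has_vector_derivative
    frechet_derivative \<phi> (at (polar r \<theta>)) (polar r (\<theta> + pi / 2))) (at \<theta>)"
proof -
  have "((\<lambda>t. (r, t)) has_derivative (\<lambda>h. (0, h))) (at \<theta>)" by (auto intro!: derivative_eq_intros)
  from has_derivative_compose[OF this polar_has_derivative[of \<theta> r]]
  have 1: "((\<lambda>\<theta>. polar r \<theta>) has_derivative (\<lambda>h. h *\<^sub>R polar r (\<theta> + pi / 2))) (at \<theta>)" by simp
  have l: "linear (frechet_derivative \<phi> (at (polar r \<theta>)))" using assms by (rule linear_frechet_derivative)
  have "(\<phi> has_derivative frechet_derivative \<phi> (at (polar r \<theta>))) (at (polar r \<theta>))"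
    using assms frechet_derivative_works by blast
  from has_derivative_compose[OF 1 this] show ?thesis
    by (simp add: has_vector_derivative_def linear_scale[OF l])
qed

section \<open>A differentiable polar chart and transfer of limits\<close>

text \<open>The angle is read off from the logarithm of the point rotated by -\<theta>0, which puts
  the branch cut opposite to the given point. So L is differentiable there even where
  \<open>ang\<close> jumps, and it returns the prescribed angle instead of its principal value.
  Continuity, derivatives and limits pass from (r, \<theta>) to x through L.\<close>

lemma polar_chart:
  assumes "0 < r0"
  shows "\<exists>L. (\<forall>x. x \<noteq> 0 \<longrightarrow> polar (fst (L x)) (snd (L x)) = x) \<and> (\<forall>x. fst (L x) = norm x) \<and>
    L (polar r0 \<theta>0) = (r0, \<theta>0) \<and>
    (L has_derivative (\<lambda>v. (v \<bullet> polar 1 \<theta>0, v \<bullet> polar 1 (\<theta>0 + pi / 2) / r0))) (at (polar r0 \<theta>0))"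
proof -
  define q where "q x = Complex (x $ 1) (x $ 2) * cis (- \<theta>0)" for x :: "real^2"
  define L where "L x = (norm x, \<theta>0 + Im (Ln (q x)))" for x :: "real^2"
  have nq: "cmod (q x) = norm x" for x
    by (simp only: q_def norm_mult norm_cis mult_1_right)
      (simp add: cmod_def norm_eq_sqrt_inner inner_vec2 power2_eq_square)
  have q0: "q (polar r0 \<theta>0) = of_real r0"
    unfolding q_def Complex_polar by (simp add: cis_mult)
  have inv: "polar (fst (L x)) (snd (L x)) = x" if "x \<noteq> 0" for x
  proof -
    have "q x \<noteq> 0" using nq[of x] that by (metis norm_eq_zero)
    then have "q x = exp (Ln (q x))" by simp
    also have "\<dots> = of_real (norm x) * cis (Im (Ln (q x)))"
      using \<open>q x \<noteq> 0\<close> that nq[of x] exp_eq_polar[of "Ln (q x)"] by (simp del: exp_Ln)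
    finally have e: "q x = of_real (norm x) * cis (Im (Ln (q x)))" .
    define a where "a = Im (Ln (q x))"
    have "q x * cis \<theta>0 = of_real (norm x) * cis (\<theta>0 + Im (Ln (q x)))"
      using e unfolding a_def[symmetric] by (simp add: cis_mult add.commute mult.assoc)
    moreover have "q x * cis \<theta>0 = Complex (x $ 1) (x $ 2)"
      by (simp add: q_def mult.assoc cis_mult)
    ultimately have "Complex (polar (fst (L x)) (snd (L x)) $ 1) (polar (fst (L x)) (snd (L x)) $ 2) = Complex (x $ 1) (x $ 2)"
      unfolding Complex_polar by (simp add: L_def)
    then show ?thesis by (simp add: vec2_eq_iff)
  qed
  have lq: "linear q"
    by (rule linearI) (simp_all add: q_def complex_eq_iff algebra_simps)
  have dq: "(q has_derivative q) (at (polar r0 \<theta>0))"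
    by (rule linear_imp_has_derivative[OF lq])
  have "(Ln has_field_derivative inverse (of_real r0)) (at (of_real r0))"
    using has_field_derivative_Ln[of "of_real r0"] assms by (simp add: complex_nonpos_Reals_iff)
  then have dL: "(Ln has_derivative (*) (inverse (of_real r0))) (at (q (polar r0 \<theta>0)))"
    unfolding q0 has_field_derivative_def .
  have dIm: "((\<lambda>x. Im (Ln (q x))) has_derivative (\<lambda>v. Im (inverse (of_real r0) * q v))) (at (polar r0 \<theta>0))"
    by (rule bounded_linear.has_derivative[OF bounded_linear_Im has_derivative_compose[OF dq dL]])
  have dn: "(norm has_derivative (\<lambda>v. v \<bullet> polar 1 \<theta>0)) (at (polar r0 \<theta>0))"
  proof -
    have s: "sgn (polar r0 \<theta>0) = polar 1 \<theta>0"
      using assms by (simp add: sgn_div_norm norm_polar vec2_eq_iff)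
    show ?thesis
      using has_derivative_norm[of "polar r0 \<theta>0"] assms unfolding s
      by (simp add: inner_commute[of "polar 1 \<theta>0"])
  qed
  have "(L has_derivative (\<lambda>v. (v \<bullet> polar 1 \<theta>0, Im (inverse (of_real r0) * q v)))) (at (polar r0 \<theta>0))"
    unfolding L_def[abs_def]
    by (rule has_derivative_Pair[OF dn]) (use has_derivative_add[OF has_derivative_const[of \<theta>0] dIm] in simp)
  moreover have "Im (inverse (of_real r0) * q v) = v \<bullet> polar 1 (\<theta>0 + pi / 2) / r0" for v
  proof -
    have "Im (inverse (of_real r0) * q v) = Im (q v) / r0"
      by (simp add: divide_inverse mult.commute flip: of_real_inverse)
    also have "Im (q v) = v \<bullet> polar 1 (\<theta>0 + pi / 2)" by (simp add: q_def inner_vec2)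
    finally show ?thesis .
  qed
  ultimately have "(L has_derivative (\<lambda>v. (v \<bullet> polar 1 \<theta>0, v \<bullet> polar 1 (\<theta>0 + pi / 2) / r0))) (at (polar r0 \<theta>0))"
    by simp
  moreover have "L (polar r0 \<theta>0) = (r0, \<theta>0)"
    unfolding L_def q0 using assms by (simp add: norm_polar flip: Ln_of_real)
  moreover have "fst (L x) = norm x" for x by (simp add: L_def)
  ultimately show ?thesis using inv by blast
qed

lemma eventually_nonzero: "x0 \<noteq> 0 \<Longrightarrow> \<forall>\<^sub>F x in nhds x0. x \<noteq> (0 :: real^2)"
  using eventually_nhds_in_open[of "- {0}" x0] by auto

lemma isCont_from_polar:
  assumes "0 < r" "isCont (\<lambda>p. F (polar (fst p) (snd p))) (r, \<theta>)"
  shows "isCont F (polar r \<theta>)"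
proof -
  obtain L where L: "\<And>x. x \<noteq> 0 \<Longrightarrow> polar (fst (L x)) (snd (L x)) = x" "\<And>x. fst (L x) = norm x" "L (polar r \<theta>) = (r, \<theta>)"
    "(L has_derivative (\<lambda>v. (v \<bullet> polar 1 \<theta>, v \<bullet> polar 1 (\<theta> + pi / 2) / r))) (at (polar r \<theta>))"
    using polar_chart[OF assms(1), of \<theta>] by blast
  have "isCont L (polar r \<theta>)" using L(4) by (rule has_derivative_continuous)
  then have "isCont (\<lambda>x. F (polar (fst (L x)) (snd (L x)))) (polar r \<theta>)"
    using assms(2) L(3) by (intro isCont_o2[where f = L and g = "\<lambda>p. F (polar (fst p) (snd p))"]) auto
  moreover have "\<forall>\<^sub>F x in nhds (polar r \<theta>). F (polar (fst (L x)) (snd (L x))) = F x"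
    using eventually_nonzero[of "polar r \<theta>"] assms(1) by (auto elim!: eventually_mono simp: L(1))
  ultimately show ?thesis using isCont_cong[of "\<lambda>x. F (polar (fst (L x)) (snd (L x)))" F] by blast
qed

lemma has_derivative_from_polar:
  assumes "0 < r" "((\<lambda>p. F (polar (fst p) (snd p))) has_derivative (\<lambda>d. fst d *\<^sub>R a + snd d *\<^sub>R b)) (at (r, \<theta>))"
  shows "(F has_derivative (\<lambda>v. (v \<bullet> polar 1 \<theta>) *\<^sub>R a + (v \<bullet> polar 1 (\<theta> + pi / 2) / r) *\<^sub>R b)) (at (polar r \<theta>))"
proof -
  obtain L where L: "\<And>x. x \<noteq> 0 \<Longrightarrow> polar (fst (L x)) (snd (L x)) = x" "\<And>x. fst (L x) = norm x" "L (polar r \<theta>) = (r, \<theta>)"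
    "(L has_derivative (\<lambda>v. (v \<bullet> polar 1 \<theta>, v \<bullet> polar 1 (\<theta> + pi / 2) / r))) (at (polar r \<theta>))"
    using polar_chart[OF assms(1), of \<theta>] by blast
  have "((\<lambda>p. F (polar (fst p) (snd p))) has_derivative (\<lambda>d. fst d *\<^sub>R a + snd d *\<^sub>R b)) (at (L (polar r \<theta>)))"
    unfolding L(3) by (rule assms(2))
  from has_derivative_compose[OF L(4) this]
  have "((\<lambda>x. F (polar (fst (L x)) (snd (L x)))) has_derivative
      (\<lambda>v. (v \<bullet> polar 1 \<theta>) *\<^sub>R a + (v \<bullet> polar 1 (\<theta> + pi / 2) / r) *\<^sub>R b)) (at (polar r \<theta>))"
    by simp
  moreover have "\<forall>\<^sub>F x in nhds (polar r \<theta>). F (polar (fst (L x)) (snd (L x))) = F x"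
    using eventually_nonzero[of "polar r \<theta>"] assms(1) by (auto elim!: eventually_mono simp: L(1))
  moreover have "F (polar (fst (L (polar r \<theta>))) (snd (L (polar r \<theta>)))) = F (polar r \<theta>)" by (simp add: L(3))
  ultimately show ?thesis
    by (elim has_derivative_transform_eventually) (auto simp: eventually_at_filter elim: eventually_mono)
qed

lemma tendsto_from_polar:
  assumes "0 < r" "((\<lambda>p. F (polar (fst p) (snd p))) \<longlongrightarrow> l) (at (r, \<theta>) within {p. 0 < fst p \<and> polar (fst p) (snd p) \<in> A})"
  shows "(F \<longlongrightarrow> l) (at (polar r \<theta>) within A)"
proof -
  obtain L where L: "\<And>x. x \<noteq> 0 \<Longrightarrow> polar (fst (L x)) (snd (L x)) = x" "\<And>x. fst (L x) = norm x" "L (polar r \<theta>) = (r, \<theta>)"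
    "(L has_derivative (\<lambda>v. (v \<bullet> polar 1 \<theta>, v \<bullet> polar 1 (\<theta> + pi / 2) / r))) (at (polar r \<theta>))"
    using polar_chart[OF assms(1), of \<theta>] by blast
  have "isCont L (polar r \<theta>)" using L(4) by (rule has_derivative_continuous)
  then have "(L \<longlongrightarrow> (r, \<theta>)) (at (polar r \<theta>) within A)"
    unfolding isCont_def L(3) by (rule tendsto_within_subset) simp
  moreover have ne: "\<forall>\<^sub>F x in at (polar r \<theta>) within A. x \<in> A \<and> x \<noteq> polar r \<theta> \<and> x \<noteq> 0"
    using eventually_nonzero[of "polar r \<theta>"] assms(1) by (auto simp: eventually_at_filter elim: eventually_mono)
  then have "\<forall>\<^sub>F x in at (polar r \<theta>) within A. L x \<in> {p. 0 < fst p \<and> polar (fst p) (snd p) \<in> A} \<and> L x \<noteq> (r, \<theta>)"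
  proof (rule eventually_mono)
    fix x assume x: "x \<in> A \<and> x \<noteq> polar r \<theta> \<and> x \<noteq> 0"
    then have "polar (fst (L x)) (snd (L x)) = x" using L(1) by blast
    then show "L x \<in> {p. 0 < fst p \<and> polar (fst p) (snd p) \<in> A} \<and> L x \<noteq> (r, \<theta>)"
      using x L(2)[of x] by auto
  qed
  ultimately have "filterlim L (at (r, \<theta>) within {p. 0 < fst p \<and> polar (fst p) (snd p) \<in> A}) (at (polar r \<theta>) within A)"
    by (simp add: filterlim_at eventually_conj_iff)
  from filterlim_compose[OF assms(2) this]
  have "((\<lambda>x. F (polar (fst (L x)) (snd (L x)))) \<longlongrightarrow> l) (at (polar r \<theta>) within A)" .
  then show ?thesis
    by (rule Lim_transform_eventually) (use ne in \<open>auto elim!: eventually_mono simp: L(1)\<close>)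
qed

section \<open>The divergence theorem in polar coordinates\<close>

lemma Basis_vec2: "(Basis :: (real^2) set) = {axis 1 1, axis 2 1}"
  by (auto simp: Basis_vec_def UNIV_2)

text \<open>Iterated integrals are taken over pairs, the change of variables over vectors. The two
  Lebesgue measures are identified by their values on boxes.\<close>

lemma lborel_vec2: "(lborel :: (real^2) measure) = distr (lborel :: (real \<times> real) measure) borel (\<lambda>p. vector [fst p, snd p])"
proof (rule lborel_eqI)
  have m: "(\<lambda>p. vector [fst p, snd p] :: real^2) \<in> borel_measurable (borel :: (real \<times> real) measure)"
  proof (rule borel_measurable_continuous_onI)
    have eq: "(\<lambda>p. vector [fst p, snd p] :: real^2) = (\<lambda>p. fst p *\<^sub>R axis 1 1 + snd p *\<^sub>R axis 2 1)"
      by (simp add: fun_eq_iff vec2_eq_iff axis_def)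
    show "continuous_on UNIV (\<lambda>p. vector [fst p, snd p] :: real^2)" unfolding eq by (intro continuous_intros)
  qed
  fix l u :: "real^2" assume lu: "\<And>b. b \<in> Basis \<Longrightarrow> l \<bullet> b \<le> u \<bullet> b"
  have ax: "axis i (1::real) \<in> Basis" for i :: 2 by (simp add: axis_in_Basis_iff)
  have le: "l $ i \<le> u $ i" for i using lu[OF ax[of i]] by (simp add: inner_axis)
  have "(\<lambda>p. vector [fst p, snd p] :: real^2) -` box l u = box (l $ 1, l $ 2) (u $ 1, u $ 2)"
    by (auto simp: box_def Basis_vec2 Basis_prod_def inner_axis)
  then have "emeasure (distr lborel borel (\<lambda>p. vector [fst p, snd p] :: real^2)) (box l u)
      = emeasure lborel (box (l $ 1, l $ 2) (u $ 1, u $ 2))"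
    using m by (subst emeasure_distr) auto
  also have "\<dots> = ennreal (\<Prod>b\<in>Basis. ((u $ 1, u $ 2) - (l $ 1, l $ 2)) \<bullet> b)"
    by (rule emeasure_lborel_box) (use le in \<open>auto simp: Basis_prod_def\<close>)
  also have "(\<Prod>b\<in>Basis. ((u $ 1, u $ 2) - (l $ 1, l $ 2)) \<bullet> b) = (u $ 1 - l $ 1) * (u $ 2 - l $ 2)"
    by (simp add: Basis_prod_def)
  also have "\<dots> = (\<Prod>b\<in>Basis. (u - l) \<bullet> b)"
  proof -
    have "axis 1 (1::real) \<noteq> (axis 2 1 :: real^2)" by (simp add: vec2_eq_iff axis_def)
    then show ?thesis by (simp add: inner_axis Basis_vec2)
  qed
  finally show "emeasure (distr lborel borel (\<lambda>p. vector [fst p, snd p] :: real^2)) (box l u) = ennreal (\<Prod>b\<in>Basis. (u - l) \<bullet> b)" .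
qed simp

lemma integrable_vec2:
  fixes g :: "real \<times> real \<Rightarrow> 'b::{banach, second_countable_topology}"
  assumes "integrable lborel g"
  shows "integrable lborel (\<lambda>v::real^2. g (v $ 1, v $ 2))" "(LINT v::real^2|lborel. g (v $ 1, v $ 2)) = (LINT p|lborel. g p)"
proof -
  have m: "(\<lambda>p. vector [fst p, snd p] :: real^2) \<in> measurable (lborel :: (real \<times> real) measure) borel"
  proof (simp, rule borel_measurable_continuous_onI)
    have eq: "(\<lambda>p. vector [fst p, snd p] :: real^2) = (\<lambda>p. fst p *\<^sub>R axis 1 1 + snd p *\<^sub>R axis 2 1)"
      by (simp add: fun_eq_iff vec2_eq_iff axis_def)
    show "continuous_on UNIV (\<lambda>p. vector [fst p, snd p] :: real^2)" unfolding eq by (intro continuous_intros)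
  qed
  have g: "g \<in> borel_measurable borel" using borel_measurable_integrable[OF assms] by simp
  have pr: "(\<lambda>v::real^2. (v $ 1, v $ 2)) \<in> borel_measurable borel"
    by (intro borel_measurable_continuous_onI continuous_intros)
  have gm: "(\<lambda>v::real^2. g (v $ 1, v $ 2)) \<in> borel_measurable borel"
    by (rule measurable_compose[OF pr g])
  show "integrable lborel (\<lambda>v::real^2. g (v $ 1, v $ 2))"
    unfolding lborel_vec2 using assms by (subst integrable_distr_eq[OF m gm]) simp
  show "(LINT v::real^2|lborel. g (v $ 1, v $ 2)) = (LINT p|lborel. g p)"
    unfolding lborel_vec2 by (subst integral_distr[OF m gm]) simp
qed

lemma inj_on_polar: "inj_on (\<lambda>v::real^2. polar (v $ 1) (v $ 2)) {v. 0 < v $ 1 \<and> 0 < v $ 2 \<and> v $ 2 < 2 * pi}"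
proof (rule inj_onI, safe)
  fix v w :: "real^2"
  assume v: "0 < v $ 1" "0 < v $ 2" "v $ 2 < 2 * pi" and w: "0 < w $ 1" "0 < w $ 2" "w $ 2 < 2 * pi"
    and "polar (v $ 1) (v $ 2) = polar (w $ 1) (w $ 2)"
  then obtain j :: int where j: "v $ 1 = w $ 1" "v $ 2 = w $ 2 + 2 * pi * of_int j" using polar_eqD by blast
  have "2 * pi * of_int j < 2 * pi * 1" "2 * pi * (- 1) < 2 * pi * of_int j"
    using j(2) v w by linarith+
  then have "of_int j < (1::real)" "- 1 < (of_int j :: real)"
    using mult_left_less_imp_less[of "2 * pi" "of_int j" 1] mult_left_less_imp_less[of "2 * pi" "- 1" "of_int j"]
    by simp_all
  then have "j = 0" by linarith
  then show "v = w" using j by (simp add: vec2_eq_iff)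
qed

text \<open>Complex integrands are passed through plane vectors, the form in which the change of
  variables is applied.\<close>

definition vec_of :: "complex \<Rightarrow> real^2" where "vec_of z = vector [Re z, Im z]"
definition of_vec :: "real^2 \<Rightarrow> complex" where "of_vec v = Complex (v $ 1) (v $ 2)"

lemma vec_of_linear: "bounded_linear vec_of" and of_vec_linear: "bounded_linear of_vec" and of_vec_of [simp]: "of_vec (vec_of z) = z"
proof -
  show "of_vec (vec_of z) = z" by (simp add: of_vec_def vec_of_def)
  show "bounded_linear vec_of" by (rule linear_conv_bounded_linear[THEN iffD1, OF linearI]) (auto simp: vec_of_def vec2_eq_iff)
  show "bounded_linear of_vec" by (rule linear_conv_bounded_linear[THEN iffD1, OF linearI]) (auto simp: of_vec_def complex_eq_iff)
qed

lemma polar_change_of_variables: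
  fixes H :: "real^2 \<Rightarrow> complex"
  defines "Q \<equiv> {p. 0 < fst p \<and> 0 < snd p \<and> snd p < 2 * pi}"
  assumes g: "integrable lborel g" and eq: "\<And>p. g p = indicator Q p *\<^sub>R (fst p *\<^sub>R H (polar (fst p) (snd p)))"
  shows "integrable lebesgue H \<and> integral\<^sup>L lebesgue H = integral\<^sup>L lborel g"
proof -
  define S where "S = {v::real^2. 0 < v $ 1 \<and> 0 < v $ 2 \<and> v $ 2 < 2 * pi}"
  define pol where "pol v = polar (v $ 1) (v $ 2)" for v :: "real^2"
  define pol' where "pol' v h = h $ 1 *\<^sub>R polar 1 (v $ 2) + h $ 2 *\<^sub>R polar (v $ 1) (v $ 2 + pi / 2)" for v h :: "real^2"
  have oS: "open S" unfolding S_def by (intro open_Collect_conj open_Collect_less continuous_intros)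
  have dpol: "(pol has_derivative pol' v) (at v within S)" for v
  proof -
    have "((\<lambda>v::real^2. (v $ 1, v $ 2)) has_derivative (\<lambda>h. (h $ 1, h $ 2))) (at v within S)"
      by (intro has_derivative_Pair bounded_linear_imp_has_derivative bounded_linear_vec_nth)
    from has_derivative_compose[OF this polar_has_derivative] show ?thesis
      by (simp add: pol_def[abs_def] pol'_def[abs_def])
  qed
  have det: "\<bar>det (matrix (pol' v))\<bar> = v $ 1" if "v \<in> S" for v
  proof -
    have "det (matrix (pol' v)) = cos (v $ 2) * (v $ 1 * cos (v $ 2)) + v $ 1 * sin (v $ 2) * sin (v $ 2)"
      by (simp add: det_2 matrix_def pol'_def axis_def)
    also have "\<dots> = v $ 1 * ((cos (v $ 2))\<^sup>2 + (sin (v $ 2))\<^sup>2)"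
      unfolding power2_eq_square by algebra
    finally have "det (matrix (pol' v)) = v $ 1 * ((cos (v $ 2))\<^sup>2 + (sin (v $ 2))\<^sup>2)" .
    then show ?thesis using that by (simp add: S_def)
  qed
  define F where "F x = vec_of (H x)" for x
  define b where "b = vec_of (integral\<^sup>L lborel g)"
  define gv where "gv v = vec_of (g (v $ 1, v $ 2))" for v :: "real^2"
  have gv1: "integrable lborel gv" and gv2: "integral\<^sup>L lborel gv = b"
  proof -
    show "integrable lborel gv" unfolding gv_def
      by (rule integrable_bounded_linear[OF vec_of_linear integrable_vec2(1)[OF g]])
    show "integral\<^sup>L lborel gv = b" unfolding gv_def b_def integrable_vec2(2)[OF g, symmetric]
      by (rule integral_bounded_linear[OF vec_of_linear integrable_vec2(1)[OF g]])
  qed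
  have gvm: "gv \<in> borel_measurable lborel" using gv1 by auto
  have gv: "gv v = indicator S v *\<^sub>R (v $ 1 *\<^sub>R F (pol v))" for v
    using linear_scale[OF bounded_linear.linear[OF vec_of_linear]] linear_0[OF bounded_linear.linear[OF vec_of_linear]]
    by (auto simp: gv_def F_def pol_def eq Q_def S_def indicator_def)
  have "set_integrable lebesgue S (\<lambda>v. v $ 1 *\<^sub>R F (pol v))"
    unfolding set_integrable_def gv[symmetric] using integrable_completion[OF gvm] gv1 by simp
  moreover have "(LINT v:S|lebesgue. v $ 1 *\<^sub>R F (pol v)) = b"
    unfolding set_lebesgue_integral_def gv[symmetric] using integral_completion[OF gvm] gv2 by simp
  ultimately have "(\<lambda>v. v $ 1 *\<^sub>R F (pol v)) absolutely_integrable_on S \<and> integral S (\<lambda>v. v $ 1 *\<^sub>R F (pol v)) = b"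
    using set_lebesgue_integral_eq_integral(2)[of S "\<lambda>v. v $ 1 *\<^sub>R F (pol v)"] by simp
  moreover have "(\<lambda>v. \<bar>det (matrix (pol' v))\<bar> *\<^sub>R F (pol v)) absolutely_integrable_on S \<longleftrightarrow> (\<lambda>v. v $ 1 *\<^sub>R F (pol v)) absolutely_integrable_on S"
    by (rule set_integrable_cong) (auto simp: det)
  moreover have "integral S (\<lambda>v. \<bar>det (matrix (pol' v))\<bar> *\<^sub>R F (pol v)) = integral S (\<lambda>v. v $ 1 *\<^sub>R F (pol v))"
    by (rule integral_cong) (simp add: det)
  ultimately have img: "F absolutely_integrable_on (pol ` S) \<and> integral (pol ` S) F = b"
    using has_absolute_integral_change_of_variables[where S = S and f = F and b = b and g = pol and g' = pol', OF _ dpol] inj_on_polar oS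
    by (simp add: S_def pol_def[abs_def] lmeasurable_iff_integrable borel_open)
  \<comment> \<open>The open angular range misses the ray \<theta> = 0 and the origin, and both lie
    on a coordinate axis.\<close>
  have null: "negligible (UNIV - pol ` S)"
  proof (rule negligible_subset)
    show "negligible {x::real^2. axis 2 1 \<bullet> x = 0}" by (rule negligible_hyperplane) simp
    show "UNIV - pol ` S \<subseteq> {x::real^2. axis 2 1 \<bullet> x = 0}"
    proof safe
      fix x :: "real^2" assume x: "x \<notin> pol ` S"
      show "axis 2 1 \<bullet> x = 0"
      proof (cases "x = 0")
        case False
        then obtain r \<theta> where r: "0 < r" "0 \<le> \<theta>" "\<theta> < 2 * pi" "x = polar r \<theta>" by (rule polar_onto)
        have "\<theta> = 0"
        proof (rule ccontr)
          assume "\<theta> \<noteq> 0"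
          then have "vector [r, \<theta>] \<in> S" using r by (simp add: S_def)
          moreover have "x = pol (vector [r, \<theta>])" using r by (simp add: pol_def)
          ultimately show False using x by blast
        qed
        then show ?thesis using r by (simp add: inner_axis')
      qed simp
    qed
  qed
  have n1: "negligible {x \<in> pol ` S - UNIV. F x \<noteq> 0}" by simp
  have n2: "negligible {x \<in> UNIV - pol ` S. F x \<noteq> 0}" by (rule negligible_subset[OF null]) auto
  have "F absolutely_integrable_on UNIV"
    using absolutely_integrable_spike_set_eq[OF n1 n2] img by blast
  moreover have "integral UNIV F = b"
    using integral_spike_set[OF n1 n2] img by simp
  ultimately have F: "integrable lebesgue F" "integral\<^sup>L lebesgue F = b"
    using set_lebesgue_integral_eq_integral(2)[of UNIV F] by (auto simp: set_integrable_def set_lebesgue_integral_def)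
  have HF: "H = (\<lambda>x. of_vec (F x))" by (simp add: F_def)
  have "integrable lebesgue H" unfolding HF by (rule integrable_bounded_linear[OF of_vec_linear F(1)])
  moreover have "integral\<^sup>L lebesgue H = of_vec b"
    unfolding HF F(2)[symmetric] by (rule integral_bounded_linear[OF of_vec_linear F(1)])
  ultimately show ?thesis by (simp add: b_def)
qed

section \<open>Green's formula in polar coordinates\<close>

text \<open>By Fubini each term is integrated first in the variable of its derivative: A vanishes at
  both radial ends and B is periodic, so the fundamental theorem gives 0. A may jump at angles in T,
  being differentiated in r only; B has to be continuous there.\<close>

lemma planar_divergence:
  fixes A B A' B' :: "real \<Rightarrow> real \<Rightarrow> complex"
  assumes T: "closed T" "finite (T \<inter> {0..2*pi})" and r: "0 < r1" "r1 \<le> r2"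
    and A: "\<And>r \<theta>. 0 < r \<Longrightarrow> \<theta> \<notin> T \<Longrightarrow> ((\<lambda>r. A r \<theta>) has_vector_derivative A' r \<theta>) (at r)"
    and B: "\<And>r \<theta>. 0 < r \<Longrightarrow> \<theta> \<notin> T \<Longrightarrow> (B r has_vector_derivative B' r \<theta>) (at \<theta>)"
    and Bc: "\<And>r. 0 < r \<Longrightarrow> continuous_on {0..2*pi} (B r)" "\<And>r. 0 < r \<Longrightarrow> B r (2*pi) = B r 0"
    and cont: "continuous_on {p. 0 < fst p \<and> snd p \<notin> T} (\<lambda>p. A' (fst p) (snd p))"
      "continuous_on {p. 0 < fst p \<and> snd p \<notin> T} (\<lambda>p. B' (fst p) (snd p))"
    and bnd: "\<And>r \<theta>. 0 < r \<Longrightarrow> 0 \<le> \<theta> \<Longrightarrow> \<theta> \<le> 2 * pi \<Longrightarrow> \<theta> \<notin> T \<Longrightarrow> norm (A' r \<theta>) \<le> M \<and> norm (B' r \<theta>) \<le> M"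
    and supp: "\<And>r \<theta>. 0 < r \<Longrightarrow> r \<notin> {r1..r2} \<Longrightarrow> A r \<theta> = 0 \<and> A' r \<theta> = 0 \<and> B' r \<theta> = 0"
  defines "Q \<equiv> {p. 0 < fst p \<and> 0 < snd p \<and> snd p < 2 * pi}"
  shows "integrable lborel (\<lambda>p. indicator (Q - UNIV \<times> T) p *\<^sub>R (A' (fst p) (snd p) + B' (fst p) (snd p)))
    \<and> (LINT p|lborel. indicator (Q - UNIV \<times> T) p *\<^sub>R (A' (fst p) (snd p) + B' (fst p) (snd p))) = 0"
proof -
  define P where "P = Q - UNIV \<times> T"
  have oP: "open P" unfolding P_def Q_def using T(1)
    by (intro open_Diff open_Collect_conj open_Collect_less continuous_intros closed_Times closed_UNIV)
  define a where "a p = indicator P p *\<^sub>R A' (fst p) (snd p)" for p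
  define b where "b p = indicator P p *\<^sub>R B' (fst p) (snd p)" for p
  have am: "a \<in> borel_measurable borel" and bm: "b \<in> borel_measurable borel"
    unfolding a_def b_def using oP
    by (auto intro!: borel_measurable_continuous_on_indicator continuous_on_subset[OF cont(1)] continuous_on_subset[OF cont(2)]
        simp: P_def Q_def)
  have ab: "norm (a p) \<le> max M 0 \<and> norm (b p) \<le> max M 0" "fst p \<notin> {r1..r2} \<or> snd p \<notin> {0..2*pi} \<Longrightarrow> a p = 0 \<and> b p = 0" for p
    using bnd[of "fst p" "snd p"] supp[of "fst p" "snd p"]
    by (auto simp: a_def b_def P_def Q_def indicator_def mem_Times_iff)
  have fin: "emeasure lborel ({r1..r2} \<times> {0..2*pi} :: (real \<times> real) set) < \<infinity>"
    by (rule emeasure_bounded_finite) (simp add: bounded_Times)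
  have out: "a p = 0 \<and> b p = 0" if "p \<notin> {r1..r2} \<times> {0..2*pi}" for p
    using that ab(2)[of p] by (auto simp: mem_Times_iff)
  have rect: "{r1..r2} \<times> {0..2*pi} \<in> sets (lborel :: (real \<times> real) measure)"
    by (simp add: borel_closed closed_Times)
  have ai: "integrable lborel a" and bi: "integrable lborel b"
    using am bm ab(1) out
    by (intro integrableI_bounded_set[OF rect _ fin, where B = "max M 0"] AE_I2; simp)+
  have ai': "integrable (lborel \<Otimes>\<^sub>M lborel) a" and bi': "integrable (lborel \<Otimes>\<^sub>M lborel) b"
    using ai bi by (simp_all add: lborel_prod)
  have one: "LINT r|lborel. a (r, \<theta>) = 0" for \<theta>
  proof (cases "0 < \<theta> \<and> \<theta> < 2 * pi \<and> \<theta> \<notin> T")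
    case True
    have int: "integrable lborel (\<lambda>r. a (r, \<theta>))"
    proof (rule integrableI_bounded_set[where A = "{r1..r2}" and B = "max M 0"])
      show "(\<lambda>r. a (r, \<theta>)) \<in> borel_measurable lborel"
        using am by (auto intro!: measurable_compose[OF _ am] borel_measurable_continuous_onI continuous_intros)
    qed (use ab in \<open>auto simp: emeasure_lborel_Icc_eq\<close>)
    \<comment> \<open>Both endpoints are positive and lie outside the radial support, so the
      boundary terms vanish.\<close>
    have "((\<lambda>r. A' r \<theta>) has_integral (A (r2 + 1) \<theta> - A (r1 / 2) \<theta>)) {r1 / 2..r2 + 1}"
    proof (rule fundamental_theorem_of_calculus)
      fix x assume "x \<in> {r1 / 2..r2 + 1}"
      then show "((\<lambda>r. A r \<theta>) has_vector_derivative A' x \<theta>) (at x within {r1 / 2..r2 + 1})"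
        using r True by (intro has_vector_derivative_at_within[OF A]) auto
    qed (use r in simp)
    moreover have "A (r2 + 1) \<theta> = 0" "A (r1 / 2) \<theta> = 0" using supp[of "r2 + 1" \<theta>] supp[of "r1 / 2" \<theta>] r by auto
    ultimately have "((\<lambda>r. A' r \<theta>) has_integral 0) {r1 / 2..r2 + 1}" by simp
    then have "((\<lambda>r. a (r, \<theta>)) has_integral 0) {r1 / 2..r2 + 1}"
      by (rule has_integral_eq[rotated]) (use True r in \<open>auto simp: a_def P_def Q_def\<close>)
    then have "((\<lambda>r. a (r, \<theta>)) has_integral 0) UNIV"
      by (rule has_integral_on_superset) (use ab r in auto)
    then show ?thesis using has_integral_integral_lborel[OF int] has_integral_unique by blast
  qed (auto simp: a_def P_def Q_def)
  have two: "LINT \<theta>|lborel. b (r, \<theta>) = 0" for r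
  proof (cases "0 < r")
    case True
    have int: "integrable lborel (\<lambda>\<theta>. b (r, \<theta>))"
    proof (rule integrableI_bounded_set[where A = "{0..2*pi}" and B = "max M 0"])
      show "(\<lambda>\<theta>. b (r, \<theta>)) \<in> borel_measurable lborel"
        using bm by (auto intro!: measurable_compose[OF _ bm] borel_measurable_continuous_onI continuous_intros)
    qed (use ab in \<open>auto simp: emeasure_lborel_Icc_eq\<close>)
    have "((\<lambda>\<theta>. B' r \<theta>) has_integral (B r (2*pi) - B r 0)) {0..2*pi}"
    proof (rule fundamental_theorem_of_calculus_interior_strong[OF T(2) _ _ Bc(1)[OF True]])
      fix x assume "x \<in> {0<..<2*pi} - T \<inter> {0..2*pi}"
      then show "(B r has_vector_derivative B' r x) (at x)" using B[OF True, of x] by auto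
    qed simp
    then have "((\<lambda>\<theta>. B' r \<theta>) has_integral 0) {0..2*pi}" using Bc(2)[OF True] by simp
    then have "((\<lambda>\<theta>. b (r, \<theta>)) has_integral 0) {0..2*pi}"
      by (rule has_integral_spike_finite[of "insert 0 (insert (2*pi) (T \<inter> {0..2*pi}))", rotated -1])
        (use True T in \<open>auto simp: b_def P_def Q_def\<close>)
    then have "((\<lambda>\<theta>. b (r, \<theta>)) has_integral 0) UNIV"
      by (rule has_integral_on_superset) (use ab in auto)
    then show ?thesis using has_integral_integral_lborel[OF int] has_integral_unique by blast
  qed (auto simp: b_def P_def Q_def)
  have "integral\<^sup>L lborel a = (LINT \<theta>|lborel. LINT r|lborel. a (r, \<theta>))"
    using lborel_pair.integral_snd[of "\<lambda>r \<theta>. a (r, \<theta>)"] ai' by (simp add: lborel_prod)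
  then have "integral\<^sup>L lborel a = 0" by (simp add: one)
  moreover have "integral\<^sup>L lborel b = (LINT r|lborel. LINT \<theta>|lborel. b (r, \<theta>))"
    using lborel_pair.integral_fst'[of b] bi' by (simp add: lborel_prod)
  then have "integral\<^sup>L lborel b = 0" by (simp add: two)
  moreover have "(\<lambda>p. indicator (Q - UNIV \<times> T) p *\<^sub>R (A' (fst p) (snd p) + B' (fst p) (snd p))) = (\<lambda>p. a p + b p)"
    by (simp add: a_def b_def P_def fun_eq_iff scaleR_add_right)
  ultimately show ?thesis using ai bi by simp
qed

lemma test_function_coefficients:
  fixes f g :: "real \<times> real \<Rightarrow> real"
  assumes \<phi>: "\<phi> \<in> test_functions G" and fg: "continuous_on UNIV f" "continuous_on UNIV g"
  shows "continuous_on UNIV (\<lambda>p::real \<times> real. \<phi> (polar (fst p) (snd p)))"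
    and "continuous_on UNIV (\<lambda>p. frechet_derivative \<phi> (at (polar (fst p) (snd p))) (polar (f p) (g p)))"
proof -
  note sm = test_functionsD(1)[OF \<phi>]
  have pc: "continuous_on UNIV (\<lambda>p::real \<times> real. polar (fst p) (snd p))" by (intro continuous_intros)
  show "continuous_on UNIV (\<lambda>p::real \<times> real. \<phi> (polar (fst p) (snd p)))"
    by (rule continuous_on_compose2[OF smooth_continuous[OF sm, of UNIV] pc]) simp
  have "continuous_on UNIV (partial i \<phi>)" for i
    by (rule smooth_continuous[OF test_functionsD(1)[OF test_functions_partial[OF \<phi>]]])
  then have c: "continuous_on UNIV (\<lambda>p::real \<times> real. partial i \<phi> (polar (fst p) (snd p)))" for i
    by (rule continuous_on_compose2[OF _ pc]) simp
  show "continuous_on UNIV (\<lambda>p. frechet_derivative \<phi> (at (polar (fst p) (snd p))) (polar (f p) (g p)))"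
    unfolding frechet_partial[OF smooth_differentiable[OF sm]] sum_2 polar_nth
    by (intro continuous_intros c fg)
qed

text \<open>Outside G the factor F is arbitrary, but K is closed and contained in G, so c vanishes
  in a whole neighbourhood of every such point.\<close>

lemma cut_off_continuous:
  fixes F :: "real \<Rightarrow> real \<Rightarrow> complex"
  assumes G: "open G" and K: "closed K" "K \<subseteq> G" and T: "closed T"
    and c: "continuous_on UNIV c" "\<And>p. polar (fst p) (snd p) \<notin> K \<Longrightarrow> c p = 0"
    and F: "continuous_on {p. 0 < fst p \<and> polar (fst p) (snd p) \<in> G \<and> snd p \<notin> T} (\<lambda>p. F (fst p) (snd p))"
  shows "continuous_on {p. 0 < fst p \<and> snd p \<notin> T} (\<lambda>p. c p *\<^sub>R F (fst p) (snd p))"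
proof (intro continuous_at_imp_continuous_on ballI)
  have pc: "continuous_on UNIV (\<lambda>p::real \<times> real. polar (fst p) (snd p))" by (intro continuous_intros)
  have o1: "open {p :: real \<times> real. polar (fst p) (snd p) \<in> G}"
    using open_vimage[OF G pc] by (simp add: vimage_def)
  have o2: "open {p :: real \<times> real. polar (fst p) (snd p) \<notin> K}"
    using open_vimage[OF open_Compl[OF K(1)] pc] by (simp add: vimage_def)
  have o3: "open {p :: real \<times> real. snd p \<notin> T}"
    using open_vimage[OF open_Compl[OF T], of snd] by (simp add: vimage_def continuous_on_snd)
  have o4: "open {p :: real \<times> real. 0 < fst p}" by (intro open_Collect_less continuous_intros)
  fix p :: "real \<times> real" assume p: "p \<in> {p. 0 < fst p \<and> snd p \<notin> T}"
  show "isCont (\<lambda>p. c p *\<^sub>R F (fst p) (snd p)) p"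
  proof (cases "polar (fst p) (snd p) \<in> G")
    case True
    have "open {p. 0 < fst p \<and> polar (fst p) (snd p) \<in> G \<and> snd p \<notin> T}"
      by (intro open_Collect_conj o1 o3 o4)
    then have "isCont (\<lambda>p. F (fst p) (snd p)) p"
      using F p True continuous_on_eq_continuous_at by blast
    moreover have "isCont c p" using c(1) continuous_on_eq_continuous_at[OF open_UNIV] by blast
    ultimately show ?thesis by (rule continuous_scaleR[rotated])
  next
    case False
    then have "p \<in> {p. polar (fst p) (snd p) \<notin> K}" using K(2) by auto
    from eventually_nhds_in_open[OF o2 this]
    have "\<forall>\<^sub>F q in nhds p. c q *\<^sub>R F (fst q) (snd q) = 0"
    proof (rule eventually_mono)
      fix q assume "q \<in> {p. polar (fst p) (snd p) \<notin> K}"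
      then show "c q *\<^sub>R F (fst q) (snd q) = 0" using c(2)[of q] by simp
    qed
    then show ?thesis using isCont_cong[of "\<lambda>p. c p *\<^sub>R F (fst p) (snd p)" "\<lambda>p. 0"] by simp
  qed
qed

lemma rays_negligible:
  assumes "finite (T \<inter> {0..2*pi})"
  shows "negligible {polar r \<theta> | r \<theta>. \<theta> \<in> T \<inter> {0..2*pi}}"
proof (rule negligible_subset)
  show "negligible (\<Union>\<theta>\<in>T \<inter> {0..2*pi}. {x. polar 1 (\<theta> + pi / 2) \<bullet> x = 0})"
    using assms by (intro negligible_Union finite_imageI) (auto intro: negligible_hyperplane)
  show "{polar r \<theta> | r \<theta>. \<theta> \<in> T \<inter> {0..2*pi}} \<subseteq> (\<Union>\<theta>\<in>T \<inter> {0..2*pi}. {x. polar 1 (\<theta> + pi / 2) \<bullet> x = 0})"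
    by (auto simp: inner_vec2)
qed

text \<open>On the exceptional rays H may be unrelated to g. As they form a null set, H is first
  replaced there by 0.\<close>

lemma polar_change_of_variables_off_rays:
  fixes H :: "real^2 \<Rightarrow> complex"
  defines "Q \<equiv> {p. 0 < fst p \<and> 0 < snd p \<and> snd p < 2 * pi}"
  assumes T: "finite (T \<inter> {0..2*pi})" and g: "integrable lborel g"
    and eq: "\<And>p. g p = indicator (Q - UNIV \<times> T) p *\<^sub>R (fst p *\<^sub>R H (polar (fst p) (snd p)))"
  shows "integrable lebesgue H \<and> integral\<^sup>L lebesgue H = integral\<^sup>L lborel g"
proof -
  define N' where "N' = {polar r \<theta> | r \<theta>. 0 < r \<and> \<theta> \<in> T \<inter> {0..2*pi}}"
  have neg: "negligible N'" by (rule negligible_subset[OF rays_negligible[OF T]]) (auto simp: N'_def)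
  define H2 where "H2 x = (if x \<in> N' then 0 else H x)" for x
  have N_iff: "polar r \<theta> \<in> N' \<longleftrightarrow> \<theta> \<in> T" if r: "0 < r" "0 < \<theta>" "\<theta> < 2 * pi" for r \<theta>
  proof
    assume "polar r \<theta> \<in> N'"
    then obtain s t where st: "polar r \<theta> = polar s t" "0 < s" "t \<in> T" "0 \<le> t" "t \<le> 2 * pi" by (auto simp: N'_def)
    obtain j :: int where j: "\<theta> = t + 2 * pi * of_int j" using polar_eqD[OF st(1) r(1) st(2)] by blast
    have "2 * pi * of_int j < 2 * pi * 1" "2 * pi * (- 1) < 2 * pi * of_int j" using j r st by linarith+
    then have "of_int j < (1::real)" "- 1 < (of_int j :: real)"
      using mult_left_less_imp_less[of "2 * pi" "of_int j" 1] mult_left_less_imp_less[of "2 * pi" "- 1" "of_int j"]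
      by simp_all
    then have "j = 0" by linarith
    then show "\<theta> \<in> T" using j st by simp
  next
    assume "\<theta> \<in> T"
    then show "polar r \<theta> \<in> N'" using r unfolding N'_def by (intro CollectI exI[of _ r] exI[of _ \<theta>]) auto
  qed
  have "g p = indicator Q p *\<^sub>R (fst p *\<^sub>R H2 (polar (fst p) (snd p)))" for p
    using N_iff[of "fst p" "snd p"] by (auto simp: eq Q_def H2_def indicator_def mem_Times_iff)
  from polar_change_of_variables[OF g this[unfolded Q_def]]
  have "integrable lebesgue H2 \<and> integral\<^sup>L lebesgue H2 = integral\<^sup>L lborel g" .
  then have h2: "H2 absolutely_integrable_on UNIV" "integral UNIV H2 = integral\<^sup>L lborel g"
    using set_lebesgue_integral_eq_integral(2)[of UNIV H2]
    by (auto simp: set_integrable_def set_lebesgue_integral_def)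
  have "H absolutely_integrable_on UNIV"
    by (rule absolutely_integrable_spike[OF h2(1) neg]) (simp add: H2_def)
  moreover have "integral UNIV H = integral\<^sup>L lborel g"
    using h2(2) integral_spike[OF neg, of UNIV H2 H] by (simp add: H2_def)
  ultimately show ?thesis
    using set_lebesgue_integral_eq_integral(2)[of UNIV H]
    by (auto simp: set_integrable_def set_lebesgue_integral_def)
qed

text \<open>Green's formula for a test function \<open>\<phi>\<close> and a vector field with radial component \<open>P/r\<close> and
  angular component \<open>Q\<close>, which may have kinks (\<open>P\<close> even jumps) across the rays with angle in \<open>T\<close>.\<close>

lemma polar_divergence:
  fixes P Q P' Q' :: "real \<Rightarrow> real \<Rightarrow> complex" and H :: "real^2 \<Rightarrow> complex"
  assumes G: "open G" "0 \<notin> G" and \<phi>: "\<phi> \<in> test_functions G"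
    and T: "closed T" "finite (T \<inter> {0..2*pi})"
    and P: "\<And>r \<theta>. 0 < r \<Longrightarrow> polar r \<theta> \<in> G \<Longrightarrow> \<theta> \<notin> T \<Longrightarrow> ((\<lambda>r. P r \<theta>) has_vector_derivative P' r \<theta>) (at r)"
    and Q: "\<And>r \<theta>. 0 < r \<Longrightarrow> polar r \<theta> \<in> G \<Longrightarrow> \<theta> \<notin> T \<Longrightarrow> (Q r has_vector_derivative Q' r \<theta>) (at \<theta>)"
    and Qc: "\<And>r \<theta>. 0 < r \<Longrightarrow> polar r \<theta> \<in> G \<Longrightarrow> isCont (Q r) \<theta>"
    and Qper: "\<And>r. 0 < r \<Longrightarrow> polar r 0 \<in> G \<Longrightarrow> Q r (2*pi) = Q r 0"
    and cont: "\<And>F. F \<in> {P, Q, P', Q'} \<Longrightarrow>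
      continuous_on {p. 0 < fst p \<and> polar (fst p) (snd p) \<in> G \<and> snd p \<notin> T} (\<lambda>p. F (fst p) (snd p))"
    and bnd: "\<And>F K. F \<in> {P, Q, P', Q'} \<Longrightarrow> compact K \<Longrightarrow> K \<subseteq> G \<Longrightarrow>
      \<exists>M. \<forall>r \<theta>. 0 < r \<and> 0 \<le> \<theta> \<and> \<theta> \<le> 2 * pi \<and> \<theta> \<notin> T \<and> polar r \<theta> \<in> K \<longrightarrow> norm (F r \<theta>) \<le> M"
    and H: "\<And>r \<theta>. 0 < r \<Longrightarrow> 0 < \<theta> \<Longrightarrow> \<theta> < 2 * pi \<Longrightarrow> \<theta> \<notin> T \<Longrightarrow> polar r \<theta> \<in> G \<Longrightarrow>
      r *\<^sub>R H (polar r \<theta>) = \<phi> (polar r \<theta>) *\<^sub>R (P' r \<theta> + Q' r \<theta>)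
        + frechet_derivative \<phi> (at (polar r \<theta>)) (polar 1 \<theta>) *\<^sub>R P r \<theta>
        + frechet_derivative \<phi> (at (polar r \<theta>)) (polar r (\<theta> + pi / 2)) *\<^sub>R Q r \<theta>"
    and H0: "\<And>x. x \<notin> closure {x. \<phi> x \<noteq> 0} \<Longrightarrow> H x = 0"
  shows "integrable lebesgue H \<and> integral\<^sup>L lebesgue H = 0"
proof -
  define K where "K = closure {x. \<phi> x \<noteq> 0}"
  have K: "compact K" "K \<subseteq> G" "closed K" using test_functionsD[OF \<phi>] by (auto simp: K_def)
  have "0 \<notin> K" using K G by auto
  then obtain r1 where r1: "0 < r1" "\<And>x. x \<in> K \<Longrightarrow> r1 \<le> dist 0 x" using separate_point_closed[OF K(3)] by metis
  obtain r2' where r2': "\<And>x. x \<in> K \<Longrightarrow> norm x \<le> r2'" using compact_imp_bounded[OF K(1)] by (auto simp: bounded_iff)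
  define r2 where "r2 = max r1 r2'"
  have rK: "r \<in> {r1..r2}" if "0 < r" "polar r \<theta> \<in> K" for r \<theta>
    using r1(2)[OF that(2)] r2'[OF that(2)] that(1) by (auto simp: norm_polar r2_def)
  define c0 where "c0 p = \<phi> (polar (fst p) (snd p))" for p
  define cr where "cr p = frechet_derivative \<phi> (at (polar (fst p) (snd p))) (polar 1 (snd p))" for p
  define ct where "ct p = frechet_derivative \<phi> (at (polar (fst p) (snd p))) (polar (fst p) (snd p + pi / 2))" for p
  have cc: "continuous_on UNIV c" if "c \<in> {c0, cr, ct}" for c
  proof -
    have i: "continuous_on UNIV (\<lambda>p::real \<times> real. 1::real)" "continuous_on UNIV (fst :: real \<times> real \<Rightarrow> real)"
      "continuous_on UNIV (snd :: real \<times> real \<Rightarrow> real)" "continuous_on UNIV (\<lambda>p::real \<times> real. snd p + pi / 2)"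
      by (intro continuous_intros)+
    show ?thesis
      using that test_function_coefficients[OF \<phi> i(1,3)] test_function_coefficients(2)[OF \<phi> i(2,4)]
      unfolding c0_def[abs_def] cr_def[abs_def] ct_def[abs_def] by blast
  qed
  have cz: "c p = 0" if "c \<in> {c0, cr, ct}" "polar (fst p) (snd p) \<notin> K" for c p
    using that test_function_deriv_zero[of "polar (fst p) (snd p)" \<phi>] closure_subset[of "{x. \<phi> x \<noteq> 0}"]
    by (auto simp: c0_def cr_def ct_def K_def)
  have cb: "\<exists>M\<ge>0. \<forall>r \<theta>. 0 < r \<and> 0 \<le> \<theta> \<and> \<theta> \<le> 2 * pi \<and> \<theta> \<notin> T \<longrightarrow> norm (c (r, \<theta>) *\<^sub>R F r \<theta>) \<le> M"
    if c: "c \<in> {c0, cr, ct}" and F: "F \<in> {P, Q, P', Q'}" for c F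
  proof -
    obtain M where M: "\<And>r \<theta>. 0 < r \<and> 0 \<le> \<theta> \<and> \<theta> \<le> 2 * pi \<and> \<theta> \<notin> T \<and> polar r \<theta> \<in> K \<Longrightarrow> norm (F r \<theta>) \<le> M"
      using bnd[OF F K(1,2)] by blast
    have "bounded (c ` ({r1..r2} \<times> {0..2*pi}))"
      by (intro compact_imp_bounded compact_continuous_image continuous_on_subset[OF cc[OF c]] compact_Times compact_Icc) simp
    then obtain C where C: "\<And>p. p \<in> {r1..r2} \<times> {0..2*pi} \<Longrightarrow> norm (c p) \<le> C"
      unfolding bounded_iff by (metis imageI)
    have "norm (c (r, \<theta>) *\<^sub>R F r \<theta>) \<le> max 0 (C * M)"
      if "0 < r" "0 \<le> \<theta>" "\<theta> \<le> 2 * pi" "\<theta> \<notin> T" for r \<theta>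
    proof (cases "polar r \<theta> \<in> K")
      case True
      have "norm (c (r, \<theta>)) \<le> C" using C rK[OF that(1) True] that by auto
      moreover have "norm (F r \<theta>) \<le> M" using M True that by blast
      ultimately have "norm (c (r, \<theta>)) * norm (F r \<theta>) \<le> C * M"
        by (intro mult_mono) (auto intro: order_trans[OF norm_ge_zero])
      then show ?thesis by simp
    qed (use cz[OF c, of "(r, \<theta>)"] in simp)
    then show ?thesis by (intro exI[of _ "max 0 (C * M)"]) auto
  qed
  \<comment> \<open>After multiplication by the test function the components vanish near every point
    outside G, so the formulas extend to all positive radii although P and Q are controlled inside G
    only.\<close>
  define A where "A r \<theta> = c0 (r, \<theta>) *\<^sub>R P r \<theta>" for r \<theta>
  define B where "B r \<theta> = c0 (r, \<theta>) *\<^sub>R Q r \<theta>" for r \<theta>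
  define A' where "A' r \<theta> = c0 (r, \<theta>) *\<^sub>R P' r \<theta> + cr (r, \<theta>) *\<^sub>R P r \<theta>" for r \<theta>
  define B' where "B' r \<theta> = c0 (r, \<theta>) *\<^sub>R Q' r \<theta> + ct (r, \<theta>) *\<^sub>R Q r \<theta>" for r \<theta>
  have sd: "\<phi> differentiable (at x)" for x by (rule smooth_differentiable[OF test_functionsD(1)[OF \<phi>]])
  have near: "\<forall>\<^sub>F q in nhds p. c0 q = 0" if "polar (fst p) (snd p) \<notin> K" for p
  proof -
    have "open ((\<lambda>p. polar (fst p) (snd p)) -` (- K))"
      by (intro open_vimage open_Compl K continuous_intros)
    from eventually_nhds_in_open[OF this, of p] show ?thesis
      using that cz[of c0] by (auto elim!: eventually_mono)
  qed
  have nr: "\<forall>\<^sub>F s in nhds r. c0 (s, \<theta>) = 0" and nt: "\<forall>\<^sub>F s in nhds \<theta>. c0 (r, s) = 0" if "polar r \<theta> \<notin> K" for r \<theta>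
  proof -
    have "filterlim (\<lambda>s. (s, \<theta>)) (nhds (r, \<theta>)) (nhds r)" "filterlim (\<lambda>s. (r, s)) (nhds (r, \<theta>)) (nhds \<theta>)"
      by (auto intro!: tendsto_intros filterlim_ident)
    then show "\<forall>\<^sub>F s in nhds r. c0 (s, \<theta>) = 0" "\<forall>\<^sub>F s in nhds \<theta>. c0 (r, s) = 0"
      using near[of "(r, \<theta>)"] that by (auto simp: filterlim_iff)
  qed
  have zero_der: "(f has_vector_derivative 0) (at x)" if "\<forall>\<^sub>F s in nhds x. f s = (0::complex)" for f and x :: real
  proof -
    have "((\<lambda>s. 0::complex) has_derivative (\<lambda>h. 0)) (at x)" by simp
    then have "(f has_derivative (\<lambda>h. 0)) (at x)"
      using that eventually_nhds_x_imp_x[OF that]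
      by (elim has_derivative_transform_eventually) (auto simp: eventually_at_filter elim: eventually_mono)
    then show ?thesis by (simp add: has_vector_derivative_def)
  qed
  have main: "integrable lborel (\<lambda>p. indicator ({p. 0 < fst p \<and> 0 < snd p \<and> snd p < 2 * pi} - UNIV \<times> T) p *\<^sub>R (A' (fst p) (snd p) + B' (fst p) (snd p)))
    \<and> (LINT p|lborel. indicator ({p. 0 < fst p \<and> 0 < snd p \<and> snd p < 2 * pi} - UNIV \<times> T) p *\<^sub>R (A' (fst p) (snd p) + B' (fst p) (snd p))) = 0"
  proof -
    obtain M1 M2 M3 M4 where M:
      "\<And>r \<theta>. 0 < r \<and> 0 \<le> \<theta> \<and> \<theta> \<le> 2 * pi \<and> \<theta> \<notin> T \<Longrightarrow> norm (c0 (r, \<theta>) *\<^sub>R P' r \<theta>) \<le> M1"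
      "\<And>r \<theta>. 0 < r \<and> 0 \<le> \<theta> \<and> \<theta> \<le> 2 * pi \<and> \<theta> \<notin> T \<Longrightarrow> norm (cr (r, \<theta>) *\<^sub>R P r \<theta>) \<le> M2"
      "\<And>r \<theta>. 0 < r \<and> 0 \<le> \<theta> \<and> \<theta> \<le> 2 * pi \<and> \<theta> \<notin> T \<Longrightarrow> norm (c0 (r, \<theta>) *\<^sub>R Q' r \<theta>) \<le> M3"
      "\<And>r \<theta>. 0 < r \<and> 0 \<le> \<theta> \<and> \<theta> \<le> 2 * pi \<and> \<theta> \<notin> T \<Longrightarrow> norm (ct (r, \<theta>) *\<^sub>R Q r \<theta>) \<le> M4"
      and pos: "0 \<le> M1" "0 \<le> M2" "0 \<le> M3" "0 \<le> M4"
      using cb[of c0 P'] cb[of cr P] cb[of c0 Q'] cb[of ct Q] by auto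
    show ?thesis
    proof (rule planar_divergence[OF T r1(1), of r2 A A' B B' "M1 + M2 + M3 + M4"])
      show "r1 \<le> r2" by (simp add: r2_def)
      fix r \<theta> :: real assume r: "0 < r"
      show "((\<lambda>r. A r \<theta>) has_vector_derivative A' r \<theta>) (at r)" if \<theta>: "\<theta> \<notin> T"
      proof (cases "polar r \<theta> \<in> G")
        case True
        show ?thesis
          unfolding A_def A'_def c0_def cr_def fst_conv snd_conv
          using has_vector_derivative_scaleR[OF polar_radial_derivative[OF sd, unfolded has_real_derivative_iff_has_vector_derivative[symmetric]] P[OF r True \<theta>]]
          by (simp add: has_real_derivative_iff_has_vector_derivative)
      next
        case False
        then have n: "polar r \<theta> \<notin> K" using K by auto
        have "\<forall>\<^sub>F s in nhds r. A s \<theta> = 0" using nr[OF n] by (rule eventually_mono) (simp add: A_def)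
        moreover have "A' r \<theta> = 0" using cz[of c0 "(r, \<theta>)"] cz[of cr "(r, \<theta>)"] n by (simp add: A'_def)
        ultimately show ?thesis using zero_der by simp
      qed
      show "(B r has_vector_derivative B' r \<theta>) (at \<theta>)" if \<theta>: "\<theta> \<notin> T"
      proof (cases "polar r \<theta> \<in> G")
        case True
        show ?thesis
          unfolding B_def[abs_def] B'_def c0_def ct_def fst_conv snd_conv
          using has_vector_derivative_scaleR[OF polar_angular_derivative[OF sd, unfolded has_real_derivative_iff_has_vector_derivative[symmetric]] Q[OF r True \<theta>]]
          by (simp add: has_real_derivative_iff_has_vector_derivative)
      next
        case False
        then have n: "polar r \<theta> \<notin> K" using K by auto
        have "\<forall>\<^sub>F s in nhds \<theta>. B r s = 0" using nt[OF n] by (rule eventually_mono) (simp add: B_def)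
        moreover have "B' r \<theta> = 0" using cz[of c0 "(r, \<theta>)"] cz[of ct "(r, \<theta>)"] n by (simp add: B'_def)
        ultimately show ?thesis using zero_der by simp
      qed
      show "continuous_on {0..2*pi} (B r)"
      proof (intro continuous_at_imp_continuous_on ballI)
        fix t
        show "isCont (B r) t"
        proof (cases "polar r t \<in> G")
          case True
          have "isCont (\<lambda>t. \<phi> (polar r t)) t"
            using has_vector_derivative_continuous[OF polar_angular_derivative[OF sd]] .
          then show ?thesis
            unfolding B_def[abs_def] c0_def fst_conv snd_conv by (rule continuous_scaleR[OF _ Qc[OF r True]])
        next
          case False
          then have n: "polar r t \<notin> K" using K by auto
          have "\<forall>\<^sub>F s in nhds t. B r s = 0" using nt[OF n] by (rule eventually_mono) (simp add: B_def)
          then show ?thesis using isCont_cong[of "B r" "\<lambda>s. 0"] by simp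
        qed
      qed
      show "B r (2*pi) = B r 0"
      proof (cases "polar r 0 \<in> G")
        case True
        then show ?thesis using Qper[OF r] polar_periodic[of r 0] by (simp add: B_def c0_def)
      next
        case False
        then have "polar r 0 \<notin> K" "polar r (2*pi) \<notin> K" using K polar_periodic[of r 0] by auto
        then show ?thesis using cz[of c0 "(r, 0)"] cz[of c0 "(r, 2*pi)"] by (simp add: B_def)
      qed
      show "norm (A' r \<theta>) \<le> M1 + M2 + M3 + M4 \<and> norm (B' r \<theta>) \<le> M1 + M2 + M3 + M4"
        if "0 \<le> \<theta>" "\<theta> \<le> 2 * pi" "\<theta> \<notin> T"
        using M(1)[of r \<theta>] M(2)[of r \<theta>] M(3)[of r \<theta>] M(4)[of r \<theta>] r that pos
          norm_triangle_ineq[of "c0 (r, \<theta>) *\<^sub>R P' r \<theta>" "cr (r, \<theta>) *\<^sub>R P r \<theta>"]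
          norm_triangle_ineq[of "c0 (r, \<theta>) *\<^sub>R Q' r \<theta>" "ct (r, \<theta>) *\<^sub>R Q r \<theta>"]
        unfolding A'_def B'_def by linarith
      show "A r \<theta> = 0 \<and> A' r \<theta> = 0 \<and> B' r \<theta> = 0" if "r \<notin> {r1..r2}"
      proof -
        have "polar r \<theta> \<notin> K" using rK r that by blast
        then show ?thesis using cz[of c0 "(r, \<theta>)"] cz[of ct "(r, \<theta>)"] cz[of cr "(r, \<theta>)"]
          by (simp add: A_def A'_def B'_def)
      qed
    next
      have cut: "continuous_on {p. 0 < fst p \<and> snd p \<notin> T} (\<lambda>p. c p *\<^sub>R F (fst p) (snd p))"
        if "c \<in> {c0, cr, ct}" "F \<in> {P, Q, P', Q'}" for c F
        by (rule cut_off_continuous[OF G(1) K(3,2) T(1) cc[OF that(1)] cz[OF that(1)] cont[OF that(2)]])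
      show "continuous_on {p. 0 < fst p \<and> snd p \<notin> T} (\<lambda>p. A' (fst p) (snd p))"
        unfolding A'_def using cut[of c0 P'] cut[of cr P] by (auto intro!: continuous_on_add)
      show "continuous_on {p. 0 < fst p \<and> snd p \<notin> T} (\<lambda>p. B' (fst p) (snd p))"
        unfolding B'_def using cut[of c0 Q'] cut[of ct Q] by (auto intro!: continuous_on_add)
    qed
  qed
  have "indicator ({p. 0 < fst p \<and> 0 < snd p \<and> snd p < 2 * pi} - UNIV \<times> T) p *\<^sub>R (A' (fst p) (snd p) + B' (fst p) (snd p))
    = indicator ({p. 0 < fst p \<and> 0 < snd p \<and> snd p < 2 * pi} - UNIV \<times> T) p *\<^sub>R (fst p *\<^sub>R H (polar (fst p) (snd p)))" for p
  proof (cases "0 < fst p \<and> 0 < snd p \<and> snd p < 2 * pi \<and> snd p \<notin> T")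
    case True
    have "fst p *\<^sub>R H (polar (fst p) (snd p)) = A' (fst p) (snd p) + B' (fst p) (snd p)"
    proof (cases "polar (fst p) (snd p) \<in> G")
      case G: True
      show ?thesis
        using H[OF _ _ _ _ G] True by (simp add: A'_def B'_def c0_def cr_def ct_def scaleR_add_right)
    next
      case nG: False
      then have n: "polar (fst p) (snd p) \<notin> K" using K by auto
      then show ?thesis using H0[of "polar (fst p) (snd p)"] cz[of c0 p] cz[of cr p] cz[of ct p]
        by (simp add: A'_def B'_def K_def)
    qed
    then show ?thesis by simp
  qed (auto simp: indicator_def mem_Times_iff)
  from polar_change_of_variables_off_rays[OF T(2) conjunct1[OF main] this] conjunct2[OF main]
  show ?thesis by simp
qed

section \<open>Star-shaped domains\<close>

lemma smooth_real_deriv: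
  assumes "smooth (h :: real \<Rightarrow> real)"
  shows "(h has_real_derivative frechet_derivative h (at x) 1) (at x)"
    and "continuous_on S (\<lambda>x. frechet_derivative h (at x) 1)"
proof -
  have d: "h differentiable (at x)" by (rule smooth_differentiable[OF assms])
  have l: "linear (frechet_derivative h (at x))" by (rule linear_frechet_derivative[OF d])
  have "(h has_derivative frechet_derivative h (at x)) (at x)" using d frechet_derivative_works by blast
  moreover have "frechet_derivative h (at x) = (*) (frechet_derivative h (at x) 1)"
  proof
    fix c show "frechet_derivative h (at x) c = frechet_derivative h (at x) 1 * c"
      using linear_scale[OF l, of c 1] by simp
  qed
  ultimately show "(h has_real_derivative frechet_derivative h (at x) 1) (at x)"
    by (simp add: has_field_derivative_def)
  show "continuous_on S (\<lambda>x. frechet_derivative h (at x) 1)"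
    by (rule smooth_continuous[OF smooth_frechet[OF assms]])
qed

lemma smooth_on_interval_deriv:
  assumes "smooth_on_interval R I" "open J" "J \<subseteq> I"
  shows "\<And>\<theta>. \<theta> \<in> J \<Longrightarrow> (R has_real_derivative deriv R \<theta>) (at \<theta>)" "continuous_on J (deriv R)"
proof -
  obtain h where h: "smooth h" "\<And>\<theta>. \<theta> \<in> I \<Longrightarrow> R \<theta> = h \<theta>" using assms(1) by (auto simp: smooth_on_interval_def)
  have d: "(R has_real_derivative frechet_derivative h (at \<theta>) 1) (at \<theta>)" if "\<theta> \<in> J" for \<theta>
    by (rule has_field_derivative_transform_within_open[OF smooth_real_deriv(1)[OF h(1)] assms(2) that])
      (use h(2) assms(3) in auto)
  have e: "deriv R \<theta> = frechet_derivative h (at \<theta>) 1" if "\<theta> \<in> J" for \<theta>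
    using d[OF that] by (rule DERIV_imp_deriv)
  show "(R has_real_derivative deriv R \<theta>) (at \<theta>)" if "\<theta> \<in> J" for \<theta>
    using d[OF that] e[OF that] by simp
  show "continuous_on J (deriv R)"
    using smooth_real_deriv(2)[OF h(1)] e by (simp cong: continuous_on_cong)
qed

locale star =
  fixes R1 :: "real \<Rightarrow> real"
  assumes star: "star_radius R1"
begin

lemma R1_pos: "0 < R1 \<theta>" and R1_cont: "continuous_on S R1" and R1_per: "R1 (\<theta> + 2 * pi) = R1 \<theta>"
  using star continuous_on_subset[of UNIV R1 S] by (auto simp: star_radius_def)

lemma R1_per_int: "R1 (\<theta> + 2 * pi * of_int j) = R1 \<theta>"
  by (rule periodic_int) (rule R1_per)

lemma reduce_angle:
  obtains j :: int where "0 \<le> \<theta> + 2 * pi * of_int j" "\<theta> + 2 * pi * of_int j < 2 * pi"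
proof -
  define j where "j = \<lfloor>\<theta> / (2 * pi)\<rfloor>"
  have a: "of_int j \<le> \<theta> / (2 * pi)" "\<theta> / (2 * pi) < of_int j + 1"
    unfolding j_def by linarith+
  have "0 \<le> \<theta> + 2 * pi * of_int (- j)" "\<theta> + 2 * pi * of_int (- j) < 2 * pi"
    using a by (simp_all add: field_simps)
  then show thesis by (rule that)
qed

lemma R1_bounds: "\<exists>m M. 0 < m \<and> (\<forall>\<theta>. m \<le> R1 \<theta>) \<and> (\<forall>\<theta>. R1 \<theta> \<le> M)"
proof -
  have ne: "{0..2*pi} \<noteq> {}" by simp
  obtain a where a: "a \<in> {0..2*pi}" "\<And>\<theta>. \<theta> \<in> {0..2*pi} \<Longrightarrow> R1 a \<le> R1 \<theta>"
    using continuous_attains_inf[OF compact_Icc ne R1_cont] by blast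
  obtain b where b: "\<And>\<theta>. \<theta> \<in> {0..2*pi} \<Longrightarrow> R1 \<theta> \<le> R1 b"
    using continuous_attains_sup[OF compact_Icc ne R1_cont] by blast
  have "R1 a \<le> R1 \<theta> \<and> R1 \<theta> \<le> R1 b" for \<theta>
  proof -
    obtain j :: int where j: "0 \<le> \<theta> + 2 * pi * of_int j" "\<theta> + 2 * pi * of_int j < 2 * pi" by (rule reduce_angle)
    then show ?thesis using a(2)[of "\<theta> + 2 * pi * of_int j"] b[of "\<theta> + 2 * pi * of_int j"] R1_per_int[of \<theta> j] by auto
  qed
  then show ?thesis using R1_pos[of a] by blast
qed

lemma R1_ang: "0 < r \<Longrightarrow> R1 (ang (polar r \<theta>)) = R1 \<theta>"
proof -
  assume r: "0 < r"
  then obtain j :: int where "ang (polar r \<theta>) = \<theta> + 2 * pi * of_int j" by (rule ang_polar)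
  then show ?thesis using R1_per_int by simp
qed

text \<open>\<open>ang\<close> jumps across the negative axis, but R1 is periodic: in polar
  coordinates the function is just R1 of the angle, and continuity is carried back through a
  chart.\<close>

lemma R1_ang_cont: "continuous_on (- {0}) (\<lambda>x. R1 (ang x))"
proof (intro continuous_at_imp_continuous_on ballI)
  fix x :: "real^2" assume "x \<in> - {0}"
  then have x: "x \<noteq> 0" by simp
  then obtain r \<theta> where r: "0 < r" "x = polar r \<theta>" using polar_onto by metis
  have c: "isCont (\<lambda>p. R1 (snd p)) (r, \<theta>)"
    using R1_cont[of UNIV] by (intro isCont_o2[where g = R1 and f = snd]) (auto simp: continuous_on_eq_continuous_at)
  have "\<forall>\<^sub>F p in nhds (r, \<theta>). R1 (snd p) = R1 (ang (polar (fst p) (snd p)))"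
  proof -
    have "open {p :: real \<times> real. 0 < fst p}" by (intro open_Collect_less continuous_intros)
    from eventually_nhds_in_open[OF this, of "(r, \<theta>)"] show ?thesis
      using r(1) by (auto elim!: eventually_mono simp: R1_ang)
  qed
  from isCont_cong[OF this] c have "isCont (\<lambda>p. R1 (ang (polar (fst p) (snd p)))) (r, \<theta>)" by simp
  then show "isCont (\<lambda>x. R1 (ang x)) x" unfolding r(2) by (rule isCont_from_polar[OF r(1)])
qed

lemma open_ang_less:
  assumes "continuous_on (- {0}) f" "continuous_on (- {0}) g"
  shows "open {x :: real^2. x \<noteq> 0 \<and> f x < (g x :: real)}"
proof -
  have "open (- {0} \<inter> (\<lambda>x. g x - f x) -` {0<..})"
    by (rule continuous_open_preimage) (auto intro!: continuous_intros assms)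
  moreover have "- {0} \<inter> (\<lambda>x. g x - f x) -` {0<..} = {x. x \<noteq> 0 \<and> f x < g x}" by auto
  ultimately show ?thesis by simp
qed

definition outside :: "(real^2) set" where "outside = {x. x \<noteq> 0 \<and> R1 (ang x) < norm x}"

lemma polar_outside: "0 < r \<Longrightarrow> polar r \<theta> \<in> outside \<longleftrightarrow> R1 \<theta> < r"
  by (simp add: outside_def R1_ang norm_polar)

lemma open_outside: "open outside"
  unfolding outside_def by (intro open_ang_less R1_ang_cont continuous_intros)

lemma layer_iff: "x \<in> layer R1 \<rho> \<longleftrightarrow> x \<noteq> 0 \<and> R1 (ang x) < norm x \<and> norm x < \<rho> * R1 (ang x)"
proof
  assume "x \<in> layer R1 \<rho>"
  then obtain r \<theta> where r: "x = polar r \<theta>" "R1 \<theta> < r" "r < \<rho> * R1 \<theta>" by (auto simp: layer_def)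
  moreover have "0 < r" using r R1_pos[of \<theta>] by simp
  ultimately show "x \<noteq> 0 \<and> R1 (ang x) < norm x \<and> norm x < \<rho> * R1 (ang x)" by (simp add: R1_ang norm_polar)
next
  assume "x \<noteq> 0 \<and> R1 (ang x) < norm x \<and> norm x < \<rho> * R1 (ang x)"
  then show "x \<in> layer R1 \<rho>" unfolding layer_def
    by (intro CollectI exI[of _ "norm x"] exI[of _ "ang x"]) (simp add: polar_norm_ang)
qed

lemma polar_layer: "0 < r \<Longrightarrow> polar r \<theta> \<in> layer R1 \<rho> \<longleftrightarrow> R1 \<theta> < r \<and> r < \<rho> * R1 \<theta>"
  by (simp add: layer_iff R1_ang norm_polar)

lemma layer_outside: "layer R1 \<rho> \<subseteq> outside"
  by (auto simp: layer_iff outside_def)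

lemma open_layer: "open (layer R1 \<rho>)"
proof -
  have "layer R1 \<rho> = {x. x \<noteq> 0 \<and> R1 (ang x) < norm x} \<inter> {x. x \<noteq> 0 \<and> norm x < \<rho> * R1 (ang x)}"
    by (auto simp: layer_iff)
  then show ?thesis
    by (simp only:) (intro open_Int open_ang_less continuous_intros R1_ang_cont)
qed

lemma star_domain_iff: "x \<in> star_domain R1 \<longleftrightarrow> x = 0 \<or> norm x < R1 (ang x)"
proof
  assume "x \<in> star_domain R1"
  then obtain r \<theta> where r: "x = polar r \<theta>" "0 \<le> r" "r < R1 \<theta>" by (auto simp: star_domain_def)
  then show "x = 0 \<or> norm x < R1 (ang x)" by (cases "r = 0") (auto simp: R1_ang norm_polar)
next
  assume x: "x = 0 \<or> norm x < R1 (ang x)"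
  then have "norm x < R1 (ang x)" using R1_pos by auto
  then show "x \<in> star_domain R1" unfolding star_domain_def
    by (intro CollectI exI[of _ "norm x"] exI[of _ "ang x"]) (simp add: polar_norm_ang)
qed

lemma open_star: "open (star_domain R1)"
proof -
  obtain m M where m: "0 < m" "\<And>\<theta>. m \<le> R1 \<theta>" "\<And>\<theta>. R1 \<theta> \<le> M" using R1_bounds by blast
  have "star_domain R1 = ball 0 m \<union> {x. x \<noteq> 0 \<and> norm x < R1 (ang x)}"
  proof (rule set_eqI)
    fix x show "x \<in> star_domain R1 \<longleftrightarrow> x \<in> ball 0 m \<union> {x. x \<noteq> 0 \<and> norm x < R1 (ang x)}"
      using m(1) m(2)[of "ang x"] by (cases "x = 0") (auto simp: star_domain_iff)
  qed
  then show ?thesis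
    by (simp only:) (intro open_Un open_ball open_ang_less continuous_intros R1_ang_cont)
qed

lemma star_layer_disjoint: "star_domain R1 \<inter> layer R1 \<rho> = {}"
  by (auto simp: star_domain_iff layer_iff)

end

section \<open>Fields transformed by a complex radius\<close>

text \<open>The regularity that survives at corners: continuous away from the rays in T and bounded
  on compact sets right up to them. It is stable under sums and products and delivers the hypotheses
  of \<open>polar_divergence\<close> as well as local integrability.\<close>

definition tame :: "(real^2) set \<Rightarrow> real set \<Rightarrow> (real \<Rightarrow> real \<Rightarrow> complex) \<Rightarrow> bool" where
  "tame G T F \<longleftrightarrow>
     continuous_on {p. 0 < fst p \<and> polar (fst p) (snd p) \<in> G \<and> snd p \<notin> T} (\<lambda>p. F (fst p) (snd p)) \<and>
     (\<forall>K. compact K \<and> K \<subseteq> G \<longrightarrow>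
        (\<exists>M. \<forall>r \<theta>. 0 < r \<and> 0 \<le> \<theta> \<and> \<theta> \<le> 2 * pi \<and> \<theta> \<notin> T \<and> polar r \<theta> \<in> K \<longrightarrow> norm (F r \<theta>) \<le> M))"

lemma tame_binop:
  assumes F: "tame G T F" and H: "tame G T H"
    and c: "\<And>S f g. continuous_on S f \<Longrightarrow> continuous_on S g \<Longrightarrow> continuous_on S (\<lambda>p :: real \<times> real. op' (f p) (g p :: complex))"
    and b: "\<And>x y A B. norm x \<le> A \<Longrightarrow> norm y \<le> B \<Longrightarrow> norm (op' x y) \<le> b A B"
  shows "tame G T (\<lambda>r \<theta>. op' (F r \<theta>) (H r \<theta>))"
  unfolding tame_def
proof (intro conjI allI impI)
  show "continuous_on {p. 0 < fst p \<and> polar (fst p) (snd p) \<in> G \<and> snd p \<notin> T} (\<lambda>p. op' (F (fst p) (snd p)) (H (fst p) (snd p)))"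
    using F H by (intro c) (auto simp: tame_def)
  fix K assume K: "compact K \<and> K \<subseteq> G"
  obtain A where A: "\<And>r \<theta>. 0 < r \<and> 0 \<le> \<theta> \<and> \<theta> \<le> 2 * pi \<and> \<theta> \<notin> T \<and> polar r \<theta> \<in> K \<Longrightarrow> norm (F r \<theta>) \<le> A"
    using F K unfolding tame_def by blast
  obtain B where B: "\<And>r \<theta>. 0 < r \<and> 0 \<le> \<theta> \<and> \<theta> \<le> 2 * pi \<and> \<theta> \<notin> T \<and> polar r \<theta> \<in> K \<Longrightarrow> norm (H r \<theta>) \<le> B"
    using H K unfolding tame_def by blast
  show "\<exists>M. \<forall>r \<theta>. 0 < r \<and> 0 \<le> \<theta> \<and> \<theta> \<le> 2 * pi \<and> \<theta> \<notin> T \<and> polar r \<theta> \<in> K \<longrightarrow> norm (op' (F r \<theta>) (H r \<theta>)) \<le> M"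
    using A B b by (intro exI[of _ "b A B"]) blast
qed

lemma tame_add: "tame G T F \<Longrightarrow> tame G T H \<Longrightarrow> tame G T (\<lambda>r \<theta>. F r \<theta> + H r \<theta>)"
  by (rule tame_binop[where b = "(+)"]) (auto intro: continuous_intros order_trans[OF norm_triangle_ineq] add_mono)

lemma tame_diff: "tame G T F \<Longrightarrow> tame G T H \<Longrightarrow> tame G T (\<lambda>r \<theta>. F r \<theta> - H r \<theta>)"
  by (rule tame_binop[where b = "(+)"]) (auto intro: continuous_intros order_trans[OF norm_triangle_ineq4] add_mono)

lemma tame_mult: "tame G T F \<Longrightarrow> tame G T H \<Longrightarrow> tame G T (\<lambda>r \<theta>. F r \<theta> * H r \<theta>)"
  by (rule tame_binop[where b = "(*)"])
    (auto intro!: continuous_intros mult_mono simp: norm_mult intro: order_trans[OF norm_ge_zero])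

lemma tame_norm_sq: "tame G T F \<Longrightarrow> tame G T (\<lambda>r \<theta>. of_real ((norm (F r \<theta>))\<^sup>2))"
  by (rule tame_binop[where b = "\<lambda>A B. A\<^sup>2" and H = F and op' = "\<lambda>x y. of_real ((norm x)\<^sup>2)"])
    (auto intro!: continuous_intros power_mono simp: norm_power)

lemma tame_continuous:
  assumes G: "0 \<notin> G" and F: "continuous_on {p. 0 < fst p \<and> polar (fst p) (snd p) \<in> G} (\<lambda>p. F (fst p) (snd p))"
  shows "tame G T F"
  unfolding tame_def
proof (intro conjI allI impI)
  show "continuous_on {p. 0 < fst p \<and> polar (fst p) (snd p) \<in> G \<and> snd p \<notin> T} (\<lambda>p. F (fst p) (snd p))"
    by (rule continuous_on_subset[OF F]) auto
  fix K assume K: "compact K \<and> K \<subseteq> G"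
  then have "0 \<notin> K" "closed K" using G compact_imp_closed by auto
  then obtain r1 where r1: "0 < r1" "\<And>x. x \<in> K \<Longrightarrow> r1 \<le> dist 0 x" using separate_point_closed by metis
  obtain r2 where r2: "\<And>x. x \<in> K \<Longrightarrow> norm x \<le> r2" using compact_imp_bounded[of K] K unfolding bounded_iff by blast
  define C where "C = ({r1..r2} \<times> {0..2*pi}) \<inter> (\<lambda>p. polar (fst p) (snd p)) -` K"
  have "closed ((\<lambda>p. polar (fst p) (snd p)) -` K)"
    by (intro closed_vimage \<open>closed K\<close> continuous_intros)
  then have "compact C" unfolding C_def by (intro compact_Int_closed compact_Times compact_Icc)
  moreover have "C \<subseteq> {p. 0 < fst p \<and> polar (fst p) (snd p) \<in> G}" using r1 K by (auto simp: C_def)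
  ultimately have "bounded ((\<lambda>p. F (fst p) (snd p)) ` C)"
    by (intro compact_imp_bounded compact_continuous_image continuous_on_subset[OF F])
  then obtain M where M: "\<And>p. p \<in> C \<Longrightarrow> norm (F (fst p) (snd p)) \<le> M" unfolding bounded_iff by (metis imageI)
  have "norm (F r \<theta>) \<le> M" if "0 < r" "0 \<le> \<theta>" "\<theta> \<le> 2 * pi" "polar r \<theta> \<in> K" for r \<theta>
    using M[of "(r, \<theta>)"] that r1(2)[of "polar r \<theta>"] r2[of "polar r \<theta>"] by (simp add: C_def norm_polar)
  then show "\<exists>M. \<forall>r \<theta>. 0 < r \<and> 0 \<le> \<theta> \<and> \<theta> \<le> 2 * pi \<and> \<theta> \<notin> T \<and> polar r \<theta> \<in> K \<longrightarrow> norm (F r \<theta>) \<le> M"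
    by blast
qed

lemma tame_angular:
  assumes "continuous_on (- T) d" "\<And>\<theta>. 0 \<le> \<theta> \<Longrightarrow> \<theta> \<le> 2 * pi \<Longrightarrow> \<theta> \<notin> T \<Longrightarrow> \<bar>d \<theta>\<bar> \<le> B"
  shows "tame G T (\<lambda>r \<theta>. of_real (d \<theta>))"
  unfolding tame_def
proof (intro conjI allI impI)
  have "continuous_on {p. 0 < fst p \<and> polar (fst p) (snd p) \<in> G \<and> snd p \<notin> T} (\<lambda>p. d (snd p))"
    by (rule continuous_on_compose2[OF assms(1)]) (auto intro!: continuous_intros)
  then show "continuous_on {p. 0 < fst p \<and> polar (fst p) (snd p) \<in> G \<and> snd p \<notin> T} (\<lambda>p. complex_of_real (d (snd p)))"
    by (intro continuous_intros)
qed (use assms(2) in \<open>auto intro!: exI[of _ B]\<close>)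

lemma tame_integrable:
  fixes H :: "real^2 \<Rightarrow> complex"
  assumes G: "0 \<notin> G" and T: "closed T" "finite (T \<inter> {0..2*pi})" and F: "tame G T F"
    and H: "\<And>r \<theta>. 0 < r \<Longrightarrow> 0 < \<theta> \<Longrightarrow> \<theta> < 2 * pi \<Longrightarrow> \<theta> \<notin> T \<Longrightarrow> polar r \<theta> \<in> G \<Longrightarrow> H (polar r \<theta>) = F r \<theta>"
    and K: "compact K" "K \<subseteq> G"
  shows "set_integrable lebesgue K H"
proof -
  define Q where "Q = {p :: real \<times> real. 0 < fst p \<and> 0 < snd p \<and> snd p < 2 * pi}"
  define P where "P = (Q - UNIV \<times> T) \<inter> (\<lambda>p. polar (fst p) (snd p)) -` K"
  define g where "g p = indicator (Q - UNIV \<times> T) p *\<^sub>R (fst p *\<^sub>R (indicator K (polar (fst p) (snd p)) *\<^sub>R H (polar (fst p) (snd p))))" for p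
  have PF: "p \<in> P \<Longrightarrow> H (polar (fst p) (snd p)) = F (fst p) (snd p)" for p
    using H[of "fst p" "snd p"] K by (auto simp: P_def Q_def mem_Times_iff)
  have g: "g p = indicator P p *\<^sub>R (fst p *\<^sub>R F (fst p) (snd p))" for p
    using PF[of p] by (auto simp: g_def P_def indicator_def)
  have oQ: "open (Q - UNIV \<times> T)" unfolding Q_def using T(1)
    by (intro open_Diff open_Collect_conj open_Collect_less continuous_intros closed_Times closed_UNIV)
  have "closed ((\<lambda>p::real \<times> real. polar (fst p) (snd p)) -` K)"
    by (intro closed_vimage compact_imp_closed K continuous_intros)
  then have Pb: "P \<in> sets borel" unfolding P_def using oQ by (intro sets.Int borel_open borel_closed)
  have cF: "continuous_on P (\<lambda>p. F (fst p) (snd p))"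
    using F K(2) unfolding tame_def by (auto elim!: continuous_on_subset simp: P_def Q_def mem_Times_iff)
  have gm: "g \<in> borel_measurable borel"
    unfolding g[abs_def] by (intro borel_measurable_continuous_on_indicator Pb continuous_intros cF)
  obtain M where M: "\<And>r \<theta>. 0 < r \<and> 0 \<le> \<theta> \<and> \<theta> \<le> 2 * pi \<and> \<theta> \<notin> T \<and> polar r \<theta> \<in> K \<Longrightarrow> norm (F r \<theta>) \<le> M"
    using F K unfolding tame_def by blast
  obtain r2 where r2: "\<And>x. x \<in> K \<Longrightarrow> norm x \<le> r2" using compact_imp_bounded[of K] K unfolding bounded_iff by blast
  have gb: "norm (g p) \<le> max 0 (r2 * M)" "p \<notin> {0..r2} \<times> {0..2*pi} \<Longrightarrow> g p = 0" for p
  proof -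
    have *: "norm (F (fst p) (snd p)) \<le> M \<and> 0 < fst p \<and> fst p \<le> r2 \<and> 0 \<le> snd p \<and> snd p \<le> 2 * pi" if "p \<in> P"
      using M[of "fst p" "snd p"] r2[of "polar (fst p) (snd p)"] that by (auto simp: P_def Q_def mem_Times_iff norm_polar)
    show "norm (g p) \<le> max 0 (r2 * M)"
    proof (cases "p \<in> P")
      case True
      then have "fst p * norm (F (fst p) (snd p)) \<le> r2 * M" using * by (intro mult_mono) auto
      then show ?thesis using True * by (simp add: g)
    qed (simp add: g)
    show "p \<notin> {0..r2} \<times> {0..2*pi} \<Longrightarrow> g p = 0" using * by (cases "p \<in> P") (auto simp: g mem_Times_iff)
  qed
  have fin: "emeasure lborel ({0..r2} \<times> {0..2*pi} :: (real \<times> real) set) < \<infinity>"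
    by (rule emeasure_bounded_finite) (simp add: bounded_Times)
  have rect: "{0..r2} \<times> {0..2*pi} \<in> sets (lborel :: (real \<times> real) measure)"
    by (simp add: borel_closed closed_Times)
  have "integrable lborel g"
    using gm gb by (intro integrableI_bounded_set[OF rect _ fin, where B = "max 0 (r2 * M)"] AE_I2; simp)
  from polar_change_of_variables_off_rays[OF T(2) this, of "\<lambda>x. indicator K x *\<^sub>R H x"]
  show ?thesis by (simp add: set_integrable_def g_def Q_def)
qed

text \<open>The Cartesian form of a vector with radial component a and angular component b.\<close>

definition polvec :: "real \<Rightarrow> complex \<Rightarrow> complex \<Rightarrow> complex^2" where
  "polvec \<theta> a b = vector [of_real (cos \<theta>) * a - of_real (sin \<theta>) * b, of_real (sin \<theta>) * a + of_real (cos \<theta>) * b]"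

lemma polvec_nth [simp]: "polvec \<theta> a b $ 1 = of_real (cos \<theta>) * a - of_real (sin \<theta>) * b"
  "polvec \<theta> a b $ 2 = of_real (sin \<theta>) * a + of_real (cos \<theta>) * b"
  by (simp_all add: polvec_def)

lemma polvec_nth': "polvec \<theta> a b $ i = of_real (polar 1 \<theta> $ i) * a + of_real (polar 1 (\<theta> + pi / 2) $ i) * b"
  using exhaust_2[of i] by auto

lemma norm_polvec: "(norm (polvec \<theta> a b))\<^sup>2 = (norm (polvec \<theta> a b $ 1))\<^sup>2 + (norm (polvec \<theta> a b $ 2))\<^sup>2"
  unfolding norm_vec_def L2_set_def sum_2 by simp

lemma grad_polar:
  assumes "(F has_derivative (\<lambda>v. (v \<bullet> polar 1 \<theta>) *\<^sub>R a + (v \<bullet> polar 1 (\<theta> + pi / 2) / r) *\<^sub>R b)) (at x)"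
  shows "grad F x = polvec \<theta> a (b / of_real r)"
proof -
  have "grad F x $ i = polvec \<theta> a (b / of_real r) $ i" for i
    unfolding grad_def partial_def frechet_derivative_at[OF assms, symmetric] polvec_nth'
    by (simp add: inner_axis' scaleR_conv_of_real)
  then show ?thesis by (simp add: vec_eq_iff)
qed

section \<open>The continued field on the sectors\<close>

locale sector_field = star R1 for R1 +
  fixes \<sigma>0 \<sigma>1 k :: real and U :: "real^2 \<Rightarrow> complex" and W W1 W2 :: "complex \<Rightarrow> real \<Rightarrow> complex" and Z :: "(complex \<times> real) set"
  assumes \<sigma>: "0 < \<sigma>0" "0 < \<sigma>1" and Z: "open Z" and sector_Z: "\<And>\<theta> z. z \<in> sector R1 \<sigma>0 \<sigma>1 \<theta> \<Longrightarrow> (z, \<theta>) \<in> Z"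
    and W_hol: "\<And>\<theta>. (\<lambda>z. W z \<theta>) holomorphic_on {z. (z, \<theta>) \<in> Z}"
    and W_der: "\<And>z \<theta>. (z, \<theta>) \<in> Z \<Longrightarrow> ((\<lambda>t. W z t) has_vector_derivative W1 z \<theta>) (at \<theta>)"
    and W1_der: "\<And>z \<theta>. (z, \<theta>) \<in> Z \<Longrightarrow> ((\<lambda>t. W1 z t) has_vector_derivative W2 z \<theta>) (at \<theta>)"
    and W_cont: "continuous_on Z (\<lambda>(z, \<theta>). W z \<theta>)" and W1_cont: "continuous_on Z (\<lambda>(z, \<theta>). W1 z \<theta>)"
    and W2_cont: "continuous_on Z (\<lambda>(z, \<theta>). W2 z \<theta>)"
    and W_real: "\<And>r \<theta>. (of_real r, \<theta>) \<in> Z \<Longrightarrow> W (of_real r) \<theta> = U (polar r \<theta>)"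
begin

definition "Wz = dz W"
definition "Wzz = dz Wz"
definition "W1z = dz W1"
definition Lam :: "complex \<Rightarrow> real \<Rightarrow> complex" where
  "Lam z \<theta> = Wzz z \<theta> + Wz z \<theta> / z + W2 z \<theta> / z\<^sup>2 + of_real (k\<^sup>2) * W z \<theta>"

lemma W1_hol: "(\<lambda>z. W1 z \<theta>) holomorphic_on {z. (z, \<theta>) \<in> Z}"
  by (rule parameter_derivative_holomorphic[OF Z W_hol W_der W1_cont])

lemma W2_hol: "(\<lambda>z. W2 z \<theta>) holomorphic_on {z. (z, \<theta>) \<in> Z}"
  by (rule parameter_derivative_holomorphic[OF Z W1_hol W1_der W2_cont])

lemma Wz_hol: "(\<lambda>z. Wz z \<theta>) holomorphic_on {z. (z, \<theta>) \<in> Z}"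
  unfolding Wz_def by (rule dz_holomorphic[OF Z W_hol])

lemma Wzz_hol: "(\<lambda>z. Wzz z \<theta>) holomorphic_on {z. (z, \<theta>) \<in> Z}"
  unfolding Wzz_def by (rule dz_holomorphic[OF Z Wz_hol])

lemma Wz_cont: "continuous_on Z (\<lambda>(z, \<theta>). Wz z \<theta>)"
  unfolding Wz_def by (rule dz_continuous[OF Z W_hol W_cont])

lemma Wzz_cont: "continuous_on Z (\<lambda>(z, \<theta>). Wzz z \<theta>)"
  unfolding Wzz_def by (rule dz_continuous[OF Z Wz_hol Wz_cont])

lemma W1z_cont: "continuous_on Z (\<lambda>(z, \<theta>). W1z z \<theta>)"
  unfolding W1z_def by (rule dz_continuous[OF Z W1_hol W1_cont])

lemma W_dz: "(z, \<theta>) \<in> Z \<Longrightarrow> ((\<lambda>z. W z \<theta>) has_field_derivative Wz z \<theta>) (at z)"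
  unfolding Wz_def by (rule dz_has_field_derivative[OF Z W_hol])

lemma Wz_dz: "(z, \<theta>) \<in> Z \<Longrightarrow> ((\<lambda>z. Wz z \<theta>) has_field_derivative Wzz z \<theta>) (at z)"
  unfolding Wzz_def by (rule dz_has_field_derivative[OF Z Wz_hol])

lemma W1_dz: "(z, \<theta>) \<in> Z \<Longrightarrow> ((\<lambda>z. W1 z \<theta>) has_field_derivative W1z z \<theta>) (at z)"
  unfolding W1z_def by (rule dz_has_field_derivative[OF Z W1_hol])

lemma W_joint: "(z, \<theta>) \<in> Z \<Longrightarrow> ((\<lambda>(z, \<theta>). W z \<theta>) has_derivative (\<lambda>(u, h). Wz z \<theta> * u + h *\<^sub>R W1 z \<theta>)) (at (z, \<theta>))"
  unfolding Wz_def by (rule parameter_chain_rule[OF Z W_hol W_der W1_cont])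

lemma W1_joint: "(z, \<theta>) \<in> Z \<Longrightarrow> ((\<lambda>(z, \<theta>). W1 z \<theta>) has_derivative (\<lambda>(u, h). W1z z \<theta> * u + h *\<^sub>R W2 z \<theta>)) (at (z, \<theta>))"
  unfolding W1z_def by (rule parameter_chain_rule[OF Z W1_hol W1_der W2_cont])

lemma joint_angular:
  assumes "((\<lambda>(z, \<theta>). F z \<theta>) has_derivative (\<lambda>(u, h). (a :: complex) * u + h *\<^sub>R b)) (at (S \<theta>, \<theta>))"
    and "(S has_vector_derivative S') (at \<theta>)"
  shows "((\<lambda>t. F (S t) t) has_vector_derivative a * S' + b) (at \<theta>)"
proof -
  have "((\<lambda>t. (S t, t)) has_derivative (\<lambda>h. (h *\<^sub>R S', h))) (at \<theta>)"
    using assms(2) unfolding has_vector_derivative_def by (intro has_derivative_Pair has_derivative_ident)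
  from has_derivative_compose[OF this assms(1)] show ?thesis
    by (simp add: has_vector_derivative_def scaleR_add_right)
qed

lemma sector_per: "sector R1 \<sigma>0 \<sigma>1 (\<theta> + 2 * pi) = sector R1 \<sigma>0 \<sigma>1 \<theta>"
  by (simp add: sector_def R1_per)

lemma real_mem_Z: "R1 \<theta> \<le> r \<Longrightarrow> (of_real r, \<theta>) \<in> Z"
  by (rule sector_Z[OF of_real_in_sector[OF \<sigma>(1)]])

lemma per_slices: "sector R1 \<sigma>0 \<sigma>1 \<theta> \<subseteq> {z. (z, \<theta>) \<in> Z} \<inter> {z. (z, \<theta> + 2 * pi) \<in> Z}"
  using sector_Z[of _ \<theta>] sector_Z[of _ "\<theta> + 2 * pi"] sector_per by auto

lemma W_real_per: "R1 \<theta> \<le> r \<Longrightarrow> W (of_real r) (\<theta> + 2 * pi) = W (of_real r) \<theta>"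
  using W_real[OF real_mem_Z[of "\<theta> + 2 * pi" r]] W_real[OF real_mem_Z[of \<theta> r]] by (simp add: R1_per)

text \<open>Periodicity of W is inherited from U: for real radii it is that of polar coordinates,
  and the identity theorem spreads it over the sector, which is the same at \<theta> and \<theta> +
  2 pi.\<close>

lemma W_per:
  assumes "z \<in> sector R1 \<sigma>0 \<sigma>1 \<theta>"
  shows "W z (\<theta> + 2 * pi) = W z \<theta>"
proof -
  define A where "A = {z. (z, \<theta>) \<in> Z} \<inter> {z. (z, \<theta> + 2 * pi) \<in> Z}"
  have A: "open A" "sector R1 \<sigma>0 \<sigma>1 \<theta> \<subseteq> A"
    unfolding A_def using per_slices[of \<theta>] by (auto intro: open_slice[OF Z])
  have hol: "(\<lambda>z. W z (\<theta> + 2 * pi) - W z \<theta>) holomorphic_on A"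
    unfolding A_def by (intro holomorphic_on_diff holomorphic_on_subset[OF W_hol]) auto
  have "W z (\<theta> + 2 * pi) - W z \<theta> = 0"
    by (rule sector_identity[OF A hol \<sigma>(1) _ assms, of "R1 \<theta>"]) (simp add: W_real_per)
  then show ?thesis by simp
qed

lemma W1_real_per: "R1 \<theta> < r \<Longrightarrow> W1 (of_real r) (\<theta> + 2 * pi) = W1 (of_real r) \<theta>"
proof -
  assume r: "R1 \<theta> < r"
  \<comment> \<open>Differentiating the periodicity relation requires it for all angles near
    \<theta>, hence the strict inequality between R1 and r.\<close>
  have "open {t. R1 t < r}" using R1_cont by (intro open_Collect_less continuous_intros)
  moreover have "((\<lambda>t. W (of_real r) (t + 2 * pi)) has_vector_derivative W1 (of_real r) (\<theta> + 2 * pi)) (at \<theta>)"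
    by (rule has_vector_derivative_shift[OF W_der[OF real_mem_Z]]) (use r R1_per in simp)
  ultimately have "(W (of_real r) has_vector_derivative W1 (of_real r) (\<theta> + 2 * pi)) (at \<theta>)"
    using r W_real_per by (elim has_vector_derivative_transform_within_open) auto
  moreover have "(W (of_real r) has_vector_derivative W1 (of_real r) \<theta>) (at \<theta>)"
    by (rule W_der[OF real_mem_Z]) (use r in simp)
  ultimately show ?thesis by (rule vector_derivative_unique_at)
qed

lemma W1_per:
  assumes "z \<in> sector R1 \<sigma>0 \<sigma>1 \<theta>"
  shows "W1 z (\<theta> + 2 * pi) = W1 z \<theta>"
proof -
  define A where "A = {z. (z, \<theta>) \<in> Z} \<inter> {z. (z, \<theta> + 2 * pi) \<in> Z}"
  have A: "open A" "sector R1 \<sigma>0 \<sigma>1 \<theta> \<subseteq> A"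
    unfolding A_def using per_slices[of \<theta>] by (auto intro: open_slice[OF Z])
  have hol: "(\<lambda>z. W1 z (\<theta> + 2 * pi) - W1 z \<theta>) holomorphic_on A"
    unfolding A_def by (intro holomorphic_on_diff holomorphic_on_subset[OF W1_hol]) auto
  have "W1 z (\<theta> + 2 * pi) - W1 z \<theta> = 0"
    by (rule sector_identity[OF A hol \<sigma>(1) _ assms, of "R1 \<theta> + 1"]) (simp add: W1_real_per)
  then show ?thesis by simp
qed

lemma sector_nonzero: "z \<in> sector R1 \<sigma>0 \<sigma>1 \<theta> \<Longrightarrow> z \<noteq> 0"
  using Re_sector_ge[OF \<sigma>, of z R1 \<theta>] R1_pos[of \<theta>] by auto

lemma Lam_zero_sector:
  assumes "\<And>r. r1 \<le> r \<Longrightarrow> Lam (of_real r) \<theta> = 0" "z \<in> sector R1 \<sigma>0 \<sigma>1 \<theta>"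
  shows "Lam z \<theta> = 0"
proof -
  have A: "open ({z. (z, \<theta>) \<in> Z} - {0})" using open_slice[OF Z] by (intro open_Diff) auto
  have B: "sector R1 \<sigma>0 \<sigma>1 \<theta> \<subseteq> {z. (z, \<theta>) \<in> Z} - {0}"
    using sector_Z[of _ \<theta>] sector_nonzero[of _ \<theta>] by blast
  have C: "(\<lambda>z. Lam z \<theta>) holomorphic_on {z. (z, \<theta>) \<in> Z} - {0}"
    unfolding Lam_def
    by (intro holomorphic_intros holomorphic_on_subset[OF Wzz_hol] holomorphic_on_subset[OF Wz_hol]
        holomorphic_on_subset[OF W2_hol] holomorphic_on_subset[OF W_hol]) auto
  show ?thesis by (rule sector_identity[OF A B C \<sigma>(1) assms(1,2)])
qed

end

section \<open>Fields evaluated at a complex radius\<close>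

text \<open>All roughness of the interface is collected in dR, the derivative of R1. S_\<theta>
  factors as dR \<alpha>, and the mixed derivative appears both as \<alpha>_r = \<beta> and as dR
  \<beta>, the \<theta>-derivative of S_r. The factors \<alpha> and \<beta> are continuous across
  the rays. One instance has S = r outside the interface, the other the compression map in the
  layer.\<close>

locale transformed = sector_field +
  fixes G :: "(real^2) set" and T :: "real set" and S Sr \<alpha> \<beta> :: "real \<Rightarrow> real \<Rightarrow> complex" and dR :: "real \<Rightarrow> real" and B :: real
  assumes G: "open G" "0 \<notin> G" and T: "closed T" "finite (T \<inter> {0..2*pi})"
    and dR: "continuous_on (- T) dR" "\<And>\<theta>. 0 \<le> \<theta> \<Longrightarrow> \<theta> \<le> 2 * pi \<Longrightarrow> \<theta> \<notin> T \<Longrightarrow> \<bar>dR \<theta>\<bar> \<le> B"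
    and S_sector: "\<And>r \<theta>. 0 < r \<Longrightarrow> polar r \<theta> \<in> G \<Longrightarrow> S r \<theta> \<in> sector R1 \<sigma>0 \<sigma>1 \<theta>"
    and S_r: "\<And>r \<theta>. 0 < r \<Longrightarrow> polar r \<theta> \<in> G \<Longrightarrow> ((\<lambda>r. S r \<theta>) has_vector_derivative Sr r \<theta>) (at r)"
    and \<alpha>_r: "\<And>r \<theta>. 0 < r \<Longrightarrow> polar r \<theta> \<in> G \<Longrightarrow> ((\<lambda>r. \<alpha> r \<theta>) has_vector_derivative \<beta> r \<theta>) (at r)"
    and S_t: "\<And>r \<theta>. 0 < r \<Longrightarrow> polar r \<theta> \<in> G \<Longrightarrow> \<theta> \<notin> T \<Longrightarrow> (S r has_vector_derivative of_real (dR \<theta>) * \<alpha> r \<theta>) (at \<theta>)"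
    and Sr_t: "\<And>r \<theta>. 0 < r \<Longrightarrow> polar r \<theta> \<in> G \<Longrightarrow> \<theta> \<notin> T \<Longrightarrow> (Sr r has_vector_derivative of_real (dR \<theta>) * \<beta> r \<theta>) (at \<theta>)"
    and cont: "\<And>F. F \<in> {S, Sr, \<alpha>, \<beta>} \<Longrightarrow> continuous_on {p. 0 < fst p \<and> polar (fst p) (snd p) \<in> G} (\<lambda>p. F (fst p) (snd p))"
    and S_per: "\<And>r. 0 < r \<Longrightarrow> polar r 0 \<in> G \<Longrightarrow> S r (2 * pi) = S r 0 \<and> Sr r (2 * pi) = Sr r 0"
begin

definition "ur r \<theta> = Wz (S r \<theta>) \<theta> * Sr r \<theta>"
definition "ut r \<theta> = Wz (S r \<theta>) \<theta> * (of_real (dR \<theta>) * \<alpha> r \<theta>) + W1 (S r \<theta>) \<theta>"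
definition "Pf r \<theta> = S r \<theta> * Wz (S r \<theta>) \<theta> - of_real (dR \<theta>) * (\<alpha> r \<theta> * (W1 (S r \<theta>) \<theta> / S r \<theta>))"
definition "Qf r \<theta> = Sr r \<theta> * (W1 (S r \<theta>) \<theta> / S r \<theta>)"
text \<open>The derivatives of \<open>Pf\<close> in r and of \<open>Qf\<close> in \<theta>. Since
  S_\<theta> occurs only in \<open>Pf\<close>, dR is never differentiated.\<close>

definition "P' r \<theta> = Sr r \<theta> * Wz (S r \<theta>) \<theta> + S r \<theta> * (Sr r \<theta> * Wzz (S r \<theta>) \<theta>)
  - of_real (dR \<theta>) * (\<beta> r \<theta> * (W1 (S r \<theta>) \<theta> / S r \<theta>)
     + \<alpha> r \<theta> * ((Sr r \<theta> * W1z (S r \<theta>) \<theta> * S r \<theta> - W1 (S r \<theta>) \<theta> * Sr r \<theta>) / (S r \<theta>)\<^sup>2))"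
definition "Q' r \<theta> = of_real (dR \<theta>) * \<beta> r \<theta> * (W1 (S r \<theta>) \<theta> / S r \<theta>)
  + Sr r \<theta> * (((W1z (S r \<theta>) \<theta> * (of_real (dR \<theta>) * \<alpha> r \<theta>) + W2 (S r \<theta>) \<theta>) * S r \<theta>
      - W1 (S r \<theta>) \<theta> * (of_real (dR \<theta>) * \<alpha> r \<theta>)) / (S r \<theta>)\<^sup>2)"

lemma S_Z: "0 < r \<Longrightarrow> polar r \<theta> \<in> G \<Longrightarrow> (S r \<theta>, \<theta>) \<in> Z" and S_nz: "0 < r \<Longrightarrow> polar r \<theta> \<in> G \<Longrightarrow> S r \<theta> \<noteq> 0"
  using S_sector sector_Z sector_nonzero by blast+

lemma comp_cont:
  assumes "continuous_on Z (\<lambda>(z, \<theta>). F z \<theta>)"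
  shows "continuous_on {p. 0 < fst p \<and> polar (fst p) (snd p) \<in> G} (\<lambda>p. F (S (fst p) (snd p)) (snd p))"
proof -
  have "continuous_on {p. 0 < fst p \<and> polar (fst p) (snd p) \<in> G} (\<lambda>p. (\<lambda>(z, \<theta>). F z \<theta>) (S (fst p) (snd p), snd p))"
    by (rule continuous_on_compose2[OF assms]) (auto intro!: continuous_intros cont S_Z)
  then show ?thesis by simp
qed

lemmas conts = cont[of S, simplified] cont[of Sr, simplified] cont[of \<alpha>, simplified] cont[of \<beta>, simplified]
  comp_cont[OF W_cont] comp_cont[OF W1_cont] comp_cont[OF W2_cont] comp_cont[OF Wz_cont] comp_cont[OF Wzz_cont] comp_cont[OF W1z_cont]

lemma tame_dR: "tame G T (\<lambda>r \<theta>. of_real (dR \<theta>))"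
  by (rule tame_angular[OF dR])

lemmas tame_c = tame_continuous[OF G(2)]

lemma tame_u: "tame G T (\<lambda>r \<theta>. W (S r \<theta>) \<theta>)" by (rule tame_c) (rule conts)
lemma tame_ur: "tame G T ur" unfolding ur_def[abs_def] by (rule tame_c) (intro continuous_intros conts)
lemma tame_ut: "tame G T ut" unfolding ut_def[abs_def]
  by (intro tame_add tame_mult tame_dR tame_c conts)
lemma tame_Pf: "tame G T Pf" unfolding Pf_def[abs_def]
  by (intro tame_diff tame_mult tame_dR tame_c conts continuous_intros) (auto simp: S_nz)
lemma tame_Qf: "tame G T Qf" unfolding Qf_def[abs_def]
  by (intro tame_c conts continuous_intros) (auto simp: S_nz)
lemma tame_P': "tame G T P'" unfolding P'_def[abs_def]
  by (intro tame_add tame_diff tame_mult tame_dR tame_c conts continuous_intros) (auto simp: S_nz)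
lemma tame_Q': "tame G T Q'"
proof -
  have e: "Q' = (\<lambda>r \<theta>. of_real (dR \<theta>) * (\<beta> r \<theta> * (W1 (S r \<theta>) \<theta> / S r \<theta>)
      + Sr r \<theta> * ((W1z (S r \<theta>) \<theta> * \<alpha> r \<theta> * S r \<theta> - W1 (S r \<theta>) \<theta> * \<alpha> r \<theta>) / (S r \<theta>)\<^sup>2))
      + Sr r \<theta> * (W2 (S r \<theta>) \<theta> * S r \<theta> / (S r \<theta>)\<^sup>2))"
    by (simp add: Q'_def fun_eq_iff add_divide_distrib diff_divide_distrib algebra_simps)
  show ?thesis unfolding e
    by (intro tame_add tame_mult tame_dR tame_c conts continuous_intros) (auto simp: S_nz)
qed

lemma radial_chain:
  assumes "0 < r" "polar r \<theta> \<in> G" "((\<lambda>z. F z \<theta>) has_field_derivative F') (at (S r \<theta>))"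
  shows "((\<lambda>r. F (S r \<theta>) \<theta>) has_vector_derivative Sr r \<theta> * F') (at r)"
  using field_vector_diff_chain_at[OF S_r[OF assms(1,2)] assms(3)] by (simp add: o_def)

lemma vd_divide:
  assumes "(f has_vector_derivative f') (at x)" "(g has_vector_derivative g') (at x)" "g x \<noteq> 0"
  shows "((\<lambda>x. f x / g x) has_vector_derivative ((f' * g x - f x * g') / (g x)\<^sup>2 :: complex)) (at (x :: real))"
proof -
  have "((\<lambda>x. f x / g x) has_derivative (\<lambda>h. - f x * (inverse (g x) * (h *\<^sub>R g') * inverse (g x)) + (h *\<^sub>R f') / g x)) (at x)"
    using assms unfolding has_vector_derivative_def by (intro has_derivative_divide) auto
  then show ?thesis unfolding has_vector_derivative_def
    by (rule has_derivative_eq_rhs) (use assms(3) in \<open>auto simp: fun_eq_iff scaleR_conv_of_real field_simps power2_eq_square\<close>)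
qed

lemma Pf_deriv:
  assumes r: "0 < r" "polar r \<theta> \<in> G"
  shows "((\<lambda>r. Pf r \<theta>) has_vector_derivative P' r \<theta>) (at r)"
proof -
  note Zm = S_Z[OF r]
  have d1: "((\<lambda>r. W1 (S r \<theta>) \<theta> / S r \<theta>) has_vector_derivative
      (Sr r \<theta> * W1z (S r \<theta>) \<theta> * S r \<theta> - W1 (S r \<theta>) \<theta> * Sr r \<theta>) / (S r \<theta>)\<^sup>2) (at r)"
    by (rule vd_divide[OF radial_chain[OF r, where F = W1, OF W1_dz[OF Zm]] S_r[OF r] S_nz[OF r]])
  have d2: "((\<lambda>r. S r \<theta> * Wz (S r \<theta>) \<theta>) has_vector_derivative
      S r \<theta> * (Sr r \<theta> * Wzz (S r \<theta>) \<theta>) + Sr r \<theta> * Wz (S r \<theta>) \<theta>) (at r)"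
    by (rule has_vector_derivative_mult[OF S_r[OF r] radial_chain[OF r, where F = Wz, OF Wz_dz[OF Zm]]])
  show ?thesis unfolding Pf_def[abs_def]
    using has_vector_derivative_diff[OF d2 has_vector_derivative_mult_right[OF has_vector_derivative_mult[OF \<alpha>_r[OF r] d1], of "of_real (dR \<theta>)"]]
    by (simp add: P'_def add.commute)
qed

lemma Qf_deriv:
  assumes r: "0 < r" "polar r \<theta> \<in> G" "\<theta> \<notin> T"
  shows "(Qf r has_vector_derivative Q' r \<theta>) (at \<theta>)"
proof -
  note Zm = S_Z[OF r(1,2)]
  have d1: "((\<lambda>t. W1 (S r t) t / S r t) has_vector_derivative
      ((W1z (S r \<theta>) \<theta> * (of_real (dR \<theta>) * \<alpha> r \<theta>) + W2 (S r \<theta>) \<theta>) * S r \<theta> - W1 (S r \<theta>) \<theta> * (of_real (dR \<theta>) * \<alpha> r \<theta>)) / (S r \<theta>)\<^sup>2) (at \<theta>)"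
    by (rule vd_divide[OF joint_angular[OF W1_joint[OF Zm] S_t[OF r]] S_t[OF r] S_nz[OF r(1,2)]])
  show ?thesis unfolding Qf_def[abs_def]
    using has_vector_derivative_mult[OF Sr_t[OF r] d1] by (simp add: Q'_def add.commute)
qed

text \<open>The mixed terms with \<beta> and the terms with \<alpha> S_r cancel between P' and Q',
  so dR disappears and only the radial-angular operator at the complex point S remains.\<close>

lemma divergence_identity:
  assumes r: "0 < r" "polar r \<theta> \<in> G"
  shows "P' r \<theta> + Q' r \<theta> = S r \<theta> * Sr r \<theta> * (Lam (S r \<theta>) \<theta> - of_real (k\<^sup>2) * W (S r \<theta>) \<theta>)"
  using S_nz[OF r] by (simp add: P'_def Q'_def Lam_def field_simps power2_eq_square)

lemma isCont_angle:
  assumes "continuous_on {p. 0 < fst p \<and> polar (fst p) (snd p) \<in> G} (\<lambda>p. F (fst p) (snd p))" "0 < r" "polar r \<theta> \<in> G"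
  shows "isCont (F r) \<theta>" "isCont (\<lambda>p. F (fst p) (snd p)) (r, \<theta>)"
proof -
  note o = open_polar_preimage[OF G(1)]
  show c: "isCont (\<lambda>p. F (fst p) (snd p)) (r, \<theta>)"
    using assms continuous_on_eq_continuous_at[OF o] by auto
  have "isCont (\<lambda>t. (r, t)) \<theta>" by (intro continuous_intros)
  from isCont_o2[OF this c] show "isCont (F r) \<theta>" by simp
qed

lemma u_radial: "0 < r \<Longrightarrow> polar r \<theta> \<in> G \<Longrightarrow> ((\<lambda>r. W (S r \<theta>) \<theta>) has_vector_derivative ur r \<theta>) (at r)"
  using radial_chain[where F = W, OF _ _ W_dz[OF S_Z]] by (simp add: ur_def mult.commute)

lemma u_angular: "0 < r \<Longrightarrow> polar r \<theta> \<in> G \<Longrightarrow> \<theta> \<notin> T \<Longrightarrow> ((\<lambda>t. W (S r t) t) has_vector_derivative ut r \<theta>) (at \<theta>)"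
  unfolding ut_def by (rule joint_angular[OF W_joint[OF S_Z] S_t])

end

lemma frechet_polar_frame:
  assumes "\<phi> \<in> test_functions G"
  shows "frechet_derivative \<phi> (at x) (polar r t) = r * (cos t * partial 1 \<phi> x + sin t * partial 2 \<phi> x)"
  unfolding frechet_partial[OF smooth_differentiable[OF test_functionsD(1)[OF assms]]]
  by (simp add: sum_2 algebra_simps)

context transformed
begin

lemma S_2pi:
  assumes "0 < r" "polar r 0 \<in> G"
  shows "W (S r (2*pi)) (2*pi) = W (S r 0) 0" "W1 (S r (2*pi)) (2*pi) = W1 (S r 0) 0"
  using W_per[OF S_sector[OF assms]] W1_per[OF S_sector[OF assms]] S_per[OF assms] by simp_all

text \<open>The divergence theorem for the field u e_i, whose radial and angular components are u
  times \<open>er\<close> and u times \<open>et\<close>. Continuity of u across the corner rays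
  makes the classical gradient off these rays the weak gradient.\<close>

lemma weak_gradient_identity:
  assumes \<phi>: "\<phi> \<in> test_functions G"
    and u: "\<And>r \<theta>. 0 < r \<Longrightarrow> polar r \<theta> \<in> G \<Longrightarrow> u (polar r \<theta>) = W (S r \<theta>) \<theta>"
    and p: "\<And>r \<theta>. 0 < r \<Longrightarrow> 0 < \<theta> \<Longrightarrow> \<theta> < 2 * pi \<Longrightarrow> \<theta> \<notin> T \<Longrightarrow> polar r \<theta> \<in> G \<Longrightarrow>
      p (polar r \<theta>) = polvec \<theta> (ur r \<theta>) (ut r \<theta> / of_real r)"
  shows "integrable lebesgue (\<lambda>x. partial i \<phi> x *\<^sub>R u x + \<phi> x *\<^sub>R p x $ i)
    \<and> (LINT x|lebesgue. partial i \<phi> x *\<^sub>R u x + \<phi> x *\<^sub>R p x $ i) = 0"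
proof -
  define er where "er \<theta> = polar 1 \<theta> $ i" for \<theta>
  define et where "et \<theta> = polar 1 (\<theta> + pi / 2) $ i" for \<theta>
  have der: "(er has_real_derivative et \<theta>) (at \<theta>)" "(et has_real_derivative - er \<theta>) (at \<theta>)" for \<theta>
    using exhaust_2[of i] by (auto simp: er_def[abs_def] et_def[abs_def] intro!: derivative_eq_intros)
  have erc: "continuous_on A er" "continuous_on A et" for A
    using DERIV_isCont[OF der(1)] DERIV_isCont[OF der(2)] by (auto intro: continuous_at_imp_continuous_on)
  have vd: "((\<lambda>x. complex_of_real (f x)) has_vector_derivative of_real f') (at x)" if "(f has_real_derivative f') (at x)" for f f' x
    using bounded_linear.has_vector_derivative[OF bounded_linear_of_real that[unfolded has_real_derivative_iff_has_vector_derivative]] .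
  define w where "w r \<theta> = W (S r \<theta>) \<theta>" for r \<theta>
  have wc: "continuous_on {p. 0 < fst p \<and> polar (fst p) (snd p) \<in> G} (\<lambda>p. w (fst p) (snd p))"
    unfolding w_def by (rule conts)
  have ce: "continuous_on {p. 0 < fst p \<and> polar (fst p) (snd p) \<in> G} (\<lambda>p. er (snd p))"
     "continuous_on {p. 0 < fst p \<and> polar (fst p) (snd p) \<in> G} (\<lambda>p. et (snd p))"
    by (rule continuous_on_compose2[OF erc(1)[of UNIV]] continuous_on_compose2[OF erc(2)[of UNIV]]; auto intro!: continuous_intros)+
  define P where "P r \<theta> = of_real (r * er \<theta>) * w r \<theta>" for r \<theta>
  define Q where "Q r \<theta> = of_real (et \<theta>) * w r \<theta>" for r \<theta>
  define dP where "dP r \<theta> = of_real (r * er \<theta>) * ur r \<theta> + of_real (er \<theta>) * w r \<theta>" for r \<theta>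
  define dQ where "dQ r \<theta> = of_real (et \<theta>) * ut r \<theta> - of_real (er \<theta>) * w r \<theta>" for r \<theta>
  have tw: "tame G T w" by (rule tame_c[OF wc])
  have te: "tame G T (\<lambda>r \<theta>. of_real (r * er \<theta>))" "tame G T (\<lambda>r \<theta>. of_real (er \<theta>))" "tame G T (\<lambda>r \<theta>. of_real (et \<theta>))"
    by (rule tame_c; intro continuous_intros ce)+
  have t: "tame G T F" if "F \<in> {P, Q, dP, dQ}" for F
    using that tame_mult[OF te(1) tw] tame_mult[OF te(3) tw] tame_add[OF tame_mult[OF te(1) tame_ur] tame_mult[OF te(2) tw]]
      tame_diff[OF tame_mult[OF te(3) tame_ut] tame_mult[OF te(2) tw]]
    unfolding P_def[abs_def] Q_def[abs_def] dP_def[abs_def] dQ_def[abs_def] by blast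
  show ?thesis
  proof (rule polar_divergence[OF G \<phi> T, of P dP Q dQ])
    fix r \<theta> :: real assume r: "0 < r" "polar r \<theta> \<in> G"
    show "((\<lambda>r. P r \<theta>) has_vector_derivative dP r \<theta>) (at r)"
    proof -
      have "((\<lambda>r. r * er \<theta>) has_real_derivative er \<theta>) (at r)" by (auto intro!: derivative_eq_intros)
      from has_vector_derivative_mult[OF vd[OF this] u_radial[OF r]] show ?thesis
        by (simp add: P_def[abs_def] dP_def w_def)
    qed
    show "(Q r has_vector_derivative dQ r \<theta>) (at \<theta>)" if "\<theta> \<notin> T"
      using has_vector_derivative_mult[OF vd[OF der(2)] u_angular[OF r that]]
      by (simp add: Q_def[abs_def] dQ_def w_def)
    show "isCont (Q r) \<theta>"
      unfolding Q_def[abs_def] using isCont_angle(1)[OF wc r] DERIV_isCont[OF der(2)]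
      by (intro continuous_intros) auto
    show "r *\<^sub>R (partial i \<phi> (polar r \<theta>) *\<^sub>R u (polar r \<theta>) + \<phi> (polar r \<theta>) *\<^sub>R p (polar r \<theta>) $ i) =
        \<phi> (polar r \<theta>) *\<^sub>R (dP r \<theta> + dQ r \<theta>)
        + frechet_derivative \<phi> (at (polar r \<theta>)) (polar 1 \<theta>) *\<^sub>R P r \<theta>
        + frechet_derivative \<phi> (at (polar r \<theta>)) (polar r (\<theta> + pi / 2)) *\<^sub>R Q r \<theta>" if th: "0 < \<theta>" "\<theta> < 2 * pi" "\<theta> \<notin> T"
    proof -
      have pi': "r *\<^sub>R p (polar r \<theta>) $ i = dP r \<theta> + dQ r \<theta>"
        unfolding p[OF r(1) th r(2)] polvec_nth' using r(1)
        by (simp add: dP_def dQ_def er_def et_def scaleR_conv_of_real field_simps)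
      have cs: "(cos \<theta>)\<^sup>2 + (sin \<theta>)\<^sup>2 = 1" by simp
      \<comment> \<open>The Cartesian derivative resolved in the rotating frame, multiplied by r to
        avoid the division.\<close>
      have fr: "r * partial i \<phi> (polar r \<theta>) = frechet_derivative \<phi> (at (polar r \<theta>)) (polar 1 \<theta>) * (r * er \<theta>)
          + frechet_derivative \<phi> (at (polar r \<theta>)) (polar r (\<theta> + pi / 2)) * et \<theta>"
      proof -
        define c s d1 d2 where "c = cos \<theta>" and "s = sin \<theta>" and "d1 = partial 1 \<phi> (polar r \<theta>)" and "d2 = partial 2 \<phi> (polar r \<theta>)"
        have "c\<^sup>2 + s\<^sup>2 = 1" using cs by (simp add: c_def s_def)
        then have "r * d1 = 1 * (c * d1 + s * d2) * (r * c) + r * (- s * d1 + c * d2) * (- s)"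
            "r * d2 = 1 * (c * d1 + s * d2) * (r * s) + r * (- s * d1 + c * d2) * c" by algebra+
        then show ?thesis
          unfolding frechet_polar_frame[OF \<phi>] cos_plus_quarter sin_plus_quarter using exhaust_2[of i]
          by (auto simp: er_def et_def c_def s_def d1_def d2_def)
      qed
      have "r *\<^sub>R (partial i \<phi> (polar r \<theta>) *\<^sub>R u (polar r \<theta>)) = (r * partial i \<phi> (polar r \<theta>)) *\<^sub>R w r \<theta>"
        using u[OF r] by (simp add: w_def)
      also have "\<dots> = frechet_derivative \<phi> (at (polar r \<theta>)) (polar 1 \<theta>) *\<^sub>R P r \<theta>
          + frechet_derivative \<phi> (at (polar r \<theta>)) (polar r (\<theta> + pi / 2)) *\<^sub>R Q r \<theta>"
        unfolding fr by (simp add: P_def Q_def scaleR_conv_of_real algebra_simps)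
      finally show ?thesis
        unfolding scaleR_add_right[of r] pi'[symmetric] by (simp add: scaleR_add_right scaleR_left_commute)
    qed
  next
    show "Q r (2 * pi) = Q r 0" if "0 < r" "polar r 0 \<in> G" for r
    proof -
      have "polar 1 (2 * pi + pi / 2) = polar 1 (0 + pi / 2)" using polar_periodic[of 1 "pi / 2"] by (simp add: add.commute)
      then show ?thesis using S_2pi(1)[OF that] by (simp add: Q_def et_def w_def)
    qed
    show "continuous_on {p. 0 < fst p \<and> polar (fst p) (snd p) \<in> G \<and> snd p \<notin> T} (\<lambda>p. F (fst p) (snd p))"
      if "F \<in> {P, Q, dP, dQ}" for F using t[OF that] by (simp add: tame_def)
    show "\<exists>M. \<forall>r \<theta>. 0 < r \<and> 0 \<le> \<theta> \<and> \<theta> \<le> 2 * pi \<and> \<theta> \<notin> T \<and> polar r \<theta> \<in> K \<longrightarrow> norm (F r \<theta>) \<le> M"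
      if "F \<in> {P, Q, dP, dQ}" "compact K" "K \<subseteq> G" for F K using t[OF that(1)] that unfolding tame_def by blast
    show "partial i \<phi> x *\<^sub>R u x + \<phi> x *\<^sub>R p x $ i = 0" if "x \<notin> closure {x. \<phi> x \<noteq> 0}" for x
      using test_function_deriv_zero[OF that] that closure_subset[of "{x. \<phi> x \<noteq> 0}"] by (auto simp: partial_def)
  qed
qed

text \<open>Green's formula combined with \<open>divergence_identity\<close>. The value of \<Lambda>
  is kept as L, because outside the interface the identity serves to prove that \<Lambda>
  vanishes.\<close>

lemma weak_equation_identity:
  assumes \<phi>: "\<phi> \<in> test_functions G"
    and u: "\<And>r \<theta>. 0 < r \<Longrightarrow> polar r \<theta> \<in> G \<Longrightarrow> u (polar r \<theta>) = W (S r \<theta>) \<theta>"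
    and F: "\<And>r \<theta>. 0 < r \<Longrightarrow> 0 < \<theta> \<Longrightarrow> \<theta> < 2 * pi \<Longrightarrow> \<theta> \<notin> T \<Longrightarrow> polar r \<theta> \<in> G \<Longrightarrow>
      F (polar r \<theta>) = polvec \<theta> (Pf r \<theta> / of_real r) (Qf r \<theta>)"
    and n: "\<And>r \<theta>. 0 < r \<Longrightarrow> polar r \<theta> \<in> G \<Longrightarrow> n (polar r \<theta>) = S r \<theta> * Sr r \<theta> / of_real r"
    and L: "\<And>r \<theta>. 0 < r \<Longrightarrow> polar r \<theta> \<in> G \<Longrightarrow> L (polar r \<theta>) = Lam (S r \<theta>) \<theta>"
  shows "integrable lebesgue (\<lambda>x. (\<Sum>i\<in>UNIV. partial i \<phi> x *\<^sub>R F x $ i) + \<phi> x *\<^sub>R (n x * (L x - of_real (k\<^sup>2) * u x)))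
    \<and> (LINT x|lebesgue. (\<Sum>i\<in>UNIV. partial i \<phi> x *\<^sub>R F x $ i) + \<phi> x *\<^sub>R (n x * (L x - of_real (k\<^sup>2) * u x))) = 0"
proof (rule polar_divergence[OF G \<phi> T, of Pf P' Qf Q'])
  have t: "tame G T X" if "X \<in> {Pf, Qf, P', Q'}" for X
    using that tame_Pf tame_Qf tame_P' tame_Q' by blast
  fix r \<theta> :: real assume r: "0 < r" "polar r \<theta> \<in> G"
  show "((\<lambda>r. Pf r \<theta>) has_vector_derivative P' r \<theta>) (at r)" by (rule Pf_deriv[OF r])
  show "(Qf r has_vector_derivative Q' r \<theta>) (at \<theta>)" if "\<theta> \<notin> T" by (rule Qf_deriv[OF r that])
  show "isCont (Qf r) \<theta>"
    unfolding Qf_def[abs_def] using isCont_angle(1)[OF conts(1) r] isCont_angle(1)[OF conts(2) r] isCont_angle(1)[OF conts(6) r] S_nz[OF r]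
    by (intro continuous_intros) auto
  show "r *\<^sub>R ((\<Sum>i\<in>UNIV. partial i \<phi> (polar r \<theta>) *\<^sub>R F (polar r \<theta>) $ i) + \<phi> (polar r \<theta>) *\<^sub>R (n (polar r \<theta>) * (L (polar r \<theta>) - of_real (k\<^sup>2) * u (polar r \<theta>)))) =
        \<phi> (polar r \<theta>) *\<^sub>R (P' r \<theta> + Q' r \<theta>)
        + frechet_derivative \<phi> (at (polar r \<theta>)) (polar 1 \<theta>) *\<^sub>R Pf r \<theta>
        + frechet_derivative \<phi> (at (polar r \<theta>)) (polar r (\<theta> + pi / 2)) *\<^sub>R Qf r \<theta>" if th: "0 < \<theta>" "\<theta> < 2 * pi" "\<theta> \<notin> T"
  proof -
    have A: "r *\<^sub>R (n (polar r \<theta>) * (L (polar r \<theta>) - of_real (k\<^sup>2) * u (polar r \<theta>))) = P' r \<theta> + Q' r \<theta>"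
      unfolding divergence_identity[OF r] n[OF r] L[OF r] u[OF r] using r(1) by (simp add: scaleR_conv_of_real)
    have B: "r *\<^sub>R (\<Sum>i\<in>UNIV. partial i \<phi> (polar r \<theta>) *\<^sub>R F (polar r \<theta>) $ i)
      = frechet_derivative \<phi> (at (polar r \<theta>)) (polar 1 \<theta>) *\<^sub>R Pf r \<theta>
        + frechet_derivative \<phi> (at (polar r \<theta>)) (polar r (\<theta> + pi / 2)) *\<^sub>R Qf r \<theta>"
      unfolding frechet_polar_frame[OF \<phi>] cos_plus_quarter sin_plus_quarter sum_2 F[OF r(1) th r(2)] polvec_nth
      using r(1) by (simp add: scaleR_conv_of_real field_simps)
    show ?thesis
      unfolding scaleR_add_right[of r] B A[symmetric] by (simp add: scaleR_left_commute)
  qed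
next
  have t: "tame G T X" if "X \<in> {Pf, Qf, P', Q'}" for X
    using that tame_Pf tame_Qf tame_P' tame_Q' by blast
  show "Qf r (2 * pi) = Qf r 0" if "0 < r" "polar r 0 \<in> G" for r
    using S_2pi(2)[OF that] S_per[OF that] by (simp add: Qf_def)
  show "continuous_on {p. 0 < fst p \<and> polar (fst p) (snd p) \<in> G \<and> snd p \<notin> T} (\<lambda>p. X (fst p) (snd p))"
    if "X \<in> {Pf, Qf, P', Q'}" for X using t[OF that] by (simp add: tame_def)
  show "\<exists>M. \<forall>r \<theta>. 0 < r \<and> 0 \<le> \<theta> \<and> \<theta> \<le> 2 * pi \<and> \<theta> \<notin> T \<and> polar r \<theta> \<in> K \<longrightarrow> norm (X r \<theta>) \<le> M"
    if "X \<in> {Pf, Qf, P', Q'}" "compact K" "K \<subseteq> G" for X K using t[OF that(1)] that unfolding tame_def by blast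
  show "(\<Sum>i\<in>UNIV. partial i \<phi> x *\<^sub>R F x $ i) + \<phi> x *\<^sub>R (n x * (L x - of_real (k\<^sup>2) * u x)) = 0" if "x \<notin> closure {x. \<phi> x \<noteq> 0}" for x
    using test_function_deriv_zero[OF that] that closure_subset[of "{x. \<phi> x \<noteq> 0}"] by (auto simp: partial_def)
qed

end

section \<open>Integrals against test functions\<close>

lemma integrable_test_mult:
  fixes h :: "real^2 \<Rightarrow> complex"
  assumes h: "\<And>K. compact K \<Longrightarrow> K \<subseteq> G \<Longrightarrow> set_integrable lebesgue K h" and \<phi>: "\<phi> \<in> test_functions G"
  shows "integrable lebesgue (\<lambda>x. \<phi> x *\<^sub>R h x)"
proof -
  define K where "K = closure {x. \<phi> x \<noteq> 0}"
  have K: "compact K" "K \<subseteq> G" using test_functionsD[OF \<phi>] by (auto simp: K_def)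
  have out: "\<phi> x = 0" if "x \<notin> K" for x using that closure_subset[of "{x. \<phi> x \<noteq> 0}"] by (auto simp: K_def)
  have c: "continuous_on UNIV \<phi>" by (rule smooth_continuous[OF test_functionsD(1)[OF \<phi>]])
  have "bounded (\<phi> ` K)"
    by (rule compact_imp_bounded[OF compact_continuous_image[OF continuous_on_subset[OF c] K(1)]]) simp
  then obtain C where C: "\<And>x. x \<in> K \<Longrightarrow> \<bar>\<phi> x\<bar> \<le> C" unfolding bounded_iff by force
  have i: "integrable lebesgue (\<lambda>x. indicator K x *\<^sub>R h x)" using h[OF K] by (simp add: set_integrable_def)
  have m: "\<phi> \<in> borel_measurable lebesgue" using borel_measurable_continuous_onI[OF c] by (simp add: measurable_completion)
  have e: "(\<lambda>x. \<phi> x *\<^sub>R h x) = (\<lambda>x. \<phi> x *\<^sub>R (indicator K x *\<^sub>R h x))"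
    using out by (auto simp: fun_eq_iff indicator_def)
  show ?thesis
  proof (rule Bochner_Integration.integrable_bound[of _ "\<lambda>x. C *\<^sub>R (indicator K x *\<^sub>R h x)"])
    show "integrable lebesgue (\<lambda>x. C *\<^sub>R (indicator K x *\<^sub>R h x))" by (rule integrable_scaleR_right[OF i])
    show "(\<lambda>x. \<phi> x *\<^sub>R h x) \<in> borel_measurable lebesgue"
      unfolding e by (rule borel_measurable_scaleR[OF m borel_measurable_integrable[OF i]])
    show "AE x in lebesgue. norm (\<phi> x *\<^sub>R h x) \<le> norm (C *\<^sub>R (indicator K x *\<^sub>R h x))"
    proof (rule AE_I2)
      fix x
      show "norm (\<phi> x *\<^sub>R h x) \<le> norm (C *\<^sub>R (indicator K x *\<^sub>R h x))"
      proof (cases "x \<in> K")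
        case True
        then have "\<bar>\<phi> x\<bar> \<le> \<bar>C\<bar>" using C[of x] by linarith
        then have "\<bar>\<phi> x\<bar> * norm (h x) \<le> \<bar>C\<bar> * norm (h x)" by (rule mult_right_mono) simp
        then show ?thesis using True by simp
      qed (use out[of x] in simp)
    qed
  qed
qed

lemma test_LINT:
  assumes "\<phi> \<in> test_functions G"
  shows "(LINT x:G|lebesgue. \<phi> x *\<^sub>R (h x :: complex)) = (LINT x|lebesgue. \<phi> x *\<^sub>R h x)"
proof -
  have "indicator G x *\<^sub>R (\<phi> x *\<^sub>R h x) = \<phi> x *\<^sub>R h x" for x
    using test_functionsD(3)[OF assms] closure_subset[of "{x. \<phi> x \<noteq> 0}"] by (cases "x \<in> G") auto
  then show ?thesis unfolding set_lebesgue_integral_def by (simp only:)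
qed

lemma partial_sum_LINT:
  assumes "\<phi> \<in> test_functions G"
  shows "(LINT x:G|lebesgue. (\<Sum>i\<in>UNIV. partial i \<phi> x *\<^sub>R (h x $ i :: complex))) = (LINT x|lebesgue. (\<Sum>i\<in>UNIV. partial i \<phi> x *\<^sub>R h x $ i))"
proof -
  have "indicator G x *\<^sub>R (\<Sum>i\<in>UNIV. partial i \<phi> x *\<^sub>R h x $ i) = (\<Sum>i\<in>UNIV. partial i \<phi> x *\<^sub>R h x $ i)" for x
  proof (cases "x \<in> G")
    case False
    then have "x \<notin> closure {x. \<phi> x \<noteq> 0}" using test_functionsD(3)[OF assms] by blast
    then show ?thesis using test_function_deriv_zero[of x \<phi>] by (simp add: partial_def)
  qed simp
  then show ?thesis unfolding set_lebesgue_integral_def by (simp only:)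
qed

text \<open>The fundamental lemma of the calculus of variations. Test functions are real while L is
  complex, so the integrand is projected onto the direction of L x0, where it is positive near
  x0.\<close>

lemma continuous_null_test:
  fixes L :: "real^2 \<Rightarrow> complex"
  assumes G: "open G" "x0 \<in> G" and L: "continuous_on G L"
    and int: "\<And>\<phi>. \<phi> \<in> test_functions G \<Longrightarrow> integrable lebesgue (\<lambda>x. \<phi> x *\<^sub>R L x) \<and> (LINT x|lebesgue. \<phi> x *\<^sub>R L x) = 0"
  shows "L x0 = 0"
proof (rule ccontr)
  assume nz: "L x0 \<noteq> 0"
  have "isCont L x0" using L G continuous_on_eq_continuous_at by blast
  then obtain d where d: "0 < d" "\<And>x. dist x x0 < d \<Longrightarrow> dist (L x) (L x0) < norm (L x0) / 2"
    unfolding continuous_at_eps_delta using nz by (meson half_gt_zero zero_less_norm_iff)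
  obtain e where e: "0 < e" "cball x0 e \<subseteq> G" using G unfolding open_contains_cball by blast
  define \<epsilon> where "\<epsilon> = min d e"
  have \<epsilon>: "0 < \<epsilon>" "\<epsilon> \<le> d" "\<epsilon> \<le> e" using d e by (auto simp: \<epsilon>_def)
  obtain \<phi> :: "real^2 \<Rightarrow> real" where \<phi>: "smooth \<phi>" "\<And>x. 0 \<le> \<phi> x" "{x. \<phi> x \<noteq> 0} = ball x0 \<epsilon>"
    using smooth_bump[OF \<epsilon>(1), of x0] by metis
  have cl: "closure {x. \<phi> x \<noteq> 0} = cball x0 \<epsilon>" using \<phi>(3) \<epsilon> by (simp add: closure_ball)
  have "\<phi> \<in> test_functions G"
    unfolding test_functions_def mem_Collect_eq cl using \<phi>(1) e(2) \<epsilon>(3) by (auto simp: subset_eq)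
  from int[OF this] have I: "integrable lebesgue (\<lambda>x. \<phi> x *\<^sub>R L x)" "(LINT x|lebesgue. \<phi> x *\<^sub>R L x) = 0" by auto
  define g where "g x = Re (\<phi> x *\<^sub>R L x * cnj (L x0))" for x
  have bl: "bounded_linear (\<lambda>z. Re (z * cnj (L x0)))"
    by (rule bounded_linear_compose[OF bounded_linear_Re bounded_linear_mult_left])
  have gi: "integrable lebesgue g" "integral\<^sup>L lebesgue g = 0"
    unfolding g_def using integrable_bounded_linear[OF bl I(1)] integral_bounded_linear[OF bl I(1)] I(2) by auto
  have pos: "0 < g x" if "x \<in> ball x0 \<epsilon>" for x
  proof -
    have p: "0 < \<phi> x" using \<phi>(2)[of x] \<phi>(3) that by (metis (mono_tags) mem_Collect_eq order_le_less)
    have "dist (L x) (L x0) < norm (L x0) / 2" using d(2)[of x] that \<epsilon> by (simp add: dist_commute)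
    then have "norm ((L x - L x0) * cnj (L x0)) < norm (L x0) / 2 * norm (L x0)"
      unfolding norm_mult complex_mod_cnj using nz by (intro mult_strict_right_mono) (auto simp: dist_norm)
    moreover have "- norm ((L x - L x0) * cnj (L x0)) \<le> Re ((L x - L x0) * cnj (L x0))"
      using abs_Re_le_cmod[of "(L x - L x0) * cnj (L x0)"] by linarith
    moreover have "Re (L x * cnj (L x0)) = (norm (L x0))\<^sup>2 + Re ((L x - L x0) * cnj (L x0))"
      unfolding cmod_power2 by (simp add: algebra_simps power2_eq_square)
    moreover have "0 < (norm (L x0))\<^sup>2" using nz by simp
    ultimately have "0 < Re (L x * cnj (L x0))" by (simp add: power2_eq_square)
    then show ?thesis using p by (simp add: g_def)
  qed
  have zero: "g x = 0" if "x \<notin> ball x0 \<epsilon>" for x using \<phi>(3) that by (auto simp: g_def)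
  have nn: "0 \<le> g x" for x using pos[of x] zero[of x] by (cases "x \<in> ball x0 \<epsilon>") auto
  have "AE x in lebesgue. g x = 0" using integral_nonneg_eq_0_iff_AE[OF gi(1)] nn gi(2) by simp
  then have "AE x in lebesgue. x \<notin> ball x0 \<epsilon>" by (rule AE_mp) (use pos in \<open>force intro!: AE_I2\<close>)
  then have "ball x0 \<epsilon> \<in> null_sets lebesgue" by (subst AE_iff_null_sets) auto
  then have "negligible (ball x0 \<epsilon>)" by (simp add: negligible_iff_null_sets)
  then show False using open_not_negligible[of "ball x0 \<epsilon>"] \<epsilon> by auto
qed

context transformed
begin

lemma u_joint:
  assumes r: "0 < r" "polar r \<theta> \<in> G" "\<theta> \<notin> T"
  shows "((\<lambda>p. W (S (fst p) (snd p)) (snd p)) has_derivative (\<lambda>d. fst d *\<^sub>R ur r \<theta> + snd d *\<^sub>R ut r \<theta>)) (at (r, \<theta>))"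
proof -
  note o = open_polar_preimage[OF G(1)]
  have "(r, \<theta>) \<in> {p. 0 < fst p \<and> polar (fst p) (snd p) \<in> G}" using r by simp
  from open_prod_elim[OF o this] obtain A B where AB: "open A" "open B" "(r, \<theta>) \<in> A \<times> B"
    "A \<times> B \<subseteq> {p. 0 < fst p \<and> polar (fst p) (snd p) \<in> G}" .
  have "r \<in> A" "\<theta> \<in> B" using AB(3) by auto
  then obtain a b where ab: "0 < a" "ball r a \<subseteq> A" "0 < b" "ball \<theta> b \<subseteq> B"
    using AB(1,2) unfolding open_contains_ball by blast
  have sub: "0 < s \<and> polar s t \<in> G" if st: "s \<in> ball r a" "t \<in> ball \<theta> b" for s t
  proof -
    have "(s, t) \<in> A \<times> B" using ab(2,4) st by blast
    then show ?thesis using AB(4) by force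
  qed
  \<comment> \<open>The variables are swapped because the partial derivative in the second slot has
    to be continuous. The radial derivative is; the angular one contains dR.\<close>
  define X where "X t s = W (S s t) t" for t s
  have "((\<lambda>(t, s). X t s) has_derivative (\<lambda>(h, g). h *\<^sub>R ut r \<theta> + blinfun_scaleR_left (ur r \<theta>) g)) (at (\<theta>, r) within ball \<theta> b \<times> ball r a)"
  proof (rule has_derivative_partialsI)
    show "((\<lambda>t. X t r) has_derivative (\<lambda>h. h *\<^sub>R ut r \<theta>)) (at \<theta> within ball \<theta> b)"
      using u_angular[OF r] by (simp add: X_def has_vector_derivative_def has_derivative_at_withinI)
    show "((\<lambda>s. X t s) has_derivative blinfun_apply (blinfun_scaleR_left (ur s t))) (at s within ball r a)"
      if "t \<in> ball \<theta> b" "s \<in> ball r a" for t s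
    proof -
      have "((\<lambda>s. X t s) has_derivative (\<lambda>h. h *\<^sub>R ur s t)) (at s within ball r a)"
        using u_radial[of s t] sub[OF that(2,1)] by (simp add: X_def has_vector_derivative_def has_derivative_at_withinI)
      moreover have "blinfun_apply (blinfun_scaleR_left (ur s t)) = (\<lambda>h. h *\<^sub>R ur s t)"
        by (simp add: blinfun_scaleR_left.rep_eq fun_eq_iff)
      ultimately show ?thesis by (simp only:)
    qed
    have "continuous_on {p. 0 < fst p \<and> polar (fst p) (snd p) \<in> G} (\<lambda>p. ur (fst p) (snd p))"
      unfolding ur_def by (intro continuous_intros conts)
    from isCont_angle(2)[OF this r(1,2)] have c: "isCont (\<lambda>p. ur (fst p) (snd p)) (r, \<theta>)" .
    have "isCont (\<lambda>p :: real \<times> real. (snd p, fst p)) (\<theta>, r)" by (intro continuous_intros)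
    from isCont_o2[OF this, of "\<lambda>p. ur (fst p) (snd p)"] c
    have "isCont (\<lambda>p. ur (snd p) (fst p)) (\<theta>, r)" by simp
    then have c2: "continuous (at (\<theta>, r)) (\<lambda>p. blinfun_scaleR_left (ur (snd p) (fst p)))"
      by (rule bounded_linear.isCont[OF bounded_linear_blinfun_scaleR_left])
    have e: "(\<lambda>p. blinfun_scaleR_left (ur (snd p) (fst p))) = (\<lambda>(t, s). blinfun_scaleR_left (ur s t))"
      unfolding case_prod_unfold by (rule refl)
    show "continuous (at (\<theta>, r) within ball \<theta> b \<times> ball r a) (\<lambda>(t, s). blinfun_scaleR_left (ur s t))"
      by (rule continuous_at_imp_continuous_at_within) (rule c2[unfolded e])
  qed (use ab in auto)
  moreover have "at (\<theta>, r) within ball \<theta> b \<times> ball r a = at (\<theta>, r)"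
    using ab by (intro at_within_open open_Times) auto
  ultimately have d: "((\<lambda>(t, s). X t s) has_derivative (\<lambda>(h, g). h *\<^sub>R ut r \<theta> + g *\<^sub>R ur r \<theta>)) (at (\<theta>, r))"
    by (simp add: blinfun_scaleR_left.rep_eq)
  have sw: "((\<lambda>p :: real \<times> real. (snd p, fst p)) has_derivative (\<lambda>p. (snd p, fst p))) (at (r, \<theta>))"
    by (auto intro!: derivative_eq_intros)
  have "((\<lambda>(t, s). X t s) has_derivative (\<lambda>(h, g). h *\<^sub>R ut r \<theta> + g *\<^sub>R ur r \<theta>)) (at ((\<lambda>p. (snd p, fst p)) (r, \<theta>)))"
    using d by simp
  from has_derivative_compose[OF sw this] show ?thesis by (simp add: X_def add.commute)
qed

lemma u_has_derivative:
  assumes r: "0 < r" "polar r \<theta> \<in> G" "\<theta> \<notin> T"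
    and u: "\<And>r \<theta>. 0 < r \<Longrightarrow> polar r \<theta> \<in> G \<Longrightarrow> u (polar r \<theta>) = W (S r \<theta>) \<theta>"
  shows "(u has_derivative (\<lambda>v. (v \<bullet> polar 1 \<theta>) *\<^sub>R ur r \<theta> + (v \<bullet> polar 1 (\<theta> + pi / 2) / r) *\<^sub>R ut r \<theta>)) (at (polar r \<theta>))"
    and "grad u (polar r \<theta>) = polvec \<theta> (ur r \<theta>) (ut r \<theta> / of_real r)"
proof -
  note o = open_polar_preimage[OF G(1)]
  have "((\<lambda>p. u (polar (fst p) (snd p))) has_derivative (\<lambda>d. fst d *\<^sub>R ur r \<theta> + snd d *\<^sub>R ut r \<theta>)) (at (r, \<theta>))"
    by (rule has_derivative_transform_within_open[OF u_joint[OF r] o]) (use r u in auto)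
  from has_derivative_from_polar[OF r(1) this]
  show d: "(u has_derivative (\<lambda>v. (v \<bullet> polar 1 \<theta>) *\<^sub>R ur r \<theta> + (v \<bullet> polar 1 (\<theta> + pi / 2) / r) *\<^sub>R ut r \<theta>)) (at (polar r \<theta>))" .
  then show "grad u (polar r \<theta>) = polvec \<theta> (ur r \<theta>) (ut r \<theta> / of_real r)" by (rule grad_polar)
qed

end

section \<open>The exterior equation beyond the interface\<close>

context sector_field
begin

lemma W2_real_per: "R1 \<theta> < r \<Longrightarrow> W2 (of_real r) (\<theta> + 2 * pi) = W2 (of_real r) \<theta>"
proof -
  assume r: "R1 \<theta> < r"
  have "open {t. R1 t < r}" using R1_cont by (intro open_Collect_less continuous_intros)
  moreover have "((\<lambda>t. W1 (of_real r) (t + 2 * pi)) has_vector_derivative W2 (of_real r) (\<theta> + 2 * pi)) (at \<theta>)"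
    by (rule has_vector_derivative_shift[OF W1_der[OF real_mem_Z]]) (use r R1_per in simp)
  ultimately have "(W1 (of_real r) has_vector_derivative W2 (of_real r) (\<theta> + 2 * pi)) (at \<theta>)"
    using r W1_real_per by (elim has_vector_derivative_transform_within_open) auto
  moreover have "(W1 (of_real r) has_vector_derivative W2 (of_real r) \<theta>) (at \<theta>)"
    by (rule W1_der[OF real_mem_Z]) (use r in simp)
  ultimately show ?thesis by (rule vector_derivative_unique_at)
qed

lemma radial_real_per:
  assumes F: "\<And>r \<theta>. (of_real r, \<theta>) \<in> Z \<Longrightarrow> ((\<lambda>z. F z \<theta>) has_field_derivative F' (of_real r) \<theta>) (at (of_real r))"
    and per: "\<And>r. R1 \<theta> < r \<Longrightarrow> F (of_real r) (\<theta> + 2 * pi) = F (of_real r) \<theta>" and r: "R1 \<theta> < r"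
  shows "F' (of_real r) (\<theta> + 2 * pi) = F' (of_real r) \<theta>"
proof -
  have m: "(of_real r, \<theta>) \<in> Z" "(of_real r, \<theta> + 2 * pi) \<in> Z" using r R1_per by (auto intro!: real_mem_Z)
  have "((\<lambda>s. F (of_real s) (\<theta> + 2 * pi)) has_vector_derivative F' (of_real r) (\<theta> + 2 * pi)) (at r)"
    by (rule has_vector_derivative_real_field[OF F[OF m(2)]])
  then have "((\<lambda>s. F (of_real s) \<theta>) has_vector_derivative F' (of_real r) (\<theta> + 2 * pi)) (at r)"
    by (rule has_vector_derivative_transform_within_open[where S = "{R1 \<theta><..}"]) (use r per in auto)
  then show ?thesis using has_vector_derivative_real_field[OF F[OF m(1)]] by (rule vector_derivative_unique_at)
qed

lemma Lam_real_per: "R1 \<theta> < r \<Longrightarrow> Lam (of_real r) (\<theta> + 2 * pi) = Lam (of_real r) \<theta>"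
proof -
  assume r: "R1 \<theta> < r"
  have z: "Wz (of_real r) (\<theta> + 2 * pi) = Wz (of_real r) \<theta>" if "R1 \<theta> < r" for r
    by (rule radial_real_per[of W Wz, OF W_dz _ that]) (auto intro: W_real_per)
  have zz: "Wzz (of_real r) (\<theta> + 2 * pi) = Wzz (of_real r) \<theta>"
    by (rule radial_real_per[of Wz Wzz, OF Wz_dz z r])
  show ?thesis
    using z[OF r] zz W2_real_per[OF r] W_real_per[of \<theta> r] r by (simp add: Lam_def)
qed

lemma Lam_ang: "R1 \<theta> < r \<Longrightarrow> 0 < r \<Longrightarrow> Lam (of_real r) (ang (polar r \<theta>)) = Lam (of_real r) \<theta>"
proof -
  assume r: "R1 \<theta> < r" "0 < r"
  obtain j :: int where j: "ang (polar r \<theta>) = \<theta> + 2 * pi * of_int j" using ang_polar[OF r(2)] by blast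
  \<comment> \<open>Extended by 0 where the radius does not exceed R1, so that the function is
    periodic at every angle and \<open>periodic_int\<close> applies.\<close>
  define f where "f t = (if R1 t < r then Lam (of_real r) t else 0)" for t
  have "f (\<theta> + 2 * pi * of_int j) = f \<theta>"
    by (rule periodic_int) (auto simp: f_def R1_per Lam_real_per)
  then show ?thesis using r R1_per_int[of \<theta> j] by (simp add: f_def j)
qed

text \<open>The trivial radius S = r. It turns the general identities into statements about U
  itself, whose interior regularity beyond the interface comes from the continuation.\<close>

lemma ext_transformed:
  "transformed R1 \<sigma>0 \<sigma>1 U W W1 W2 Z outside {} (\<lambda>r \<theta>. of_real r) (\<lambda>r \<theta>. 1) (\<lambda>r \<theta>. 0) (\<lambda>r \<theta>. 0) (\<lambda>\<theta>. 0) 0"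
proof
  show "open outside" by (rule open_outside)
  show "0 \<notin> outside" by (simp add: outside_def)
  fix r \<theta> :: real assume r: "0 < r" "polar r \<theta> \<in> outside"
  show "complex_of_real r \<in> sector R1 \<sigma>0 \<sigma>1 \<theta>"
    using r polar_outside by (intro of_real_in_sector \<sigma>) auto
  show "(complex_of_real has_vector_derivative 1) (at r)"
    by (auto simp: has_vector_derivative_def scaleR_conv_of_real intro!: derivative_eq_intros)
qed (auto intro!: continuous_intros)

end

context sector_field
begin

lemma real_polar: "0 < r \<Longrightarrow> polar r \<theta> \<in> outside \<Longrightarrow> U (polar r \<theta>) = W (of_real r) \<theta>"
  using W_real[OF real_mem_Z[of \<theta> r]] by (simp add: polar_outside)

text \<open>The solution concept provides some weak gradient p, the continuation the classical
  gradient q. Tested with a partial derivative of \<phi>, both give minus the integral of a second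
  derivative of \<phi> times U. So q may replace p in the weak equation, and Green's formula moves
  the derivatives from \<phi> onto q.\<close>

lemma exterior_equation:
  assumes sol: "solves_div_form (- closure D) (\<lambda>x. mat 1) (\<lambda>x. 1) k f U"
    and D: "closure D \<subseteq> star_domain R1" and \<phi>: "\<phi> \<in> test_functions outside"
  shows "integrable lebesgue (\<lambda>x. \<phi> x *\<^sub>R Lam (of_real (norm x)) (ang x))"
    and "(LINT x|lebesgue. \<phi> x *\<^sub>R f x) = (LINT x|lebesgue. \<phi> x *\<^sub>R Lam (of_real (norm x)) (ang x))"
proof -
  interpret ext: transformed R1 \<sigma>0 \<sigma>1 k U W W1 W2 Z outside "{}" "\<lambda>r \<theta>. of_real r" "\<lambda>r \<theta>. 1" "\<lambda>r \<theta>. 0" "\<lambda>r \<theta>. 0" "\<lambda>\<theta>. 0" 0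
    by (rule ext_transformed)
  define L where "L x = Lam (of_real (norm x)) (ang x)" for x
  define q where "q x = grad U x" for x
  have sub: "outside \<subseteq> - closure D" using D by (auto simp: outside_def star_domain_iff)
  have \<phi>D: "\<phi> \<in> test_functions (- closure D)" using \<phi> test_functions_mono[OF sub] by blast
  obtain p where wg: "has_weak_gradient (- closure D) U p"
    and eq: "- (LINT x: - closure D|lebesgue. (\<Sum>i\<in>UNIV. partial i \<phi> x *\<^sub>R (mat 1 *v p x) $ i))
           + of_real (k\<^sup>2) * (LINT x: - closure D|lebesgue. \<phi> x *\<^sub>R (1 * U x)) = (LINT x: - closure D|lebesgue. \<phi> x *\<^sub>R f x)"
    using sol \<phi>D unfolding solves_div_form_def by blast
  have qp: "q (polar r \<theta>) = polvec \<theta> (ext.ur r \<theta>) (ext.ut r \<theta> / of_real r)" if "0 < r" "polar r \<theta> \<in> outside" for r \<theta>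
    unfolding q_def by (rule ext.u_has_derivative(2)) (use that real_polar in auto)
  have LU: "\<And>K. compact K \<Longrightarrow> K \<subseteq> - closure D \<Longrightarrow> set_integrable lebesgue K U"
    using wg by (auto simp: has_weak_gradient_def locally_integrable_def)
  have Lp: "set_integrable lebesgue K (\<lambda>x. p x $ i)" if "compact K" "K \<subseteq> - closure D" for K i
  proof -
    have "set_integrable lebesgue K p" using wg that by (auto simp: has_weak_gradient_def locally_integrable_def)
    from integrable_bounded_linear[OF bounded_linear_vec_nth this[unfolded set_integrable_def], of i]
    show ?thesis by (simp add: set_integrable_def)
  qed
  have ip: "integrable lebesgue (\<lambda>x. partial i \<phi> x *\<^sub>R p x $ i)" for i
    by (rule integrable_test_mult[OF Lp test_functions_partial[OF \<phi>D]])
  have iU: "integrable lebesgue (\<lambda>x. \<phi> x *\<^sub>R U x)" by (rule integrable_test_mult[OF LU \<phi>D])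
  have pq: "integrable lebesgue (\<lambda>x. partial i \<phi> x *\<^sub>R q x $ i) \<and>
      (LINT x|lebesgue. partial i \<phi> x *\<^sub>R p x $ i) = (LINT x|lebesgue. partial i \<phi> x *\<^sub>R q x $ i)" for i
  proof -
    \<comment> \<open>The weak gradient is tested with this derivative of \<phi>, which is a test
      function as well.\<close>
    define \<psi> where "\<psi> = partial i \<phi>"
    have \<psi>: "\<psi> \<in> test_functions outside" "\<psi> \<in> test_functions (- closure D)"
      unfolding \<psi>_def using test_functions_partial \<phi> \<phi>D by blast+
    have a: "integrable lebesgue (\<lambda>x. partial i \<psi> x *\<^sub>R U x)"
      by (rule integrable_test_mult[OF LU test_functions_partial[OF \<psi>(2)]])
    have "(LINT x: - closure D|lebesgue. partial i \<psi> x *\<^sub>R U x) = - (LINT x: - closure D|lebesgue. \<psi> x *\<^sub>R p x $ i)"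
      using wg \<psi>(2) by (simp add: has_weak_gradient_def)
    then have b: "(LINT x|lebesgue. partial i \<psi> x *\<^sub>R U x) = - (LINT x|lebesgue. \<psi> x *\<^sub>R p x $ i)"
      unfolding test_LINT[OF \<psi>(2)] test_LINT[OF test_functions_partial[OF \<psi>(2)]] .
    have c: "integrable lebesgue (\<lambda>x. partial i \<psi> x *\<^sub>R U x + \<psi> x *\<^sub>R q x $ i)
       \<and> (LINT x|lebesgue. partial i \<psi> x *\<^sub>R U x + \<psi> x *\<^sub>R q x $ i) = 0"
      by (rule ext.weak_gradient_identity[OF \<psi>(1)]) (use real_polar qp in auto)
    have d: "integrable lebesgue (\<lambda>x. \<psi> x *\<^sub>R q x $ i)"
      using Bochner_Integration.integrable_diff[OF c[THEN conjunct1] a] by simp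
    have "(LINT x|lebesgue. partial i \<psi> x *\<^sub>R U x) + (LINT x|lebesgue. \<psi> x *\<^sub>R q x $ i) = 0"
      using c Bochner_Integration.integral_add[OF a d] by simp
    then show ?thesis using b d by (simp add: \<psi>_def add_eq_0_iff)
  qed
  define Q where "Q = (LINT x|lebesgue. (\<Sum>i\<in>UNIV. partial i \<phi> x *\<^sub>R q x $ i))"
  have iq: "integrable lebesgue (\<lambda>x. \<Sum>i\<in>UNIV. partial i \<phi> x *\<^sub>R q x $ i)" using pq by simp
  have P: "(LINT x: - closure D|lebesgue. (\<Sum>i\<in>UNIV. partial i \<phi> x *\<^sub>R (mat 1 *v p x) $ i)) = Q"
    unfolding partial_sum_LINT[OF \<phi>D] Q_def using ip pq by (simp add: Bochner_Integration.integral_sum)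
  have E: "- Q + of_real (k\<^sup>2) * (LINT x|lebesgue. \<phi> x *\<^sub>R U x) = (LINT x|lebesgue. \<phi> x *\<^sub>R f x)"
    using eq unfolding P by (simp add: test_LINT[OF \<phi>D])
  have w: "integrable lebesgue (\<lambda>x. (\<Sum>i\<in>UNIV. partial i \<phi> x *\<^sub>R q x $ i) + \<phi> x *\<^sub>R (1 * (L x - of_real (k\<^sup>2) * U x)))
    \<and> (LINT x|lebesgue. (\<Sum>i\<in>UNIV. partial i \<phi> x *\<^sub>R q x $ i) + \<phi> x *\<^sub>R (1 * (L x - of_real (k\<^sup>2) * U x))) = 0"
  proof (rule ext.weak_equation_identity[OF \<phi>])
    fix r \<theta> :: real assume r: "0 < r" "polar r \<theta> \<in> outside"
    show "U (polar r \<theta>) = W (of_real r) \<theta>" by (rule real_polar[OF r])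
    show "q (polar r \<theta>) = polvec \<theta> (ext.Pf r \<theta> / of_real r) (ext.Qf r \<theta>)"
      unfolding qp[OF r] ext.ur_def ext.ut_def ext.Pf_def ext.Qf_def using r(1) by simp
    show "1 = of_real r * 1 / complex_of_real r" using r(1) by simp
    show "L (polar r \<theta>) = Lam (of_real r) \<theta>" unfolding L_def using Lam_ang r by (simp add: norm_polar polar_outside)
  qed
  have e: "\<phi> x *\<^sub>R L x = ((\<Sum>i\<in>UNIV. partial i \<phi> x *\<^sub>R q x $ i) + \<phi> x *\<^sub>R (1 * (L x - of_real (k\<^sup>2) * U x)))
      - (\<Sum>i\<in>UNIV. partial i \<phi> x *\<^sub>R q x $ i) + of_real (k\<^sup>2) * (\<phi> x *\<^sub>R U x)" for x
    by (simp add: scaleR_conv_of_real algebra_simps)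
  have i2: "integrable lebesgue (\<lambda>x. of_real (k\<^sup>2) * (\<phi> x *\<^sub>R U x))" by (rule integrable_mult_right[OF iU])
  note i1 = Bochner_Integration.integrable_diff[OF w[THEN conjunct1] iq]
  have "integrable lebesgue (\<lambda>x. \<phi> x *\<^sub>R L x)"
    unfolding e by (rule Bochner_Integration.integrable_add[OF i1 i2])
  then show "integrable lebesgue (\<lambda>x. \<phi> x *\<^sub>R Lam (of_real (norm x)) (ang x))" by (simp add: L_def)
  have "(LINT x|lebesgue. \<phi> x *\<^sub>R L x) = (LINT x|lebesgue. \<phi> x *\<^sub>R f x)"
    unfolding e Bochner_Integration.integral_add[OF i1 i2] Bochner_Integration.integral_diff[OF w[THEN conjunct1] iq]
    using w[THEN conjunct2] E unfolding integral_mult_right_zero Q_def[symmetric] by simp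
  then show "(LINT x|lebesgue. \<phi> x *\<^sub>R f x) = (LINT x|lebesgue. \<phi> x *\<^sub>R Lam (of_real (norm x)) (ang x))"
    by (simp add: L_def)
qed

lemma Lam_polar_cont: "continuous_on outside (\<lambda>x. Lam (of_real (norm x)) (ang x))"
proof (intro continuous_at_imp_continuous_on ballI)
  interpret ext: transformed R1 \<sigma>0 \<sigma>1 k U W W1 W2 Z outside "{}" "\<lambda>r \<theta>. of_real r" "\<lambda>r \<theta>. 1" "\<lambda>r \<theta>. 0" "\<lambda>r \<theta>. 0" "\<lambda>\<theta>. 0" 0
    by (rule ext_transformed)
  fix x assume x: "x \<in> outside"
  then obtain r \<theta> where r: "0 < r" "x = polar r \<theta>" using polar_onto[of x] by (metis ext.G(2))
  have "continuous_on {p. 0 < fst p \<and> polar (fst p) (snd p) \<in> outside} (\<lambda>p. Lam (of_real (fst p)) (snd p))"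
    unfolding Lam_def by (intro continuous_intros ext.conts) auto
  from ext.isCont_angle(2)[OF this r(1)] have c: "isCont (\<lambda>p. Lam (of_real (fst p)) (snd p)) (r, \<theta>)" using x r by simp
  have o: "open {p :: real \<times> real. R1 (snd p) < fst p}"
    by (intro open_Collect_less continuous_intros continuous_on_compose2[OF R1_cont[of UNIV]]) auto
  have "(r, \<theta>) \<in> {p. R1 (snd p) < fst p}" using x r by (simp add: polar_outside)
  from eventually_nhds_in_open[OF o this]
  have "\<forall>\<^sub>F p in nhds (r, \<theta>). Lam (of_real (fst p)) (snd p) = Lam (of_real (norm (polar (fst p) (snd p)))) (ang (polar (fst p) (snd p)))"
  proof (rule eventually_mono)
    fix p assume "p \<in> {p. R1 (snd p) < fst p}"
    then show "Lam (of_real (fst p)) (snd p) = Lam (of_real (norm (polar (fst p) (snd p)))) (ang (polar (fst p) (snd p)))"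
      using R1_pos[of "snd p"] Lam_ang[of "snd p" "fst p"] by (simp add: norm_polar)
  qed
  from isCont_cong[OF this] c
  have "isCont (\<lambda>p. Lam (of_real (norm (polar (fst p) (snd p)))) (ang (polar (fst p) (snd p)))) (r, \<theta>)" by simp
  then show "isCont (\<lambda>x. Lam (of_real (norm x)) (ang x)) x" unfolding r(2) by (rule isCont_from_polar[OF r(1)])
qed

text \<open>Far beyond the disk containing the support of f, testing gives \<Lambda> = 0 on the real
  ray. The identity theorem then covers the whole sector, including real radii that still lie inside
  the disk.\<close>

lemma Lam_vanishes:
  assumes sol: "solves_div_form (- closure D) (\<lambda>x. mat 1) (\<lambda>x. 1) k f U"
    and D: "closure D \<subseteq> star_domain R1" and f: "{x. f x \<noteq> 0} \<subseteq> ball b rB"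
    and z: "z \<in> sector R1 \<sigma>0 \<sigma>1 \<theta>"
  shows "Lam z \<theta> = 0"
proof (rule Lam_zero_sector[OF _ z])
  \<comment> \<open>By the triangle inequality these points lie outside the ball with centre b and
    radius rB.\<close>
  define H where "H = outside \<inter> {x. norm b + rB < norm x}"
  have oH: "open H" unfolding H_def by (intro open_Int open_outside open_Collect_less continuous_intros)
  have fH: "f x = 0" if "x \<in> H" for x
  proof (rule ccontr)
    assume "f x \<noteq> 0"
    then have "dist b x < rB" using f by auto
    then show False using that norm_triangle_ineq2[of x b] by (simp add: H_def dist_norm norm_minus_commute)
  qed
  fix r assume r: "max (R1 \<theta>) (norm b + rB) + 1 \<le> r"
  then have r': "0 < r" "R1 \<theta> < r" "norm b + rB < r" using R1_pos[of \<theta>] by linarith+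
  have xH: "polar r \<theta> \<in> H" using r' by (simp add: H_def polar_outside norm_polar)
  have "Lam (of_real (norm (polar r \<theta>))) (ang (polar r \<theta>)) = 0"
  proof (rule continuous_null_test[OF oH xH])
    show "continuous_on H (\<lambda>x. Lam (of_real (norm x)) (ang x))"
      by (rule continuous_on_subset[OF Lam_polar_cont]) (auto simp: H_def)
    fix \<phi> assume \<phi>: "\<phi> \<in> test_functions H"
    then have \<phi>o: "\<phi> \<in> test_functions outside" using test_functions_mono[of H outside] by (auto simp: H_def)
    have "\<phi> x *\<^sub>R f x = 0" for x
      using fH[of x] test_functionsD(3)[OF \<phi>] closure_subset[of "{x. \<phi> x \<noteq> 0}"] by (cases "\<phi> x = 0") auto
    then have "(LINT x|lebesgue. \<phi> x *\<^sub>R f x) = (LINT x|(lebesgue :: (real^2) measure). 0)" by (simp only:)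
    then show "integrable lebesgue (\<lambda>x. \<phi> x *\<^sub>R Lam (of_real (norm x)) (ang x)) \<and>
        (LINT x|lebesgue. \<phi> x *\<^sub>R Lam (of_real (norm x)) (ang x)) = 0"
      using exterior_equation[OF sol D \<phi>o] by simp
  qed
  then show "Lam (of_real r) \<theta> = 0" using r' by (simp add: norm_polar Lam_ang)
qed

text \<open>The sector contains the real ray from the interface on, so \<Lambda> = 0 there. The
  exterior equation then forces f to vanish beyond the interface as a distribution, even where the
  disk reaches into the layer.\<close>

lemma source_vanishes:
  assumes sol: "solves_div_form (- closure D) (\<lambda>x. mat 1) (\<lambda>x. 1) k f U"
    and D: "closure D \<subseteq> star_domain R1" and f: "{x. f x \<noteq> 0} \<subseteq> ball b rB"
    and \<phi>: "\<phi> \<in> test_functions outside"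
  shows "(LINT x|lebesgue. \<phi> x *\<^sub>R f x) = 0"
proof -
  have "\<phi> x *\<^sub>R Lam (of_real (norm x)) (ang x) = 0" for x
  proof (cases "\<phi> x = 0")
    case False
    then have x: "x \<in> outside" using test_functionsD(3)[OF \<phi>] closure_subset[of "{x. \<phi> x \<noteq> 0}"] by auto
    then have "of_real (norm x) \<in> sector R1 \<sigma>0 \<sigma>1 (ang x)" by (intro of_real_in_sector \<sigma>) (auto simp: outside_def)
    then show ?thesis using Lam_vanishes[OF sol D f] by simp
  qed simp
  then have "(LINT x|lebesgue. \<phi> x *\<^sub>R Lam (of_real (norm x)) (ang x)) = (LINT x|(lebesgue :: (real^2) measure). 0)" by (simp only:)
  then show ?thesis using exterior_equation(2)[OF sol D \<phi>] by simp
qed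

section \<open>Boundedness far out in the sectors\<close>

text \<open>\<open>radiating\<close> is instantiated beyond an upper bound M of R1, where every ray
  is available. Its bounded continuation agrees with W by reflection. That X and C are the same for
  all angles yields uniform boundedness at the outer boundary.\<close>

lemma W_bounded_far:
  assumes k: "0 < k" and rad: "sommerfeld k U" and L: "\<And>z \<theta>. z \<in> sector R1 \<sigma>0 \<sigma>1 \<theta> \<Longrightarrow> Lam z \<theta> = 0"
  shows "\<exists>X C. \<forall>\<theta>. \<forall>z\<in>sector R1 \<sigma>0 \<sigma>1 \<theta>. X < Re z \<longrightarrow> norm (W z \<theta>) \<le> C"
proof -
  obtain m M where M: "0 < m" "\<And>\<theta>. m \<le> R1 \<theta>" "\<And>\<theta>. R1 \<theta> \<le> M" using R1_bounds by blast
  have M0: "0 < M" using M(1) M(2)[of 0] M(3)[of 0] by linarith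
  obtain c R' where R': "0 < R'" "\<And>x. R' \<le> norm x \<Longrightarrow> \<exists>d. ((\<lambda>t. U (t *\<^sub>R sgn x)) has_vector_derivative d) (at (norm x)) \<and>
               norm (d - \<i> * of_real k * U x) \<le> c / norm x"
    using rad unfolding sommerfeld_def by blast
  define R where "R = max R' M + 1"
  have mem: "(of_real r, \<theta>) \<in> Z" if "M < r" for r \<theta> using M(3)[of \<theta>] that by (intro real_mem_Z) auto
  have cont: "continuous_on ({M<..} \<times> UNIV) (\<lambda>(r, \<theta>). F (of_real r) \<theta>)" if "continuous_on Z (\<lambda>(z, \<theta>). F z \<theta>)" for F :: "complex \<Rightarrow> real \<Rightarrow> complex"
  proof -
    have "continuous_on ({M<..} \<times> UNIV) (\<lambda>p. (\<lambda>(z, \<theta>). F z \<theta>) (of_real (fst p), snd p))"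
      by (rule continuous_on_compose2[OF that]) (auto intro!: continuous_intros mem)
    then show ?thesis by (simp add: case_prod_unfold)
  qed
  interpret rd: radiating k M R c "\<lambda>r \<theta>. W (of_real r) \<theta>" "\<lambda>r \<theta>. Wz (of_real r) \<theta>" "\<lambda>r \<theta>. Wzz (of_real r) \<theta>"
    "\<lambda>r \<theta>. W1 (of_real r) \<theta>" "\<lambda>r \<theta>. W2 (of_real r) \<theta>"
  proof
    show "0 < k" "0 < M" "M < R" "1 \<le> R" using k M0 by (auto simp: R_def)
    fix r \<theta> :: real assume r: "M < r"
    show "((\<lambda>r. W (of_real r) \<theta>) has_vector_derivative Wz (of_real r) \<theta>) (at r)"
      by (rule has_vector_derivative_real_field[OF W_dz[OF mem[OF r]]])
    show "((\<lambda>r. Wz (of_real r) \<theta>) has_vector_derivative Wzz (of_real r) \<theta>) (at r)"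
      by (rule has_vector_derivative_real_field[OF Wz_dz[OF mem[OF r]]])
    show "(W (of_real r) has_vector_derivative W1 (of_real r) \<theta>) (at \<theta>)" by (rule W_der[OF mem[OF r]])
    show "(W1 (of_real r) has_vector_derivative W2 (of_real r) \<theta>) (at \<theta>)" by (rule W1_der[OF mem[OF r]])
    show "W (of_real r) (\<theta> + 2 * pi) = W (of_real r) \<theta>" using M(3)[of \<theta>] r by (intro W_real_per) simp
    have "of_real r \<in> sector R1 \<sigma>0 \<sigma>1 \<theta>" using M(3)[of \<theta>] r by (intro of_real_in_sector \<sigma>) auto
    from L[OF this] show "Wzz (of_real r) \<theta> + Wz (of_real r) \<theta> / of_real r + W2 (of_real r) \<theta> / of_real (r\<^sup>2) + of_real (k\<^sup>2) * W (of_real r) \<theta> = 0"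
      by (simp add: Lam_def)
  next
    fix r \<theta> assume r: "R \<le> r"
    then have r': "0 < r" "R' \<le> r" "M < r" using M0 by (auto simp: R_def)
    have U: "U (polar s \<theta>) = W (of_real s) \<theta>" if "M < s" for s using W_real[OF mem[OF that]] by simp
    have n: "norm (polar r \<theta>) = r" using r' by (simp add: norm_polar)
    have s: "t *\<^sub>R sgn (polar r \<theta>) = polar t \<theta>" for t
      using r'(1) polar_scaleR[of t 1 \<theta>] polar_scaleR[of "inverse r" r \<theta>]
      by (simp add: sgn_div_norm n)
    obtain d where d: "((\<lambda>t. U (polar t \<theta>)) has_vector_derivative d) (at r)" "norm (d - \<i> * of_real k * U (polar r \<theta>)) \<le> c / r"
      using R'(2)[of "polar r \<theta>"] r'(2) unfolding n s by blast
    have "((\<lambda>t. W (of_real t) \<theta>) has_vector_derivative d) (at r)"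
      by (rule has_vector_derivative_transform_within_open[OF d(1), of "{M<..}"]) (use r' U in auto)
    then have "d = Wz (of_real r) \<theta>"
      using has_vector_derivative_real_field[OF W_dz[OF mem[OF r'(3)]]] by (rule vector_derivative_unique_at)
    then show "norm (Wz (of_real r) \<theta> - \<i> * of_real k * W (of_real r) \<theta>) \<le> c / r"
      using d(2) U[OF r'(3)] by simp
  qed (rule cont[OF W_cont] cont[OF Wz_cont] cont[OF Wzz_cont] cont[OF W2_cont])+
  have "\<exists>X C Vc. M < X \<and> (\<forall>\<theta>. (\<lambda>z. Vc z \<theta>) holomorphic_on {z. X < Re z \<and> 0 < Im z}) \<and>
    (\<forall>\<theta>. continuous_on {z. X < Re z \<and> 0 \<le> Im z} (\<lambda>z. Vc z \<theta>)) \<and>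
    (\<forall>r \<theta>. X < r \<longrightarrow> Vc (of_real r) \<theta> = W (of_real r) \<theta>) \<and>
    (\<forall>z \<theta>. X < Re z \<longrightarrow> 0 \<le> Im z \<longrightarrow> norm (Vc z \<theta>) \<le> C)"
    by (rule rd.continuation_bounded) (intro exI conjI allI impI, assumption+)
  then obtain X C Vc where V0: "M < X \<and> (\<forall>\<theta>. (\<lambda>z. Vc z \<theta>) holomorphic_on {z. X < Re z \<and> 0 < Im z}) \<and>
    (\<forall>\<theta>. continuous_on {z. X < Re z \<and> 0 \<le> Im z} (\<lambda>z. Vc z \<theta>)) \<and>
    (\<forall>r \<theta>. X < r \<longrightarrow> Vc (of_real r) \<theta> = W (of_real r) \<theta>) \<and>
    (\<forall>z \<theta>. X < Re z \<longrightarrow> 0 \<le> Im z \<longrightarrow> norm (Vc z \<theta>) \<le> C)"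
    by (elim exE) (rule that)
  have V: "M < X" "\<And>\<theta>. (\<lambda>z. Vc z \<theta>) holomorphic_on {z. X < Re z \<and> 0 < Im z}"
    "\<And>\<theta>. continuous_on {z. X < Re z \<and> 0 \<le> Im z} (\<lambda>z. Vc z \<theta>)"
    "\<And>r \<theta>. X < r \<Longrightarrow> Vc (of_real r) \<theta> = W (of_real r) \<theta>"
    "\<And>z \<theta>. X < Re z \<Longrightarrow> 0 \<le> Im z \<Longrightarrow> norm (Vc z \<theta>) \<le> C"
    using V0 by auto
  have "norm (W z \<theta>) \<le> C" if z: "z \<in> sector R1 \<sigma>0 \<sigma>1 \<theta>" "X < Re z" for z \<theta>
  proof (rule sector_bound_by_reflection[OF open_slice[OF Z] _ W_hol \<sigma> _ V(2) V(3) V(4) V(5) z])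
    show "sector R1 \<sigma>0 \<sigma>1 \<theta> \<subseteq> {z. (z, \<theta>) \<in> Z}" using sector_Z by blast
    show "R1 \<theta> \<le> X" using M(3)[of \<theta>] V(1) by simp
  qed auto
  then show ?thesis by blast
qed

end

section \<open>Restricting and gluing weak solutions\<close>

lemma test_zero: "\<phi> \<in> test_functions G \<Longrightarrow> x \<notin> G \<Longrightarrow> \<phi> x = 0"
  using test_functionsD(3)[of \<phi> G] closure_subset[of "{x. \<phi> x \<noteq> 0}"] by auto

lemma test_LINT_cong:
  assumes \<phi>: "\<phi> \<in> test_functions H" and sub: "H \<subseteq> G" and eq: "\<And>x. x \<in> H \<Longrightarrow> h' x = h x"
  shows "(LINT x:H|lebesgue. \<phi> x *\<^sub>R (h' x :: complex)) = (LINT x:G|lebesgue. \<phi> x *\<^sub>R h x)"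
proof -
  have \<phi>G: "\<phi> \<in> test_functions G" using \<phi> test_functions_mono[OF sub] by blast
  have "\<phi> x *\<^sub>R h' x = \<phi> x *\<^sub>R h x" for x using eq test_zero[OF \<phi>] by (cases "x \<in> H") auto
  then show ?thesis unfolding test_LINT[OF \<phi>] test_LINT[OF \<phi>G] by (simp only:)
qed

lemma partial_LINT_cong:
  assumes \<phi>: "\<phi> \<in> test_functions H" and sub: "H \<subseteq> G" and eq: "\<And>x. x \<in> H \<Longrightarrow> h' x = h x"
  shows "(LINT x:H|lebesgue. (\<Sum>i\<in>UNIV. partial i \<phi> x *\<^sub>R (h' x $ i :: complex)))
    = (LINT x:G|lebesgue. (\<Sum>i\<in>UNIV. partial i \<phi> x *\<^sub>R h x $ i))"
proof -
  have \<phi>G: "\<phi> \<in> test_functions G" using \<phi> test_functions_mono[OF sub] by blast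
  have "(\<Sum>i\<in>UNIV. partial i \<phi> x *\<^sub>R h' x $ i) = (\<Sum>i\<in>UNIV. partial i \<phi> x *\<^sub>R h x $ i)" for x
    using eq test_zero[OF test_functions_partial[OF \<phi>]] by (cases "x \<in> H") auto
  then show ?thesis unfolding partial_sum_LINT[OF \<phi>] partial_sum_LINT[OF \<phi>G] by (simp only:)
qed

lemma locally_integrable_cong:
  assumes "locally_integrable G h" "H \<subseteq> G" "\<And>x. x \<in> H \<Longrightarrow> h' x = h x"
  shows "locally_integrable H h'"
  unfolding locally_integrable_def
proof (intro allI impI)
  fix K assume K: "compact K \<and> K \<subseteq> H"
  then have "set_integrable lebesgue K h" using assms(1,2) unfolding locally_integrable_def by blast
  moreover have "set_integrable lebesgue K h' = set_integrable lebesgue K h"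
    by (rule set_integrable_cong) (use K assms(3) in auto)
  ultimately show "set_integrable lebesgue K h'" by simp
qed

lemma has_weak_gradient_cong:
  assumes wg: "has_weak_gradient G u p" and sub: "H \<subseteq> G" and u: "\<And>x. x \<in> H \<Longrightarrow> u' x = u x"
  shows "has_weak_gradient H u' p"
  unfolding has_weak_gradient_def
proof (intro conjI ballI allI)
  show "locally_integrable H u'" "locally_integrable H p"
    using wg u unfolding has_weak_gradient_def by (auto intro: locally_integrable_cong[OF _ sub])
  fix \<phi> i assume \<phi>: "\<phi> \<in> test_functions H"
  have \<phi>G: "\<phi> \<in> test_functions G" using \<phi> test_functions_mono[OF sub] by blast
  have "(LINT x:G|lebesgue. partial i \<phi> x *\<^sub>R u x) = - (LINT x:G|lebesgue. \<phi> x *\<^sub>R p x $ i)"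
    using wg \<phi>G unfolding has_weak_gradient_def by blast
  moreover have "(LINT x:H|lebesgue. partial i \<phi> x *\<^sub>R u' x) = (LINT x:G|lebesgue. partial i \<phi> x *\<^sub>R u x)"
    by (rule test_LINT_cong[OF test_functions_partial[OF \<phi>] sub]) (rule u)
  moreover have "(LINT x:H|lebesgue. \<phi> x *\<^sub>R p x $ i) = (LINT x:G|lebesgue. \<phi> x *\<^sub>R p x $ i)"
    by (rule test_LINT_cong[OF \<phi> sub]) (rule refl)
  ultimately show "(LINT x:H|lebesgue. partial i \<phi> x *\<^sub>R u' x) = - (LINT x:H|lebesgue. \<phi> x *\<^sub>R p x $ i)" by simp
qed

lemma solves_div_form_cong:
  assumes sol: "solves_div_form G C n k f u" and sub: "H \<subseteq> G"
    and eq: "\<And>x. x \<in> H \<Longrightarrow> C' x = C x" "\<And>x. x \<in> H \<Longrightarrow> n' x = n x" "\<And>x. x \<in> H \<Longrightarrow> u' x = u x"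
  shows "solves_div_form H C' n' k f u'"
proof -
  obtain p where wg: "has_weak_gradient G u p" and li: "locally_integrable G (\<lambda>x. (norm (u x))\<^sup>2)"
    "locally_integrable G (\<lambda>x. (norm (p x))\<^sup>2)" "locally_integrable G (\<lambda>x. C x *v p x)" "locally_integrable G (\<lambda>x. n x * u x)"
    and E: "\<And>\<phi>. \<phi> \<in> test_functions G \<Longrightarrow> - (LINT x:G|lebesgue. (\<Sum>i\<in>UNIV. partial i \<phi> x *\<^sub>R (C x *v p x) $ i))
           + of_real (k\<^sup>2) * (LINT x:G|lebesgue. \<phi> x *\<^sub>R (n x * u x)) = (LINT x:G|lebesgue. \<phi> x *\<^sub>R f x)"
    using sol unfolding solves_div_form_def by blast
  show ?thesis unfolding solves_div_form_def
  proof (intro exI[of _ p] conjI ballI)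
    show "has_weak_gradient H u' p" by (rule has_weak_gradient_cong[OF wg sub eq(3)])
    show "locally_integrable H (\<lambda>x. (norm (u' x))\<^sup>2)" by (rule locally_integrable_cong[OF li(1) sub]) (simp add: eq)
    show "locally_integrable H (\<lambda>x. (norm (p x))\<^sup>2)" by (rule locally_integrable_cong[OF li(2) sub]) simp
    show "locally_integrable H (\<lambda>x. C' x *v p x)" by (rule locally_integrable_cong[OF li(3) sub]) (simp add: eq)
    show "locally_integrable H (\<lambda>x. n' x * u' x)" by (rule locally_integrable_cong[OF li(4) sub]) (simp add: eq)
    fix \<phi> assume \<phi>: "\<phi> \<in> test_functions H"
    then have \<phi>G: "\<phi> \<in> test_functions G" using test_functions_mono[OF sub] by blast
    have a: "(LINT x:H|lebesgue. (\<Sum>i\<in>UNIV. partial i \<phi> x *\<^sub>R (C' x *v p x) $ i))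
        = (LINT x:G|lebesgue. (\<Sum>i\<in>UNIV. partial i \<phi> x *\<^sub>R (C x *v p x) $ i))"
      by (rule partial_LINT_cong[OF \<phi> sub]) (simp add: eq)
    have b: "(LINT x:H|lebesgue. \<phi> x *\<^sub>R (n' x * u' x)) = (LINT x:G|lebesgue. \<phi> x *\<^sub>R (n x * u x))"
      by (rule test_LINT_cong[OF \<phi> sub]) (simp add: eq)
    show "- (LINT x:H|lebesgue. (\<Sum>i\<in>UNIV. partial i \<phi> x *\<^sub>R (C' x *v p x) $ i))
           + of_real (k\<^sup>2) * (LINT x:H|lebesgue. \<phi> x *\<^sub>R (n' x * u' x)) = (LINT x:H|lebesgue. \<phi> x *\<^sub>R f x)"
      unfolding a b test_LINT_cong[OF \<phi> sub refl, of f] by (rule E[OF \<phi>G])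
  qed
qed

section \<open>Splitting over disjoint open sets\<close>

text \<open>The part of \<phi> that lives on A. For a test function on the union of disjoint open
  sets it is again smooth, since the sharp cut takes place off the support.\<close>

definition cutoff :: "(real^2) set \<Rightarrow> (real^2 \<Rightarrow> real) \<Rightarrow> real^2 \<Rightarrow> real" where
  "cutoff A \<phi> x = (if x \<in> A then \<phi> x else 0)"

lemma cutoff_has_derivative:
  assumes AB: "open A" "open B" "A \<inter> B = {}" and \<phi>: "\<phi> \<in> test_functions (A \<union> B)"
  shows "(cutoff A \<phi> has_derivative (if x \<in> A then frechet_derivative \<phi> (at x) else (\<lambda>v. 0))) (at x)"
proof (cases "x \<in> A")
  case True
  have "(\<phi> has_derivative frechet_derivative \<phi> (at x)) (at x)" by (rule smooth_has_derivative[OF test_functionsD(1)[OF \<phi>]])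
  then have "(cutoff A \<phi> has_derivative frechet_derivative \<phi> (at x)) (at x)"
    by (rule has_derivative_transform_within_open[OF _ AB(1) True]) (simp add: cutoff_def)
  then show ?thesis using True by simp
next
  case False
  \<comment> \<open>A point outside A lies in B or off the support of \<phi>; in either case the cut
    function vanishes in a whole neighbourhood.\<close>
  define N where "N = B \<union> - closure {x. \<phi> x \<noteq> 0}"
  have N: "open N" "x \<in> N" using AB(2) False test_functionsD(3)[OF \<phi>] by (auto simp: N_def)
  have "((\<lambda>x. 0) has_derivative (\<lambda>v. 0)) (at x)" by simp
  then have "(cutoff A \<phi> has_derivative (\<lambda>v. 0)) (at x)"
    by (rule has_derivative_transform_within_open[OF _ N])
      (use AB(3) closure_subset[of "{x. \<phi> x \<noteq> 0}"] in \<open>auto simp: N_def cutoff_def\<close>)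
  then show ?thesis using False by simp
qed

lemma cutoff_frechet:
  assumes "open A" "open B" "A \<inter> B = {}" "\<phi> \<in> test_functions (A \<union> B)"
  shows "(\<lambda>x. frechet_derivative (cutoff A \<phi>) (at x) v) = cutoff A (\<lambda>x. frechet_derivative \<phi> (at x) v)"
proof
  fix x show "frechet_derivative (cutoff A \<phi>) (at x) v = cutoff A (\<lambda>x. frechet_derivative \<phi> (at x) v) x"
    using frechet_derivative_at[OF cutoff_has_derivative[OF assms, of x]] by (simp add: cutoff_def fun_eq_iff split: if_splits)
qed

lemma cutoff_partial:
  assumes "open A" "open B" "A \<inter> B = {}" "\<phi> \<in> test_functions (A \<union> B)"
  shows "partial i (cutoff A \<phi>) = cutoff A (partial i \<phi>)"
  using cutoff_frechet[OF assms, of "axis i 1"] by (simp add: partial_def fun_eq_iff cutoff_def)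

lemma cutoff_test:
  assumes AB: "open A" "open B" "A \<inter> B = {}" and \<phi>: "\<phi> \<in> test_functions (A \<union> B)"
  shows "cutoff A \<phi> \<in> test_functions A"
proof -
  have "smooth (cutoff A \<phi>)"
  proof (rule smooth_family[of "cutoff A ` test_functions (A \<union> B)"])
    fix h assume "h \<in> cutoff A ` test_functions (A \<union> B)"
    then obtain h0 where h0: "h0 \<in> test_functions (A \<union> B)" "h = cutoff A h0" by blast
    show "h differentiable (at x)" for x
      unfolding h0(2) differentiable_def using cutoff_has_derivative[OF AB h0(1)] by blast
    show "(\<lambda>x. frechet_derivative h (at x) v) \<in> cutoff A ` test_functions (A \<union> B)" for v
      unfolding h0(2) cutoff_frechet[OF AB h0(1)] using test_functions_frechet[OF h0(1)] by blast
  qed (use \<phi> in blast)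
  define K where "K = closure {x. cutoff A \<phi> x \<noteq> 0}"
  have K: "K \<subseteq> closure {x. \<phi> x \<noteq> 0}" unfolding K_def by (rule closure_mono) (auto simp: cutoff_def)
  have "K \<subseteq> - B" unfolding K_def by (rule closure_minimal) (use AB in \<open>auto simp: cutoff_def\<close>)
  then have "K \<subseteq> A" using K test_functionsD(3)[OF \<phi>] by blast
  moreover have "compact (closure {x. \<phi> x \<noteq> 0} \<inter> K)"
    by (rule compact_Int_closed[OF test_functionsD(2)[OF \<phi>]]) (simp add: K_def)
  then have "compact K" using K by (simp add: inf.absorb2)
  ultimately show ?thesis using \<open>smooth (cutoff A \<phi>)\<close> unfolding test_functions_def K_def by blast
qed

lemma LINT_split:
  assumes AB: "open A" "open B" "A \<inter> B = {}" and \<phi>: "\<phi> \<in> test_functions (A \<union> B)"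
    and h: "locally_integrable A h1" "locally_integrable B h2"
    and eq: "\<And>x. x \<in> A \<Longrightarrow> h x = h1 x" "\<And>x. x \<in> B \<Longrightarrow> h x = h2 x"
  shows "(LINT x:A \<union> B|lebesgue. \<phi> x *\<^sub>R (h x :: complex))
    = (LINT x:A|lebesgue. cutoff A \<phi> x *\<^sub>R h1 x) + (LINT x:B|lebesgue. cutoff B \<phi> x *\<^sub>R h2 x)"
    and "integrable lebesgue (\<lambda>x. \<phi> x *\<^sub>R h x)"
proof -
  have \<phi>': "\<phi> \<in> test_functions (B \<union> A)" using \<phi> by (simp add: Un_commute)
  have AB': "B \<inter> A = {}" using AB by blast
  note t = cutoff_test[OF AB \<phi>] cutoff_test[OF AB(2,1) AB' \<phi>']
  have i: "integrable lebesgue (\<lambda>x. cutoff A \<phi> x *\<^sub>R h1 x)" "integrable lebesgue (\<lambda>x. cutoff B \<phi> x *\<^sub>R h2 x)"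
    by (rule integrable_test_mult[OF _ t(1)] integrable_test_mult[OF _ t(2)]; use h in \<open>auto simp: locally_integrable_def\<close>)+
  have s: "\<phi> x *\<^sub>R h x = cutoff A \<phi> x *\<^sub>R h1 x + cutoff B \<phi> x *\<^sub>R h2 x" for x
    using eq AB(3) test_zero[OF \<phi>, of x] by (auto simp: cutoff_def)
  show "integrable lebesgue (\<lambda>x. \<phi> x *\<^sub>R h x)" unfolding s using i by (rule Bochner_Integration.integrable_add)
  show "(LINT x:A \<union> B|lebesgue. \<phi> x *\<^sub>R h x)
    = (LINT x:A|lebesgue. cutoff A \<phi> x *\<^sub>R h1 x) + (LINT x:B|lebesgue. cutoff B \<phi> x *\<^sub>R h2 x)"
    unfolding test_LINT[OF \<phi>] test_LINT[OF t(1)] test_LINT[OF t(2)] unfolding s using i by (rule Bochner_Integration.integral_add)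
qed

text \<open>A compact subset K of the union splits into K - B and K - A, which are compact because A
  and B are open and lie in A and B respectively.\<close>

lemma locally_integrable_Un:
  fixes h :: "real^2 \<Rightarrow> 'b::{banach, second_countable_topology}"
  assumes AB: "open A" "open B" "A \<inter> B = {}" and h: "locally_integrable A h1" "locally_integrable B h2"
    and eq: "\<And>x. x \<in> A \<Longrightarrow> h x = h1 x" "\<And>x. x \<in> B \<Longrightarrow> h x = h2 x"
  shows "locally_integrable (A \<union> B) h"
  unfolding locally_integrable_def
proof (intro allI impI)
  fix K assume K: "compact K \<and> K \<subseteq> A \<union> B"
  have c: "compact (K - B)" "compact (K - A)" using K AB by (auto intro: compact_diff)
  have s: "K - B \<subseteq> A" "K - A \<subseteq> B" "(K - B) \<union> (K - A) = K" using K AB by auto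
  have m: "K - B \<in> sets lebesgue" "K - A \<in> sets lebesgue" using c by (auto intro: lmeasurable_compact fmeasurableD)
  have 1: "set_integrable lebesgue (K - B) h"
    using locally_integrable_cong[OF h(1) subset_refl eq(1)] c(1) s(1) unfolding locally_integrable_def by blast
  have 2: "set_integrable lebesgue (K - A) h"
    using locally_integrable_cong[OF h(2) subset_refl eq(2)] c(2) s(2) unfolding locally_integrable_def by blast
  show "set_integrable lebesgue K h" using set_integrable_Un[OF 1 2 m] s(3) by simp
qed

lemma locally_integrable_nth: "locally_integrable G (h :: real^2 \<Rightarrow> complex^2) \<Longrightarrow> locally_integrable G (\<lambda>x. h x $ i)"
  unfolding locally_integrable_def set_integrable_def
proof (intro allI impI)
  fix K assume "\<forall>K. compact K \<and> K \<subseteq> G \<longrightarrow> integrable lebesgue (\<lambda>x. indicat_real K x *\<^sub>R h x)" "compact K \<and> K \<subseteq> G"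
  then have "integrable lebesgue (\<lambda>x. indicat_real K x *\<^sub>R h x)" by blast
  from integrable_bounded_linear[OF bounded_linear_vec_nth this, of i]
  show "integrable lebesgue (\<lambda>x. indicat_real K x *\<^sub>R h x $ i)" by simp
qed

text \<open>Each test function is the sum of its two cut parts, so the equations add up. In the
  application the interface lies outside the union; the coupling of the two sides is expressed by
  \<open>transmission\<close>.\<close>

lemma solves_div_form_Un:
  assumes AB: "open A" "open B" "A \<inter> B = {}" and sA: "solves_div_form A C n k f u" and sB: "solves_div_form B C n k f u"
    and f: "integrable lebesgue f"
  shows "solves_div_form (A \<union> B) C n k f u"
proof -
  obtain p where wp: "has_weak_gradient A u p" and lp: "locally_integrable A (\<lambda>x. (norm (u x))\<^sup>2)"
    "locally_integrable A (\<lambda>x. (norm (p x))\<^sup>2)" "locally_integrable A (\<lambda>x. C x *v p x)" "locally_integrable A (\<lambda>x. n x * u x)"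
    and Ep: "\<And>\<phi>. \<phi> \<in> test_functions A \<Longrightarrow> - (LINT x:A|lebesgue. (\<Sum>i\<in>UNIV. partial i \<phi> x *\<^sub>R (C x *v p x) $ i))
           + of_real (k\<^sup>2) * (LINT x:A|lebesgue. \<phi> x *\<^sub>R (n x * u x)) = (LINT x:A|lebesgue. \<phi> x *\<^sub>R f x)"
    using sA unfolding solves_div_form_def by blast
  obtain q where wq: "has_weak_gradient B u q" and lq: "locally_integrable B (\<lambda>x. (norm (u x))\<^sup>2)"
    "locally_integrable B (\<lambda>x. (norm (q x))\<^sup>2)" "locally_integrable B (\<lambda>x. C x *v q x)" "locally_integrable B (\<lambda>x. n x * u x)"
    and Eq: "\<And>\<phi>. \<phi> \<in> test_functions B \<Longrightarrow> - (LINT x:B|lebesgue. (\<Sum>i\<in>UNIV. partial i \<phi> x *\<^sub>R (C x *v q x) $ i))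
           + of_real (k\<^sup>2) * (LINT x:B|lebesgue. \<phi> x *\<^sub>R (n x * u x)) = (LINT x:B|lebesgue. \<phi> x *\<^sub>R f x)"
    using sB unfolding solves_div_form_def by blast
  have lu: "locally_integrable A u" "locally_integrable B u" "locally_integrable A p" "locally_integrable B q"
    using wp wq by (auto simp: has_weak_gradient_def)
  define w where "w x = (if x \<in> A then p x else q x)" for x
  have w: "x \<in> A \<Longrightarrow> w x = p x" "x \<in> B \<Longrightarrow> w x = q x" for x using AB(3) by (auto simp: w_def)
  have lf: "locally_integrable G f" for G
    unfolding locally_integrable_def set_integrable_def
    by (auto intro!: integrable_mult_indicator f lmeasurable_compact fmeasurableD)
  have AB': "B \<inter> A = {}" using AB by blast
  show ?thesis unfolding solves_div_form_def
  proof (intro exI[of _ w] conjI ballI)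
    show "has_weak_gradient (A \<union> B) u w"
      unfolding has_weak_gradient_def
    proof (intro conjI ballI allI)
      show "locally_integrable (A \<union> B) u" by (rule locally_integrable_Un[OF AB lu(1,2) refl refl])
      show "locally_integrable (A \<union> B) w" by (rule locally_integrable_Un[OF AB lu(3,4) w])
      fix \<phi> i assume \<phi>: "\<phi> \<in> test_functions (A \<union> B)"
      then have \<phi>': "\<phi> \<in> test_functions (B \<union> A)" by (simp add: Un_commute)
      have a: "(LINT x:A|lebesgue. cutoff A (partial i \<phi>) x *\<^sub>R u x) = - (LINT x:A|lebesgue. cutoff A \<phi> x *\<^sub>R p x $ i)"
        using wp cutoff_test[OF AB \<phi>] unfolding has_weak_gradient_def cutoff_partial[OF AB \<phi>, symmetric] by blast
      have b: "(LINT x:B|lebesgue. cutoff B (partial i \<phi>) x *\<^sub>R u x) = - (LINT x:B|lebesgue. cutoff B \<phi> x *\<^sub>R q x $ i)"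
        using wq cutoff_test[OF AB(2,1) AB' \<phi>'] unfolding has_weak_gradient_def cutoff_partial[OF AB(2,1) AB' \<phi>', symmetric] by blast
      have c: "(LINT x:A \<union> B|lebesgue. \<phi> x *\<^sub>R w x $ i)
        = (LINT x:A|lebesgue. cutoff A \<phi> x *\<^sub>R p x $ i) + (LINT x:B|lebesgue. cutoff B \<phi> x *\<^sub>R q x $ i)"
        by (rule LINT_split(1)[OF AB \<phi> locally_integrable_nth[OF lu(3)] locally_integrable_nth[OF lu(4)]]) (simp_all add: w)
      show "(LINT x:A \<union> B|lebesgue. partial i \<phi> x *\<^sub>R u x) = - (LINT x:A \<union> B|lebesgue. \<phi> x *\<^sub>R w x $ i)"
        unfolding c LINT_split(1)[OF AB test_functions_partial[OF \<phi>] lu(1,2) refl refl] a b by simp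
    qed
    show "locally_integrable (A \<union> B) (\<lambda>x. (norm (u x))\<^sup>2)" by (rule locally_integrable_Un[OF AB lp(1) lq(1) refl refl])
    show "locally_integrable (A \<union> B) (\<lambda>x. (norm (w x))\<^sup>2)" by (rule locally_integrable_Un[OF AB lp(2) lq(2)]) (simp_all add: w)
    show "locally_integrable (A \<union> B) (\<lambda>x. C x *v w x)" by (rule locally_integrable_Un[OF AB lp(3) lq(3)]) (simp_all add: w)
    show "locally_integrable (A \<union> B) (\<lambda>x. n x * u x)" by (rule locally_integrable_Un[OF AB lp(4) lq(4) refl refl])
    fix \<phi> assume \<phi>: "\<phi> \<in> test_functions (A \<union> B)"
    then have \<phi>': "\<phi> \<in> test_functions (B \<union> A)" by (simp add: Un_commute)
    note t = cutoff_test[OF AB \<phi>] cutoff_test[OF AB(2,1) AB' \<phi>']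
    have d: "(LINT x:A \<union> B|lebesgue. partial i \<phi> x *\<^sub>R (C x *v w x) $ i)
        = (LINT x:A|lebesgue. partial i (cutoff A \<phi>) x *\<^sub>R (C x *v p x) $ i) + (LINT x:B|lebesgue. partial i (cutoff B \<phi>) x *\<^sub>R (C x *v q x) $ i)"
      "integrable lebesgue (\<lambda>x. partial i \<phi> x *\<^sub>R (C x *v w x) $ i)" for i
      unfolding cutoff_partial[OF AB \<phi>] cutoff_partial[OF AB(2,1) AB' \<phi>']
      by (rule LINT_split[OF AB test_functions_partial[OF \<phi>] locally_integrable_nth[OF lp(3)] locally_integrable_nth[OF lq(3)]]; simp add: w)+
    have iA: "integrable lebesgue (\<lambda>x. partial i (cutoff A \<phi>) x *\<^sub>R (C x *v p x) $ i)" for i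
      by (rule integrable_test_mult[OF _ test_functions_partial[OF t(1)]]) (use locally_integrable_nth[OF lp(3)] in \<open>auto simp: locally_integrable_def\<close>)
    have iB: "integrable lebesgue (\<lambda>x. partial i (cutoff B \<phi>) x *\<^sub>R (C x *v q x) $ i)" for i
      by (rule integrable_test_mult[OF _ test_functions_partial[OF t(2)]]) (use locally_integrable_nth[OF lq(3)] in \<open>auto simp: locally_integrable_def\<close>)
    have S: "(LINT x:G|lebesgue. (\<Sum>i\<in>UNIV. partial i \<psi> x *\<^sub>R (v x) $ i)) = (\<Sum>i\<in>UNIV. LINT x:G|lebesgue. partial i \<psi> x *\<^sub>R (v x $ i :: complex))"
      if \<psi>: "\<psi> \<in> test_functions G" and i: "\<And>i. integrable lebesgue (\<lambda>x. partial i \<psi> x *\<^sub>R v x $ i)" for G \<psi> v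
      unfolding partial_sum_LINT[OF \<psi>] test_LINT[OF test_functions_partial[OF \<psi>]] using i by (rule Bochner_Integration.integral_sum)
    show "- (LINT x:A \<union> B|lebesgue. (\<Sum>i\<in>UNIV. partial i \<phi> x *\<^sub>R (C x *v w x) $ i))
           + of_real (k\<^sup>2) * (LINT x:A \<union> B|lebesgue. \<phi> x *\<^sub>R (n x * u x)) = (LINT x:A \<union> B|lebesgue. \<phi> x *\<^sub>R f x)"
      unfolding S[OF \<phi> d(2)] d(1) sum.distrib S[OF t(1) iA, symmetric] S[OF t(2) iB, symmetric]
        LINT_split(1)[OF AB \<phi> lp(4) lq(4) refl refl] LINT_split(1)[OF AB \<phi> lf lf refl refl]
        Ep[OF t(1), symmetric] Eq[OF t(2), symmetric]
      by (simp add: algebra_simps)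
  qed
qed

text \<open>The trace is local at the boundary of D: shrinking the neighbourhood to its intersection
  with H only decreases the H^1 distances, with the same approximating functions.\<close>

lemma has_outer_trace_cong:
  assumes tr: "has_outer_trace D u g" and H: "open H" "closure D \<subseteq> H" and eq: "\<And>x. x \<in> H \<Longrightarrow> u' x = u x"
  shows "has_outer_trace D u' g"
proof -
  obtain N p and \<phi> :: "nat \<Rightarrow> real^2 \<Rightarrow> complex" where N: "open N" "bounded N" "closure D \<subseteq> N"
    and wg: "has_weak_gradient (N - closure D) u p" and \<phi>: "\<And>j. smooth (\<phi> j)"
    and l: "(\<lambda>j. \<integral>\<^sup>+x\<in>N - closure D. ennreal ((norm (u x - \<phi> j x))\<^sup>2 + (norm (p x - grad (\<phi> j) x))\<^sup>2) \<partial>lebesgue) \<longlonglongrightarrow> 0"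
    and b: "(\<lambda>j. \<integral>\<^sup>+x\<in>frontier D. ennreal ((norm (\<phi> j x - g x))\<^sup>2) \<partial>arc_length) \<longlonglongrightarrow> 0"
    using tr unfolding has_outer_trace_def by blast
  show ?thesis unfolding has_outer_trace_def
  proof (intro exI[of _ "N \<inter> H"] exI[of _ p] exI[of _ \<phi>] conjI allI)
    show "open (N \<inter> H)" "bounded (N \<inter> H)" "closure D \<subseteq> N \<inter> H" using N H by (auto intro: bounded_subset)
    show "has_weak_gradient (N \<inter> H - closure D) u' p"
      by (rule has_weak_gradient_cong[OF wg]) (use eq in auto)
    show "(\<lambda>j. \<integral>\<^sup>+x\<in>N \<inter> H - closure D. ennreal ((norm (u' x - \<phi> j x))\<^sup>2 + (norm (p x - grad (\<phi> j) x))\<^sup>2) \<partial>lebesgue) \<longlonglongrightarrow> 0"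
    proof (rule tendsto_sandwich[OF _ _ tendsto_const l])
      show "\<forall>\<^sub>F j in sequentially. (\<integral>\<^sup>+x\<in>N \<inter> H - closure D. ennreal ((norm (u' x - \<phi> j x))\<^sup>2 + (norm (p x - grad (\<phi> j) x))\<^sup>2) \<partial>lebesgue)
        \<le> (\<integral>\<^sup>+x\<in>N - closure D. ennreal ((norm (u x - \<phi> j x))\<^sup>2 + (norm (p x - grad (\<phi> j) x))\<^sup>2) \<partial>lebesgue)"
        by (intro always_eventually allI nn_integral_mono) (auto simp: indicator_def eq)
    qed auto
  qed (use \<phi> b in auto)
qed

section \<open>Corners of the interface\<close>

context star
begin

text \<open>Angles without a neighbourhood on which R1 is continuously differentiable. This makes
  the set closed, and it excludes breakpoints where neighbouring pieces join smoothly; at those the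
  flux condition in \<open>transmission\<close> is imposed too.\<close>

definition corners :: "real set" where
  "corners = {\<theta>. \<not> (\<exists>J. open J \<and> \<theta> \<in> J \<and> (\<forall>s\<in>J. (R1 has_real_derivative deriv R1 s) (at s)) \<and> continuous_on J (deriv R1))}"

definition slope :: real where "slope = (SUP \<theta>\<in>{0..2*pi} - corners. \<bar>deriv R1 \<theta>\<bar>)"

lemma smooth_not_corner:
  assumes "smooth_on_interval R1 {a<..<b}" "a < \<theta>" "\<theta> < b"
  shows "\<theta> \<notin> corners"
proof -
  have "open {a<..<b} \<and> \<theta> \<in> {a<..<b} \<and> (\<forall>s\<in>{a<..<b}. (R1 has_real_derivative deriv R1 s) (at s)) \<and> continuous_on {a<..<b} (deriv R1)"
    using smooth_on_interval_deriv[OF assms(1) open_greaterThanLessThan subset_refl] assms(2,3) by auto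
  then show ?thesis unfolding corners_def by blast
qed

lemma R1_deriv: "\<theta> \<notin> corners \<Longrightarrow> (R1 has_real_derivative deriv R1 \<theta>) (at \<theta>)"
  unfolding corners_def by blast

text \<open>Between consecutive breakpoints R1 is smooth, so within one period corners are
  breakpoints. Each piece agrees with a smooth function on a closed interval, which bounds its slope
  up to the corners.\<close>

lemma corners: "closed corners" "finite (corners \<inter> {0..2*pi})" "continuous_on (- corners) (deriv R1)"
  "0 \<le> \<theta> \<Longrightarrow> \<theta> \<le> 2 * pi \<Longrightarrow> \<theta> \<notin> corners \<Longrightarrow> \<bar>deriv R1 \<theta>\<bar> \<le> slope"
proof -
  have loc: "\<exists>J. open J \<and> \<theta> \<in> J \<and> J \<subseteq> - corners \<and> continuous_on J (deriv R1)" if th: "\<theta> \<notin> corners" for \<theta>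
  proof -
    obtain J where J: "open J" "\<theta> \<in> J" "\<forall>s\<in>J. (R1 has_real_derivative deriv R1 s) (at s)" "continuous_on J (deriv R1)"
      using th unfolding corners_def by blast
    then have "J \<subseteq> - corners" unfolding corners_def by blast
    then show ?thesis using J by blast
  qed
  have "open (- corners)"
    by (subst open_subopen) (use loc in blast)
  then show "closed corners" by (simp add: closed_def)
  show c: "continuous_on (- corners) (deriv R1)"
  proof (intro continuous_at_imp_continuous_on ballI)
    fix \<theta> assume "\<theta> \<in> - corners"
    then obtain J where "open J" "\<theta> \<in> J" "continuous_on J (deriv R1)" using loc[of \<theta>] by auto
    then show "isCont (deriv R1) \<theta>" using continuous_on_eq_continuous_at by blast
  qed
  obtain m :: nat and t where t: "t 0 = 0" "t m = 2 * pi" "\<And>i. i < m \<Longrightarrow> smooth_on_interval R1 {t i..t (Suc i)}"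
    using star unfolding star_radius_def by blast
  have piece: "\<exists>i<m. t i < \<theta> \<and> \<theta> < t (Suc i)" if \<theta>: "0 \<le> \<theta>" "\<theta> \<le> 2 * pi" "\<theta> \<notin> t ` {..m}" for \<theta>
  proof -
    have ne: "\<theta> \<noteq> t i" if "i \<le> m" for i using \<theta>(3) that by auto
    have "\<exists>i\<le>m. t i > \<theta>" using ne[of m] \<theta> t(2) by (intro exI[of _ m]) auto
    then obtain i where i: "i \<le> m" "t i > \<theta>" "\<And>l. l < i \<Longrightarrow> \<not> (l \<le> m \<and> t l > \<theta>)"
      using exists_least_iff[of "\<lambda>i. i \<le> m \<and> t i > \<theta>"] by blast
    have "i \<noteq> 0" using i(2) t(1) \<theta> by (cases i) auto
    then obtain l where l: "i = Suc l" by (cases i) auto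
    have "t l < \<theta>" using i(3)[of l] ne[of l] i(1) l by auto
    then show ?thesis using i l by (intro exI[of _ l]) auto
  qed
  have "corners \<inter> {0..2*pi} \<subseteq> t ` {..m}"
  proof
    fix \<theta> assume \<theta>: "\<theta> \<in> corners \<inter> {0..2*pi}"
    show "\<theta> \<in> t ` {..m}"
    proof (rule ccontr)
      assume "\<theta> \<notin> t ` {..m}"
      then obtain i where i: "i < m" "t i < \<theta>" "\<theta> < t (Suc i)" using piece[of \<theta>] \<theta> by auto
      have "smooth_on_interval R1 {t i<..<t (Suc i)}" using t(3)[OF i(1)] unfolding smooth_on_interval_def by fastforce
      from smooth_not_corner[OF this i(2,3)] show False using \<theta> by simp
    qed
  qed
  then show "finite (corners \<inter> {0..2*pi})" by (rule finite_subset) simp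
  define h where "h \<theta> = \<bar>deriv R1 \<theta>\<bar>" for \<theta>
  have bi: "bdd_above (h ` {t i<..<t (Suc i)})" if im: "i < m" for i
  proof -
    obtain g where g: "smooth g" "\<And>\<theta>. \<theta> \<in> {t i..t (Suc i)} \<Longrightarrow> R1 \<theta> = g \<theta>"
      using t(3)[OF im] unfolding smooth_on_interval_def by blast
    have e: "deriv R1 s = frechet_derivative g (at s) 1" if "t i < s" "s < t (Suc i)" for s
      by (rule DERIV_imp_deriv, rule has_field_derivative_transform_within_open[OF smooth_real_deriv(1)[OF g(1)], of "{t i<..<t (Suc i)}"])
        (use that g(2) in auto)
    have "bounded ((\<lambda>s. frechet_derivative g (at s) 1) ` {t i..t (Suc i)})"
      by (intro compact_imp_bounded compact_continuous_image smooth_real_deriv(2)[OF g(1)] compact_Icc)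
    then obtain B where "\<And>s. s \<in> {t i..t (Suc i)} \<Longrightarrow> norm (frechet_derivative g (at s) 1) \<le> B"
      unfolding bounded_iff by (metis imageI)
    then show ?thesis using e by (intro bdd_aboveI[of _ B]) (auto simp: h_def)
  qed
  \<comment> \<open>Breakpoints that are not corners add finitely many values to the bounded
    families from the open pieces.\<close>
  have "bdd_above (h ` (t ` {..m}) \<union> (\<Union>i\<in>{..<m}. h ` {t i<..<t (Suc i)}))"
    using bi by (simp add: bdd_above_Un bdd_above_UN)
  moreover have "h ` ({0..2*pi} - corners) \<subseteq> h ` (t ` {..m}) \<union> (\<Union>i\<in>{..<m}. h ` {t i<..<t (Suc i)})"
  proof
    fix y assume "y \<in> h ` ({0..2*pi} - corners)"
    then obtain \<theta> where \<theta>: "y = h \<theta>" "0 \<le> \<theta>" "\<theta> \<le> 2 * pi" by auto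
    show "y \<in> h ` (t ` {..m}) \<union> (\<Union>i\<in>{..<m}. h ` {t i<..<t (Suc i)})"
    proof (cases "\<theta> \<in> t ` {..m}")
      case True
      then show ?thesis using \<theta>(1) by blast
    next
      case False
      then obtain i where "i < m" "\<theta> \<in> {t i<..<t (Suc i)}" using piece[OF \<theta>(2,3)] by auto
      then show ?thesis using \<theta>(1) by blast
    qed
  qed
  ultimately have "bdd_above (h ` ({0..2*pi} - corners))" by (rule bdd_above_mono)
  then show "0 \<le> \<theta> \<Longrightarrow> \<theta> \<le> 2 * pi \<Longrightarrow> \<theta> \<notin> corners \<Longrightarrow> \<bar>deriv R1 \<theta>\<bar> \<le> slope"
    unfolding slope_def h_def by (rule cSUP_upper[rotated]) auto
qed

end

section \<open>The compression transformation\<close>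

text \<open>The compression as a function of the interface radius R instead of the angle. Angular
  derivatives then become the derivative of R1 times R-derivatives, the factorisation that
  \<open>transformed\<close> requires.\<close>

definition comp_T :: "real \<Rightarrow> real \<Rightarrow> real \<Rightarrow> real" where
  "comp_T \<rho> R r = (\<rho> * R - R) * (r - R) / (\<rho> * R - r)"

definition comp_Tr :: "real \<Rightarrow> real \<Rightarrow> real \<Rightarrow> real" where
  "comp_Tr \<rho> R r = (\<rho> * R - R)\<^sup>2 / (\<rho> * R - r)\<^sup>2"

definition comp_TR :: "real \<Rightarrow> real \<Rightarrow> real \<Rightarrow> real" where
  "comp_TR \<rho> R r = (\<rho> - 1) * (2 * R * r - r\<^sup>2 - \<rho> * R\<^sup>2) / (\<rho> * R - r)\<^sup>2"

definition comp_TrR :: "real \<Rightarrow> real \<Rightarrow> real \<Rightarrow> real" where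
  "comp_TrR \<rho> R r = - (2 * R * r * (\<rho> - 1)\<^sup>2) / (\<rho> * R - r) ^ 3"

lemma comp_derivs:
  assumes "\<rho> * R - r \<noteq> 0"
  shows "((\<lambda>r. comp_T \<rho> R r) has_real_derivative comp_Tr \<rho> R r) (at r)"
    "((\<lambda>R. comp_T \<rho> R r) has_real_derivative comp_TR \<rho> R r) (at R)"
    "((\<lambda>r. comp_TR \<rho> R r) has_real_derivative comp_TrR \<rho> R r) (at r)"
    "((\<lambda>R. comp_Tr \<rho> R r) has_real_derivative comp_TrR \<rho> R r) (at R)"
proof -
  define d where "d = \<rho> * R - r"
  have d: "d \<noteq> 0" and r: "r = \<rho> * R - d" using assms by (auto simp: d_def)
  show "((\<lambda>r. comp_T \<rho> R r) has_real_derivative comp_Tr \<rho> R r) (at r)"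
    unfolding comp_T_def comp_Tr_def
    by (rule derivative_eq_intros refl assms)+ (use d in \<open>simp add: r field_simps power2_eq_square\<close>)
  show "((\<lambda>R. comp_T \<rho> R r) has_real_derivative comp_TR \<rho> R r) (at R)"
    unfolding comp_T_def comp_TR_def
    by (rule derivative_eq_intros refl assms)+ (use d in \<open>simp add: r field_simps power2_eq_square\<close>)
  show "((\<lambda>r. comp_TR \<rho> R r) has_real_derivative comp_TrR \<rho> R r) (at r)"
    unfolding comp_TR_def comp_TrR_def
    by (rule derivative_eq_intros refl assms)+ (use d in \<open>simp_all add: r field_simps power2_eq_square power3_eq_cube\<close>)
  show "((\<lambda>R. comp_Tr \<rho> R r) has_real_derivative comp_TrR \<rho> R r) (at R)"
    unfolding comp_Tr_def comp_TrR_def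
    by (rule derivative_eq_intros refl assms)+ (use d in \<open>simp_all add: r field_simps power2_eq_square power3_eq_cube\<close>)
qed

lemma has_vector_derivative_affine:
  assumes "(f has_real_derivative f') (at x)"
  shows "((\<lambda>x. a + b * complex_of_real (f x)) has_vector_derivative b * of_real f') (at x)"
  using has_vector_derivative_add[OF has_vector_derivative_const
    has_vector_derivative_mult_right[OF bounded_linear.has_vector_derivative[OF bounded_linear_of_real
      assms[unfolded has_real_derivative_iff_has_vector_derivative]]], of a b] by simp

lemma has_vector_derivative_of_real:
  assumes "(f has_real_derivative f') (at x)"
  shows "((\<lambda>x. complex_of_real (f x)) has_vector_derivative of_real f') (at x)"
  using has_vector_derivative_affine[OF assms, of 0 1] by simp

section \<open>The layer as a transformed field\<close>

locale pal = sector_field +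
  fixes \<rho> :: real
  assumes \<rho>: "1 < \<rho>"
begin

definition "\<sigma> = Complex \<sigma>1 \<sigma>0"
definition "lS r \<theta> = of_real (R1 \<theta>) + \<sigma> * of_real (comp_T \<rho> (R1 \<theta>) r)"
definition "lSr r \<theta> = \<sigma> * of_real (comp_Tr \<rho> (R1 \<theta>) r)"
definition "lA r \<theta> = 1 + \<sigma> * of_real (comp_TR \<rho> (R1 \<theta>) r)"
definition "lB r \<theta> = \<sigma> * of_real (comp_TrR \<rho> (R1 \<theta>) r)"

lemma comp_T_nonneg: "R1 \<theta> \<le> r \<Longrightarrow> r < \<rho> * R1 \<theta> \<Longrightarrow> 0 \<le> comp_T \<rho> (R1 \<theta>) r"
  using \<rho> R1_pos[of \<theta>] unfolding comp_T_def by (intro divide_nonneg_pos mult_nonneg_nonneg) auto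

lemma sector_ray: "0 \<le> t \<Longrightarrow> of_real (R1 \<theta>) + \<sigma> * of_real t \<in> sector R1 \<sigma>0 \<sigma>1 \<theta>"
  using \<sigma> by (simp add: sector_iff \<sigma>_def)

lemma lS_sector: "R1 \<theta> \<le> r \<Longrightarrow> r < \<rho> * R1 \<theta> \<Longrightarrow> lS r \<theta> \<in> sector R1 \<sigma>0 \<sigma>1 \<theta>"
  unfolding lS_def by (intro sector_ray comp_T_nonneg)

lemma lS_theta:
  assumes "(R1 has_real_derivative d) (at \<theta>)" "r < \<rho> * R1 \<theta>"
  shows "(lS r has_vector_derivative of_real d * lA r \<theta>) (at \<theta>)"
    and "(lSr r has_vector_derivative of_real d * lB r \<theta>) (at \<theta>)"
proof -
  have nz: "\<rho> * R1 \<theta> - r \<noteq> 0" using assms by simp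
  have a: "((\<lambda>t. comp_T \<rho> (R1 t) r) has_real_derivative comp_TR \<rho> (R1 \<theta>) r * d) (at \<theta>)"
    by (rule DERIV_chain2[OF comp_derivs(2)[OF nz] assms(1)])
  have b: "((\<lambda>t. comp_Tr \<rho> (R1 t) r) has_real_derivative comp_TrR \<rho> (R1 \<theta>) r * d) (at \<theta>)"
    by (rule DERIV_chain2[OF comp_derivs(4)[OF nz] assms(1)])
  show "(lS r has_vector_derivative of_real d * lA r \<theta>) (at \<theta>)"
    using has_vector_derivative_add[OF has_vector_derivative_of_real[OF assms(1)] has_vector_derivative_affine[OF a, of 0 \<sigma>]]
    by (simp add: lS_def[abs_def] lA_def algebra_simps)
  show "(lSr r has_vector_derivative of_real d * lB r \<theta>) (at \<theta>)"
    using has_vector_derivative_affine[OF b, of 0 \<sigma>] by (simp add: lSr_def[abs_def] lB_def algebra_simps)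
qed

lemma lS_r: "r < \<rho> * R1 \<theta> \<Longrightarrow> ((\<lambda>r. lS r \<theta>) has_vector_derivative lSr r \<theta>) (at r)"
  unfolding lS_def lSr_def by (intro has_vector_derivative_affine comp_derivs) simp

lemma comp_cont:
  assumes "F \<in> {lS, lSr, lA, lB}"
  shows "continuous_on {p. fst p < \<rho> * R1 (snd p)} (\<lambda>p. F (fst p) (snd p))"
proof -
  have [continuous_intros]: "continuous_on S (\<lambda>p. R1 (snd p))" for S :: "(real \<times> real) set"
    by (rule continuous_on_compose2[OF R1_cont[of UNIV]]) (auto intro!: continuous_intros)
  show ?thesis using assms unfolding lS_def[abs_def] lSr_def[abs_def] lA_def[abs_def] lB_def[abs_def]
      comp_T_def comp_Tr_def comp_TR_def comp_TrR_def
    by (elim insertE emptyE; simp only:; intro continuous_intros) auto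
qed

sublocale lay: transformed R1 \<sigma>0 \<sigma>1 k U W W1 W2 Z "layer R1 \<rho>" corners lS lSr lA lB "deriv R1" slope
proof
  show "open (layer R1 \<rho>)" by (rule open_layer)
  show "0 \<notin> layer R1 \<rho>" by (simp add: layer_iff)
  show "closed corners" "finite (corners \<inter> {0..2*pi})" "continuous_on (- corners) (deriv R1)" by (rule corners)+
  show "\<bar>deriv R1 \<theta>\<bar> \<le> slope" if "0 \<le> \<theta>" "\<theta> \<le> 2 * pi" "\<theta> \<notin> corners" for \<theta> using that by (rule corners)
  show "lS r (2 * pi) = lS r 0 \<and> lSr r (2 * pi) = lSr r 0" for r
    using R1_per[of 0] by (simp add: lS_def lSr_def)
  show "continuous_on {p. 0 < fst p \<and> polar (fst p) (snd p) \<in> layer R1 \<rho>} (\<lambda>p. F (fst p) (snd p))"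
    if "F \<in> {lS, lSr, lA, lB}" for F
    by (rule continuous_on_subset[OF comp_cont[OF that]]) (auto simp: polar_layer)
  fix r \<theta> :: real assume "0 < r" "polar r \<theta> \<in> layer R1 \<rho>"
  then have r: "R1 \<theta> < r" "r < \<rho> * R1 \<theta>" by (auto simp: polar_layer)
  show "lS r \<theta> \<in> sector R1 \<sigma>0 \<sigma>1 \<theta>" using r by (intro lS_sector) auto
  show "((\<lambda>r. lS r \<theta>) has_vector_derivative lSr r \<theta>) (at r)" by (rule lS_r[OF r(2)])
  show "((\<lambda>r. lA r \<theta>) has_vector_derivative lB r \<theta>) (at r)"
    unfolding lA_def lB_def by (intro has_vector_derivative_affine comp_derivs) (use r in simp)
  show "(lS r has_vector_derivative of_real (deriv R1 \<theta>) * lA r \<theta>) (at \<theta>)"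
    "(lSr r has_vector_derivative of_real (deriv R1 \<theta>) * lB r \<theta>) (at \<theta>)" if "\<theta> \<notin> corners"
    using lS_theta[OF R1_deriv[OF that] r(2)] by blast+
qed

lemma pal_S_layer: "R1 \<theta> < r \<Longrightarrow> r < \<rho> * R1 \<theta> \<Longrightarrow> pal_S R1 \<rho> \<sigma>0 \<sigma>1 r \<theta> = lS r \<theta>"
proof -
  assume r: "R1 \<theta> < r" "r < \<rho> * R1 \<theta>"
  have "pal_T R1 \<rho> r \<theta> = comp_T \<rho> (R1 \<theta>) r" by (simp add: pal_T_def comp_T_def)
  then show ?thesis using r by (simp add: pal_S_def lS_def \<sigma>_def Complex_eq algebra_simps)
qed

lemma pal_S_r_layer:
  assumes "R1 \<theta> < r" "r < \<rho> * R1 \<theta>"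
  shows "pal_S_r R1 \<rho> \<sigma>0 \<sigma>1 r \<theta> = lSr r \<theta>"
  unfolding pal_S_r_def
  by (rule vector_derivative_at, rule has_vector_derivative_transform_within_open[OF lS_r, of _ _ "{R1 \<theta><..<\<rho> * R1 \<theta>}"])
    (use assms pal_S_layer in auto)

lemma pal_S_shift: "pal_S R1 \<rho> \<sigma>0 \<sigma>1 r (\<theta> + 2 * pi * of_int j) = pal_S R1 \<rho> \<sigma>0 \<sigma>1 r \<theta>"
  by (simp add: pal_S_def pal_T_def R1_per_int)

text \<open>Coefficients are evaluated at the principal angle of a point, whereas the calculus runs
  at an arbitrary \<theta>. The two differ by a multiple of 2 pi, hence the shift by j.\<close>

lemma pal_S_theta_layer:
  assumes r: "R1 \<theta> < r" "r < \<rho> * R1 \<theta>" and \<theta>: "\<theta> \<notin> corners"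
  shows "pal_S_theta R1 \<rho> \<sigma>0 \<sigma>1 r (\<theta> + 2 * pi * of_int j) = of_real (deriv R1 \<theta>) * lA r \<theta>"
proof -
  have "open ({t. R1 t < r} \<inter> {t. r < \<rho> * R1 t})"
    by (intro open_Int open_Collect_less continuous_intros R1_cont)
  then have "(pal_S R1 \<rho> \<sigma>0 \<sigma>1 r has_vector_derivative of_real (deriv R1 \<theta>) * lA r \<theta>) (at \<theta>)"
    by (rule has_vector_derivative_transform_within_open[OF lS_theta(1)[OF R1_deriv[OF \<theta>] r(2)]])
      (use r pal_S_layer in auto)
  then have "(pal_S R1 \<rho> \<sigma>0 \<sigma>1 r has_vector_derivative of_real (deriv R1 \<theta>) * lA r \<theta>)
      (at ((\<theta> + 2 * pi * of_int j) + 2 * pi * of_int (- j)))" by simp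
  from has_vector_derivative_shift[OF this]
  show ?thesis unfolding pal_S_theta_def pal_S_shift by (rule vector_derivative_at)
qed

definition "u = pal_field R1 \<rho> \<sigma>0 \<sigma>1 U W"

lemma W_per_int:
  assumes "z \<in> sector R1 \<sigma>0 \<sigma>1 \<theta>"
  shows "W z (\<theta> + 2 * pi * of_int j) = W z \<theta>"
proof -
  define f where "f t = (if z \<in> sector R1 \<sigma>0 \<sigma>1 t then W z t else 0)" for t
  have s: "sector R1 \<sigma>0 \<sigma>1 (t + 2 * pi) = sector R1 \<sigma>0 \<sigma>1 t" for t by (simp add: sector_def R1_per)
  have s': "sector R1 \<sigma>0 \<sigma>1 (t + 2 * pi * of_int j) = sector R1 \<sigma>0 \<sigma>1 t" for t by (simp add: sector_def R1_per_int)
  have "f (\<theta> + 2 * pi * of_int j) = f \<theta>"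
    by (rule periodic_int) (use W_per in \<open>auto simp: f_def s\<close>)
  then show ?thesis using assms by (simp add: f_def s')
qed

lemma u_layer:
  assumes "0 < r" "polar r \<theta> \<in> layer R1 \<rho>"
  shows "u (polar r \<theta>) = W (lS r \<theta>) \<theta>"
proof -
  obtain j :: int where j: "ang (polar r \<theta>) = \<theta> + 2 * pi * of_int j" using ang_polar[OF assms(1)] by blast
  have r: "R1 \<theta> < r" "r < \<rho> * R1 \<theta>" using assms by (auto simp: polar_layer)
  show ?thesis using assms r
    by (simp add: u_def pal_field_def j pal_S_shift norm_polar pal_S_layer W_per_int lS_sector)
qed

lemma grad_u:
  assumes "0 < r" "polar r \<theta> \<in> layer R1 \<rho>" "\<theta> \<notin> corners"
  shows "grad u (polar r \<theta>) = polvec \<theta> (lay.ur r \<theta>) (lay.ut r \<theta> / of_real r)"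
  using assms u_layer by (rule lay.u_has_derivative(2))

lemma n_layer:
  assumes "0 < r" "polar r \<theta> \<in> layer R1 \<rho>"
  shows "pal_n R1 \<rho> \<sigma>0 \<sigma>1 (polar r \<theta>) = lS r \<theta> * lSr r \<theta> / of_real r"
proof -
  obtain j :: int where j: "ang (polar r \<theta>) = \<theta> + 2 * pi * of_int j" using ang_polar[OF assms(1)] by blast
  have r: "R1 \<theta> < r" "r < \<rho> * R1 \<theta>" using assms by (auto simp: polar_layer)
  have "lSr r (\<theta> + 2 * pi * of_int j) = lSr r \<theta>" by (simp add: lSr_def R1_per_int)
  moreover have "pal_S_r R1 \<rho> \<sigma>0 \<sigma>1 r (\<theta> + 2 * pi * of_int j) = lSr r (\<theta> + 2 * pi * of_int j)"
    by (rule pal_S_r_layer) (use r in \<open>simp_all add: R1_per_int\<close>)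
  ultimately show ?thesis using assms r by (simp add: pal_n_def j pal_S_shift norm_polar pal_S_layer)
qed

text \<open>Conjugation by the rotation means that the matrix acts directly on radial and angular
  components.\<close>

lemma rot_conjugate:
  fixes b11 b12 b21 b22 a b :: complex
  shows "(rot t ** vector [vector [b11, b12], vector [b21, b22]] ** transpose (rot t)) *v polvec t a b
    = polvec t (b11 * a + b12 * b) (b21 * a + b22 * b)"
proof -
  define c s where "c = complex_of_real (cos t)" and "s = complex_of_real (sin t)"
  have cs: "c * c + s * s = 1"
    unfolding c_def s_def of_real_mult[symmetric] of_real_add[symmetric] by (simp add: power2_eq_square[symmetric])
  have "transpose (rot t) *v polvec t a b = vector [(c * c + s * s) * a, (c * c + s * s) * b]"
    by (simp add: vec2_eq_iff matrix_vector_mult_def sum_2 transpose_def rot_def c_def[symmetric] s_def[symmetric] algebra_simps)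
  then have e: "transpose (rot t) *v polvec t a b = vector [a, b]" unfolding cs by simp
  show ?thesis unfolding matrix_vector_mul_assoc[symmetric] e
    by (simp add: vec2_eq_iff matrix_vector_mult_def sum_2 rot_def algebra_simps)
qed

lemma polvec_shift: "polvec (\<theta> + 2 * pi * of_int j) a b = polvec \<theta> a b"
proof -
  have "cos (\<theta> + 2 * pi * of_int j) = cos \<theta>" "sin (\<theta> + 2 * pi * of_int j) = sin \<theta>"
    by (rule periodic_int; simp)+
  then show ?thesis by (simp add: polvec_def)
qed

lemma Tr_pos: "R1 \<theta> < r \<Longrightarrow> r < \<rho> * R1 \<theta> \<Longrightarrow> 0 < comp_Tr \<rho> (R1 \<theta>) r"
  unfolding comp_Tr_def by (intro divide_pos_pos) auto

lemma lSr_nz: "R1 \<theta> < r \<Longrightarrow> r < \<rho> * R1 \<theta> \<Longrightarrow> lSr r \<theta> \<noteq> 0"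
  using Tr_pos[of \<theta> r] \<sigma> by (auto simp: lSr_def \<sigma>_def complex_eq_iff)

text \<open>The identity from which B originates: it sends (u_r, u_\<theta>/r) to (P/r, Q). The term
  with S_\<theta>^2 in the first entry cancels the W_z S_\<theta> part of u_\<theta> in the radial
  flux, and the off-diagonal entry removes W_z from the angular flux.\<close>

lemma C_layer:
  assumes r: "0 < r" "polar r \<theta> \<in> layer R1 \<rho>" and \<theta>: "\<theta> \<notin> corners"
  shows "pal_C R1 \<rho> \<sigma>0 \<sigma>1 (polar r \<theta>) *v grad u (polar r \<theta>) = polvec \<theta> (lay.Pf r \<theta> / of_real r) (lay.Qf r \<theta>)"
proof -
  obtain j :: int where j: "ang (polar r \<theta>) = \<theta> + 2 * pi * of_int j" using ang_polar[OF r(1)] by blast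
  have R: "R1 \<theta> < r" "r < \<rho> * R1 \<theta>" using r by (auto simp: polar_layer)
  have Sr: "pal_S_r R1 \<rho> \<sigma>0 \<sigma>1 r (\<theta> + 2 * pi * of_int j) = lSr r \<theta>"
  proof -
    have "pal_S_r R1 \<rho> \<sigma>0 \<sigma>1 r (\<theta> + 2 * pi * of_int j) = lSr r (\<theta> + 2 * pi * of_int j)"
      by (rule pal_S_r_layer) (use R in \<open>simp_all add: R1_per_int\<close>)
    then show ?thesis by (simp add: lSr_def R1_per_int)
  qed
  define S Sr St w w1 where "S = lS r \<theta>" and "Sr = lSr r \<theta>" and "St = of_real (deriv R1 \<theta>) * lA r \<theta>"
    and "w = Wz (lS r \<theta>) \<theta>" and "w1 = W1 (lS r \<theta>) \<theta>"
  have nz: "S \<noteq> 0" "Sr \<noteq> 0" "complex_of_real r \<noteq> 0" using lay.S_nz[OF r] lSr_nz[OF R] r(1) by (auto simp: S_def Sr_def)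
  have B: "pal_B R1 \<rho> \<sigma>0 \<sigma>1 r (\<theta> + 2 * pi * of_int j) =
      vector [vector [S / (of_real r * Sr) * (1 + St\<^sup>2 / S\<^sup>2), - St / S], vector [- St / S, of_real r * Sr / S]]"
    unfolding pal_B_def Let_def Sr pal_S_theta_layer[OF R \<theta>] pal_S_shift pal_S_layer[OF R] S_def Sr_def St_def by simp
  have g: "grad u (polar r \<theta>) = polvec (\<theta> + 2 * pi * of_int j) (w * Sr) ((w * St + w1) / of_real r)"
    unfolding grad_u[OF r \<theta>] polvec_shift lay.ur_def lay.ut_def w_def w1_def Sr_def St_def by simp
  have a: "S / (of_real r * Sr) * (1 + St\<^sup>2 / S\<^sup>2) * (w * Sr) + (- St / S) * ((w * St + w1) / of_real r) = (S * w - St * w1 / S) / of_real r"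
    using nz by (simp add: field_simps power2_eq_square)
  have b: "(- St / S) * (w * Sr) + (of_real r * Sr / S) * ((w * St + w1) / of_real r) = Sr * (w1 / S)"
    using nz by (simp add: field_simps)
  have p: "lay.Pf r \<theta> = S * w - St * w1 / S" "lay.Qf r \<theta> = Sr * (w1 / S)"
    by (simp_all add: lay.Pf_def lay.Qf_def S_def Sr_def St_def w_def w1_def)
  have C: "pal_C R1 \<rho> \<sigma>0 \<sigma>1 (polar r \<theta>) = rot (\<theta> + 2 * pi * of_int j) ** pal_B R1 \<rho> \<sigma>0 \<sigma>1 r (\<theta> + 2 * pi * of_int j) ** transpose (rot (\<theta> + 2 * pi * of_int j))"
    using r by (simp add: pal_C_def j norm_polar)
  show ?thesis unfolding C g B rot_conjugate a b p unfolding polvec_shift by (rule refl)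
qed

end

section \<open>The transformed problem\<close>

lemma eventually_from_polar:
  assumes "0 < r" "\<forall>\<^sub>F p in nhds (r, \<theta>). P (polar (fst p) (snd p))"
  shows "\<forall>\<^sub>F x in nhds (polar r \<theta>). P x"
proof -
  obtain L where L: "\<And>x. x \<noteq> 0 \<Longrightarrow> polar (fst (L x)) (snd (L x)) = x" "L (polar r \<theta>) = (r, \<theta>)"
    "(L has_derivative (\<lambda>v. (v \<bullet> polar 1 \<theta>, v \<bullet> polar 1 (\<theta> + pi / 2) / r))) (at (polar r \<theta>))"
    using polar_chart[OF assms(1), of \<theta>] by blast
  have "isCont L (polar r \<theta>)" using L(3) by (rule has_derivative_continuous)
  then have "filterlim L (nhds (r, \<theta>)) (nhds (polar r \<theta>))"
    using tendsto_at_iff_tendsto_nhds[of L "polar r \<theta>"] unfolding isCont_def L(2) by blast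
  then have "\<forall>\<^sub>F x in nhds (polar r \<theta>). P (polar (fst (L x)) (snd (L x)))"
    using assms(2) unfolding filterlim_iff by blast
  moreover have "\<forall>\<^sub>F x in nhds (polar r \<theta>). x \<noteq> 0" using assms(1) by (intro eventually_nonzero) simp
  ultimately show ?thesis by eventually_elim (simp add: L(1))
qed

lemma locally_integrable_vec2:
  fixes h :: "real^2 \<Rightarrow> complex^2"
  assumes "\<And>i. locally_integrable G (\<lambda>x. h x $ i)"
  shows "locally_integrable G h"
  unfolding locally_integrable_def set_integrable_def
proof (intro allI impI)
  fix K assume K: "compact K \<and> K \<subseteq> G"
  have l: "bounded_linear (axis i :: complex \<Rightarrow> complex^2)" for i
    by (intro linear_conv_bounded_linear[THEN iffD1] linearI) (auto simp: vec_eq_iff axis_def)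
  have "integrable lebesgue (\<lambda>x. indicat_real K x *\<^sub>R h x $ i)" for i
    using assms[of i] K unfolding locally_integrable_def set_integrable_def by blast
  then have "integrable lebesgue (\<lambda>x. \<Sum>i\<in>UNIV. axis i (indicat_real K x *\<^sub>R h x $ i))"
    by (intro Bochner_Integration.integrable_sum integrable_bounded_linear[OF l])
  moreover have "(\<Sum>i\<in>UNIV. axis i (indicat_real K x *\<^sub>R h x $ i)) = indicat_real K x *\<^sub>R h x" for x
    by (simp add: sum_2 vec2_eq_iff axis_def)
  ultimately show "integrable lebesgue (\<lambda>x. indicat_real K x *\<^sub>R h x)" by simp
qed

context sector_field
begin

text \<open>Z is an open neighbourhood of the sectors, so this also holds slightly inside the
  interface. One-sided limits from within are thereby values of W and its derivatives.\<close>

lemma U_has_derivative: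
  assumes r: "0 < r" and Zr: "(of_real r, \<theta>) \<in> Z"
  shows "(U has_derivative (\<lambda>v. (v \<bullet> polar 1 \<theta>) *\<^sub>R Wz (of_real r) \<theta> + (v \<bullet> polar 1 (\<theta> + pi / 2) / r) *\<^sub>R W1 (of_real r) \<theta>))
    (at (polar r \<theta>))"
proof -
  define h where "h p = (complex_of_real (fst p), snd p)" for p :: "real \<times> real"
  have "(h has_derivative (\<lambda>d. (of_real (fst d), snd d))) (at (r, \<theta>))"
    unfolding h_def by (auto intro!: derivative_eq_intros)
  moreover have "((\<lambda>(z, \<theta>). W z \<theta>) has_derivative (\<lambda>(u, h). Wz (of_real r) \<theta> * u + h *\<^sub>R W1 (of_real r) \<theta>)) (at (h (r, \<theta>)))"
    using W_joint[OF Zr] by (simp add: h_def)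
  ultimately have d: "((\<lambda>p. (\<lambda>(z, \<theta>). W z \<theta>) (h p)) has_derivative (\<lambda>d. fst d *\<^sub>R Wz (of_real r) \<theta> + snd d *\<^sub>R W1 (of_real r) \<theta>)) (at (r, \<theta>))"
    by (rule has_derivative_compose[THEN has_derivative_eq_rhs]) (auto simp: scaleR_conv_of_real mult.commute)
  have "open (h -` Z)" unfolding h_def by (intro open_vimage Z continuous_intros)
  then have "((\<lambda>p. U (polar (fst p) (snd p))) has_derivative (\<lambda>d. fst d *\<^sub>R Wz (of_real r) \<theta> + snd d *\<^sub>R W1 (of_real r) \<theta>)) (at (r, \<theta>))"
    by (rule has_derivative_transform_within_open[OF d]) (use Zr W_real in \<open>auto simp: h_def\<close>)
  then show ?thesis by (rule has_derivative_from_polar[OF r])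
qed

end

section \<open>The weak equation in the layer and the outer boundary\<close>

context pal
begin

lemma tame_local:
  assumes "tame (layer R1 \<rho>) corners F"
    and "\<And>r \<theta>. 0 < r \<Longrightarrow> polar r \<theta> \<in> layer R1 \<rho> \<Longrightarrow> \<theta> \<notin> corners \<Longrightarrow> H (polar r \<theta>) = F r \<theta>"
  shows "locally_integrable (layer R1 \<rho>) (H :: real^2 \<Rightarrow> complex)"
  unfolding locally_integrable_def
proof (intro allI impI)
  fix K assume "compact K \<and> K \<subseteq> layer R1 \<rho>"
  then have K: "compact K" "K \<subseteq> layer R1 \<rho>" by auto
  show "set_integrable lebesgue K H"
    by (rule tame_integrable[OF lay.G(2) lay.T assms(1) _ K]) (rule assms(2))
qed

lemma tame_local_real:
  assumes "tame (layer R1 \<rho>) corners (\<lambda>r \<theta>. of_real (F r \<theta>))"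
    and "\<And>r \<theta>. 0 < r \<Longrightarrow> polar r \<theta> \<in> layer R1 \<rho> \<Longrightarrow> \<theta> \<notin> corners \<Longrightarrow> H (polar r \<theta>) = F r \<theta>"
  shows "locally_integrable (layer R1 \<rho>) (H :: real^2 \<Rightarrow> real)"
  unfolding locally_integrable_def set_integrable_def
proof (intro allI impI)
  fix K assume K: "compact K \<and> K \<subseteq> layer R1 \<rho>"
  have "locally_integrable (layer R1 \<rho>) (\<lambda>x. complex_of_real (H x))"
    by (rule tame_local[OF assms(1)]) (simp add: assms(2))
  then have "integrable lebesgue (\<lambda>x. indicat_real K x *\<^sub>R complex_of_real (H x))"
    using K unfolding locally_integrable_def set_integrable_def by blast
  from integrable_bounded_linear[OF bounded_linear_Re this]
  show "integrable lebesgue (\<lambda>x. indicat_real K x *\<^sub>R H x)" by simp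
qed

lemma tame_polvec:
  assumes "tame (layer R1 \<rho>) corners a" "tame (layer R1 \<rho>) corners b"
  shows "tame (layer R1 \<rho>) corners (\<lambda>r \<theta>. polvec \<theta> (a r \<theta>) (b r \<theta>) $ i)"
  unfolding polvec_nth'
  by (intro tame_add tame_mult assms lay.tame_c continuous_intros) 
    (use exhaust_2[of i] in \<open>auto intro!: continuous_intros\<close>)

text \<open>The classical gradient serves as weak gradient, since the field is continuous across the
  corner rays and these are null. With \<Lambda> = 0 Green's formula gives the equation with
  right-hand side 0, which f matches on test functions in \<open>outside\<close>.\<close>

lemma layer_solution:
  assumes L: "\<And>z \<theta>. z \<in> sector R1 \<sigma>0 \<sigma>1 \<theta> \<Longrightarrow> Lam z \<theta> = 0"
    and f: "\<And>\<phi>. \<phi> \<in> test_functions outside \<Longrightarrow> (LINT x|lebesgue. \<phi> x *\<^sub>R f x) = 0"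
  shows "solves_div_form (layer R1 \<rho>) (pal_C R1 \<rho> \<sigma>0 \<sigma>1) (pal_n R1 \<rho> \<sigma>0 \<sigma>1) k f u"
proof -
  have inv: "tame (layer R1 \<rho>) corners (\<lambda>r \<theta>. 1 / of_real r)"
    by (rule lay.tame_c) (auto intro!: continuous_intros)
  have tut: "tame (layer R1 \<rho>) corners (\<lambda>r \<theta>. lay.ut r \<theta> / of_real r)" and tPf: "tame (layer R1 \<rho>) corners (\<lambda>r \<theta>. lay.Pf r \<theta> / of_real r)"
    using tame_mult[OF lay.tame_ut inv] tame_mult[OF lay.tame_Pf inv] by simp_all
  have lu: "locally_integrable (layer R1 \<rho>) u" by (rule tame_local[OF lay.tame_u]) (rule u_layer)
  have lp: "locally_integrable (layer R1 \<rho>) (\<lambda>x. grad u x $ i)" for i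
    by (rule tame_local[OF tame_polvec[OF lay.tame_ur tut, of i]]) (rule arg_cong[OF grad_u])
  have lF: "locally_integrable (layer R1 \<rho>) (\<lambda>x. (pal_C R1 \<rho> \<sigma>0 \<sigma>1 x *v grad u x) $ i)" for i
    by (rule tame_local[OF tame_polvec[OF tPf lay.tame_Qf, of i]]) (rule arg_cong[OF C_layer])
  have ln: "locally_integrable (layer R1 \<rho>) (\<lambda>x. pal_n R1 \<rho> \<sigma>0 \<sigma>1 x * u x)"
  proof (rule tame_local)
    show "tame (layer R1 \<rho>) corners (\<lambda>r \<theta>. lS r \<theta> * lSr r \<theta> / of_real r * W (lS r \<theta>) \<theta>)"
      by (intro lay.tame_c continuous_intros lay.conts) auto
  qed (simp only: n_layer u_layer)
  show ?thesis unfolding solves_div_form_def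
  proof (intro exI[of _ "grad u"] conjI ballI)
    show "has_weak_gradient (layer R1 \<rho>) u (grad u)" unfolding has_weak_gradient_def
    proof (intro conjI ballI allI)
      show "locally_integrable (layer R1 \<rho>) u" by (rule lu)
      show "locally_integrable (layer R1 \<rho>) (grad u)" by (rule locally_integrable_vec2[OF lp])
      fix \<phi> i assume \<phi>: "\<phi> \<in> test_functions (layer R1 \<rho>)"
      have w: "integrable lebesgue (\<lambda>x. partial i \<phi> x *\<^sub>R u x + \<phi> x *\<^sub>R grad u x $ i)
         \<and> (LINT x|lebesgue. partial i \<phi> x *\<^sub>R u x + \<phi> x *\<^sub>R grad u x $ i) = 0"
        by (rule lay.weak_gradient_identity[OF \<phi> u_layer grad_u])
      have a: "integrable lebesgue (\<lambda>x. partial i \<phi> x *\<^sub>R u x)"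
        by (rule integrable_test_mult[OF _ test_functions_partial[OF \<phi>]]) (use lu in \<open>auto simp: locally_integrable_def\<close>)
      have b: "integrable lebesgue (\<lambda>x. \<phi> x *\<^sub>R grad u x $ i)"
        by (rule integrable_test_mult[OF _ \<phi>]) (use lp in \<open>auto simp: locally_integrable_def\<close>)
      show "(LINT x:layer R1 \<rho>|lebesgue. partial i \<phi> x *\<^sub>R u x) = - (LINT x:layer R1 \<rho>|lebesgue. \<phi> x *\<^sub>R grad u x $ i)"
        unfolding test_LINT[OF \<phi>] test_LINT[OF test_functions_partial[OF \<phi>]]
        using w[THEN conjunct2] unfolding Bochner_Integration.integral_add[OF a b] by (simp add: add_eq_0_iff2)
    qed
    show "locally_integrable (layer R1 \<rho>) (\<lambda>x. (norm (u x))\<^sup>2)"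
      by (rule tame_local_real[OF tame_norm_sq[OF lay.tame_u]]) (simp only: u_layer)
    show "locally_integrable (layer R1 \<rho>) (\<lambda>x. (norm (grad u x))\<^sup>2)"
    proof (rule tame_local_real)
      show "tame (layer R1 \<rho>) corners (\<lambda>r \<theta>. of_real ((norm (polvec \<theta> (lay.ur r \<theta>) (lay.ut r \<theta> / of_real r)))\<^sup>2))"
        unfolding norm_polvec of_real_add by (intro tame_add tame_norm_sq tame_polvec lay.tame_ur tut)
    qed (rule arg_cong[OF grad_u])
    show "locally_integrable (layer R1 \<rho>) (\<lambda>x. pal_C R1 \<rho> \<sigma>0 \<sigma>1 x *v grad u x)" by (rule locally_integrable_vec2[OF lF])
    show "locally_integrable (layer R1 \<rho>) (\<lambda>x. pal_n R1 \<rho> \<sigma>0 \<sigma>1 x * u x)" by (rule ln)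
    fix \<phi> assume \<phi>: "\<phi> \<in> test_functions (layer R1 \<rho>)"
    then have \<phi>o: "\<phi> \<in> test_functions outside" using test_functions_mono[OF layer_outside] by blast
    have w: "integrable lebesgue (\<lambda>x. (\<Sum>i\<in>UNIV. partial i \<phi> x *\<^sub>R (pal_C R1 \<rho> \<sigma>0 \<sigma>1 x *v grad u x) $ i) + \<phi> x *\<^sub>R (pal_n R1 \<rho> \<sigma>0 \<sigma>1 x * (0 - of_real (k\<^sup>2) * u x)))
       \<and> (LINT x|lebesgue. (\<Sum>i\<in>UNIV. partial i \<phi> x *\<^sub>R (pal_C R1 \<rho> \<sigma>0 \<sigma>1 x *v grad u x) $ i) + \<phi> x *\<^sub>R (pal_n R1 \<rho> \<sigma>0 \<sigma>1 x * (0 - of_real (k\<^sup>2) * u x))) = 0"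
      by (rule lay.weak_equation_identity[OF \<phi> u_layer C_layer n_layer]) (use L[OF lay.S_sector] in auto)
    have e: "\<phi> x *\<^sub>R (pal_n R1 \<rho> \<sigma>0 \<sigma>1 x * (0 - of_real (k\<^sup>2) * u x)) = - of_real (k\<^sup>2) * (\<phi> x *\<^sub>R (pal_n R1 \<rho> \<sigma>0 \<sigma>1 x * u x))" for x
      by (simp add: scaleR_conv_of_real)
    have a: "integrable lebesgue (\<lambda>x. \<Sum>i\<in>UNIV. partial i \<phi> x *\<^sub>R (pal_C R1 \<rho> \<sigma>0 \<sigma>1 x *v grad u x) $ i)"
      by (intro Bochner_Integration.integrable_sum, rule integrable_test_mult[OF _ test_functions_partial[OF \<phi>]])
        (use lF in \<open>auto simp: locally_integrable_def\<close>)
    have b: "integrable lebesgue (\<lambda>x. - of_real (k\<^sup>2) * (\<phi> x *\<^sub>R (pal_n R1 \<rho> \<sigma>0 \<sigma>1 x * u x)))"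
      by (rule integrable_mult_right, rule integrable_test_mult[OF _ \<phi>]) (use ln in \<open>auto simp: locally_integrable_def\<close>)
    have "(LINT x|lebesgue. (\<Sum>i\<in>UNIV. partial i \<phi> x *\<^sub>R (pal_C R1 \<rho> \<sigma>0 \<sigma>1 x *v grad u x) $ i))
        + - of_real (k\<^sup>2) * (LINT x|lebesgue. \<phi> x *\<^sub>R (pal_n R1 \<rho> \<sigma>0 \<sigma>1 x * u x)) = 0"
      using w[THEN conjunct2] unfolding e Bochner_Integration.integral_add[OF a b] integral_mult_right_zero .
    then show "- (LINT x:layer R1 \<rho>|lebesgue. (\<Sum>i\<in>UNIV. partial i \<phi> x *\<^sub>R (pal_C R1 \<rho> \<sigma>0 \<sigma>1 x *v grad u x) $ i))
           + of_real (k\<^sup>2) * (LINT x:layer R1 \<rho>|lebesgue. \<phi> x *\<^sub>R (pal_n R1 \<rho> \<sigma>0 \<sigma>1 x * u x)) = (LINT x:layer R1 \<rho>|lebesgue. \<phi> x *\<^sub>R f x)"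
      unfolding test_LINT[OF \<phi>] partial_sum_LINT[OF \<phi>] f[OF \<phi>o] by simp
  qed
qed

text \<open>Since \<open>R\<^sub>1\<close> is bounded away from zero, the real part of \<open>S\<close> tends to infinity uniformly in the
  angle, so only values of the continuation at large real part matter.\<close>

lemma bounded_outer:
  assumes "\<And>z \<theta>. z \<in> sector R1 \<sigma>0 \<sigma>1 \<theta> \<Longrightarrow> X < Re z \<Longrightarrow> norm (W z \<theta>) \<le> C"
  shows "bounded_at_outer_boundary R1 \<rho> u"
proof -
  obtain m where m: "0 < m" "\<And>\<theta>. m \<le> R1 \<theta>" using R1_bounds by blast
  \<comment> \<open>A lower bound for the thickness of the layer in every direction.\<close>
  define a where "a = (\<rho> - 1) * m"
  have a: "0 < a" using m \<rho> by (simp add: a_def)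
  define Y where "Y = \<bar>X\<bar> + 1"
  have Y: "0 < Y" "X < Y" by (auto simp: Y_def)
  \<comment> \<open>For a distance d < \<delta> to the outer boundary the first bound gives T \<ge>
    a^2 / (2 d), and the second turns this into \<sigma>1 T \<ge> Y.\<close>
  define \<delta> where "\<delta> = min (a / 2) (\<sigma>1 * a\<^sup>2 / (2 * Y))"
  have \<delta>: "0 < \<delta>" "\<delta> \<le> a / 2" "\<delta> \<le> \<sigma>1 * a\<^sup>2 / (2 * Y)" using a Y \<sigma> by (auto simp: \<delta>_def)
  have "norm (u (polar r \<theta>)) \<le> C" if r: "R1 \<theta> < r" "r < \<rho> * R1 \<theta>" "\<rho> * R1 \<theta> - r < \<delta>" for r \<theta>
  proof -
    define d where "d = \<rho> * R1 \<theta> - r"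
    have d: "0 < d" "d < \<delta>" using r by (auto simp: d_def)
    have "a \<le> (\<rho> - 1) * R1 \<theta>" unfolding a_def using m(2)[of \<theta>] \<rho> by (intro mult_left_mono) auto
    then have g: "a \<le> \<rho> * R1 \<theta> - R1 \<theta>" by (simp add: algebra_simps)
    then have "a / 2 \<le> r - R1 \<theta>" using d \<delta>(2) unfolding d_def by linarith
    then have "a * (a / 2) \<le> (\<rho> * R1 \<theta> - R1 \<theta>) * (r - R1 \<theta>)" using g a by (intro mult_mono) auto
    then have "a * (a / 2) / d \<le> comp_T \<rho> (R1 \<theta>) r"
      unfolding comp_T_def d_def[symmetric] using d by (intro divide_right_mono) auto
    then have t: "\<sigma>1 * (a * (a / 2) / d) \<le> \<sigma>1 * comp_T \<rho> (R1 \<theta>) r" using \<sigma> by (intro mult_left_mono) auto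
    have "d \<le> \<sigma>1 * a\<^sup>2 / (2 * Y)" using d \<delta>(3) by linarith
    then have "Y * d \<le> \<sigma>1 * (a * (a / 2))" using Y by (simp add: field_simps power2_eq_square)
    then have "Y \<le> \<sigma>1 * (a * (a / 2) / d)" using d by (simp add: field_simps)
    then have "X < Re (lS r \<theta>)" using t Y R1_pos[of \<theta>] by (simp add: lS_def \<sigma>_def)
    moreover have "lS r \<theta> \<in> sector R1 \<sigma>0 \<sigma>1 \<theta>" using r by (intro lS_sector) auto
    moreover have "0 < r" using r(1) R1_pos[of \<theta>] by linarith
    ultimately show ?thesis using assms r by (simp add: u_layer polar_layer)
  qed
  then show ?thesis unfolding bounded_at_outer_boundary_def using \<delta>(1) by blast
qed

end

section \<open>Transmission across the interface\<close>

context pal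
begin

text \<open>The radii of both sides agree at r = R1, but S_r is \<sigma> there and not 1. The
  gradient therefore jumps, while the values of the field and the conormal flux match.\<close>

lemma interface_values: "lS (R1 \<theta>) \<theta> = of_real (R1 \<theta>)" "lSr (R1 \<theta>) \<theta> = \<sigma>" "lA (R1 \<theta>) \<theta> = 1 - \<sigma>"
proof -
  have p: "0 < (\<rho> - 1) * R1 \<theta>" using \<rho> R1_pos[of \<theta>] by simp
  then have nz: "\<rho> * R1 \<theta> - R1 \<theta> \<noteq> 0" unfolding left_diff_distrib by linarith
  have "comp_T \<rho> (R1 \<theta>) (R1 \<theta>) = 0" "comp_Tr \<rho> (R1 \<theta>) (R1 \<theta>) = 1" using nz by (simp_all add: comp_T_def comp_Tr_def)
  moreover have "comp_TR \<rho> (R1 \<theta>) (R1 \<theta>) = - 1"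
  proof -
    have "(\<rho> - 1) * (2 * R1 \<theta> * R1 \<theta> - (R1 \<theta>)\<^sup>2 - \<rho> * (R1 \<theta>)\<^sup>2) = - ((\<rho> * R1 \<theta> - R1 \<theta>)\<^sup>2)" by algebra
    then show ?thesis using nz by (simp only: comp_TR_def) simp
  qed
  ultimately show "lS (R1 \<theta>) \<theta> = of_real (R1 \<theta>)" "lSr (R1 \<theta>) \<theta> = \<sigma>" "lA (R1 \<theta>) \<theta> = 1 - \<sigma>"
    by (simp_all add: lS_def lSr_def lA_def)
qed

lemma interface_lS:
  assumes "F \<in> {lS, lSr, lA, lB}"
  shows "isCont (\<lambda>p. F (fst p) (snd p)) (R1 \<theta>, \<theta>)"
proof -
  have "open {p :: real \<times> real. fst p < \<rho> * R1 (snd p)}"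
    by (intro open_Collect_less continuous_intros continuous_on_compose2[OF R1_cont[of UNIV]]) auto
  moreover have "(R1 \<theta>, \<theta>) \<in> {p. fst p < \<rho> * R1 (snd p)}" using \<rho> R1_pos[of \<theta>] by simp
  ultimately show ?thesis using comp_cont[OF assms] continuous_on_eq_continuous_at by blast
qed

lemma interface_cont:
  assumes "continuous_on Z (\<lambda>(z, \<theta>). F z \<theta>)"
  shows "isCont (\<lambda>p. F (of_real (fst p)) (snd p)) (R1 \<theta>, \<theta>)"
    and "isCont (\<lambda>p. F (lS (fst p) (snd p)) (snd p)) (R1 \<theta>, \<theta>)"
proof -
  have m: "(of_real (R1 \<theta>), \<theta>) \<in> Z" by (rule real_mem_Z) simp
  then have c: "isCont (\<lambda>(z, \<theta>). F z \<theta>) (of_real (R1 \<theta>), \<theta>)" using assms Z continuous_on_eq_continuous_at by blast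
  have g: "isCont (\<lambda>p. F (h (fst p) (snd p)) (snd p)) (R1 \<theta>, \<theta>)"
    if h: "isCont (\<lambda>p. h (fst p) (snd p)) (R1 \<theta>, \<theta>)" "h (R1 \<theta>) \<theta> = of_real (R1 \<theta>)" for h
  proof -
    have "isCont (\<lambda>p. (h (fst p) (snd p), snd p)) (R1 \<theta>, \<theta>)" by (intro continuous_intros h)
    from isCont_o2[OF this, of "\<lambda>(z, \<theta>). F z \<theta>"] c h(2) show ?thesis by simp
  qed
  show "isCont (\<lambda>p. F (of_real (fst p)) (snd p)) (R1 \<theta>, \<theta>)"
    by (rule g[of "\<lambda>r \<theta>. of_real r"]) (auto intro!: continuous_intros)
  show "isCont (\<lambda>p. F (lS (fst p) (snd p)) (snd p)) (R1 \<theta>, \<theta>)"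
    by (rule g[OF interface_lS(1)[of lS]]) (simp_all add: interface_values)
qed

lemma inside_polar:
  "\<forall>\<^sub>F p in nhds (R1 \<theta>, \<theta>). 0 < fst p \<and> (of_real (fst p), snd p) \<in> Z"
proof -
  have m: "(of_real (R1 \<theta>), \<theta>) \<in> Z" by (rule real_mem_Z) simp
  have "open ({p :: real \<times> real. 0 < fst p} \<inter> (\<lambda>p. (complex_of_real (fst p), snd p)) -` Z)"
    by (intro open_Int open_vimage Z open_Collect_less continuous_intros)
  from eventually_nhds_in_open[OF this, of "(R1 \<theta>, \<theta>)"] show ?thesis
    using m R1_pos[of \<theta>] by (auto elim!: eventually_mono)
qed

lemma conormal_polar:
  assumes "C x *v grad v x = polvec t a b"
  shows "conormal_flux \<nu> C v x = of_real (\<nu> \<bullet> polar 1 t) * a + of_real (\<nu> \<bullet> polar 1 (t + pi / 2)) * b"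
  unfolding conormal_flux_def assms by (simp add: sum_2 inner_vec2 algebra_simps)

lemma inside_grad:
  assumes A: "open A" "A \<inter> layer R1 \<rho> = {}" and p: "0 < r" "(of_real r, t) \<in> Z" "polar r t \<in> A"
  shows "u differentiable (at (polar r t))"
    and "pal_C R1 \<rho> \<sigma>0 \<sigma>1 (polar r t) *v grad u (polar r t) = polvec t (Wz (of_real r) t) (W1 (of_real r) t / of_real r)"
proof -
  have "(u has_derivative (\<lambda>v. (v \<bullet> polar 1 t) *\<^sub>R Wz (of_real r) t + (v \<bullet> polar 1 (t + pi / 2) / r) *\<^sub>R W1 (of_real r) t)) (at (polar r t))"
    by (rule has_derivative_transform_within_open[OF U_has_derivative[OF p(1,2)] A(1) p(3)])
      (use A(2) in \<open>auto simp: u_def pal_field_def\<close>)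
  then show "u differentiable (at (polar r t))" "pal_C R1 \<rho> \<sigma>0 \<sigma>1 (polar r t) *v grad u (polar r t) = polvec t (Wz (of_real r) t) (W1 (of_real r) t / of_real r)"
    using grad_polar A(2) p(3) by (auto simp: differentiable_def pal_C_def)
qed

lemma interface_tangent:
  assumes "\<theta> \<notin> corners"
  shows "vector_derivative (\<lambda>t. polar (R1 t) t) (at \<theta>) = deriv R1 \<theta> *\<^sub>R polar 1 \<theta> + R1 \<theta> *\<^sub>R polar 1 (\<theta> + pi / 2)"
proof -
  have "((\<lambda>t. (R1 t, t)) has_derivative (\<lambda>h. (h * deriv R1 \<theta>, h))) (at \<theta>)"
    using R1_deriv[OF assms] unfolding has_field_derivative_def
    by (intro has_derivative_Pair has_derivative_ident) (simp add: mult.commute[of _ "deriv R1 \<theta>"])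
  from has_derivative_compose[OF this polar_has_derivative]
  have d: "((\<lambda>t. polar (R1 t) t) has_derivative (\<lambda>h. (h * deriv R1 \<theta>) *\<^sub>R polar 1 \<theta> + h *\<^sub>R polar (R1 \<theta>) (\<theta> + pi / 2))) (at \<theta>)"
    by simp
  have "((\<lambda>t. polar (R1 t) t) has_vector_derivative deriv R1 \<theta> *\<^sub>R polar 1 \<theta> + R1 \<theta> *\<^sub>R polar 1 (\<theta> + pi / 2)) (at \<theta>)"
    unfolding has_vector_derivative_def
    by (rule has_derivative_eq_rhs[OF d]) (auto simp: fun_eq_iff vec2_eq_iff algebra_simps)
  then show ?thesis by (rule vector_derivative_at)
qed

lemma isCont_within: "isCont f a \<Longrightarrow> (f \<longlongrightarrow> f a) (at a within A)"
  unfolding isCont_def by (erule tendsto_within_subset) (rule subset_UNIV)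

text \<open>Both one-sided limits are values of continuous functions of (r, \<theta>) at the
  interface. The two limiting fluxes differ by a multiple of the scalar product of \<nu> with the
  tangent, which is zero.\<close>

lemma transmission_u:
  assumes A: "open A" "A \<inter> layer R1 \<rho> = {}"
  shows "transmission R1 A (layer R1 \<rho>) (pal_C R1 \<rho> \<sigma>0 \<sigma>1) u"
  unfolding transmission_def
proof (intro conjI allI impI)
  fix \<theta>
  define l where "l = W (of_real (R1 \<theta>)) \<theta>"
  show "\<exists>l. (u \<longlongrightarrow> l) (at (polar (R1 \<theta>) \<theta>) within A) \<and> (u \<longlongrightarrow> l) (at (polar (R1 \<theta>) \<theta>) within layer R1 \<rho>)"
  proof (intro exI[of _ l] conjI tendsto_from_polar R1_pos)
    have "((\<lambda>p. W (of_real (fst p)) (snd p)) \<longlongrightarrow> l) (at (R1 \<theta>, \<theta>) within {p. 0 < fst p \<and> polar (fst p) (snd p) \<in> A})"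
      using isCont_within[OF interface_cont(1)[OF W_cont]] by (simp add: l_def)
    then show "((\<lambda>p. u (polar (fst p) (snd p))) \<longlongrightarrow> l) (at (R1 \<theta>, \<theta>) within {p. 0 < fst p \<and> polar (fst p) (snd p) \<in> A})"
      by (rule Lim_transform_eventually)
        (use inside_polar[of \<theta>] A(2) W_real in \<open>auto simp: eventually_at_filter u_def pal_field_def elim!: eventually_mono\<close>)
    have "((\<lambda>p. W (lS (fst p) (snd p)) (snd p)) \<longlongrightarrow> l) (at (R1 \<theta>, \<theta>) within {p. 0 < fst p \<and> polar (fst p) (snd p) \<in> layer R1 \<rho>})"
      using isCont_within[OF interface_cont(2)[OF W_cont]] by (simp add: l_def interface_values)
    then show "((\<lambda>p. u (polar (fst p) (snd p))) \<longlongrightarrow> l) (at (R1 \<theta>, \<theta>) within {p. 0 < fst p \<and> polar (fst p) (snd p) \<in> layer R1 \<rho>})"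
      by (rule Lim_transform_eventually) (auto simp: eventually_at_filter u_layer)
  qed
next
  fix \<theta> \<epsilon> \<nu>
  assume h: "0 < \<epsilon> \<and> smooth_on_interval R1 {\<theta> - \<epsilon><..<\<theta> + \<epsilon>} \<and> norm \<nu> = 1 \<and> \<nu> \<bullet> vector_derivative (\<lambda>t. polar (R1 t) t) (at \<theta>) = 0"
  have nc: "t \<notin> corners" if "t \<in> {\<theta> - \<epsilon><..<\<theta> + \<epsilon>}" for t
    using smooth_not_corner[of "\<theta> - \<epsilon>" "\<theta> + \<epsilon>" t] h that by auto
  have \<theta>: "\<theta> \<notin> corners" using nc h by simp
  have op: "open {p :: real \<times> real. snd p \<in> {\<theta> - \<epsilon><..<\<theta> + \<epsilon>}}"
    using open_vimage[OF open_greaterThanLessThan continuous_on_snd[OF continuous_on_id], of "\<theta> - \<epsilon>" "\<theta> + \<epsilon>"]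
    by (simp add: vimage_def)
  have ang: "\<forall>\<^sub>F p in nhds (R1 \<theta>, \<theta>). snd p \<notin> corners"
  proof -
    have "(R1 \<theta>, \<theta>) \<in> {p. snd p \<in> {\<theta> - \<epsilon><..<\<theta> + \<epsilon>}}" using h by simp
    from eventually_nhds_in_open[OF op this] show ?thesis by (rule eventually_mono) (rule nc, simp)
  qed
  have "\<forall>\<^sub>F p in nhds (R1 \<theta>, \<theta>). polar (fst p) (snd p) \<in> A \<union> layer R1 \<rho> \<longrightarrow> u differentiable (at (polar (fst p) (snd p)))"
    using ang inside_polar[of \<theta>]
  proof eventually_elim
    case (elim p)
    show ?case
    proof
      assume "polar (fst p) (snd p) \<in> A \<union> layer R1 \<rho>"
      then show "u differentiable (at (polar (fst p) (snd p)))"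
      proof
        assume "polar (fst p) (snd p) \<in> A"
        then show ?thesis using elim by (intro inside_grad(1)[OF A]) auto
      next
        assume "polar (fst p) (snd p) \<in> layer R1 \<rho>"
        from lay.u_has_derivative(1)[where u = u, OF elim(2)[THEN conjunct1] this elim(1) u_layer] show ?thesis
          by (rule differentiableI)
      qed
    qed
  qed
  from eventually_from_polar[OF R1_pos this]
  show "\<forall>\<^sub>F x in at (polar (R1 \<theta>) \<theta>) within A \<union> layer R1 \<rho>. u differentiable (at x)"
    unfolding eventually_at_filter by (rule eventually_mono) blast
  define er et where "er t = complex_of_real (\<nu> \<bullet> polar 1 t)" and "et t = complex_of_real (\<nu> \<bullet> polar 1 (t + pi / 2))" for t
  have ec: "isCont (\<lambda>p. er (snd p)) q" "isCont (\<lambda>p. et (snd p)) q" for q :: "real \<times> real"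
  proof -
    have "continuous_on UNIV (\<lambda>p :: real \<times> real. er (snd p))" "continuous_on UNIV (\<lambda>p :: real \<times> real. et (snd p))"
      unfolding er_def et_def by (intro continuous_intros)+
    then show "isCont (\<lambda>p. er (snd p)) q" "isCont (\<lambda>p. et (snd p)) q"
      using continuous_on_eq_continuous_at[OF open_UNIV, of "\<lambda>p :: real \<times> real. er (snd p)"]
        continuous_on_eq_continuous_at[OF open_UNIV, of "\<lambda>p :: real \<times> real. et (snd p)"] by (simp_all only: UNIV_I ball_UNIV)
  qed
  define z where "z = complex_of_real (R1 \<theta>)"
  have z: "z \<noteq> 0" using R1_pos[of \<theta>] by (simp add: z_def)
  define q where "q = er \<theta> * Wz z \<theta> + et \<theta> * (W1 z \<theta> / z)"
  have "\<nu> \<bullet> (deriv R1 \<theta> *\<^sub>R polar 1 \<theta> + R1 \<theta> *\<^sub>R polar 1 (\<theta> + pi / 2)) = 0"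
    using h unfolding interface_tangent[OF \<theta>] by blast
  then have "complex_of_real (deriv R1 \<theta> * (\<nu> \<bullet> polar 1 \<theta>) + R1 \<theta> * (\<nu> \<bullet> polar 1 (\<theta> + pi / 2))) = 0"
    by (simp add: inner_add_right)
  \<comment> \<open>Orthogonality of \<nu> to the interface, with the tangent expressed in the polar
    frame.\<close>
  then have tang: "of_real (deriv R1 \<theta>) * er \<theta> + z * et \<theta> = 0" by (simp add: er_def et_def z_def)
  show "\<exists>q. (conormal_flux \<nu> (pal_C R1 \<rho> \<sigma>0 \<sigma>1) u \<longlongrightarrow> q) (at (polar (R1 \<theta>) \<theta>) within A) \<and>
     (conormal_flux \<nu> (pal_C R1 \<rho> \<sigma>0 \<sigma>1) u \<longlongrightarrow> q) (at (polar (R1 \<theta>) \<theta>) within layer R1 \<rho>)"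
  proof (intro exI[of _ q] conjI tendsto_from_polar R1_pos)
    define F where "F p = er (snd p) * Wz (of_real (fst p)) (snd p) + et (snd p) * (W1 (of_real (fst p)) (snd p) / of_real (fst p))" for p
    have "isCont F (R1 \<theta>, \<theta>)" unfolding F_def
      by (intro continuous_intros ec interface_cont Wz_cont W1_cont) (use z in \<open>simp add: z_def\<close>)
    from isCont_within[OF this]
    have "(F \<longlongrightarrow> q) (at (R1 \<theta>, \<theta>) within {p. 0 < fst p \<and> polar (fst p) (snd p) \<in> A})"
      by (simp add: F_def q_def z_def)
    moreover have "\<forall>\<^sub>F p in at (R1 \<theta>, \<theta>) within {p. 0 < fst p \<and> polar (fst p) (snd p) \<in> A}.
        F p = conormal_flux \<nu> (pal_C R1 \<rho> \<sigma>0 \<sigma>1) u (polar (fst p) (snd p))"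
      unfolding eventually_at_filter using inside_polar[of \<theta>]
    proof eventually_elim
      case (elim p)
      show ?case
      proof (intro impI)
        assume "p \<in> {p. 0 < fst p \<and> polar (fst p) (snd p) \<in> A}"
        then have "polar (fst p) (snd p) \<in> A" by simp
        from conormal_polar[where C = "pal_C R1 \<rho> \<sigma>0 \<sigma>1" and v = u and x = "polar (fst p) (snd p)" and \<nu> = \<nu>, OF inside_grad(2)[OF A elim[THEN conjunct1] elim[THEN conjunct2] this]]
        show "F p = conormal_flux \<nu> (pal_C R1 \<rho> \<sigma>0 \<sigma>1) u (polar (fst p) (snd p))"
          unfolding F_def er_def et_def by (rule sym)
      qed
    qed
    ultimately show "((\<lambda>p. conormal_flux \<nu> (pal_C R1 \<rho> \<sigma>0 \<sigma>1) u (polar (fst p) (snd p))) \<longlongrightarrow> q)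
      (at (R1 \<theta>, \<theta>) within {p. 0 < fst p \<and> polar (fst p) (snd p) \<in> A})" by (rule Lim_transform_eventually)
    define H where "H p = er (snd p) * (lay.Pf (fst p) (snd p) / of_real (fst p)) + et (snd p) * lay.Qf (fst p) (snd p)" for p
    have "\<forall>t\<in>- corners. isCont (deriv R1) t"
      using corners(3) unfolding continuous_on_eq_continuous_at[OF corners(1)[unfolded closed_def]] .
    then have "isCont (deriv R1) (snd (R1 \<theta>, \<theta>))" using \<theta> by simp
    moreover have "isCont snd (R1 \<theta>, \<theta>)" by (intro continuous_intros)
    ultimately have dc: "isCont (\<lambda>p. deriv R1 (snd p)) (R1 \<theta>, \<theta>)" by (rule isCont_o2[rotated])
    have lc: "isCont (\<lambda>p. lS (fst p) (snd p)) (R1 \<theta>, \<theta>)" "isCont (\<lambda>p. lSr (fst p) (snd p)) (R1 \<theta>, \<theta>)"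
      "isCont (\<lambda>p. lA (fst p) (snd p)) (R1 \<theta>, \<theta>)"
      by (rule interface_lS; simp)+
    have "isCont H (R1 \<theta>, \<theta>)" unfolding H_def lay.Pf_def lay.Qf_def
      by (intro continuous_intros ec dc lc interface_cont(2)[OF Wz_cont] interface_cont(2)[OF W1_cont]) (use z in \<open>simp_all add: z_def interface_values\<close>)
    from isCont_within[OF this]
    have "(H \<longlongrightarrow> H (R1 \<theta>, \<theta>)) (at (R1 \<theta>, \<theta>) within {p. 0 < fst p \<and> polar (fst p) (snd p) \<in> layer R1 \<rho>})" .
    moreover have "H (R1 \<theta>, \<theta>) = q"
    proof -
      define y w d where "y = W1 z \<theta> / z / z" and "w = Wz z \<theta>" and "d = complex_of_real (deriv R1 \<theta>)"
      have y: "W1 z \<theta> / z = z * y" using z by (simp add: y_def)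
      have "z * w - d * ((1 - \<sigma>) * (z * y)) = z * (w - d * ((1 - \<sigma>) * y))" by algebra
      then have "(z * w - d * ((1 - \<sigma>) * (z * y))) / z = w - d * ((1 - \<sigma>) * y)" using z by simp
      then have "H (R1 \<theta>, \<theta>) = er \<theta> * (w - d * ((1 - \<sigma>) * y)) + et \<theta> * (\<sigma> * (z * y))"
        unfolding H_def lay.Pf_def lay.Qf_def fst_conv snd_conv interface_values z_def[symmetric] y w_def[symmetric] d_def[symmetric] by simp
      \<comment> \<open>The layer flux is the interior flux plus (\<sigma> - 1) times the tangential
        component of \<nu>, up to a factor; \<open>tang\<close> removes it.\<close>
      also have "\<dots> = er \<theta> * w + et \<theta> * (z * y) + (\<sigma> - 1) * y * (d * er \<theta> + z * et \<theta>)" by algebra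
      finally show ?thesis using tang by (simp add: q_def y w_def d_def)
    qed
    moreover have "\<forall>\<^sub>F p in at (R1 \<theta>, \<theta>) within {p. 0 < fst p \<and> polar (fst p) (snd p) \<in> layer R1 \<rho>}.
        H p = conormal_flux \<nu> (pal_C R1 \<rho> \<sigma>0 \<sigma>1) u (polar (fst p) (snd p))"
      unfolding eventually_at_filter using ang
    proof eventually_elim
      case (elim p)
      show ?case
      proof (intro impI)
        assume "p \<in> {p. 0 < fst p \<and> polar (fst p) (snd p) \<in> layer R1 \<rho>}"
        then have "0 < fst p" "polar (fst p) (snd p) \<in> layer R1 \<rho>" by simp_all
        from conormal_polar[where C = "pal_C R1 \<rho> \<sigma>0 \<sigma>1" and v = u and x = "polar (fst p) (snd p)" and \<nu> = \<nu>, OF C_layer[OF this elim]]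
        show "H p = conormal_flux \<nu> (pal_C R1 \<rho> \<sigma>0 \<sigma>1) u (polar (fst p) (snd p))"
          unfolding H_def er_def et_def by (rule sym)
      qed
    qed
    ultimately show "((\<lambda>p. conormal_flux \<nu> (pal_C R1 \<rho> \<sigma>0 \<sigma>1) u (polar (fst p) (snd p))) \<longlongrightarrow> q)
      (at (R1 \<theta>, \<theta>) within {p. 0 < fst p \<and> polar (fst p) (snd p) \<in> layer R1 \<rho>})"
      by (simp only:) (rule Lim_transform_eventually)
  qed
qed

lemma solves_pal:
  assumes "0 < k" and f: "integrable lebesgue f" "closure {x. f x \<noteq> 0} \<subseteq> ball b rB"
    and sol: "solves_exterior_helmholtz k D f g U" and D: "closure D \<subseteq> star_domain R1"
  shows "solves_pal_problem k D R1 \<rho> \<sigma>0 \<sigma>1 f g (pal_field R1 \<rho> \<sigma>0 \<sigma>1 U W)"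
proof -
  have sol: "solves_div_form (- closure D) (\<lambda>x. mat 1) (\<lambda>x. 1) k f U" "has_outer_trace D U g" "sommerfeld k U"
    using sol by (auto simp: solves_exterior_helmholtz_def)
  have fs: "{x. f x \<noteq> 0} \<subseteq> ball b rB" using closure_subset f(2) by (rule subset_trans)
  have L: "\<And>z \<theta>. z \<in> sector R1 \<sigma>0 \<sigma>1 \<theta> \<Longrightarrow> Lam z \<theta> = 0"
    by (rule Lam_vanishes[OF sol(1) D fs])
  have oA: "open (star_domain R1 - closure D)" and dA: "(star_domain R1 - closure D) \<inter> layer R1 \<rho> = {}"
    using open_star star_layer_disjoint by auto
  have nl: "x \<notin> layer R1 \<rho>" if "x \<in> star_domain R1" for x using that star_layer_disjoint by blast
  have inner: "solves_div_form (star_domain R1 - closure D) (pal_C R1 \<rho> \<sigma>0 \<sigma>1) (pal_n R1 \<rho> \<sigma>0 \<sigma>1) k f u"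
    by (rule solves_div_form_cong[OF sol(1)]) (auto simp: pal_C_def pal_n_def u_def pal_field_def nl)
  have outer: "solves_div_form (layer R1 \<rho>) (pal_C R1 \<rho> \<sigma>0 \<sigma>1) (pal_n R1 \<rho> \<sigma>0 \<sigma>1) k f u"
  proof (rule layer_solution)
    show "(LINT x|lebesgue. \<phi> x *\<^sub>R f x) = 0" if "\<phi> \<in> test_functions outside" for \<phi>
      by (rule source_vanishes[OF sol(1) D fs that])
  qed (rule L)
  obtain X C where XC: "\<And>z \<theta>. z \<in> sector R1 \<sigma>0 \<sigma>1 \<theta> \<Longrightarrow> X < Re z \<Longrightarrow> norm (W z \<theta>) \<le> C"
    using W_bounded_far[OF \<open>0 < k\<close> sol(3) L] by blast
  show ?thesis
    unfolding solves_pal_problem_def u_def[symmetric]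
  proof (intro conjI)
    show "solves_div_form (star_domain R1 - closure D \<union> layer R1 \<rho>) (pal_C R1 \<rho> \<sigma>0 \<sigma>1) (pal_n R1 \<rho> \<sigma>0 \<sigma>1) k f u"
      by (rule solves_div_form_Un[OF oA open_layer dA inner outer f(1)])
    show "has_outer_trace D u g"
      by (rule has_outer_trace_cong[OF sol(2) open_star D]) (simp add: u_def pal_field_def nl)
    show "bounded_at_outer_boundary R1 \<rho> u" by (rule bounded_outer[OF XC])
    show "transmission R1 (star_domain R1 - closure D) (layer R1 \<rho>) (pal_C R1 \<rho> \<sigma>0 \<sigma>1) u"
      by (rule transmission_u[OF oA dA])
  qed
qed

end

theorem theorem1:
  fixes k \<rho> \<sigma>0 \<sigma>1 rB :: real
    and D :: "(real^2) set" and b :: "real^2"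
    and f g U :: "real^2 \<Rightarrow> complex"
    and R1 :: "real \<Rightarrow> real"
    and W :: "complex \<Rightarrow> real \<Rightarrow> complex"
  assumes "0 < k"
    and "open D" "bounded D" "D \<noteq> {}" "lipschitz_boundary D"
    and "H_half (frontier D) g"
    and "D \<subseteq> ball b rB"
    and "integrable lebesgue f" "closure {x. f x \<noteq> 0} \<subseteq> ball b rB"
    and "solves_exterior_helmholtz k D f g U"
    and "star_radius R1" "closure D \<subseteq> star_domain R1"
    and "1 < \<rho>" "0 < \<sigma>0" "0 < \<sigma>1"
    and "radial_continuation R1 \<sigma>0 \<sigma>1 U W"
  shows "solves_pal_problem k D R1 \<rho> \<sigma>0 \<sigma>1 f g (pal_field R1 \<rho> \<sigma>0 \<sigma>1 U W)"
proof -
  obtain Z W1 W2 where rc: "open Z" "\<And>\<theta> z. z \<in> sector R1 \<sigma>0 \<sigma>1 \<theta> \<Longrightarrow> (z, \<theta>) \<in> Z"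
    "\<And>\<theta>. (\<lambda>z. W z \<theta>) holomorphic_on {z. (z, \<theta>) \<in> Z}"
    "\<And>z \<theta>. (z, \<theta>) \<in> Z \<Longrightarrow> ((\<lambda>t. W z t) has_vector_derivative W1 z \<theta>) (at \<theta>)"
    "\<And>z \<theta>. (z, \<theta>) \<in> Z \<Longrightarrow> ((\<lambda>t. W1 z t) has_vector_derivative W2 z \<theta>) (at \<theta>)"
    "continuous_on Z (\<lambda>(z, \<theta>). W z \<theta>)" "continuous_on Z (\<lambda>(z, \<theta>). W1 z \<theta>)" "continuous_on Z (\<lambda>(z, \<theta>). W2 z \<theta>)"
    "\<And>r \<theta>. (of_real r, \<theta>) \<in> Z \<Longrightarrow> W (of_real r) \<theta> = U (polar r \<theta>)"
    using \<open>radial_continuation R1 \<sigma>0 \<sigma>1 U W\<close> unfolding radial_continuation_def by (elim exE conjE) blast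
  have "pal R1 \<sigma>0 \<sigma>1 U W W1 W2 Z \<rho>"
  proof unfold_locales
    show "star_radius R1" "0 < \<sigma>0" "0 < \<sigma>1" "1 < \<rho>" by fact+
    show "open Z" by (rule rc)
    show "(z, \<theta>) \<in> Z" if "z \<in> sector R1 \<sigma>0 \<sigma>1 \<theta>" for z \<theta> using that by (rule rc)
    show "(\<lambda>z. W z \<theta>) holomorphic_on {z. (z, \<theta>) \<in> Z}" for \<theta> by (rule rc)
    fix z \<theta> assume z: "(z, \<theta>) \<in> Z"
    show "(W z has_vector_derivative W1 z \<theta>) (at \<theta>)" using rc(4)[OF z] .
    show "(W1 z has_vector_derivative W2 z \<theta>) (at \<theta>)" using rc(5)[OF z] .
  next
    show "continuous_on Z (\<lambda>(z, \<theta>). W z \<theta>)" by (rule rc)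
    show "continuous_on Z (\<lambda>(z, \<theta>). W1 z \<theta>)" by (rule rc)
    show "continuous_on Z (\<lambda>(z, \<theta>). W2 z \<theta>)" by (rule rc)
    show "W (of_real r) \<theta> = U (polar r \<theta>)" if "(of_real r, \<theta>) \<in> Z" for r \<theta> using that by (rule rc)
  qed
  from pal.solves_pal[OF this] show ?thesis using assms by blast
qed

end
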